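(* The characters of the irreducible $\mathcal{A}_2$-modules decompose into $V_{D_-}\otimes\mathcal{W}(2)$-characters as follows: for $r\in\{0,1,2,3\}$, $$\sum_{s\in4\mathbb{Z}}\mathrm{ch}[\mathcal{E}_0^{r+s}]=\mathrm{ch}[\mathsf{V}_{[-r/2]}]\cdot\mathrm{ch}[W_{1,2}],\qquad \sum_{s\in4\mathbb{Z}}\mathrm{ch}[\mathcal{E}_1^{r+s}]=\mathrm{ch}[\mathsf{V}_{[(2-r)/2]}]\cdot\mathrm{ch}[W_{2,2}],$$ $$\sum_{s\in4\mathbb{Z}}\mathrm{ch}[\mathcal{L}_0^{s+r}]=\mathrm{ch}[\mathsf{V}_{[-r/2]}]\cdot\mathrm{ch}[W_{1,1}],\qquad \sum_{s\in4\mathbb{Z}}\mathrm{ch}[\mathcal{L}_1^{s+r}]=\mathrm{ch}[\mathsf{V}_{[1-r/2]}]\cdot\mathrm{ch}[W_{2,1}].$$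
   Context: **Affine $\mathfrak{sl}(2)$ at level $k=-1/2$ ($c=-1$).** $\widehat{\mathfrak{sl}}(2)$ has generators $h_n,e_n,f_n,K$ with nonzero brackets $[h_m,e_n]=2e_{m+n}$, $[h_m,h_n]=2m\delta_{m+n,0}K$, $[e_m,f_n]=-h_{m+n}-m\delta_{m+n,0}K$, $[h_m,f_n]=-2f_{m+n}$, with $K$ acting as $k$, and $L_n$ is given by the Sugawara construction. Spectral flow: $\sigma_s(h_n)=h_n-\delta_{n,0}sk$, $\sigma_s(e_n)=e_{n-s}$, $\sigma_s(f_n)=f_{n+s}$, $\sigma_s(L_0)=L_0-\frac s2h_0+\frac{s^2}{4}k$. For a module $V$, $V^s=\{\sigma_s^*(v):v\in V\}$ with action $X\sigma_s^*(v)=\sigma_s^*(\sigma_s^{-1}(X)v)$. Characters are $\mathrm{ch}[V]=\mathrm{tr}_V\,z^{h_0}q^{L_0-c/24}$, as formal series. $\mathcal{L}_0$ is the irreducible vacuum module and $\mathcal{L}_1$ the irreducible highest weight module whose ground states form the two-dimensional $\mathfrak{sl}(2)$-module. For $\lambda\in\mathbb{R}/2\mathbb{Z}$, $\mathcal{E}_\lambda$ is the standard (relaxed highest weight) module, whose ground states have $h_0$-weights $\lambda+2n$ ($n\in\mathbb{Z}$), each of multiplicity one, and conformal weight $-1/8$; $\mathrm{ch}[\mathcal{E}^s_\lambda]=\frac{1}{\eta(q)^2}\sum_{n\in\mathbb{Z}}z^{2n+\lambda+ks}q^{s(2n+\lambda+ks/2)/2}$. **$\mathcal{A}_2$.** $\mathcal{A}_2=\bigoplus_{m\in\mathbb{Z}}\mathcal{L}_0^{4m}$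 is the simple current extension of affine $\mathfrak{sl}(2)$ at level $-1/2$ (its construction assumes the conjecture that fusion respects spectral flow, $V^s\times W^t=(V\times W)^{s+t}$). Its irreducible (untwisted) modules considered here are, as $\widehat{\mathfrak{sl}}(2)$-modules, the orbits $\bigoplus_{s\in4\mathbb{Z}}\mathcal{E}_0^{r+s}$, $\bigoplus_{s\in4\mathbb{Z}}\mathcal{E}_1^{r+s}$, $\bigoplus_{s\in4\mathbb{Z}}\mathcal{L}_0^{r+s}$, $\bigoplus_{s\in4\mathbb{Z}}\mathcal{L}_1^{r+s}$, $r\in\{0,1,2,3\}$; the claim concerns the characters of these direct sums. **$V_{D_-}$.** $D_-=2\mathbb{Z}\beta_-$ with $(\beta_-,\beta_-)=-1$. $\mathsf{F}_\lambda$ is the irreducible module of the Heisenberg algebra generated by $h$ with $h_0=\lambda$, $\mathrm{ch}[\mathsf{F}_\lambda]=z^\lambda q^{-\lambda^2/2}/\eta(q)$. $\mathsf{V}_{[\lambda]}$ is the $V_{D_-}$-module with $\mathrm{ch}[\mathsf{V}_{[\lambda]}]=\sum_{m\in\mathbb{Z}}\mathrm{ch}[\mathsf{F}_{2m+\lambda}]$. **Triplet algebra $\mathcal{W}(2)$** (central charge $-2$). Let $\alpha_+=2$, $\alpha_-=-1$, $\alpha_0=1$, $\alpha_{r,s}=\frac{1-r}{2}\alpha_++\frac{1-s}{2}\alpha_-$. Let $\mathcal{F}_\mu$ be the Heisenberg Fock space of weight $\mu$ with Virasoro field $\frac12:a^2:+\frac{\alpha_0}{2}\partial a$, $\mathrm{ch}[\mathcal{F}_\mu]=q^{(\mu-\alpha_0/2)^2/2}/\eta(q)$;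 let $\mathcal{V}_{[\mu]}=\bigoplus_{\nu\in\mu+\mathbb{Z}\alpha_+}\mathcal{F}_\nu$ and $Q_-=\oint V_{\alpha_-}(z)dz$, where $V_{\alpha_-}=:e^{\alpha_-\phi}:$, $\partial\phi=a$. Then $\mathcal{W}(2)=\ker(Q_-:\mathcal{V}_{[0]}\to\mathcal{V}_{[\alpha_-]})$, with simple modules $W_{r,1}=\ker(Q_-:\mathcal{V}_{[\alpha_{r,1}]}\to\mathcal{V}_{[\alpha_{3-r,1}]})$ and $W_{r,2}=\mathcal{V}_{[\alpha_{r,2}]}$, $r=1,2$. With $p=2$, $\mathrm{ch}[W_{r,s}]=\frac1{\eta(q)}\sum_{n\ge0}(2n+r)\bigl(q^{((2n+r)p-s)^2/4p}-q^{((2n+r)p+s)^2/4p}\bigr)$. *)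

theory Defs
  imports Complex_Main "HOL-Library.Multiset" "HOL-Library.Poly_Mapping"
    "HOL-Analysis.Infinite_Sum"
begin

section \<open>Formal characters\<close>

text \<open>
  A formal series in \<open>z\<close> and \<open>q\<close> is the function sending \<open>(a, b)\<close> to the coefficient of
  \<open>z^a q^b\<close>. Sums and products are taken coefficientwise; on \<^typ>\<open>nat\<close> (discrete topology)
  summability means that all but finitely many terms vanish.
\<close>

type_synonym fseries = "complex \<times> complex \<Rightarrow> nat"

definition fs_sum :: "'i set \<Rightarrow> ('i \<Rightarrow> fseries) \<Rightarrow> fseries"
  where "fs_sum I F = (\<lambda>x. \<Sum>\<^sub>\<infinity>i\<in>I. F i x)"

definition fs_summable :: "'i set \<Rightarrow> ('i \<Rightarrow> fseries) \<Rightarrow> bool"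
  where "fs_summable I F \<longleftrightarrow> (\<forall>x. (\<lambda>i. F i x) summable_on I)"

definition fs_mult :: "fseries \<Rightarrow> fseries \<Rightarrow> fseries"
  where "fs_mult F G = (\<lambda>x. \<Sum>\<^sub>\<infinity>y. F y * G (x - y))"

definition fs_multipliable :: "fseries \<Rightarrow> fseries \<Rightarrow> bool"
  where "fs_multipliable F G \<longleftrightarrow> (\<forall>x. (\<lambda>y. F y * G (x - y)) summable_on UNIV)"

definition joint_eigenspace ::
  "(complex \<Rightarrow> 'v \<Rightarrow> 'v) \<Rightarrow> 'v set \<Rightarrow> ('v \<Rightarrow> 'v) \<Rightarrow> ('v \<Rightarrow> 'v) \<Rightarrow> complex \<Rightarrow> complex \<Rightarrow> 'v set"
  where "joint_eigenspace sc V A B a b = {v \<in> V. A v = sc a v \<and> B v = sc b v}"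

text \<open>
  \<open>tr_V z^A q^(B - c/24)\<close> for a subspace \<open>V\<close> with commuting operators \<open>A\<close>, \<open>B\<close>. The trace is
  defined when \<open>V\<close> is spanned by joint eigenvectors and all multiplicities are finite; this is
  \<open>trace_defined\<close>. (\<^const>\<open>vector_space.dim\<close> is \<open>0\<close> on infinite-dimensional spaces.)
\<close>

definition trace_series ::
  "(complex \<Rightarrow> 'v::ab_group_add \<Rightarrow> 'v) \<Rightarrow> 'v set \<Rightarrow> ('v \<Rightarrow> 'v) \<Rightarrow> ('v \<Rightarrow> 'v) \<Rightarrow> complex \<Rightarrow> fseries"
  where "trace_series sc V A B c =
    (\<lambda>(a, b). vector_space.dim sc (joint_eigenspace sc V A B a (b + c / 24)))"

definition trace_defined ::
  "(complex \<Rightarrow> 'v::ab_group_add \<Rightarrow> 'v) \<Rightarrow> 'v set \<Rightarrow> ('v \<Rightarrow> 'v) \<Rightarrow> ('v \<Rightarrow> 'v) \<Rightarrow> bool"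
  where "trace_defined sc V A B \<longleftrightarrow>
    V = module.span sc (\<Union>a b. joint_eigenspace sc V A B a b) \<and>
    (\<forall>a b. \<exists>X. finite X \<and> joint_eigenspace sc V A B a b \<subseteq> module.span sc X)"


section \<open>Modules over affine sl(2)\<close>

text \<open>The underlying vector space of a module is the whole type \<^typ>\<open>'v\<close>.\<close>

record 'v sl2_module =
  scl :: "complex \<Rightarrow> 'v \<Rightarrow> 'v"
  eop :: "int \<Rightarrow> 'v \<Rightarrow> 'v"
  fop :: "int \<Rightarrow> 'v \<Rightarrow> 'v"
  hop :: "int \<Rightarrow> 'v \<Rightarrow> 'v"

text \<open>
  \<open>smooth\<close> is what makes the Sugawara operators well defined. The bracket \<open>[e, f]\<close> carries
  a minus sign, so the invariant form has \<open>(h, h) = 2\<close> and \<open>(e, f) = -1\<close>.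
\<close>

locale affine_sl2_module =
  fixes k :: complex and M :: "'v::ab_group_add sl2_module"
  assumes vector_space: "vector_space (scl M)"
    and linear_e: "\<And>n. Vector_Spaces.linear (scl M) (scl M) (eop M n)"
    and linear_f: "\<And>n. Vector_Spaces.linear (scl M) (scl M) (fop M n)"
    and linear_h: "\<And>n. Vector_Spaces.linear (scl M) (scl M) (hop M n)"
    and bracket_he: "\<And>m n v. hop M m (eop M n v) - eop M n (hop M m v) = scl M 2 (eop M (m + n) v)"
    and bracket_hf: "\<And>m n v. hop M m (fop M n v) - fop M n (hop M m v) = scl M (-2) (fop M (m + n) v)"
    and bracket_hh: "\<And>m n v. hop M m (hop M n v) - hop M n (hop M m v) =
          scl M (if m + n = 0 then 2 * of_int m * k else 0) v"
    and bracket_ef: "\<And>m n v. eop M m (fop M n v) - fop M n (eop M m v) =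
          - hop M (m + n) v - scl M (if m + n = 0 then of_int m * k else 0) v"
    and bracket_ee: "\<And>m n v. eop M m (eop M n v) = eop M n (eop M m v)"
    and bracket_ff: "\<And>m n v. fop M m (fop M n v) = fop M n (fop M m v)"
    and smooth: "\<And>v. \<exists>N. \<forall>n\<ge>N. eop M n v = 0 \<and> fop M n v = 0 \<and> hop M n v = 0"

definition sl2_submodule :: "'v::ab_group_add sl2_module \<Rightarrow> 'v set \<Rightarrow> bool"
  where "sl2_submodule M N \<longleftrightarrow> module.subspace (scl M) N \<and>
    (\<forall>n. \<forall>v\<in>N. eop M n v \<in> N \<and> fop M n v \<in> N \<and> hop M n v \<in> N)"

definition irreducible_sl2 :: "'v::ab_group_add sl2_module \<Rightarrow> bool"
  where "irreducible_sl2 M \<longleftrightarrow> (UNIV :: 'v set) \<noteq> {0} \<and>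
    (\<forall>N. sl2_submodule M N \<longrightarrow> N = {0} \<or> N = UNIV)"

definition ground_states :: "'v::ab_group_add sl2_module \<Rightarrow> 'v set"
  where "ground_states M = {v. \<forall>n>0. eop M n v = 0 \<and> fop M n v = 0 \<and> hop M n v = 0}"

text \<open>
  The zero mode of \<open>(1/2 :hh: - :ef: - :fe:) / (2 (k + 2))\<close>; the sum over \<open>n\<close> is restricted to
  its nonzero terms.
\<close>

definition sugawara_L0 :: "complex \<Rightarrow> 'v::ab_group_add sl2_module \<Rightarrow> 'v \<Rightarrow> 'v"
  where "sugawara_L0 k M v = scl M (1 / (2 * (k + 2)))
    (scl M (1 / 2) (hop M 0 (hop M 0 v)) - eop M 0 (fop M 0 v) - fop M 0 (eop M 0 v)
     + (\<Sum>n | n > 0 \<and> (eop M n v \<noteq> 0 \<or> fop M n v \<noteq> 0 \<or> hop M n v \<noteq> 0).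
          hop M (- n) (hop M n v) - scl M 2 (eop M (- n) (fop M n v))
          - scl M 2 (fop M (- n) (eop M n v))))"

text \<open>
  The module \<open>V^s\<close>, on the same vector space: \<open>X\<close> acts as \<open>\<sigma>_s^(-1)(X) = \<sigma>_(-s)(X)\<close>.
\<close>

definition spectral_flow :: "complex \<Rightarrow> int \<Rightarrow> 'v::ab_group_add sl2_module \<Rightarrow> 'v sl2_module"
  where "spectral_flow k s M = \<lparr>scl = scl M,
    eop = (\<lambda>n. eop M (n + s)),
    fop = (\<lambda>n. fop M (n - s)),
    hop = (\<lambda>n v. hop M n v + scl M (if n = 0 then of_int s * k else 0) v)\<rparr>"

definition sl2_central_charge :: "complex \<Rightarrow> complex"
  where "sl2_central_charge k = 3 * k / (k + 2)"

definition sl2_ch :: "complex \<Rightarrow> 'v::ab_group_add sl2_module \<Rightarrow> fseries"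
  where "sl2_ch k M = trace_series (scl M) UNIV (hop M 0) (sugawara_L0 k M) (sl2_central_charge k)"

definition sl2_ch_defined :: "complex \<Rightarrow> 'v::ab_group_add sl2_module \<Rightarrow> bool"
  where "sl2_ch_defined k M \<longleftrightarrow> trace_defined (scl M) UNIV (hop M 0) (sugawara_L0 k M)"

text \<open>
  Every summand of the direct sum of the \<open>M^(r+s)\<close> over \<open>s \<in> 4\<int>\<close> has a character, and these
  characters are summable.
\<close>

definition orbit_ch_defined :: "complex \<Rightarrow> int \<Rightarrow> 'v::ab_group_add sl2_module \<Rightarrow> bool"
  where "orbit_ch_defined k r M \<longleftrightarrow>
    (\<forall>s. 4 dvd s \<longrightarrow> sl2_ch_defined k (spectral_flow k (r + s) M)) \<and>
    fs_summable {s. 4 dvd s} (\<lambda>s. sl2_ch k (spectral_flow k (r + s) M))"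

definition level :: complex
  where "level = - 1 / 2"

definition is_vacuum_module :: "'v::ab_group_add sl2_module \<Rightarrow> bool"
  where "is_vacuum_module M \<longleftrightarrow> affine_sl2_module level M \<and> irreducible_sl2 M \<and>
    (\<exists>v. v \<noteq> 0 \<and> (\<forall>n\<ge>0. eop M n v = 0 \<and> fop M n v = 0 \<and> hop M n v = 0))"

definition is_doublet_module :: "'v::ab_group_add sl2_module \<Rightarrow> bool"
  where "is_doublet_module M \<longleftrightarrow> affine_sl2_module level M \<and> irreducible_sl2 M \<and>
    vector_space.dim (scl M) (ground_states M) = 2 \<and>
    (\<exists>v\<in>ground_states M. v \<noteq> 0 \<and> eop M 0 v = 0 \<and> hop M 0 v = v)"

text \<open>
  Irreducible standard modules \<open>E_l\<close>. The standard modules at this level are irreducible unless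
  \<open>l = 1/2\<close> or \<open>l = -1/2\<close> modulo \<open>2\<close>; only \<open>l = 0\<close> and \<open>l = 1\<close> are used.
\<close>

definition is_standard_module :: "complex \<Rightarrow> 'v::ab_group_add sl2_module \<Rightarrow> bool"
  where "is_standard_module l M \<longleftrightarrow> affine_sl2_module level M \<and> irreducible_sl2 M \<and>
    (let G = (\<lambda>n. {v \<in> ground_states M. hop M 0 v = scl M (l + 2 * of_int n) v}) in
      ground_states M = module.span (scl M) (\<Union>n::int. G n) \<and>
      (\<forall>n. vector_space.dim (scl M) (G n) = 1)) \<and>
    (\<forall>v\<in>ground_states M. sugawara_L0 level M v = scl M (- 1 / 8) v)"


section \<open>Heisenberg Fock spaces and lattice modules\<close>

text \<open>
  The underlying space of every Fock space is spanned by multisets of naturals; the multiset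
  \<open>{#i, j, \<dots>#}\<close> stands for \<open>a_(-(i+1)) a_(-(j+1)) \<dots>\<close> applied to the highest weight vector.
  The bracket is \<open>[a_m, a_n] = \<kappa> m \<delta>_(m+n,0)\<close>, and \<open>a_0\<close> acts as \<open>\<nu>\<close>.
\<close>

type_synonym fock = "nat multiset \<Rightarrow>\<^sub>0 complex"

definition fock_scale :: "complex \<Rightarrow> fock \<Rightarrow> fock"
  where "fock_scale c = Poly_Mapping.map ((*) c)"

definition heis :: "complex \<Rightarrow> complex \<Rightarrow> int \<Rightarrow> fock \<Rightarrow> fock"
  where "heis \<kappa> \<nu> n v =
    (if n = 0 then fock_scale \<nu> v
     else if n < 0 then
       (\<Sum>P\<in>Poly_Mapping.keys v. Poly_Mapping.single (add_mset (nat (- n) - 1) P) (Poly_Mapping.lookup v P))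
     else
       (\<Sum>P\<in>Poly_Mapping.keys v. Poly_Mapping.single (P - {#nat n - 1#})
          (\<kappa> * of_int n * of_nat (count P (nat n - 1)) * Poly_Mapping.lookup v P)))"

text \<open>The zero mode of \<open>:a\<^sup>2: / (2 \<kappa>) + \<beta> \<partial>a\<close>; note \<open>(\<partial>a)_n = -(n+1) a_n\<close>.\<close>

definition fock_L0 :: "complex \<Rightarrow> complex \<Rightarrow> complex \<Rightarrow> fock \<Rightarrow> fock"
  where "fock_L0 \<kappa> \<beta> \<nu> v =
    fock_scale (1 / (2 * \<kappa>)) (heis \<kappa> \<nu> 0 (heis \<kappa> \<nu> 0 v)
      + fock_scale 2 (\<Sum>n | n > 0 \<and> heis \<kappa> \<nu> n v \<noteq> 0. heis \<kappa> \<nu> (- n) (heis \<kappa> \<nu> n v)))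
    - fock_scale \<beta> (heis \<kappa> \<nu> 0 v)"

text \<open>
  \<^typ>\<open>complex \<Rightarrow>\<^sub>0 fock\<close> is the direct sum of the Fock spaces of all weights \<open>\<nu>\<close>.
\<close>

type_synonym fock_sum = "complex \<Rightarrow>\<^sub>0 fock"

definition fsum_scale :: "complex \<Rightarrow> fock_sum \<Rightarrow> fock_sum"
  where "fsum_scale c = Poly_Mapping.map (fock_scale c)"

definition fsum_a0 :: "complex \<Rightarrow> fock_sum \<Rightarrow> fock_sum"
  where "fsum_a0 \<kappa> = Poly_Mapping.mapp (\<lambda>\<nu>. heis \<kappa> \<nu> 0)"

definition fsum_L0 :: "complex \<Rightarrow> complex \<Rightarrow> fock_sum \<Rightarrow> fock_sum"
  where "fsum_L0 \<kappa> \<beta> = Poly_Mapping.mapp (\<lambda>\<nu>. fock_L0 \<kappa> \<beta> \<nu>)"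

definition lattice_module :: "complex \<Rightarrow> complex \<Rightarrow> fock_sum set"
  where "lattice_module \<alpha> \<mu> = {v. Poly_Mapping.keys v \<subseteq> {\<mu> + of_int m * \<alpha> | m. True}}"


section \<open>Modules of the lattice algebra of \<open>D\<^sub>-\<close>\<close>

text \<open>
  Here \<open>[h_m, h_n] = - m \<delta>_(m+n,0)\<close>, the Virasoro field is \<open>- 1/2 :h\<^sup>2:\<close>, and \<open>c = 1\<close>.
\<close>

definition ch_VD :: "complex \<Rightarrow> fseries"
  where "ch_VD l = trace_series fsum_scale (lattice_module 2 l) (fsum_a0 (- 1)) (fsum_L0 (- 1) 0) 1"

definition ch_VD_defined :: "complex \<Rightarrow> bool"
  where "ch_VD_defined l \<longleftrightarrow>
    trace_defined fsum_scale (lattice_module 2 l) (fsum_a0 (- 1)) (fsum_L0 (- 1) 0)"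


section \<open>Modules of the triplet algebra\<close>

definition alpha_plus :: complex where "alpha_plus = 2"
definition alpha_minus :: complex where "alpha_minus = - 1"
definition alpha_zero :: complex where "alpha_zero = 1"

definition alpha :: "nat \<Rightarrow> nat \<Rightarrow> complex"
  where "alpha r s = (1 - of_nat r) / 2 * alpha_plus + (1 - of_nat s) / 2 * alpha_minus"

text \<open>
  For operators \<open>X_1, X_2, \<dots>\<close>: \<open>pow_coeff X j n\<close> is the coefficient of \<open>z^n\<close> in
  \<open>(\<Sum>i\<ge>1. X_i z^i)^j\<close>, and \<open>exp_coeff X n\<close> that of \<open>exp (\<Sum>i\<ge>1. X_i z^i)\<close>.
\<close>

fun pow_coeff :: "(nat \<Rightarrow> fock \<Rightarrow> fock) \<Rightarrow> nat \<Rightarrow> nat \<Rightarrow> fock \<Rightarrow> fock" where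
  "pow_coeff X 0 n v = (if n = 0 then v else 0)"
| "pow_coeff X (Suc j) n v = (\<Sum>i = 1..n. X i (pow_coeff X j (n - i) v))"

definition exp_coeff :: "(nat \<Rightarrow> fock \<Rightarrow> fock) \<Rightarrow> nat \<Rightarrow> fock \<Rightarrow> fock"
  where "exp_coeff X n v = (\<Sum>j\<le>n. fock_scale (1 / fact j) (pow_coeff X j n v))"

text \<open>
  On the Fock space of weight \<open>\<nu>\<close>, up to the identification of the underlying spaces of weights
  \<open>\<nu>\<close> and \<open>\<nu> + \<alpha>\<close>,
  \<open>V_\<alpha>(z) = z^(\<alpha>\<nu>) exp(\<alpha> \<Sum>i\<ge>1. a_(-i) z^i / i) exp(- \<alpha> \<Sum>i\<ge>1. a_i z^(-i) / i)\<close>.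
  The residue collects the coefficient of \<open>z^(-1)\<close>; the sum has finitely many nonzero terms.
\<close>

definition vertex_creation :: "complex \<Rightarrow> complex \<Rightarrow> nat \<Rightarrow> fock \<Rightarrow> fock"
  where "vertex_creation \<alpha> \<nu> =
    exp_coeff (\<lambda>i v. fock_scale (\<alpha> / of_nat i) (heis 1 \<nu> (- int i) v))"

definition vertex_annihilation :: "complex \<Rightarrow> complex \<Rightarrow> nat \<Rightarrow> fock \<Rightarrow> fock"
  where "vertex_annihilation \<alpha> \<nu> =
    exp_coeff (\<lambda>i v. fock_scale (- \<alpha> / of_nat i) (heis 1 \<nu> (int i) v))"

definition vertex_residue :: "complex \<Rightarrow> complex \<Rightarrow> fock \<Rightarrow> fock"
  where "vertex_residue \<alpha> \<nu> v =
    (\<Sum>(i, j) | \<alpha> * \<nu> + of_nat i - of_nat j = - 1 \<and> vertex_annihilation \<alpha> \<nu> j v \<noteq> 0.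
       vertex_creation \<alpha> \<nu> i (vertex_annihilation \<alpha> \<nu> j v))"

definition Q_minus :: "fock_sum \<Rightarrow> fock_sum"
  where "Q_minus v = (\<Sum>\<nu>\<in>Poly_Mapping.keys v.
    Poly_Mapping.single (\<nu> + alpha_minus) (vertex_residue alpha_minus \<nu> (Poly_Mapping.lookup v \<nu>)))"

definition triplet_simple :: "nat \<Rightarrow> nat \<Rightarrow> fock_sum set"
  where "triplet_simple r s =
    (if s = 1 then {v \<in> lattice_module alpha_plus (alpha r 1). Q_minus v = 0}
     else lattice_module alpha_plus (alpha r s))"

text \<open>
  The Virasoro field is \<open>1/2 :a\<^sup>2: + \<alpha>\<^sub>0/2 \<partial>a\<close> with \<open>c = -2\<close>. These characters do not involve
  \<open>z\<close>, which corresponds to the trivial first operator.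
\<close>

definition ch_W :: "nat \<Rightarrow> nat \<Rightarrow> fseries"
  where "ch_W r s = trace_series fsum_scale (triplet_simple r s) (\<lambda>v. 0)
    (fsum_L0 1 (alpha_zero / 2)) (- 2)"

definition ch_W_defined :: "nat \<Rightarrow> nat \<Rightarrow> bool"
  where "ch_W_defined r s \<longleftrightarrow> trace_defined fsum_scale (triplet_simple r s) (\<lambda>v. 0)
    (fsum_L0 1 (alpha_zero / 2))"

end

theory Submission
  imports Defs
begin

text \<open>
  Both sides of each identity are counted by explicit index sets, and the counts are compared.

  The modules over \<open>sl(2)\<close> at level \<open>-1/2\<close> are given abstractly; their bases come from the
  beta-gamma system, in which \<open>e = 1/2 \<beta>\<beta>\<close>, \<open>f = 1/2 \<gamma>\<gamma>\<close> and \<open>h\<close> is the symmetrized \<open>\<beta>\<gamma>\<close>. It acts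
  on the span of symbols \<open>(a, P, Q)\<close>: a power \<open>x^a\<close> of the zero mode \<open>\<beta>_0\<close>, with \<open>\<gamma>_0\<close> acting as
  \<open>x^a \<mapsto> (a + \<rho>) x^(a-1)\<close>, and multisets \<open>P\<close>, \<open>Q\<close> of creation modes of \<open>\<beta>\<close> and \<open>\<gamma>\<close>. The currents
  preserve the parity of the charge \<open>a + |P| - |Q|\<close>. For \<open>\<rho> = -1/2\<close> and \<open>a \<in> \<int>\<close> the two parities are
  \<open>\<E>_0\<close> and \<open>\<E>_1\<close>; for \<open>\<rho> = 0\<close> and \<open>a \<ge> 0\<close> they are the images of \<open>\<L>_0\<close> and \<open>\<L>_1\<close> under the spectral
  flow by \<open>-1\<close>. That an abstract irreducible module with the right ground states has this basis is
  \<open>irreducible_eigenbasis\<close>. In the product of the abstract module with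
  the model, the vectors generated by matching ground states form the graph of an isomorphism
  (\<open>irreducible_comparison\<close>), since every vector of the model killed by all positive modes has
  conformal weight \<open>-1/8\<close> (\<open>ground_weight\<close>), and the top generates the whole sector
  (\<open>sector_space_generated\<close>).

  Spectral flow shifts the eigenvalue of \<open>h_0\<close> linearly and that of \<open>L_0\<close> by completing a square
  (\<open>sugawara_flow\<close>). In an orbit sum each charge \<open>c\<close> of the right parity therefore occurs exactly once
  for a given power \<open>z^x\<close>, with \<open>x \<in> l + 2\<int>\<close>, and the coefficient of
  \<open>q^(- x^2/2 - 1/24 + \<kappa> + t)\<close> is \<open>\<Sum>c. N_c (t - e c)\<close>, where \<open>N_c d\<close> counts the pairs \<open>(P, Q)\<close> of total
  weight \<open>d\<close>, subject to \<open>|P| - |Q| \<le> c\<close> if \<open>\<rho> = 0\<close> (\<open>orbit_sum\<close>). The factor \<open>z^x q^(- x^2/2 - 1/24)\<close>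
  is the leading term of the Heisenberg character on the other side, so what remains is an identity
  between sequences in \<open>t\<close>: the convolution of the partition numbers with the coefficients of
  \<open>ch[W_(r,s)]\<close> equals \<open>\<Sum>c. N_c (t - e c)\<close>.

  For \<open>s = 2\<close> the triplet module is a sum of Fock spaces and this holds term by term. For \<open>s = 1\<close> it is
  the kernel of the screening charge. The modes of the fermions \<open>V_(-1)\<close> and \<open>V_1\<close> anticommute to a
  delta function (\<open>Wop_anticommutator\<close>), so the screening complex has a contracting homotopy and the
  kernel dimensions \<open>k_\<nu>\<close> satisfy \<open>k_\<nu> d + k_(\<nu>-1) (d + \<nu> - 1) = p d\<close> (\<open>ker_exact\<close>). After
  convolution with \<open>p\<close> this becomes the recursion for the numbers of bounded pairs
  (\<open>bounded_pairs_recursion\<close>); both sequences vanish for large \<open>\<nu>\<close>, so they agree (\<open>ker_convolution_eq_bounded_pairs\<close>).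
\<close>

section \<open>Eigenbases and traces\<close>

context vector_space begin

text \<open>
  Applying \<open>T\<close> and subtracting one eigenvalue times the relation removes one summand and only
  rescales the others by nonzero factors.
\<close>

lemma eigenvectors_sum_zero:
  assumes T: "Vector_Spaces.linear scale scale T"
    and "finite I" "inj_on l I" "\<And>i. i \<in> I \<Longrightarrow> T (g i) = l i *s g i"
    and "(\<Sum>i\<in>I. g i) = 0"
  shows "\<forall>i\<in>I. g i = 0"
  using assms(2-)
proof (induction I arbitrary: g rule: finite_induct)
  case empty
  then show ?case by simp
next
  case (insert j I)
  interpret T: Vector_Spaces.linear scale scale T by (rule T)
  have s: "g j + (\<Sum>i\<in>I. g i) = 0" using insert by simp
  have "T (g j + (\<Sum>i\<in>I. g i)) = 0" unfolding s by simp
  then have "l j *s g j + (\<Sum>i\<in>I. l i *s g i) = 0"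
    using insert.prems(2) by (simp add: T.add T.sum)
  moreover have "l j *s (g j + (\<Sum>i\<in>I. g i)) = 0" unfolding s by simp
  then have "l j *s g j + (\<Sum>i\<in>I. l j *s g i) = 0"
    by (simp add: scale_right_distrib scale_sum_right)
  ultimately have "l j *s g j + (\<Sum>i\<in>I. l i *s g i) = l j *s g j + (\<Sum>i\<in>I. l j *s g i)"
    by (simp only:)
  then have "(\<Sum>i\<in>I. (l i - l j) *s g i) = 0"
    by (simp add: scale_left_diff_distrib sum_subtractf)
  then have "\<forall>i\<in>I. (l i - l j) *s g i = 0"
    using insert.prems insert.hyps
    by (intro insert.IH) (auto simp: T.scale inj_on_insert mult.commute)
  moreover have "\<And>i. i \<in> I \<Longrightarrow> l i \<noteq> l j"
    using inj_onD[OF insert.prems(1)] insert.hyps(2) by blast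
  ultimately have z: "\<forall>i\<in>I. g i = 0" by simp
  then show ?case using s by simp
qed

lemma span_Union_subspaces:
  assumes "\<And>i. subspace (S i)" "x \<in> span (\<Union>i. S i)"
  shows "\<exists>J g. finite J \<and> (\<forall>j\<in>J. g j \<in> S j) \<and> x = (\<Sum>j\<in>J. g j)"
  using assms(2)
proof (induction rule: span_induct_alt)
  case base
  show ?case by (rule exI[of _ "{}"]) simp
next
  case (step c x y)
  then obtain i J g where i: "x \<in> S i" and J: "finite J" "\<forall>j\<in>J. g j \<in> S j" "y = (\<Sum>j\<in>J. g j)"
    by blast
  define g' where "g' j = (if j \<in> J then g j else 0) + (if j = i then c *s x else 0)" for j
  have "\<forall>j\<in>insert i J. g' j \<in> S j"
    unfolding g'_def using J i assms(1) by (auto intro: subspace_add subspace_scale subspace_0)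
  moreover have "c *s x + y = (\<Sum>j\<in>insert i J. g' j)"
    using J(1) by (simp add: g'_def sum.distrib J(3) sum.If_cases Int_absorb1 subset_insertI add.commute)
  ultimately show ?case using J(1) by (intro exI[of _ "insert i J"] exI[of _ g']) simp
qed

text \<open>
  Bases of finitely many subspaces in direct sum; \<open>dir\<close> is directness. It also
  forces the bases to be disjoint, which is why cardinalities add up.
\<close>

lemma independent_direct_sum:
  assumes I: "finite I" and B: "\<And>i. i \<in> I \<Longrightarrow> finite (B i) \<and> independent (B i)"
    and dir: "\<And>v. (\<And>i. i \<in> I \<Longrightarrow> v i \<in> span (B i)) \<Longrightarrow> (\<Sum>i\<in>I. v i) = 0 \<Longrightarrow> \<forall>i\<in>I. v i = 0"
  shows "independent (\<Union>i\<in>I. B i)" "card (\<Union>i\<in>I. B i) = (\<Sum>i\<in>I. card (B i))"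
proof -
  have disj: "B i \<inter> B j = {}" if ij: "i \<in> I" "j \<in> I" "i \<noteq> j" for i j
  proof (rule ccontr)
    assume "B i \<inter> B j \<noteq> {}"
    then obtain b where b: "b \<in> B i" "b \<in> B j" by blast
    define v where "v k = (if k = i then b else 0) - (if k = j then b else 0)" for k
    have "\<forall>k\<in>I. v k = 0"
      by (rule dir) (use b ij I in \<open>auto simp: v_def sum_subtractf intro: span_base span_neg span_zero\<close>)
    then have "b = 0" using ij by (auto simp: v_def split: if_splits)
    then show False using b B[OF ij(1)] dependent_zero by blast
  qed
  show "card (\<Union>i\<in>I. B i) = (\<Sum>i\<in>I. card (B i))"
    using I B disj by (intro card_UN_disjoint) auto
  have fin: "finite (\<Union>i\<in>I. B i)" using I B by auto
  show "independent (\<Union>i\<in>I. B i)"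
  proof (rule independent_if_scalars_zero[OF fin])
    fix u x assume z: "(\<Sum>x\<in>(\<Union>i\<in>I. B i). u x *s x) = 0" and x: "x \<in> (\<Union>i\<in>I. B i)"
    have "(\<Sum>i\<in>I. \<Sum>x\<in>B i. u x *s x) = 0"
      using z I B disj by (subst (asm) sum.UNION_disjoint) auto
    then have "\<forall>i\<in>I. (\<Sum>x\<in>B i. u x *s x) = 0"
      by (intro dir) (auto intro: span_sum span_scale span_base)
    then show "u x = 0"
      using x B independentD[OF _ _ subset_refl] by blast
  qed
qed

lemma span_image_finite_combination:
  assumes "inj_on f I" "v \<in> span (f ` I)"
  shows "\<exists>J c. finite J \<and> J \<subseteq> I \<and> v = (\<Sum>i\<in>J. c i *s f i)"
proof -
  obtain t r where t: "finite t" "t \<subseteq> f ` I" "v = (\<Sum>a\<in>t. r a *s a)"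
    using assms(2) unfolding span_explicit by blast
  then obtain J where J: "J \<subseteq> I" "finite J" "t = f ` J"
    using finite_subset_image[of t f I] by blast
  have "inj_on f J" using J(1) assms(1) inj_on_subset by blast
  then show ?thesis using t J by (auto simp: sum.reindex)
qed

lemma independent_image_coeff_zero:
  assumes "inj_on f I" "independent (f ` I)" "finite J" "J \<subseteq> I" "(\<Sum>i\<in>J. c i *s f i) = 0" "i \<in> J"
  shows "c i = 0"
proof -
  have inj: "inj_on f J" using assms(1,4) inj_on_subset by blast
  have "(\<Sum>a\<in>f ` J. c (the_inv_into J f a) *s a) = 0"
    using assms(5) inj by (simp add: sum.reindex the_inv_into_f_f)
  then have "c (the_inv_into J f (f i)) = 0"
    using assms by (intro independentD[of "f ` I" "f ` J"]) auto
  then show ?thesis using inj assms(6) by (simp add: the_inv_into_f_f)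
qed

text \<open>
  Independence of a family given by its coefficients, the form in which it can be checked by reading
  off coordinates.
\<close>

lemma independent_imageI:
  assumes "inj_on f I"
    and "\<And>J c i. finite J \<Longrightarrow> J \<subseteq> I \<Longrightarrow> (\<Sum>i\<in>J. c i *s f i) = 0 \<Longrightarrow> i \<in> J \<Longrightarrow> c i = 0"
  shows "independent (f ` I)"
  unfolding independent_explicit_finite_subsets
proof (intro allI impI ballI)
  fix A u a assume A: "A \<subseteq> f ` I" "finite A" "(\<Sum>v\<in>A. u v *s v) = 0" "a \<in> A"
  then obtain J where J: "J \<subseteq> I" "finite J" "A = f ` J"
    using finite_subset_image[of A f I] by blast
  have inj: "inj_on f J" using J(1) assms(1) inj_on_subset by blast
  have "(\<Sum>i\<in>J. u (f i) *s f i) = 0" using A(3) inj by (simp add: J(3) sum.reindex)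
  then show "u a = 0" using assms(2)[of J "\<lambda>i. u (f i)"] J A(4) by auto
qed

end

locale complex_space = vector_space scale
  for scale :: "complex \<Rightarrow> 'b::ab_group_add \<Rightarrow> 'b" (infixr \<open>*s\<close> 75)
begin

text \<open>
  In the expansion of a joint eigenvector in a basis of joint eigenvectors, comparing coefficients
  leaves only basis vectors with the same pair of eigenvalues. Characters are therefore
  cardinalities of fibres of an index set.
\<close>

lemma joint_eigenspace_eigenbasis:
  assumes A: "Vector_Spaces.linear scale scale A" and B: "Vector_Spaces.linear scale scale B"
    and f: "inj_on f I" "independent (f ` I)" "V = span (f ` I)"
    and a: "\<And>i. i \<in> I \<Longrightarrow> A (f i) = a i *s f i" and b: "\<And>i. i \<in> I \<Longrightarrow> B (f i) = b i *s f i"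
  shows "joint_eigenspace scale V A B x y = span (f ` {i\<in>I. a i = x \<and> b i = y})" (is "?E = span (f ` ?J)")
proof
  interpret A: Vector_Spaces.linear scale scale A by (rule A)
  interpret B: Vector_Spaces.linear scale scale B by (rule B)
  have sub: "subspace ?E"
    unfolding joint_eigenspace_def f(3) subspace_def
    by (auto simp: A.add B.add A.scale B.scale scale_right_distrib mult.commute
        intro: span_add span_scale span_zero)
  have "f ` ?J \<subseteq> ?E"
    unfolding joint_eigenspace_def f(3) using a b by (auto intro: span_base)
  then show "span (f ` ?J) \<subseteq> ?E" using sub by (rule span_minimal)
  show "?E \<subseteq> span (f ` ?J)"
  proof
    fix v assume v: "v \<in> ?E"
    then obtain J c where J: "finite J" "J \<subseteq> I" "v = (\<Sum>i\<in>J. c i *s f i)"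
      using span_image_finite_combination[OF f(1)] unfolding joint_eigenspace_def f(3) by blast
    have "A v = (\<Sum>i\<in>J. (c i * a i) *s f i)"
      unfolding J(3) A.sum using a J(2) by (intro sum.cong) (auto simp: A.scale)
    moreover have "x *s v = (\<Sum>i\<in>J. (c i * x) *s f i)"
      unfolding J(3) scale_sum_right by (simp add: mult.commute)
    ultimately have "(\<Sum>i\<in>J. (c i * (a i - x)) *s f i) = A v - x *s v"
      by (simp add: right_diff_distrib scale_left_diff_distrib sum_subtractf)
    then have "(\<Sum>i\<in>J. (c i * (a i - x)) *s f i) = 0"
      using v unfolding joint_eigenspace_def by simp
    then have 1: "c i * (a i - x) = 0" if "i \<in> J" for i
      by (rule independent_image_coeff_zero[OF f(1,2) J(1,2) _ that])
    have "B v = (\<Sum>i\<in>J. (c i * b i) *s f i)"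
      unfolding J(3) B.sum using b J(2) by (intro sum.cong) (auto simp: B.scale)
    moreover have "y *s v = (\<Sum>i\<in>J. (c i * y) *s f i)"
      unfolding J(3) scale_sum_right by (simp add: mult.commute)
    ultimately have "(\<Sum>i\<in>J. (c i * (b i - y)) *s f i) = B v - y *s v"
      by (simp add: right_diff_distrib scale_left_diff_distrib sum_subtractf)
    then have "(\<Sum>i\<in>J. (c i * (b i - y)) *s f i) = 0"
      using v unfolding joint_eigenspace_def by simp
    then have 2: "c i * (b i - y) = 0" if "i \<in> J" for i
      by (rule independent_image_coeff_zero[OF f(1,2) J(1,2) _ that])
    show "v \<in> span (f ` ?J)"
      unfolding J(3)
    proof (rule span_sum)
      fix i assume i: "i \<in> J"
      show "c i *s f i \<in> span (f ` ?J)"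
      proof (cases "c i = 0")
        case False
        then have "f i \<in> f ` ?J" using 1[OF i] 2[OF i] i J(2) by auto
        then show ?thesis by (intro span_scale span_base)
      qed (simp add: span_zero)
    qed
  qed
qed

lemma dim_joint_eigenspace_eigenbasis:
  assumes A: "Vector_Spaces.linear scale scale A" and B: "Vector_Spaces.linear scale scale B"
    and f: "inj_on f I" "independent (f ` I)" "V = span (f ` I)"
    and a: "\<And>i. i \<in> I \<Longrightarrow> A (f i) = a i *s f i" and b: "\<And>i. i \<in> I \<Longrightarrow> B (f i) = b i *s f i"
  shows "dim (joint_eigenspace scale V A B x y) = card {i\<in>I. a i = x \<and> b i = y}"
proof -
  have eq: "joint_eigenspace scale V A B x y = span (f ` {i\<in>I. a i = x \<and> b i = y})"
    by (rule joint_eigenspace_eigenbasis[OF A B f]) (simp_all add: a b)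
  have "dim (joint_eigenspace scale V A B x y) = card (f ` {i\<in>I. a i = x \<and> b i = y})"
    unfolding eq dim_span
    by (rule dim_eq_card_independent, rule independent_mono[OF f(2)]) auto
  also have "\<dots> = card {i\<in>I. a i = x \<and> b i = y}"
    by (rule card_image, rule inj_on_subset[OF f(1)]) auto
  finally show ?thesis .
qed

lemma trace_defined_eigenbasis:
  assumes A: "Vector_Spaces.linear scale scale A" and B: "Vector_Spaces.linear scale scale B"
    and f: "inj_on f I" "independent (f ` I)" "V = span (f ` I)"
    and a: "\<And>i. i \<in> I \<Longrightarrow> A (f i) = a i *s f i" and b: "\<And>i. i \<in> I \<Longrightarrow> B (f i) = b i *s f i"
    and fin: "\<And>x y. finite {i\<in>I. a i = x \<and> b i = y}"
  shows "trace_defined scale V A B"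
  unfolding trace_defined_def
proof (intro conjI allI)
  fix x y
  show "\<exists>X. finite X \<and> joint_eigenspace scale V A B x y \<subseteq> span X"
  proof (intro exI conjI)
    show "joint_eigenspace scale V A B x y \<subseteq> span (f ` {i\<in>I. a i = x \<and> b i = y})"
      by (rule equalityD1, rule joint_eigenspace_eigenbasis[OF A B f]) (simp_all add: a b)
  qed (use fin[of x y] in simp)
next
  have "f ` I \<subseteq> (\<Union>x y. joint_eigenspace scale V A B x y)"
    using a b span_superset[of "f ` I"] unfolding joint_eigenspace_def f(3) by blast
  then have "V \<subseteq> span (\<Union>x y. joint_eigenspace scale V A B x y)"
    unfolding f(3) by (rule span_mono)
  moreover have "span (\<Union>x y. joint_eigenspace scale V A B x y) \<subseteq> V"
    unfolding f(3) joint_eigenspace_def by (rule span_minimal) (blast, rule subspace_span)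
  ultimately show "V = span (\<Union>x y. joint_eigenspace scale V A B x y)" by blast
qed

end

section \<open>Fock spaces and the lattice modules\<close>

abbreviation "lookup \<equiv> Poly_Mapping.lookup"
abbreviation "keys \<equiv> Poly_Mapping.keys"

text \<open>
  Scalar multiplication on \<^typ>\<open>'b \<Rightarrow>\<^sub>0 complex\<close> for any index type, so that Fock spaces and the
  beta-gamma modules share the same linear algebra.
\<close>

definition pscale :: "complex \<Rightarrow> ('b \<Rightarrow>\<^sub>0 complex) \<Rightarrow> ('b \<Rightarrow>\<^sub>0 complex)"
  where "pscale c = Poly_Mapping.map ((*) c)"

lemma lookup_pscale [simp]: "lookup (pscale c v) b = c * lookup v b"
  unfolding pscale_def by (simp add: Poly_Mapping.map.rep_eq when_def)

interpretation pm: complex_space "pscale :: complex \<Rightarrow> ('b \<Rightarrow>\<^sub>0 complex) \<Rightarrow> ('b \<Rightarrow>\<^sub>0 complex)"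
  by unfold_locales (auto intro!: poly_mapping_eqI simp: lookup_add algebra_simps)

lemma fock_scale_eq: "fock_scale = pscale"
  by (simp add: fun_eq_iff fock_scale_def pscale_def)

lemma pscale_single [simp]: "pscale c (Poly_Mapping.single b d) = Poly_Mapping.single b (c * d)"
  by (rule poly_mapping_eqI) (simp add: lookup_single when_def)

definition plinear :: "(('b \<Rightarrow>\<^sub>0 complex) \<Rightarrow> ('c \<Rightarrow>\<^sub>0 complex)) \<Rightarrow> bool"
  where "plinear F \<longleftrightarrow> (\<forall>x y. F (x + y) = F x + F y) \<and> (\<forall>c x. F (pscale c x) = pscale c (F x))"

lemma plinear_iff: "plinear F \<longleftrightarrow> Vector_Spaces.linear pscale pscale F"
proof
  assume "plinear F"
  then show "Vector_Spaces.linear pscale pscale F"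
    by unfold_locales (simp_all add: plinear_def)
next
  assume "Vector_Spaces.linear pscale pscale F"
  then interpret F: Vector_Spaces.linear pscale pscale F .
  show "plinear F" unfolding plinear_def by (simp add: F.add F.scale)
qed

lemma plinear_add: "plinear F \<Longrightarrow> F (x + y) = F x + F y"
  and plinear_scale: "plinear F \<Longrightarrow> F (pscale c x) = pscale c (F x)"
  by (auto simp: plinear_def)

lemma plinear_0: "plinear F \<Longrightarrow> F 0 = 0"
  using plinear_scale[of F 0 0] by simp

lemma plinear_sum: "plinear F \<Longrightarrow> F (\<Sum>i\<in>I. g i) = (\<Sum>i\<in>I. F (g i))"
  by (induction I rule: infinite_finite_induct) (auto simp: plinear_add plinear_0)

lemma plinear_neg: "plinear F \<Longrightarrow> F (- x) = - F x"
  using plinear_add[of F x "- x"] by (simp add: plinear_0 eq_neg_iff_add_eq_0 add.commute)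

lemma plinear_diff: "plinear F \<Longrightarrow> F (x - y) = F x - F y"
  using plinear_add[of F x "- y"] by (simp add: plinear_neg)

lemma pm_decompose: "v = (\<Sum>b\<in>keys v. Poly_Mapping.single b (lookup v b))"
  by (rule poly_mapping_eqI) (simp add: lookup_sum lookup_single when_def sum.If_cases in_keys_iff)

lemma plinear_eqI:
  assumes "plinear F" "plinear G" "\<And>b. F (Poly_Mapping.single b 1) = G (Poly_Mapping.single b 1)"
  shows "F v = G v"
proof -
  have s: "H v = (\<Sum>b\<in>keys v. pscale (lookup v b) (H (Poly_Mapping.single b 1)))" if "plinear H"
    for H :: "('a \<Rightarrow>\<^sub>0 complex) \<Rightarrow> ('b \<Rightarrow>\<^sub>0 complex)"
  proof -
    have "H v = H (\<Sum>b\<in>keys v. pscale (lookup v b) (Poly_Mapping.single b 1))"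
      using pm_decompose[of v] by simp
    also have "\<dots> = (\<Sum>b\<in>keys v. pscale (lookup v b) (H (Poly_Mapping.single b 1)))"
      by (simp only: plinear_sum[OF that] plinear_scale[OF that])
    finally show ?thesis .
  qed
  show ?thesis unfolding s[OF assms(1)] s[OF assms(2)] assms(3) ..
qed

text \<open>
  The linear extension of a map given on the basis vectors.
\<close>

definition plin :: "('b \<Rightarrow> ('c \<Rightarrow>\<^sub>0 complex)) \<Rightarrow> ('b \<Rightarrow>\<^sub>0 complex) \<Rightarrow> ('c \<Rightarrow>\<^sub>0 complex)"
  where "plin f v = (\<Sum>b\<in>keys v. pscale (lookup v b) (f b))"

lemma plin_superset:
  assumes "finite S" "keys v \<subseteq> S"
  shows "plin f v = (\<Sum>b\<in>S. pscale (lookup v b) (f b))"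
  unfolding plin_def using assms
  by (intro sum.mono_neutral_left) (auto simp: in_keys_iff)

lemma plinear_plin [intro, simp]: "plinear (plin f)"
  unfolding plinear_def
proof (intro conjI allI)
  fix x y :: "'a \<Rightarrow>\<^sub>0 complex"
  have "plin f (x + y) = (\<Sum>b\<in>keys x \<union> keys y. pscale (lookup (x + y) b) (f b))"
    by (rule plin_superset) (auto simp: in_keys_iff lookup_add)
  moreover have "plin f x = (\<Sum>b\<in>keys x \<union> keys y. pscale (lookup x b) (f b))"
    by (rule plin_superset) auto
  moreover have "plin f y = (\<Sum>b\<in>keys x \<union> keys y. pscale (lookup y b) (f b))"
    by (rule plin_superset) auto
  ultimately show "plin f (x + y) = plin f x + plin f y"
    by (simp add: lookup_add pm.scale_left_distrib sum.distrib)
next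
  fix c and x :: "'a \<Rightarrow>\<^sub>0 complex"
  have "plin f (pscale c x) = (\<Sum>b\<in>keys x. pscale (lookup (pscale c x) b) (f b))"
    by (rule plin_superset) (auto simp: in_keys_iff)
  then show "plin f (pscale c x) = pscale c (plin f x)"
    by (simp add: plin_def pm.scale_sum_right)
qed

lemma plin_single [simp]: "plin f (Poly_Mapping.single b c) = pscale c (f b)"
  by (cases "c = 0") (simp_all add: plin_def)

lemma lookup_plin_diag: "lookup (plin (\<lambda>b. Poly_Mapping.single b (g b)) v) b = g b * lookup v b"
  by (simp add: plin_def lookup_sum lookup_single when_def sum.If_cases in_keys_iff)

definition heis_basis :: "complex \<Rightarrow> complex \<Rightarrow> int \<Rightarrow> nat multiset \<Rightarrow> fock"
  where "heis_basis \<kappa> \<nu> n P =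
    (if n = 0 then Poly_Mapping.single P \<nu>
     else if n < 0 then Poly_Mapping.single (add_mset (nat (- n) - 1) P) 1
     else Poly_Mapping.single (P - {#nat n - 1#}) (\<kappa> * of_int n * of_nat (count P (nat n - 1))))"

lemma heis_eq_plin: "heis \<kappa> \<nu> n = plin (heis_basis \<kappa> \<nu> n)"
proof
  fix v
  show "heis \<kappa> \<nu> n v = plin (heis_basis \<kappa> \<nu> n) v"
  proof (cases "n = 0")
    case True
    have "plin (heis_basis \<kappa> \<nu> n) v = plin (\<lambda>P. Poly_Mapping.single P \<nu>) v"
      by (simp add: plin_def heis_basis_def True)
    then show ?thesis
      by (intro poly_mapping_eqI) (simp add: heis_def True fock_scale_eq lookup_plin_diag)
  next
    case False
    then show ?thesis
      by (auto simp: heis_def plin_def heis_basis_def mult.commute intro!: sum.cong)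
  qed
qed

lemma plinear_heis [intro, simp]: "plinear (heis \<kappa> \<nu> n)"
  by (simp add: heis_eq_plin)

text \<open>
  The conformal weight of the Fock monomial \<open>P\<close>: the entry \<open>i\<close> stands for the mode \<open>a_(-(i+1))\<close>.
\<close>

definition wt :: "nat multiset \<Rightarrow> nat" where "wt P = sum_mset P + size P"

lemma wt_simps [simp]: "wt {#} = 0" "wt (add_mset x P) = Suc x + wt P" "wt (P + Q) = wt P + wt Q"
  by (simp_all add: wt_def)

lemma wt_ge: "x \<in># P \<Longrightarrow> Suc x \<le> wt P"
  by (metis insert_DiffM le_add1 wt_simps(2))

lemma finite_wt [simp, intro]: "finite {P. wt P = n}"
proof (induction n rule: less_induct)
  case (less n)
  have "{P. wt P = n} \<subseteq> {{#}} \<union> (\<Union>x<n. add_mset x ` {P. wt P = n - Suc x})"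
  proof
    fix P assume "P \<in> {P. wt P = n}"
    then show "P \<in> {{#}} \<union> (\<Union>x<n. add_mset x ` {P. wt P = n - Suc x})"
    proof (cases P)
      case (add x N)
      then have "P \<in> add_mset x ` {P. wt P = n - Suc x}" "x < n" using \<open>P \<in> {P. wt P = n}\<close> by auto
      then show ?thesis by blast
    qed simp
  qed
  moreover have "finite ({{#}} \<union> (\<Union>x<n. add_mset x ` {P. wt P = n - Suc x}))"
    using less by auto
  ultimately show ?case by (rule finite_subset)
qed

lemma finite_wt_le [simp, intro]: "finite {P. wt P \<le> n}"
proof -
  have "{P. wt P \<le> n} = (\<Union>m\<le>n. {P. wt P = m})" by auto
  then show ?thesis by simp
qed

lemma wt_eq_sum:
  assumes "\<forall>x\<in>#P. x < M"
  shows "wt P = (\<Sum>j<M. Suc j * count P j)"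
  using assms
proof (induction P)
  case (add x P)
  have "(\<Sum>j<M. Suc j * count (add_mset x P) j) = (\<Sum>j<M. Suc j * count P j + (if j = x then Suc j else 0))"
    by (rule sum.cong) auto
  also have "\<dots> = (\<Sum>j<M. Suc j * count P j) + Suc x"
    using add.prems by (simp add: sum.distrib)
  finally show ?case using add by simp
qed simp

lemma heis_pos_eq_0:
  assumes "\<And>P. P \<in> keys v \<Longrightarrow> wt P < n"
  shows "heis \<kappa> \<nu> (int n) v = 0"
proof -
  have "count P (n - 1) = 0" if "P \<in> keys v" for P
    using assms[OF that] wt_ge[of "n - 1" P] by (auto simp: count_eq_zero_iff)
  moreover have "n > 0 \<or> v = 0"
  proof (cases "v = 0")
    case False
    then obtain P where "P \<in> keys v" by fastforce
    then show ?thesis using assms[of P] by simp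
  qed simp
  ultimately show ?thesis
    by (auto simp: heis_def fock_scale_eq intro!: sum.neutral)
qed

lemma heis_pos_smooth: "\<exists>M. \<forall>n\<ge>M. heis \<kappa> \<nu> (int n) v = 0"
proof (intro exI allI impI)
  fix n assume n: "Suc (\<Sum>P\<in>keys v. wt P) \<le> n"
  show "heis \<kappa> \<nu> (int n) v = 0"
  proof (rule heis_pos_eq_0)
    fix P assume "P \<in> keys v"
    then have "wt P \<le> (\<Sum>P\<in>keys v. wt P)" by (intro member_le_sum) auto
    then show "wt P < n" using n by simp
  qed
qed

lemma plinear_compose: "plinear F \<Longrightarrow> plinear G \<Longrightarrow> plinear (\<lambda>v. F (G v))"
  by (simp add: plinear_def)

text \<open>
  \<open>a_(-n) a_n\<close> counts the modes of index \<open>n\<close>; hence \<open>L_0\<close> is diagonal on monomials.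
\<close>

lemma heis_number_operator:
  assumes "n > 0"
  shows "heis \<kappa> \<nu> (- n) (heis \<kappa> \<nu> n v) =
    plin (\<lambda>P. Poly_Mapping.single P (\<kappa> * of_int n * of_nat (count P (nat n - 1)))) v"
proof (rule plinear_eqI[where F = "\<lambda>v. heis \<kappa> \<nu> (- n) (heis \<kappa> \<nu> n v)"])
  fix P
  show "heis \<kappa> \<nu> (- n) (heis \<kappa> \<nu> n (Poly_Mapping.single P 1)) =
    plin (\<lambda>P. Poly_Mapping.single P (\<kappa> * of_int n * of_nat (count P (nat n - 1)))) (Poly_Mapping.single P 1)"
    using assms
    by (cases "count P (nat n - 1) = 0")
       (auto simp: heis_eq_plin heis_basis_def plinear_0 simp del: count_eq_zero_iff)
qed (auto intro: plinear_compose)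

text \<open>
  The occupation numbers weighted by the mode indices add up to the weight, because \<open>\<kappa>\<close> cancels
  against the normalization \<open>1 / (2 \<kappa>)\<close>.
\<close>

lemma lookup_fock_L0:
  assumes "\<kappa> \<noteq> 0"
  shows "lookup (fock_L0 \<kappa> \<beta> \<nu> v) P = (\<nu>\<^sup>2 / (2 * \<kappa>) - \<beta> * \<nu> + of_nat (wt P)) * lookup v P"
proof -
  obtain M where M: "\<forall>n\<ge>M. heis \<kappa> \<nu> (int n) v = 0" using heis_pos_smooth by blast
  \<comment> \<open>Beyond \<open>K\<close> neither a mode acts nontrivially on \<open>v\<close> nor can it occur in \<open>P\<close>.\<close>
  define K where "K = M + wt P + 1"
  have "(\<Sum>n | n > 0 \<and> heis \<kappa> \<nu> n v \<noteq> 0. heis \<kappa> \<nu> (- n) (heis \<kappa> \<nu> n v)) =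
     (\<Sum>n\<in>{1..int K}. heis \<kappa> \<nu> (- n) (heis \<kappa> \<nu> n v))"
  proof (rule sum.mono_neutral_left)
    show "{n. n > 0 \<and> heis \<kappa> \<nu> n v \<noteq> 0} \<subseteq> {1..int K}"
    proof
      fix n assume n: "n \<in> {n. n > 0 \<and> heis \<kappa> \<nu> n v \<noteq> 0}"
      then have "nat n < M" using M[rule_format, of "nat n"] by force
      then show "n \<in> {1..int K}" using n by (auto simp: K_def)
    qed
  qed (auto simp: plinear_0)
  also have "lookup \<dots> P = (\<Sum>n\<in>{1..int K}. \<kappa> * of_int n * of_nat (count P (nat n - 1)) * lookup v P)"
    unfolding lookup_sum by (rule sum.cong) (auto simp: heis_number_operator lookup_plin_diag)
  also have "\<dots> = (\<Sum>j<K. \<kappa> * of_nat (Suc j) * of_nat (count P j) * lookup v P)"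
    by (rule sum.reindex_bij_witness[of _ "\<lambda>j. int (Suc j)" "\<lambda>n. nat n - 1"]) (auto simp: of_nat_diff)
  also have "\<dots> = \<kappa> * lookup v P * of_nat (\<Sum>j<K. Suc j * count P j)"
    by (simp add: sum_distrib_left algebra_simps)
  also have "(\<Sum>j<K. Suc j * count P j) = wt P"
    by (rule wt_eq_sum[symmetric]) (auto simp: K_def dest: wt_ge)
  finally have s: "lookup (\<Sum>n | n > 0 \<and> heis \<kappa> \<nu> n v \<noteq> 0. heis \<kappa> \<nu> (- n) (heis \<kappa> \<nu> n v)) P =
    \<kappa> * lookup v P * of_nat (wt P)" .
  have h0: "heis \<kappa> \<nu> 0 w = pscale \<nu> w" for w by (simp add: heis_def fock_scale_eq)
  show ?thesis
    unfolding fock_L0_def fock_scale_eq h0 using assms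
    by (simp add: lookup_add lookup_minus s power2_eq_square field_simps)
qed

lemma fock_L0_0: "\<kappa> \<noteq> 0 \<Longrightarrow> fock_L0 \<kappa> \<beta> \<nu> 0 = 0"
  by (rule poly_mapping_eqI) (simp add: lookup_fock_L0)

lemma lookup_fsum_scale [simp]: "lookup (fsum_scale c v) \<nu> = pscale c (lookup v \<nu>)"
  unfolding fsum_scale_def fock_scale_eq
  by (auto simp: Poly_Mapping.map.rep_eq when_def intro!: poly_mapping_eqI)

interpretation fsum: complex_space fsum_scale
  by unfold_locales (auto intro!: poly_mapping_eqI simp: lookup_add algebra_simps)

lemma lookup_fsum_L0:
  "\<kappa> \<noteq> 0 \<Longrightarrow> lookup (fsum_L0 \<kappa> \<beta> v) \<nu> = fock_L0 \<kappa> \<beta> \<nu> (lookup v \<nu>)"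
  unfolding fsum_L0_def by (auto simp: lookup_mapp when_def in_keys_iff fock_L0_0)

lemma lookup_fsum_a0: "lookup (fsum_a0 \<kappa> v) \<nu> = pscale \<nu> (lookup v \<nu>)"
  unfolding fsum_a0_def by (auto simp: lookup_mapp when_def in_keys_iff heis_def fock_scale_eq)

lemma fock_sum_eqI: "(\<And>\<nu> P. lookup (lookup v \<nu>) P = lookup (lookup w \<nu>) P) \<Longrightarrow> v = w" for v w :: fock_sum
  by (intro poly_mapping_eqI) auto

lemma linear_fsum_L0: "\<kappa> \<noteq> 0 \<Longrightarrow> Vector_Spaces.linear fsum_scale fsum_scale (fsum_L0 \<kappa> \<beta>)"
  by unfold_locales
     (auto intro!: fock_sum_eqI simp: lookup_fsum_L0 lookup_fock_L0 lookup_add algebra_simps add_divide_distrib)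

lemma linear_fsum_a0: "Vector_Spaces.linear fsum_scale fsum_scale (fsum_a0 \<kappa>)"
  by unfold_locales
     (auto intro!: fock_sum_eqI simp: lookup_fsum_a0 lookup_add algebra_simps)

lemma linear_fsum_zero: "Vector_Spaces.linear fsum_scale fsum_scale (\<lambda>v. 0)"
  by unfold_locales auto

definition fock_vec :: "complex \<times> nat multiset \<Rightarrow> fock_sum"
  where "fock_vec = (\<lambda>(\<nu>, P). Poly_Mapping.single \<nu> (Poly_Mapping.single P 1))"

lemma lookup_fock_vec: "lookup (lookup (fock_vec i) \<nu>) P = (if i = (\<nu>, P) then 1 else 0)"
  by (cases i) (auto simp: fock_vec_def lookup_single when_def)

lemma inj_fock_vec: "inj_on fock_vec I"
proof (rule inj_onI)
  fix i j assume eq: "fock_vec i = fock_vec j"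
  have "lookup (lookup (fock_vec i) (fst i)) (snd i) = 1" by (simp add: lookup_fock_vec)
  then have "(if j = (fst i, snd i) then 1 else 0) = (1 :: complex)" unfolding eq lookup_fock_vec .
  then show "i = j" by (simp split: if_splits)
qed

lemma lookup_sum2: "lookup (lookup (\<Sum>i\<in>J. g i) \<nu>) P = (\<Sum>i\<in>J. lookup (lookup (g i) \<nu>) P)"
  for g :: "'i \<Rightarrow> fock_sum"
  by (simp add: lookup_sum)

lemma independent_fock_vec: "fsum.independent (fock_vec ` I)"
proof (rule fsum.independent_imageI[OF inj_fock_vec])
  fix J c i assume J: "finite J" "(\<Sum>i\<in>J. fsum_scale (c i) (fock_vec i)) = 0" "i \<in> J"
  have "lookup (lookup (\<Sum>i\<in>J. fsum_scale (c i) (fock_vec i)) (fst i)) (snd i) = (\<Sum>j\<in>J. if j = i then c j else 0)"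
    unfolding lookup_sum2 by (rule sum.cong) (auto simp: lookup_fock_vec)
  then show "c i = 0" using J by simp
qed

lemma fock_vec_decompose:
  "v = (\<Sum>\<nu>\<in>keys v. \<Sum>P\<in>keys (lookup v \<nu>). fsum_scale (lookup (lookup v \<nu>) P) (fock_vec (\<nu>, P)))"
proof (rule fock_sum_eqI)
  fix \<nu> P
  have "(\<Sum>\<mu>\<in>keys v. \<Sum>R\<in>keys (lookup v \<mu>). lookup (lookup v \<mu>) R * (if (\<mu>, R) = (\<nu>, P) then 1 else 0))
    = (\<Sum>\<mu>\<in>keys v. \<Sum>R\<in>keys (lookup v \<mu>). if \<mu> = \<nu> then if R = P then lookup (lookup v \<nu>) P else 0 else 0)"
    by (intro sum.cong) auto
  also have "\<dots> = (\<Sum>\<mu>\<in>keys v. if \<mu> = \<nu> then lookup (lookup v \<nu>) P else 0)"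
    by (rule sum.cong) (auto simp: in_keys_iff)
  also have "\<dots> = lookup (lookup v \<nu>) P"
    by (auto simp: in_keys_iff)
  finally show "lookup (lookup v \<nu>) P = lookup (lookup (\<Sum>\<nu>\<in>keys v. \<Sum>P\<in>keys (lookup v \<nu>).
      fsum_scale (lookup (lookup v \<nu>) P) (fock_vec (\<nu>, P))) \<nu>) P"
    by (simp add: lookup_sum2 lookup_fock_vec)
qed

lemma subspace_lattice_module: "fsum.subspace (lattice_module \<alpha> l)"
  unfolding fsum.subspace_def lattice_module_def
proof (intro conjI ballI allI; clarify)
  fix v w :: fock_sum and \<nu>
  assume vw: "keys v \<subseteq> {l + of_int m * \<alpha> |m. True}" "keys w \<subseteq> {l + of_int m * \<alpha> |m. True}" "\<nu> \<in> keys (v + w)"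
  have "\<nu> \<in> keys v \<or> \<nu> \<in> keys w" using vw(3) Poly_Mapping.keys_add[of v w] by blast
  then show "\<exists>m. \<nu> = l + of_int m * \<alpha> \<and> True" using vw by blast
next
  fix c v \<nu>
  assume v: "keys v \<subseteq> {l + of_int m * \<alpha> |m. True}" "\<nu> \<in> keys (fsum_scale c v)"
  then have "\<nu> \<in> keys v" by (auto simp: in_keys_iff)
  then show "\<exists>m. \<nu> = l + of_int m * \<alpha> \<and> True" using v by blast
next
  fix \<nu> :: complex assume "\<nu> \<in> keys (0 :: fock_sum)"
  then show "\<exists>m. \<nu> = l + of_int m * \<alpha> \<and> True" by simp
qed

lemma lattice_module_span:
  "lattice_module \<alpha> l = fsum.span (fock_vec ` {(\<nu>, P). \<exists>m::int. \<nu> = l + of_int m * \<alpha>})" (is "_ = fsum.span (_ ` ?I)")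
proof
  show "lattice_module \<alpha> l \<subseteq> fsum.span (fock_vec ` ?I)"
  proof
    fix v assume v: "v \<in> lattice_module \<alpha> l"
    show "v \<in> fsum.span (fock_vec ` ?I)"
      by (subst fock_vec_decompose, intro fsum.span_sum fsum.span_scale fsum.span_base imageI)
         (use v in \<open>auto simp: lattice_module_def\<close>)
  qed
  show "fsum.span (fock_vec ` ?I) \<subseteq> lattice_module \<alpha> l"
    by (rule fsum.span_minimal[OF _ subspace_lattice_module])
       (auto simp: lattice_module_def fock_vec_def split: if_splits)
qed

lemma fsum_L0_fock_vec:
  "\<kappa> \<noteq> 0 \<Longrightarrow> fsum_L0 \<kappa> \<beta> (fock_vec i) = fsum_scale ((fst i)\<^sup>2 / (2 * \<kappa>) - \<beta> * fst i + of_nat (wt (snd i))) (fock_vec i)"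
  by (rule fock_sum_eqI) (auto simp: lookup_fsum_L0 lookup_fock_L0 lookup_fock_vec)

lemma fsum_a0_fock_vec: "fsum_a0 \<kappa> (fock_vec i) = fsum_scale (fst i) (fock_vec i)"
  by (rule fock_sum_eqI) (auto simp: lookup_fsum_a0 lookup_fock_vec)

lemma ch_VD_card:
  "ch_VD l (x, y) = card {(\<nu>, P). (\<exists>m::int. \<nu> = l + of_int m * 2) \<and> \<nu> = x \<and> - \<nu>\<^sup>2 / 2 + of_nat (wt P) = y + 1 / 24}"
  (is "_ = card ?S")
proof -
  have "ch_VD l (x, y) = card {i \<in> {(\<nu>, P). \<exists>m::int. \<nu> = l + of_int m * 2}. fst i = x \<and>
      (fst i)\<^sup>2 / (2 * (- 1)) - 0 * fst i + of_nat (wt (snd i)) = y + 1 / 24}"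
    unfolding ch_VD_def trace_series_def prod.case
    by (rule fsum.dim_joint_eigenspace_eigenbasis[OF linear_fsum_a0 linear_fsum_L0 inj_fock_vec
         independent_fock_vec lattice_module_span fsum_a0_fock_vec fsum_L0_fock_vec]) simp_all
  also have "{i \<in> {(\<nu>, P). \<exists>m::int. \<nu> = l + of_int m * 2}. fst i = x \<and>
      (fst i)\<^sup>2 / (2 * (- 1)) - 0 * fst i + of_nat (wt (snd i)) = y + 1 / 24} = ?S"
    by auto
  finally show ?thesis .
qed

lemma ch_VD_is_defined: "ch_VD_defined l"
  unfolding ch_VD_defined_def
proof (rule fsum.trace_defined_eigenbasis[OF linear_fsum_a0 linear_fsum_L0 inj_fock_vec
         independent_fock_vec lattice_module_span fsum_a0_fock_vec fsum_L0_fock_vec])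
  fix x y :: complex
  have "{i \<in> {(\<nu>, P). \<exists>m::int. \<nu> = l + of_int m * 2}. fst i = x \<and>
      (fst i)\<^sup>2 / (2 * - 1) - 0 * fst i + of_nat (wt (snd i)) = y}
      \<subseteq> {x} \<times> {P. wt P = nat \<lfloor>Re (y + x\<^sup>2 / 2)\<rfloor>}" (is "?L \<subseteq> _")
  proof
    fix i assume i: "i \<in> ?L"
    then have e: "of_nat (wt (snd i)) = y + x\<^sup>2 / 2" by (auto simp: algebra_simps)
    have "Re (y + x\<^sup>2 / 2) = real (wt (snd i))" unfolding e[symmetric] by simp
    then show "i \<in> {x} \<times> {P. wt P = nat \<lfloor>Re (y + x\<^sup>2 / 2)\<rfloor>}" using i by (cases i) auto
  qed
  then show "finite {i \<in> {(\<nu>, P). \<exists>m::int. \<nu> = l + of_int m * 2}. fst i = x \<and>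
      (fst i)\<^sup>2 / (2 * - 1) - 0 * fst i + of_nat (wt (snd i)) = y}"
    by (rule finite_subset) auto
qed simp_all

section \<open>Smooth modules over affine sl(2)\<close>

definition sug_zero :: "'v::ab_group_add sl2_module \<Rightarrow> 'v \<Rightarrow> 'v"
  where "sug_zero M v = scl M (1 / 2) (hop M 0 (hop M 0 v)) - eop M 0 (fop M 0 v) - fop M 0 (eop M 0 v)"

definition sug_term :: "'v::ab_group_add sl2_module \<Rightarrow> int \<Rightarrow> 'v \<Rightarrow> 'v"
  where "sug_term M n v = hop M (- n) (hop M n v) - scl M 2 (eop M (- n) (fop M n v))
          - scl M 2 (fop M (- n) (eop M n v))"

text \<open>
  A bound beyond which all modes annihilate \<open>v\<close>. It makes the Sugawara sum a sum over \<open>{1..N}\<close>, so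
  that sums for different vectors can be compared.
\<close>

definition killed_above :: "'v::ab_group_add sl2_module \<Rightarrow> int \<Rightarrow> 'v \<Rightarrow> bool"
  where "killed_above M N v \<longleftrightarrow> (\<forall>n>N. eop M n v = 0 \<and> fop M n v = 0 \<and> hop M n v = 0)"

lemma killed_above_mono: "killed_above M N v \<Longrightarrow> N \<le> N' \<Longrightarrow> killed_above M N' v"
  by (auto simp: killed_above_def)

locale affine = affine_sl2_module k M for k :: complex and M :: "'v::ab_group_add sl2_module"
begin

sublocale V: complex_space "scl M"
  by (simp add: complex_space_def vector_space)

lemma lin_e: "eop M n (x + y) = eop M n x + eop M n y" "eop M n (scl M c x) = scl M c (eop M n x)"
  "eop M n 0 = 0" "eop M n (x - y) = eop M n x - eop M n y" "eop M n (- x) = - eop M n x"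
  "eop M n (\<Sum>i\<in>I. g i) = (\<Sum>i\<in>I. eop M n (g i))"
proof -
  interpret l: Vector_Spaces.linear "scl M" "scl M" "eop M n" by (rule linear_e)
  show "eop M n (x + y) = eop M n x + eop M n y" "eop M n (scl M c x) = scl M c (eop M n x)"
  "eop M n 0 = 0" "eop M n (x - y) = eop M n x - eop M n y" "eop M n (- x) = - eop M n x"
  "eop M n (\<Sum>i\<in>I. g i) = (\<Sum>i\<in>I. eop M n (g i))"
    by (fact l.add l.scale l.zero l.diff l.neg l.sum)+
qed

lemma lin_f: "fop M n (x + y) = fop M n x + fop M n y" "fop M n (scl M c x) = scl M c (fop M n x)"
  "fop M n 0 = 0" "fop M n (x - y) = fop M n x - fop M n y" "fop M n (- x) = - fop M n x"
  "fop M n (\<Sum>i\<in>I. g i) = (\<Sum>i\<in>I. fop M n (g i))"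
proof -
  interpret l: Vector_Spaces.linear "scl M" "scl M" "fop M n" by (rule linear_f)
  show "fop M n (x + y) = fop M n x + fop M n y" "fop M n (scl M c x) = scl M c (fop M n x)"
  "fop M n 0 = 0" "fop M n (x - y) = fop M n x - fop M n y" "fop M n (- x) = - fop M n x"
  "fop M n (\<Sum>i\<in>I. g i) = (\<Sum>i\<in>I. fop M n (g i))"
    by (fact l.add l.scale l.zero l.diff l.neg l.sum)+
qed

lemma lin_h: "hop M n (x + y) = hop M n x + hop M n y" "hop M n (scl M c x) = scl M c (hop M n x)"
  "hop M n 0 = 0" "hop M n (x - y) = hop M n x - hop M n y" "hop M n (- x) = - hop M n x"
  "hop M n (\<Sum>i\<in>I. g i) = (\<Sum>i\<in>I. hop M n (g i))"
proof -
  interpret l: Vector_Spaces.linear "scl M" "scl M" "hop M n" by (rule linear_h)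
  show "hop M n (x + y) = hop M n x + hop M n y" "hop M n (scl M c x) = scl M c (hop M n x)"
  "hop M n 0 = 0" "hop M n (x - y) = hop M n x - hop M n y" "hop M n (- x) = - hop M n x"
  "hop M n (\<Sum>i\<in>I. g i) = (\<Sum>i\<in>I. hop M n (g i))"
    by (fact l.add l.scale l.zero l.diff l.neg l.sum)+
qed

lemmas lin = lin_e lin_f lin_h

lemma he: "hop M m (eop M n v) = eop M n (hop M m v) + scl M 2 (eop M (m + n) v)"
  using bracket_he[of m n v] by (simp add: algebra_simps)

lemma hf: "hop M m (fop M n v) = fop M n (hop M m v) - scl M 2 (fop M (m + n) v)"
  using bracket_hf[of m n v] by (simp add: algebra_simps)

lemma hh: "hop M m (hop M n v) = hop M n (hop M m v) + scl M (if m + n = 0 then 2 * of_int m * k else 0) v"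
  using bracket_hh[of m n v] by (simp only: diff_eq_eq) (simp add: add.commute)

lemma fe: "fop M n (eop M m v) = eop M m (fop M n v) + hop M (m + n) v + scl M (if m + n = 0 then of_int m * k else 0) v"
  using bracket_ef[of m n v] by (simp add: algebra_simps)

lemma killed_above_exists: "\<exists>N\<ge>0. killed_above M N v"
proof -
  obtain N where "\<forall>n\<ge>N. eop M n v = 0 \<and> fop M n v = 0 \<and> hop M n v = 0" using smooth by blast
  then show ?thesis by (intro exI[of _ "max 0 N"]) (auto simp: killed_above_def)
qed

lemma killed_above_exists2: "\<exists>N\<ge>0. killed_above M N v \<and> killed_above M N w"
proof -
  obtain N1 N2 where "N1 \<ge> 0" "killed_above M N1 v" "N2 \<ge> 0" "killed_above M N2 w"
    using killed_above_exists by blast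
  then show ?thesis by (intro exI[of _ "max N1 N2"]) (auto intro: killed_above_mono)
qed

lemma sugawara_bounded:
  assumes "killed_above M N v"
  shows "sugawara_L0 k M v = scl M (1 / (2 * (k + 2))) (sug_zero M v + (\<Sum>n\<in>{1..N}. sug_term M n v))"
proof -
  have "(\<Sum>n | n > 0 \<and> (eop M n v \<noteq> 0 \<or> fop M n v \<noteq> 0 \<or> hop M n v \<noteq> 0). sug_term M n v)
      = (\<Sum>n\<in>{1..N}. sug_term M n v)"
  proof (rule sum.mono_neutral_left)
    show "{n. n > 0 \<and> (eop M n v \<noteq> 0 \<or> fop M n v \<noteq> 0 \<or> hop M n v \<noteq> 0)} \<subseteq> {1..N}"
      using assms unfolding killed_above_def by (auto simp: not_less[symmetric])
    show "\<forall>n\<in>{1..N} - {n. n > 0 \<and> (eop M n v \<noteq> 0 \<or> fop M n v \<noteq> 0 \<or> hop M n v \<noteq> 0)}. sug_term M n v = 0"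
      by (auto simp: sug_term_def lin)
  qed simp
  then show ?thesis
    unfolding sugawara_L0_def sug_zero_def sug_term_def by simp
qed

lemma sugawara_add: "sugawara_L0 k M (v + w) = sugawara_L0 k M v + sugawara_L0 k M w"
proof -
  obtain N where N: "killed_above M N v" "killed_above M N w" using killed_above_exists2 by blast
  then have "killed_above M N (v + w)" by (auto simp: killed_above_def lin)
  then show ?thesis
    unfolding N[THEN sugawara_bounded]
    by (subst sugawara_bounded, assumption)
       (simp add: sug_zero_def sug_term_def lin sum.distrib sum_subtractf V.scale_right_distrib
          V.scale_right_diff_distrib)
qed

lemma sugawara_scale: "sugawara_L0 k M (scl M c v) = scl M c (sugawara_L0 k M v)"
proof -
  obtain N where N: "killed_above M N v" using killed_above_exists by blast
  then have "killed_above M N (scl M c v)" by (auto simp: killed_above_def lin)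
  then show ?thesis
    unfolding N[THEN sugawara_bounded]
    by (subst sugawara_bounded, assumption)
       (simp add: sug_zero_def sug_term_def lin V.scale_sum_right V.scale_right_distrib
          V.scale_right_diff_distrib mult.commute mult.left_commute)
qed

lemma linear_sugawara: "Vector_Spaces.linear (scl M) (scl M) (sugawara_L0 k M)"
  by unfold_locales (rule sugawara_add sugawara_scale)+

lemma sugawara_0: "sugawara_L0 k M 0 = 0"
  using sugawara_scale[of 0 0] by simp

lemma two_scale: "scl M 2 v = v + v"
  using V.scale_left_distrib[of 1 1 v] by simp

lemma half_half: "scl M (1/2) v + scl M (1/2) v = v"
  using V.scale_left_distrib[of "1/2" "1/2" v] by simp

text \<open>
  The Sugawara operator commutes with the horizontal \<open>sl(2)\<close> already term by term.
\<close>

lemma sug_term_e0: "sug_term M n (eop M 0 v) = eop M 0 (sug_term M n v)"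
  by (simp add: sug_term_def he fe lin two_scale bracket_ee[of _ 0] algebra_simps)

lemma sug_term_f0: "sug_term M n (fop M 0 v) = fop M 0 (sug_term M n v)"
  by (simp add: sug_term_def hf fe lin two_scale bracket_ff[of _ 0] algebra_simps)

lemma sug_zero_e0: "sug_zero M (eop M 0 v) = eop M 0 (sug_zero M v)"
  by (simp add: sug_zero_def he fe lin two_scale algebra_simps half_half)

lemma sug_zero_f0: "sug_zero M (fop M 0 v) = fop M 0 (sug_zero M v)"
  by (simp add: sug_zero_def hf fe lin two_scale algebra_simps half_half)

lemma sugawara_e0: "sugawara_L0 k M (eop M 0 v) = eop M 0 (sugawara_L0 k M v)"
proof -
  obtain N where N: "killed_above M N v" "killed_above M N (eop M 0 v)" using killed_above_exists2 by blast
  show ?thesis unfolding N[THEN sugawara_bounded] by (simp add: sug_term_e0 sug_zero_e0 lin)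
qed

lemma sugawara_f0: "sugawara_L0 k M (fop M 0 v) = fop M 0 (sugawara_L0 k M v)"
proof -
  obtain N where N: "killed_above M N v" "killed_above M N (fop M 0 v)" using killed_above_exists2 by blast
  show ?thesis unfolding N[THEN sugawara_bounded] by (simp add: sug_term_f0 sug_zero_f0 lin)
qed

lemma linearI:
  assumes "\<And>x y. f (x + y) = f x + f y" "\<And>c x. f (scl M c x) = scl M c (f x)"
  shows "Vector_Spaces.linear (scl M) (scl M) f"
  by unfold_locales (simp_all add: assms)

lemma spectral_flow_affine: "affine k (spectral_flow k s M)"
  unfolding affine_def
proof (rule affine_sl2_module.intro, goal_cases)
  case 1
  show ?case by (simp add: spectral_flow_def vector_space)
next
  case (2 n)
  show ?case by (simp add: spectral_flow_def linear_e)
next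
  case (3 n)
  show ?case by (simp add: spectral_flow_def linear_f)
next
  case (4 n)
  show ?case unfolding spectral_flow_def sl2_module.simps
    by (rule linearI) (simp_all add: lin algebra_simps)
next
  case (5 m n v)
  show ?case by (simp add: spectral_flow_def he lin algebra_simps)
next
  case (6 m n v)
  show ?case by (simp add: spectral_flow_def hf lin algebra_simps)
next
  case (7 m n v)
  show ?case by (simp add: spectral_flow_def hh[of m n] lin algebra_simps)
next
  case (8 m n v)
  show ?case by (simp add: spectral_flow_def fe lin algebra_simps)
next
  case (9 m n v)
  show ?case by (simp add: spectral_flow_def bracket_ee)
next
  case (10 m n v)
  show ?case by (simp add: spectral_flow_def bracket_ff)
next
  case (11 v)
  obtain N where N: "\<forall>n\<ge>N. eop M n v = 0 \<and> fop M n v = 0 \<and> hop M n v = 0" using smooth by blast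
  then show ?case
    by (intro exI[of _ "max 1 (N + \<bar>s\<bar>)"]) (auto simp: spectral_flow_def)
qed

text \<open>
  The terms of \<open>L_0\<close> on the flowed module are those on \<open>M\<close> with the indices of the \<open>e\<close> and \<open>f\<close> modes
  shifted in opposite directions. After reindexing only boundary terms remain, and reordering them
  produces \<open>h_0 / 2\<close> and \<open>k / 4\<close>.
\<close>

lemma sugawara_flow_1:
  assumes k2: "k + 2 \<noteq> 0"
  shows "sugawara_L0 k (spectral_flow k 1 M) v = sugawara_L0 k M v + scl M (1/2) (hop M 0 v) + scl M (k/4) v"
proof -
  let ?F = "spectral_flow k 1 M"
  interpret F: affine k ?F by (rule spectral_flow_affine)
  obtain N where N: "N \<ge> 0" "killed_above M N v" using killed_above_exists by blast
  define K where "K = N + 1"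
  have K: "killed_above M K v" "K \<ge> 1" using N by (auto simp: K_def intro: killed_above_mono)
  have z: "eop M n v = 0" "fop M n v = 0" "hop M n v = 0" if "n > N" for n
    using N(2) that by (auto simp: killed_above_def)
  have FK: "killed_above ?F K v"
    unfolding killed_above_def using N(1) by (auto simp: K_def spectral_flow_def z)
  define S1 where "S1 = (\<Sum>n\<in>{1..K}. hop M (- n) (hop M n v))"
  define S2 where "S2 = (\<Sum>n\<in>{1..K}. eop M (- n) (fop M n v))"
  define S3 where "S3 = (\<Sum>n\<in>{1..K}. fop M (- n) (eop M n v))"
  have M: "(\<Sum>n\<in>{1..K}. sug_term M n v) = S1 - scl M 2 S2 - scl M 2 S3"
    by (simp add: sug_term_def S1_def S2_def S3_def sum_subtractf V.scale_sum_right)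
  have s2: "(\<Sum>n\<in>{1..K}. eop M (1 - n) (fop M (n - 1) v)) = eop M 0 (fop M 0 v) + S2"
  proof -
    have "(\<Sum>n\<in>{1..K}. eop M (1 - n) (fop M (n - 1) v)) = (\<Sum>n\<in>{0..K - 1}. eop M (- n) (fop M n v))"
      by (rule sum.reindex_bij_witness[of _ "\<lambda>n. n + 1" "\<lambda>n. n - 1"]) auto
    also have "\<dots> = (\<Sum>n\<in>{0..K}. eop M (- n) (fop M n v))"
      by (rule sum.mono_neutral_left) (auto simp: K_def z lin)
    also have "{0..K} = insert 0 {1..K}" using K(2) by auto
    finally show ?thesis by (simp add: S2_def)
  qed
  have s3: "(\<Sum>n\<in>{1..K}. fop M (- n - 1) (eop M (n + 1) v)) = S3 - fop M (-1) (eop M 1 v)"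
  proof -
    have "(\<Sum>n\<in>{1..K}. fop M (- n - 1) (eop M (n + 1) v)) = (\<Sum>n\<in>{2..K + 1}. fop M (- n) (eop M n v))"
      by (rule sum.reindex_bij_witness[of _ "\<lambda>n. n - 1" "\<lambda>n. n + 1"]) auto
    also have "\<dots> = (\<Sum>n\<in>{2..K}. fop M (- n) (eop M n v))"
      by (rule sum.mono_neutral_right) (auto simp: K_def z lin)
    moreover have "{1..K} = insert 1 {2..K}" using K(2) by auto
    ultimately show ?thesis by (simp add: S3_def)
  qed
  have t: "sug_term ?F n v = hop M (- n) (hop M n v) - scl M 2 (eop M (1 - n) (fop M (n - 1) v))
      - scl M 2 (fop M (- n - 1) (eop M (n + 1) v))" if "n \<in> {1..K}" for n
    using that by (simp add: sug_term_def spectral_flow_def add.commute)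
  have F: "(\<Sum>n\<in>{1..K}. sug_term ?F n v) = S1 - scl M 2 (eop M 0 (fop M 0 v) + S2) - scl M 2 (S3 - fop M (-1) (eop M 1 v))"
    unfolding s2[symmetric] s3[symmetric] S1_def V.scale_sum_right sum_subtractf[symmetric]
    by (rule sum.cong) (auto simp: t)
  have h2: "scl M (1/2) (scl M k v') + scl M (1/2) (scl M k v') = scl M k v'" for v'
    using half_half by blast
  have "sug_zero ?F v + (\<Sum>n\<in>{1..K}. sug_term ?F n v) = sug_zero M v + (\<Sum>n\<in>{1..K}. sug_term M n v)
     + scl M (k + 2) (hop M 0 v) + scl M (k * (k + 2) / 2) v"
  proof -
    have e1: "eop M 1 (fop M (-1) v) = fop M (-1) (eop M 1 v) - hop M 0 v - scl M k v"
      using fe[of "-1" 1 v] by (simp add: algebra_simps)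
    have e0: "fop M 0 (eop M 0 v) = eop M 0 (fop M 0 v) + hop M 0 v"
      using fe[of 0 0 v] by simp
    have z0: "sug_zero ?F v = scl M (1/2) (hop M 0 (hop M 0 v)) + scl M k (hop M 0 v) + scl M (k * k / 2) v
        - eop M 1 (fop M (-1) v) - fop M (-1) (eop M 1 v)"
      using h2[of "hop M 0 v"] by (simp add: sug_zero_def spectral_flow_def lin algebra_simps)
    show ?thesis
      unfolding M F z0 e1 unfolding sug_zero_def e0
      by (simp add: two_scale V.scale_left_distrib V.scale_right_distrib V.scale_right_diff_distrib
        distrib_left add_divide_distrib)
  qed
  then have "sugawara_L0 k ?F v = scl M (1 / (2 * (k + 2))) (sug_zero M v + (\<Sum>n\<in>{1..K}. sug_term M n v)
     + scl M (k + 2) (hop M 0 v) + scl M (k * (k + 2) / 2) v)"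
    unfolding F.sugawara_bounded[OF FK] by (simp add: spectral_flow_def)
  also have "\<dots> = sugawara_L0 k M v + scl M (1 / (2 * (k + 2)) * (k + 2)) (hop M 0 v)
      + scl M (1 / (2 * (k + 2)) * (k * (k + 2) / 2)) v"
    unfolding sugawara_bounded[OF K(1)] by (simp only: V.scale_right_distrib V.scale_scale)
  also have "1 / (2 * (k + 2)) * (k + 2) = 1/2"
  proof -
    obtain c where c: "k + 2 = c" "c \<noteq> 0" using k2 by blast
    show ?thesis unfolding c(1) using c(2) by simp
  qed
  also have "1 / (2 * (k + 2)) * (k * (k + 2) / 2) = k / 4"
  proof -
    obtain c where c: "k + 2 = c" "c \<noteq> 0" using k2 by blast
    show ?thesis unfolding c(1) using c(2) by simp
  qed
  finally show ?thesis .
qed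

end

lemma spectral_flow_flow: "affine k M \<Longrightarrow> spectral_flow k s (spectral_flow k t M) = spectral_flow k (s + t) M"
proof -
  assume "affine k M"
  then interpret affine k M .
  show ?thesis unfolding spectral_flow_def
    by (auto simp: fun_eq_iff add.assoc add.left_commute V.scale_left_distrib algebra_simps)
qed

lemma spectral_flow_0: "affine k M \<Longrightarrow> spectral_flow k 0 M = M"
proof -
  assume "affine k M"
  then interpret affine k M .
  show ?thesis by (rule sl2_module.equality) (simp_all add: spectral_flow_def fun_eq_iff)
qed

lemma spectral_flow_sel [simp]:
  "scl (spectral_flow k s M) = scl M" "eop (spectral_flow k s M) n = eop M (n + s)"
  "fop (spectral_flow k s M) n = fop M (n - s)"
  "hop (spectral_flow k s M) n v = hop M n v + scl M (if n = 0 then of_int s * k else 0) v"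
  by (simp_all add: spectral_flow_def)

context affine begin

text \<open>
  Iteration of the flow by one step, in both directions.
\<close>

lemma sugawara_flow:
  assumes k2: "k + 2 \<noteq> 0"
  shows "sugawara_L0 k (spectral_flow k s M) v = sugawara_L0 k M v + scl M (of_int s / 2) (hop M 0 v) + scl M ((of_int s)\<^sup>2 * k / 4) v"
proof (induction s rule: int_induct[of _ 0])
  case base
  show ?case by (simp add: spectral_flow_0[OF affine_axioms])
next
  case (step1 i)
  have "sugawara_L0 k (spectral_flow k (i + 1) M) v = sugawara_L0 k (spectral_flow k 1 (spectral_flow k i M)) v"
    by (simp add: spectral_flow_flow[OF affine_axioms] add.commute)
  also have "\<dots> = sugawara_L0 k M v + (scl M (of_int i / 2) (hop M 0 v) + scl M (1/2) (hop M 0 v)) +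
      (scl M ((of_int i)\<^sup>2 * k / 4) v + scl M (of_int i * k / 2) v + scl M (k / 4) v)"
    unfolding affine.sugawara_flow_1[OF spectral_flow_affine k2] by (simp add: step1 algebra_simps)
  also have "\<dots> = sugawara_L0 k M v + scl M (of_int (i + 1) / 2) (hop M 0 v) + scl M ((of_int (i + 1))\<^sup>2 * k / 4) v"
    unfolding V.scale_left_distrib[symmetric] by (simp add: power2_eq_square field_simps)
  finally show ?case .
next
  case (step2 i)
  have "sugawara_L0 k (spectral_flow k i M) v = sugawara_L0 k (spectral_flow k 1 (spectral_flow k (i - 1) M)) v"
    by (simp add: spectral_flow_flow[OF affine_axioms])
  also have "\<dots> = sugawara_L0 k (spectral_flow k (i - 1) M) v + scl M (1/2) (hop M 0 v) +
     (scl M ((of_int i - 1) * k / 2) v + scl M (k / 4) v)"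
    unfolding affine.sugawara_flow_1[OF spectral_flow_affine k2]
    by (simp add: algebra_simps) (simp add: V.scale_left_distrib[symmetric] field_simps)
  finally have "sugawara_L0 k (spectral_flow k (i - 1) M) v = sugawara_L0 k M v +
     (scl M (of_int i / 2) (hop M 0 v) - scl M (1/2) (hop M 0 v))
    + (scl M ((of_int i)\<^sup>2 * k / 4) v - (scl M ((of_int i - 1) * k / 2) v + scl M (k / 4) v))"
    unfolding step2 by (simp only: algebra_simps)
  also have "\<dots> = sugawara_L0 k M v + scl M (of_int (i - 1) / 2) (hop M 0 v) + scl M ((of_int (i - 1))\<^sup>2 * k / 4) v"
    unfolding V.scale_left_distrib[symmetric] V.scale_left_diff_distrib[symmetric]
    by (simp add: power2_eq_square field_simps)
  finally show ?case .
qed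

text \<open>
  \<open>e_n\<close> is the zero mode of \<open>e\<close> on a spectral flow of \<open>M\<close>, where it commutes with the flowed \<open>L_0\<close>; the
  commutator with \<open>L_0\<close> itself comes from the term \<open>h_0\<close> of \<open>sugawara_flow\<close>. This avoids
  commuting \<open>e_n\<close> through the normally ordered sum.
\<close>

lemma sugawara_e:
  assumes k2: "k + 2 \<noteq> 0"
  shows "sugawara_L0 k M (eop M n v) = eop M n (sugawara_L0 k M v) - scl M (of_int n) (eop M n v)"
proof -
  have "sugawara_L0 k (spectral_flow k n M) (eop M n v) = eop M n (sugawara_L0 k (spectral_flow k n M) v)"
    using affine.sugawara_e0[OF spectral_flow_affine, of n v] by simp
  then show ?thesis
    by (simp add: sugawara_flow[OF k2] he lin algebra_simps)
qed

lemma sugawara_f: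
  assumes k2: "k + 2 \<noteq> 0"
  shows "sugawara_L0 k M (fop M n v) = fop M n (sugawara_L0 k M v) - scl M (of_int n) (fop M n v)"
proof -
  have "sugawara_L0 k (spectral_flow k (- n) M) (fop M n v) = fop M n (sugawara_L0 k (spectral_flow k (- n) M) v)"
    using affine.sugawara_f0[OF spectral_flow_affine, of "- n" v] by simp
  then show ?thesis
    by (simp add: sugawara_flow[OF k2] hf lin algebra_simps)
qed

text \<open>
  The modes of \<open>h\<close> inherit their \<open>L_0\<close>-grading from those of \<open>e\<close> and \<open>f\<close>.
\<close>

lemma h_eq_fe: "hop M n v = fop M 0 (eop M n v) - eop M n (fop M 0 v)"
  by (simp add: fe)

lemma sugawara_diff: "sugawara_L0 k M (v - w) = sugawara_L0 k M v - sugawara_L0 k M w"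
proof -
  interpret l: Vector_Spaces.linear "scl M" "scl M" "sugawara_L0 k M" by (rule linear_sugawara)
  show ?thesis by (rule l.diff)
qed

lemma sugawara_h:
  assumes k2: "k + 2 \<noteq> 0"
  shows "sugawara_L0 k M (hop M n v) = hop M n (sugawara_L0 k M v) - scl M (of_int n) (hop M n v)"
  unfolding h_eq_fe[of n] by (simp add: sugawara_diff sugawara_e[OF k2] sugawara_f[OF k2] lin algebra_simps)

end

section \<open>Modules generated from a top space\<close>

datatype current = cE | cF | cH

fun mode :: "'v sl2_module \<Rightarrow> current \<Rightarrow> int \<Rightarrow> 'v \<Rightarrow> 'v" where
  "mode M cE = eop M" | "mode M cF = fop M" | "mode M cH = hop M"

lemma sl2_submodule_mode:
  "sl2_submodule M N \<longleftrightarrow> module.subspace (scl M) N \<and> (\<forall>X n. \<forall>v\<in>N. mode M X n v \<in> N)"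
  unfolding sl2_submodule_def by (metis (full_types) current.exhaust mode.simps)

context affine begin

lemma linear_mode: "Vector_Spaces.linear (scl M) (scl M) (mode M X n)"
  by (cases X) (simp_all add: linear_e linear_f linear_h)

lemma lin_mode: "mode M X n (x + y) = mode M X n x + mode M X n y" "mode M X n (scl M c x) = scl M c (mode M X n x)"
  "mode M X n 0 = 0"
  by (cases X; simp add: lin)+

text \<open>
  The only information about the brackets needed for reordering products of modes: up to a scalar
  there is one correction mode, of the added index.
\<close>

lemma mode_bracket:
  "\<exists>Z c c'. \<forall>v. mode M X m (mode M Y n v) =
     mode M Y n (mode M X m v) + scl M c (mode M Z (m + n) v) + scl M (if m + n = 0 then c' else 0) v"
proof -
  have ef: "eop M m (fop M n v) = fop M n (eop M m v) + scl M (-1) (hop M (m + n) v) +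
      scl M (if m + n = 0 then - of_int m * k else 0) v" for m n v
    using fe[of n m v] by auto
  have fe': "fop M m (eop M n v) = eop M n (fop M m v) + scl M 1 (hop M (m + n) v) +
      scl M (if m + n = 0 then of_int n * k else 0) v" for m n v
    using fe[of m n v] by (simp add: add.commute)
  have hh': "hop M m (hop M n v) = hop M n (hop M m v) + scl M 0 (hop M (m + n) v) +
      scl M (if m + n = 0 then 2 * of_int m * k else 0) v" for m n v
    using hh[of m n v] by simp
  have he': "hop M m (eop M n v) = eop M n (hop M m v) + scl M 2 (eop M (m + n) v) + scl M (if m + n = 0 then 0 else 0) v"
    "eop M n (hop M m v) = hop M m (eop M n v) + scl M (-2) (eop M (n + m) v) + scl M (if n + m = 0 then 0 else 0) v" for m n v
    by (simp_all add: he add.commute)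
  have hf': "hop M m (fop M n v) = fop M n (hop M m v) + scl M (-2) (fop M (m + n) v) + scl M (if m + n = 0 then 0 else 0) v"
    "fop M n (hop M m v) = hop M m (fop M n v) + scl M 2 (fop M (n + m) v) + scl M (if n + m = 0 then 0 else 0) v" for m n v
    by (simp_all add: hf add.commute)
  have ee': "eop M m (eop M n v) = eop M n (eop M m v) + scl M 0 (eop M (m + n) v) + scl M (if m + n = 0 then 0 else 0) v"
    "fop M m (fop M n v) = fop M n (fop M m v) + scl M 0 (fop M (m + n) v) + scl M (if m + n = 0 then 0 else 0) v" for m n v
    using bracket_ee[of m n v] bracket_ff[of m n v] by simp_all
  show ?thesis
  proof (cases X; cases Y)
    assume XY: "X = cE" "Y = cE"
    show ?thesis unfolding XY mode.simps
      by (intro exI[of _ cE] exI[of _ "0"] exI[of _ "0"] allI) (unfold mode.simps, rule ee'(1))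
  next
    assume XY: "X = cE" "Y = cF"
    show ?thesis unfolding XY mode.simps
      by (intro exI[of _ cH] exI[of _ "-1"] exI[of _ "- of_int m * k"] allI) (unfold mode.simps, rule ef)
  next
    assume XY: "X = cE" "Y = cH"
    show ?thesis unfolding XY mode.simps
      by (intro exI[of _ cE] exI[of _ "-2"] exI[of _ "0"] allI) (unfold mode.simps, rule he'(2))
  next
    assume XY: "X = cF" "Y = cE"
    show ?thesis unfolding XY mode.simps
      by (intro exI[of _ cH] exI[of _ "1"] exI[of _ "of_int n * k"] allI) (unfold mode.simps, rule fe')
  next
    assume XY: "X = cF" "Y = cF"
    show ?thesis unfolding XY mode.simps
      by (intro exI[of _ cF] exI[of _ "0"] exI[of _ "0"] allI) (unfold mode.simps, rule ee'(2))
  next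
    assume XY: "X = cF" "Y = cH"
    show ?thesis unfolding XY mode.simps
      by (intro exI[of _ cF] exI[of _ "2"] exI[of _ "0"] allI) (unfold mode.simps, rule hf'(2))
  next
    assume XY: "X = cH" "Y = cE"
    show ?thesis unfolding XY mode.simps
      by (intro exI[of _ cE] exI[of _ "2"] exI[of _ "0"] allI) (unfold mode.simps, rule he'(1))
  next
    assume XY: "X = cH" "Y = cF"
    show ?thesis unfolding XY mode.simps
      by (intro exI[of _ cF] exI[of _ "-2"] exI[of _ "0"] allI) (unfold mode.simps, rule hf'(1))
  next
    assume XY: "X = cH" "Y = cH"
    show ?thesis unfolding XY mode.simps
      by (intro exI[of _ cH] exI[of _ "0"] exI[of _ "2 * of_int m * k"] allI) (unfold mode.simps, rule hh')
  qed
qed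

lemma sugawara_mode:
  "k + 2 \<noteq> 0 \<Longrightarrow> sugawara_L0 k M (mode M X n v) = mode M X n (sugawara_L0 k M v) - scl M (of_int n) (mode M X n v)"
  by (cases X) (simp_all add: sugawara_e sugawara_f sugawara_h)

text \<open>
  The vectors obtained from \<open>\<Gamma>\<close> by products of lowering modes of total degree \<open>d\<close>. The degree is
  recorded so that it can serve for induction; \<open>lowered_L0\<close> relates it to the conformal weight.
\<close>

inductive lowered :: "'v set \<Rightarrow> int \<Rightarrow> 'v \<Rightarrow> bool" for \<Gamma> where
  base: "v \<in> \<Gamma> \<Longrightarrow> lowered \<Gamma> 0 v"
| zero: "lowered \<Gamma> d 0"
| add: "lowered \<Gamma> d v \<Longrightarrow> lowered \<Gamma> d w \<Longrightarrow> lowered \<Gamma> d (v + w)"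
| scale: "lowered \<Gamma> d v \<Longrightarrow> lowered \<Gamma> d (scl M c v)"
| step: "lowered \<Gamma> d v \<Longrightarrow> n > 0 \<Longrightarrow> lowered \<Gamma> (d + n) (mode M X (- n) v)"

lemma lowered_subspace: "V.subspace {v. lowered \<Gamma> d v}"
  by (auto simp: V.subspace_def intro: lowered.intros)

lemma lowered_neg: "lowered \<Gamma> d v \<Longrightarrow> d < 0 \<Longrightarrow> v = 0"
  by (induction rule: lowered.induct) (auto simp: lin_mode)

lemma lowered_0:
  assumes "V.subspace \<Gamma>" "lowered \<Gamma> d v" "d = 0"
  shows "v \<in> \<Gamma>"
  using assms(2,3)
proof (induction rule: lowered.induct)
  case (step d v n X)
  then have "v = 0" using lowered_neg by auto
  then show ?case using assms(1) by (simp add: lin_mode V.subspace_0)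
qed (use assms(1) in \<open>auto intro: V.subspace_0 V.subspace_add V.subspace_scale\<close>)

text \<open>
  A mode \<open>X_j\<close> is commuted to the right through the lowering modes; there it annihilates the top
  space or, for \<open>j = 0\<close>, preserves it. So degrees are respected by all modes, not only by lowering ones.
\<close>

lemma lowered_mode:
  assumes top: "\<And>X j v. v \<in> \<Gamma> \<Longrightarrow> j > 0 \<Longrightarrow> mode M X j v = 0" "\<And>X v. v \<in> \<Gamma> \<Longrightarrow> mode M X 0 v \<in> \<Gamma>"
    and "lowered \<Gamma> d v"
  shows "lowered \<Gamma> (d - j) (mode M X j v)"
proof (cases "j \<ge> 0")
  case False
  then show ?thesis using lowered.step[OF assms(3), of "- j" X] by simp
next
  case True
  with assms(3) show ?thesis
  proof (induction arbitrary: X j rule: lowered.induct)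
    case (base v)
    then show ?case using top by (cases "j = 0") (auto intro: lowered.intros)
  next
    case (zero d)
    then show ?case by (simp add: lin_mode lowered.zero)
  next
    case (add d v w)
    then show ?case by (auto simp: lin_mode intro: lowered.intros)
  next
    case (scale d v c)
    then show ?case by (auto simp: lin_mode intro: lowered.intros)
  next
    case (step d v n Y)
    obtain Z c c' where br: "\<And>v. mode M X j (mode M Y (- n) v) =
     mode M Y (- n) (mode M X j v) + scl M c (mode M Z (j + - n) v) + scl M (if j + - n = 0 then c' else 0) v"
      using mode_bracket[of X j Y "- n"] by blast
    have 1: "lowered \<Gamma> (d + n - j) (mode M Y (- n) (mode M X j v))"
      using lowered.step[OF step.IH[OF step.prems, of X] step.hyps(2), of Y] by (simp add: algebra_simps)
    have 2: "lowered \<Gamma> (d + n - j) (mode M Z (j + - n) v)"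
    proof (cases "j - n \<ge> 0")
      case True
      then show ?thesis using step.IH[of "j - n" Z] by (simp add: algebra_simps)
    next
      case False
      then show ?thesis using lowered.step[OF step.hyps(1), of "n - j" Z] by (simp add: algebra_simps)
    qed
    have 3: "lowered \<Gamma> (d + n - j) (scl M (if j + - n = 0 then c' else 0) v)"
      using lowered.scale[OF step.hyps(1)] by (auto intro: lowered.zero)
    show ?case unfolding br by (rule lowered.add[OF lowered.add[OF 1 lowered.scale[OF 2]] 3])
  qed
qed

lemma lowered_L0:
  assumes "k + 2 \<noteq> 0" "\<And>v. v \<in> \<Gamma> \<Longrightarrow> sugawara_L0 k M v = scl M y v" "lowered \<Gamma> d v"
  shows "sugawara_L0 k M v = scl M (y + of_int d) v"
  using assms(3)
proof (induction rule: lowered.induct)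
  case (step d v n X)
  then show ?case by (simp add: sugawara_mode[OF assms(1)] lin_mode algebra_simps)
qed (auto simp: assms(2) sugawara_0 sugawara_add sugawara_scale algebra_simps)

definition generated :: "'v set \<Rightarrow> 'v set" where "generated \<Gamma> = V.span (\<Union>d. {v. lowered \<Gamma> d v})"

lemma generated_base: "\<Gamma> \<subseteq> generated \<Gamma>"
  unfolding generated_def by (blast intro: V.span_base lowered.base)

lemma generated_submodule:
  assumes top: "\<And>X j v. v \<in> \<Gamma> \<Longrightarrow> j > 0 \<Longrightarrow> mode M X j v = 0" "\<And>X v. v \<in> \<Gamma> \<Longrightarrow> mode M X 0 v \<in> \<Gamma>"
  shows "sl2_submodule M (generated \<Gamma>)"
  unfolding sl2_submodule_mode
proof (intro conjI allI ballI)
  show "V.subspace (generated \<Gamma>)" unfolding generated_def by (rule V.subspace_span)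
  fix X n v assume "v \<in> generated \<Gamma>"
  then have "v \<in> V.span (\<Union>d. {v. lowered \<Gamma> d v})" by (simp add: generated_def)
  then show "mode M X n v \<in> generated \<Gamma>"
  proof (induction rule: V.span_induct_alt)
    case base
    then show ?case by (simp add: lin_mode generated_def V.span_zero)
  next
    case (step c x w)
    then obtain d where "lowered \<Gamma> d x" by blast
    then have "mode M X n x \<in> generated \<Gamma>" unfolding generated_def
      using lowered_mode[OF top, where X = X and j = n] by (blast intro: V.span_base)
    then show ?case using step.IH unfolding generated_def by (simp add: lin_mode V.span_add V.span_scale)
  qed
qed

lemma generated_minimal:
  assumes "sl2_submodule M W" "\<Gamma> \<subseteq> W"
  shows "generated \<Gamma> \<subseteq> W"
  unfolding generated_def
proof (rule V.span_minimal)
  show W: "V.subspace W" using assms(1) by (simp add: sl2_submodule_mode)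
  have "v \<in> W" if "lowered \<Gamma> d v" for d v
    using that assms W
    by induction (auto simp: sl2_submodule_mode intro: V.subspace_0 V.subspace_add V.subspace_scale)
  then show "(\<Union>d. {v. lowered \<Gamma> d v}) \<subseteq> W" by blast
qed

lemma generated_decompose:
  assumes "v \<in> generated \<Gamma>"
  obtains J g where "finite J" "\<And>d. d \<in> J \<Longrightarrow> lowered \<Gamma> d (g d)" "v = (\<Sum>d\<in>J. g d)"
  using V.span_Union_subspaces[of "\<lambda>d. {v. lowered \<Gamma> d v}" v] assms lowered_subspace
  unfolding generated_def by blast

text \<open>
  A vector \<open>w\<close> killed by all positive modes generates the irreducible module by lowering modes, and
  these only raise the conformal weight. Hence no weight lies outside \<open>y + \<nat>\<close>.
\<close>

lemma irreducible_ground_weight: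
  assumes k2: "k + 2 \<noteq> 0" and irr: "irreducible_sl2 M"
    and w: "w \<noteq> 0" "\<And>X j. j > 0 \<Longrightarrow> mode M X j w = 0" "sugawara_L0 k M w = scl M y w"
    and u: "u \<noteq> 0" "sugawara_L0 k M u = scl M y0 u"
  shows "\<exists>d::nat. y0 = y + of_nat d"
proof (rule ccontr)
  assume neg: "\<not> ?thesis"
  define \<Gamma> where "\<Gamma> = {v. (\<forall>X j. j > 0 \<longrightarrow> mode M X j v = 0) \<and> sugawara_L0 k M v = scl M y v}"
  have top: "mode M X j v = 0" if "v \<in> \<Gamma>" "j > 0" for X j v using that by (auto simp: \<Gamma>_def)
  have top0: "mode M X 0 v \<in> \<Gamma>" if v: "v \<in> \<Gamma>" for X v
    unfolding \<Gamma>_def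
  proof (intro CollectI conjI allI impI)
    fix Y and j :: int assume j: "j > 0"
    obtain Z c c' where br: "\<And>v. mode M Y j (mode M X 0 v) =
     mode M X 0 (mode M Y j v) + scl M c (mode M Z (j + 0) v) + scl M (if j + 0 = 0 then c' else 0) v"
      using mode_bracket[of Y j X 0] by blast
    show "mode M Y j (mode M X 0 v) = 0" unfolding br using top[OF v] j by (simp add: lin_mode)
  next
    show "sugawara_L0 k M (mode M X 0 v) = scl M y (mode M X 0 v)"
      using v by (simp add: sugawara_mode[OF k2] \<Gamma>_def lin_mode)
  qed
  have "sl2_submodule M (generated \<Gamma>)" by (rule generated_submodule[OF top top0])
  moreover have "w \<in> \<Gamma>" using w by (simp add: \<Gamma>_def)
  then have "w \<in> generated \<Gamma>" using generated_base by blast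
  ultimately have "generated \<Gamma> = UNIV" using irr w(1) unfolding irreducible_sl2_def by blast
  then have "u \<in> generated \<Gamma>" by simp
  then obtain J g where J: "finite J" "\<And>d. d \<in> J \<Longrightarrow> lowered \<Gamma> d (g d)" "u = (\<Sum>d\<in>J. g d)"
    using generated_decompose by blast
  have gL: "sugawara_L0 k M (g d) = scl M (y + of_int d) (g d)" if "d \<in> J" for d
    by (rule lowered_L0[OF k2 _ J(2)[OF that]]) (simp add: \<Gamma>_def)
  have sum0: "(\<Sum>d\<in>J. scl M (y + of_int d - y0) (g d)) = 0"
  proof -
    interpret l: Vector_Spaces.linear "scl M" "scl M" "sugawara_L0 k M" by (rule linear_sugawara)
    have "(\<Sum>d\<in>J. scl M (y + of_int d - y0) (g d)) = sugawara_L0 k M u - scl M y0 u"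
      unfolding J(3) l.sum V.scale_sum_right sum_subtractf[symmetric]
      by (rule sum.cong) (simp_all add: gL V.scale_left_diff_distrib)
    then show ?thesis using u by simp
  qed
  have "\<forall>d\<in>J. scl M (y + of_int d - y0) (g d) = 0"
    by (rule V.eigenvectors_sum_zero[OF linear_sugawara J(1) _ _ sum0, where l = "\<lambda>d. y + of_int d"])
       (auto simp: inj_on_def sugawara_scale gL mult.commute)
  moreover have "g d = 0 \<or> y + of_int d - y0 \<noteq> 0" if "d \<in> J" for d
  proof (cases "d < 0")
    case True
    then show ?thesis using lowered_neg[OF J(2)[OF that]] by simp
  next
    case False
    then have "y0 \<noteq> y + of_nat (nat d)" using neg by blast
    then show ?thesis using False by auto
  qed
  ultimately have "\<forall>d\<in>J. g d = 0" by auto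
  then show False using u(1) J(3) by simp
qed

end

definition prod_module :: "'v::ab_group_add sl2_module \<Rightarrow> 'w::ab_group_add sl2_module \<Rightarrow> ('v \<times> 'w) sl2_module"
  where "prod_module M N = \<lparr>scl = (\<lambda>c p. (scl M c (fst p), scl N c (snd p))),
    eop = (\<lambda>n p. (eop M n (fst p), eop N n (snd p))),
    fop = (\<lambda>n p. (fop M n (fst p), fop N n (snd p))),
    hop = (\<lambda>n p. (hop M n (fst p), hop N n (snd p)))\<rparr>"

lemma prod_module_sel [simp]:
  "scl (prod_module M N) c p = (scl M c (fst p), scl N c (snd p))"
  "eop (prod_module M N) n p = (eop M n (fst p), eop N n (snd p))"
  "fop (prod_module M N) n p = (fop M n (fst p), fop N n (snd p))"
  "hop (prod_module M N) n p = (hop M n (fst p), hop N n (snd p))"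
  by (simp_all add: prod_module_def)

lemma mode_prod_module [simp]: "mode (prod_module M N) X n p = (mode M X n (fst p), mode N X n (snd p))"
  by (cases X) simp_all

lemma prod_module_affine:
  assumes "affine k M" "affine k N"
  shows "affine k (prod_module M N)"
proof -
  interpret M: affine k M by fact
  interpret N: affine k N by fact
  interpret P: complex_space "scl (prod_module M N)"
    by unfold_locales (simp_all add: algebra_simps prod_eq_iff)
  have linI: "Vector_Spaces.linear (scl (prod_module M N)) (scl (prod_module M N)) f"
    if "\<And>x y. f (x + y) = f x + f y" "\<And>c x. f (scl (prod_module M N) c x) = scl (prod_module M N) c (f x)" for f
    by unfold_locales (simp_all only: that)
  show ?thesis
    unfolding affine_def
  proof (rule affine_sl2_module.intro, goal_cases)
    case 1
    show ?case by (rule P.vector_space_axioms)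
  next
    case (11 v)
    obtain a b where "\<forall>n\<ge>a. eop M n (fst v) = 0 \<and> fop M n (fst v) = 0 \<and> hop M n (fst v) = 0"
      "\<forall>n\<ge>b. eop N n (snd v) = 0 \<and> fop N n (snd v) = 0 \<and> hop N n (snd v) = 0"
      using M.smooth N.smooth by blast
    then show ?case by (intro exI[of _ "max a b"]) (simp add: zero_prod_def)
  next
    case (2 n)
    show ?case by (rule linI) (simp_all add: M.lin N.lin prod_eq_iff)
  next
    case (3 n)
    show ?case by (rule linI) (simp_all add: M.lin N.lin prod_eq_iff)
  next
    case (4 n)
    show ?case by (rule linI) (simp_all add: M.lin N.lin prod_eq_iff)
  next
    case (5 m n v)
    show ?case by (simp add: M.bracket_he N.bracket_he)
  next
    case (6 m n v)
    show ?case by (simp add: M.bracket_hf N.bracket_hf)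
  next
    case (7 m n v)
    show ?case using M.bracket_hh[of m n "fst v"] N.bracket_hh[of m n "snd v"] by simp
  next
    case (8 m n v)
    show ?case using M.bracket_ef[of m n "fst v"] N.bracket_ef[of m n "snd v"] by simp
  next
    case (9 m n v)
    show ?case by (simp add: M.bracket_ee[of m n] N.bracket_ee[of m n])
  next
    case (10 m n v)
    show ?case by (simp add: M.bracket_ff[of m n] N.bracket_ff[of m n])
  qed
qed

lemma sugawara_prod_module:
  assumes "affine k M" "affine k N"
  shows "sugawara_L0 k (prod_module M N) p = (sugawara_L0 k M (fst p), sugawara_L0 k N (snd p))"
proof -
  interpret M: affine k M by fact
  interpret N: affine k N by fact
  interpret P: affine k "prod_module M N" by (rule prod_module_affine[OF assms])
  obtain K where K: "killed_above (prod_module M N) K p" using P.killed_above_exists by blast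
  then have "killed_above M K (fst p)" "killed_above N K (snd p)"
    by (auto simp: killed_above_def zero_prod_def)
  note b = P.sugawara_bounded[OF K] M.sugawara_bounded[OF this(1)] N.sugawara_bounded[OF this(2)]
  show ?thesis unfolding b
    by (simp add: prod_eq_iff sug_zero_def sug_term_def fst_sum snd_sum)
qed

text \<open>
  Matching tops determine the module. Inside \<open>M \<times> N\<close> let \<open>G\<close> be generated by the pairs
  \<open>(u a, x a)\<close>. A vector of \<open>G\<close> with one vanishing component, taken of least positive degree \<open>d\<close>, is
  killed by all positive modes, since these map it to smaller degrees. Its component in \<open>N\<close> would then
  be a ground state of weight \<open>y + d\<close>, excluded by \<open>ground\<close>, and its component in \<open>M\<close> is excluded by
  \<open>irreducible_ground_weight\<close>. So \<open>G\<close> is the graph of an injective map from the submodule \<open>W\<close>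
  generated by the \<open>x a\<close>, and it is onto because \<open>M\<close> is irreducible. Only \<open>N\<close> has to be understood
  concretely.
\<close>

lemma irreducible_comparison:
  fixes M :: "'v::ab_group_add sl2_module" and N :: "'w::ab_group_add sl2_module"
    and u :: "'i \<Rightarrow> 'v" and x :: "'i \<Rightarrow> 'w"
  assumes k2: "k + 2 \<noteq> 0" and M: "affine k M" and N: "affine k N" and irr: "irreducible_sl2 M"
    and A: "A \<noteq> {}" "\<And>a. a \<in> A \<Longrightarrow> u a \<noteq> 0" "\<And>a. a \<in> A \<Longrightarrow> x a \<noteq> 0"
    and pos: "\<And>a X j. a \<in> A \<Longrightarrow> j > 0 \<Longrightarrow> mode M X j (u a) = 0" "\<And>a X j. a \<in> A \<Longrightarrow> j > 0 \<Longrightarrow> mode N X j (x a) = 0"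
    and zero: "\<And>a X. a \<in> A \<Longrightarrow> \<exists>b\<in>A. \<exists>c. mode M X 0 (u a) = scl M c (u b) \<and> mode N X 0 (x a) = scl N c (x b)"
    and L0: "\<And>a. a \<in> A \<Longrightarrow> sugawara_L0 k M (u a) = scl M y (u a)" "\<And>a. a \<in> A \<Longrightarrow> sugawara_L0 k N (x a) = scl N y (x a)"
    and wgt: "\<And>a. a \<in> A \<Longrightarrow> hop M 0 (u a) = scl M (wg a) (u a)" "\<And>a. a \<in> A \<Longrightarrow> hop N 0 (x a) = scl N (wg a) (x a)" "inj_on wg A"
    and ground: "\<And>n. (\<And>X j. j > 0 \<Longrightarrow> mode N X j n = 0) \<Longrightarrow> sugawara_L0 k N n = scl N y n"
  shows "\<exists>W \<phi>. sl2_submodule N W \<and> x ` A \<subseteq> W \<and> (\<forall>W'. sl2_submodule N W' \<longrightarrow> x ` A \<subseteq> W' \<longrightarrow> W \<subseteq> W') \<and>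
    bij_betw \<phi> W UNIV \<and> (\<forall>v\<in>W. \<forall>w\<in>W. \<phi> (v + w) = \<phi> v + \<phi> w) \<and> (\<forall>c. \<forall>v\<in>W. \<phi> (scl N c v) = scl M c (\<phi> v)) \<and>
    (\<forall>v\<in>W. hop M 0 (\<phi> v) = \<phi> (hop N 0 v)) \<and> (\<forall>v\<in>W. \<forall>c. sugawara_L0 k N v = scl N c v \<longrightarrow> sugawara_L0 k M (\<phi> v) = scl M c (\<phi> v))"
proof -
  interpret M: affine k M by (rule M)
  interpret N: affine k N by (rule N)
  let ?P = "prod_module M N"
  interpret P: affine k ?P by (rule prod_module_affine[OF M N])
  have sP: "sugawara_L0 k ?P p = (sugawara_L0 k M (fst p), sugawara_L0 k N (snd p))" for p
    by (rule sugawara_prod_module[OF M N])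
  define B where "B = (\<lambda>a. (u a, x a)) ` A"
  define \<Gamma> where "\<Gamma> = P.V.span B"
  have sub\<Gamma>: "P.V.subspace \<Gamma>" by (simp add: \<Gamma>_def)
  have top: "mode ?P X j v = 0" if "v \<in> \<Gamma>" "j > 0" for X j v
  proof -
    have "v \<in> P.V.span B" using that by (simp add: \<Gamma>_def)
    then show ?thesis
    proof (induction rule: P.V.span_induct_alt)
      case base
      show ?case by (rule P.lin_mode)
    next
      case (step c p q)
      then have z: "mode ?P X j p = 0" using pos \<open>j > 0\<close> by (auto simp: B_def zero_prod_def)
      show ?case unfolding P.lin_mode step.IH z P.V.scale_zero_right by (rule add_0_left)
    qed
  qed
  have top0: "mode ?P X 0 v \<in> \<Gamma>" if "v \<in> \<Gamma>" for X v
  proof -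
    have "v \<in> P.V.span B" using that by (simp add: \<Gamma>_def)
    then show ?thesis
    proof (induction rule: P.V.span_induct_alt)
      case base
      show ?case unfolding P.lin_mode by (rule P.V.subspace_0[OF sub\<Gamma>])
    next
      case (step c p q)
      then obtain a where a: "a \<in> A" "p = (u a, x a)" by (auto simp: B_def)
      from zero[OF a(1), of X] obtain b d where "b \<in> A" "mode M X 0 (u a) = scl M d (u b)" "mode N X 0 (x a) = scl N d (x b)"
        by blast
      then have "mode ?P X 0 p = scl ?P d (u b, x b)" by (simp add: a)
      moreover have "(u b, x b) \<in> \<Gamma>" unfolding \<Gamma>_def B_def using \<open>b \<in> A\<close> by (intro P.V.span_base imageI)
      ultimately have "mode ?P X 0 p \<in> \<Gamma>" using P.V.subspace_scale[OF sub\<Gamma>] by metis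
      then show ?case unfolding P.lin_mode
        by (intro P.V.subspace_add[OF sub\<Gamma>] P.V.subspace_scale[OF sub\<Gamma>] step.IH)
    qed
  qed
  have top_L0: "sugawara_L0 k ?P v = scl ?P y v" if "v \<in> \<Gamma>" for v
  proof -
    have "v \<in> P.V.span B" using that by (simp add: \<Gamma>_def)
    then show ?thesis
    proof (induction rule: P.V.span_induct_alt)
      case base
      show ?case by (simp only: P.sugawara_0 P.V.scale_zero_right)
    next
      case (step c p q)
      then have "sugawara_L0 k ?P p = scl ?P y p" using L0 by (auto simp: B_def sP)
      then show ?case unfolding P.sugawara_add P.sugawara_scale step.IH
        by (simp only: P.V.scale_right_distrib P.V.scale_scale mult.commute)
    qed
  qed
  have inj_B: "inj_on (\<lambda>a. (u a, x a)) A"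
  proof (rule inj_onI)
    fix a b assume ab: "a \<in> A" "b \<in> A" "(u a, x a) = (u b, x b)"
    then have "scl M (wg a) (u a) = scl M (wg b) (u a)"
      using wgt(1)[OF ab(1)] wgt(1)[OF ab(2)] by (metis prod.inject)
    then have "wg a = wg b" using A(2)[OF ab(1)] by simp
    then show "a = b" using wgt(3) ab by (simp add: inj_on_def)
  qed
  have coeff0: "c a = 0" if "finite J" "J \<subseteq> A" "a \<in> J" and
    z: "(\<Sum>a\<in>J. scl M (c a) (u a)) = 0 \<or> (\<Sum>a\<in>J. scl N (c a) (x a)) = 0" for c J a
    using z
  proof
    assume z: "(\<Sum>a\<in>J. scl M (c a) (u a)) = 0"
    have "\<forall>a\<in>J. scl M (c a) (u a) = 0"
    proof (rule M.V.eigenvectors_sum_zero[OF M.linear_h that(1) _ _ z])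
      show "inj_on wg J" using wgt(3) that(2) by (rule inj_on_subset)
      show "\<And>i. i \<in> J \<Longrightarrow> hop M 0 (scl M (c i) (u i)) = scl M (wg i) (scl M (c i) (u i))"
        using wgt(1) that(2) by (auto simp: M.lin subset_iff mult.commute)
    qed
    then show "c a = 0" using A(2) that(2,3) by auto
  next
    assume z: "(\<Sum>a\<in>J. scl N (c a) (x a)) = 0"
    have "\<forall>a\<in>J. scl N (c a) (x a) = 0"
    proof (rule N.V.eigenvectors_sum_zero[OF N.linear_h that(1) _ _ z])
      show "inj_on wg J" using wgt(3) that(2) by (rule inj_on_subset)
      show "\<And>i. i \<in> J \<Longrightarrow> hop N 0 (scl N (c i) (x i)) = scl N (wg i) (scl N (c i) (x i))"
        using wgt(2) that(2) by (auto simp: N.lin subset_iff mult.commute)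
    qed
    then show "c a = 0" using A(3) that(2,3) by auto
  qed
  have graph\<Gamma>: "p = 0" if "p \<in> \<Gamma>" "fst p = 0 \<or> snd p = 0" for p
  proof -
    have "\<exists>J c. finite J \<and> J \<subseteq> A \<and> p = (\<Sum>a\<in>J. scl ?P (c a) (u a, x a))"
      by (rule P.V.span_image_finite_combination[OF inj_B that(1)[unfolded \<Gamma>_def B_def]])
    then obtain J c where J: "finite J" "J \<subseteq> A" "p = (\<Sum>a\<in>J. scl ?P (c a) (u a, x a))"
      by (elim exE conjE) (rule that)
    have s: "fst p = (\<Sum>a\<in>J. scl M (c a) (u a))" "snd p = (\<Sum>a\<in>J. scl N (c a) (x a))"
      unfolding J(3) fst_sum snd_sum by simp_all
    have "scl ?P (c a) (u a, x a) = 0" if "a \<in> J" for a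
      unfolding coeff0[OF J(1,2) that \<open>fst p = 0 \<or> snd p = 0\<close>[unfolded s]] by (rule P.V.scale_zero_left)
    then show "p = 0" unfolding J(3) by (intro sum.neutral) blast
  qed
  \<comment> \<open>Injectivity of both projections in every degree, by the argument on the least degree.\<close>
  have graph_lowered: "p = 0" if "P.lowered \<Gamma> (int d) p" "fst p = 0 \<or> snd p = 0" for d p
    using that
  proof (induction d arbitrary: p rule: less_induct)
    case (less d)
    show ?case
    proof (cases "d = 0")
      case True
      then have "p \<in> \<Gamma>" using P.lowered_0[OF sub\<Gamma> less.prems(1)] by simp
      then show ?thesis using graph\<Gamma> less.prems(2) by blast
    next
      case False
      have down: "mode ?P X j p = 0" if j: "j > 0" for X j
      proof -
        have l: "P.lowered \<Gamma> (int d - j) (mode ?P X j p)"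
          by (rule P.lowered_mode[OF top top0 less.prems(1)])
        have z: "fst (mode ?P X j p) = 0 \<or> snd (mode ?P X j p) = 0"
          using less.prems(2) by (auto simp: M.lin_mode N.lin_mode)
        show ?thesis
        proof (cases "int d - j < 0")
          case True
          then show ?thesis using P.lowered_neg[OF l] by blast
        next
          case False
          then have "P.lowered \<Gamma> (int (nat (int d - j))) (mode ?P X j p)" using l by simp
          moreover have "nat (int d - j) < d" using False j \<open>d \<noteq> 0\<close> by linarith
          ultimately show ?thesis using less.IH z by blast
        qed
      qed
      have L: "sugawara_L0 k ?P p = scl ?P (y + of_int (int d)) p"
        by (rule P.lowered_L0[OF k2 top_L0 less.prems(1)])
      have dM: "mode M X j (fst p) = 0" and dN: "mode N X j (snd p) = 0" if "j > 0" for X j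
        using down[OF that, of X] by (simp_all add: prod_eq_iff)
      have LM: "sugawara_L0 k M (fst p) = scl M (y + of_nat d) (fst p)"
        and LN: "sugawara_L0 k N (snd p) = scl N (y + of_nat d) (snd p)"
        using L by (simp_all add: sP)
      have "scl N y (snd p) = scl N (y + of_nat d) (snd p)"
        using ground[OF dN] LN by simp
      then have "snd p = 0" using False by simp
      moreover have "fst p = 0"
      proof (rule ccontr)
        assume "fst p \<noteq> 0"
        moreover obtain a where "a \<in> A" using A(1) by blast
        ultimately have "\<exists>d'::nat. y = y + of_nat d + of_nat d'"
          using M.irreducible_ground_weight[OF k2 irr _ dM LM A(2) L0(1)] by blast
        then obtain d' where "y = y + of_nat d + of_nat d'" by blast
        then have "of_nat (d + d') = (0::complex)" by (simp add: add.assoc)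
        then have "d + d' = 0" by (simp only: of_nat_eq_0_iff)
        then show False using False by simp
      qed
      ultimately show ?thesis by (simp add: prod_eq_iff)
    qed
  qed
  define R where "R = P.generated \<Gamma>"
  have subR: "sl2_submodule ?P R" unfolding R_def by (rule P.generated_submodule[OF top top0])
  have mR: "mode ?P X n p \<in> R" if "p \<in> R" for X n p
    using subR that unfolding sl2_submodule_mode by blast
  have ssR: "P.V.subspace R" using subR by (simp add: sl2_submodule_mode)
  have inR: "(u a, x a) \<in> R" if "a \<in> A" for a
  proof -
    have "(u a, x a) \<in> B" unfolding B_def using that by blast
    then have "(u a, x a) \<in> \<Gamma>" unfolding \<Gamma>_def by (rule P.V.span_base)
    then show ?thesis unfolding R_def using P.generated_base[of \<Gamma>] by blast
  qed
  have graphR: "p = 0" if pR: "p \<in> R" and p0: "fst p = 0 \<or> snd p = 0" for p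
  proof -
    obtain J g where J: "finite J" "\<And>d. d \<in> J \<Longrightarrow> P.lowered \<Gamma> d (g d)" "p = (\<Sum>d\<in>J. g d)"
      by (rule P.generated_decompose[OF pR[unfolded R_def]]) (rule that)
    have L: "sugawara_L0 k ?P (g d) = scl ?P (y + of_int d) (g d)" if "d \<in> J" for d
      by (rule P.lowered_L0[OF k2 top_L0 J(2)[OF that]])
    have LM: "sugawara_L0 k M (fst (g d)) = scl M (y + of_int d) (fst (g d))"
      and LN: "sugawara_L0 k N (snd (g d)) = scl N (y + of_int d) (snd (g d))" if "d \<in> J" for d
      using L[OF that] by (simp_all add: sP)
    have comp: "(\<forall>d\<in>J. fst (g d) = 0) \<or> (\<forall>d\<in>J. snd (g d) = 0)"
      using p0
    proof
      assume "fst p = 0"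
      then have "(\<Sum>d\<in>J. fst (g d)) = 0" by (simp add: J(3) fst_sum)
      then have "\<forall>d\<in>J. fst (g d) = 0"
        by (rule M.V.eigenvectors_sum_zero[OF M.linear_sugawara J(1) _ LM, rotated 2]) (auto simp: inj_on_def)
      then show ?thesis ..
    next
      assume "snd p = 0"
      then have "(\<Sum>d\<in>J. snd (g d)) = 0" by (simp add: J(3) snd_sum)
      then have "\<forall>d\<in>J. snd (g d) = 0"
        by (rule N.V.eigenvectors_sum_zero[OF N.linear_sugawara J(1) _ LN, rotated 2]) (auto simp: inj_on_def)
      then show ?thesis ..
    qed
    have "g d = 0" if d: "d \<in> J" for d
    proof (cases "d < 0")
      case True
      show ?thesis by (rule P.lowered_neg[OF J(2)[OF d] True])
    next
      case False
      have "P.lowered \<Gamma> (int (nat d)) (g d)" using J(2)[OF d] False by simp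
      moreover have "fst (g d) = 0 \<or> snd (g d) = 0" using comp d by blast
      ultimately show ?thesis by (rule graph_lowered)
    qed
    then show "p = 0" unfolding J(3) by (rule sum.neutral[OF ballI])
  qed
  have uniq: "m = m'" if "(m, n) \<in> R" "(m', n) \<in> R" for m m' n
  proof -
    have "(m, n) - (m', n) = 0" by (rule graphR[OF P.V.subspace_diff[OF ssR that]]) simp
    then show ?thesis by (simp add: prod_eq_iff)
  qed
  have uniq2: "n = n'" if "(m, n) \<in> R" "(m, n') \<in> R" for m n n'
  proof -
    have "(m, n) - (m, n') = 0" by (rule graphR[OF P.V.subspace_diff[OF ssR that]]) simp
    then show ?thesis by (simp add: prod_eq_iff)
  qed
  define W where "W = snd ` R"
  define \<phi> where "\<phi> n = (THE m. (m, n) \<in> R)" for n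
  have phi_eq: "\<phi> n = m" if "(m, n) \<in> R" for m n
    unfolding \<phi>_def using that uniq by (intro the_equality) blast+
  have phi: "(\<phi> n, n) \<in> R" if "n \<in> W" for n
  proof -
    obtain m where "(m, n) \<in> R" using \<open>n \<in> W\<close> unfolding W_def by auto
    then show ?thesis using phi_eq by simp
  qed
  have R_add: "(m + m', n + n') \<in> R" if "(m, n) \<in> R" "(m', n') \<in> R" for m n m' n'
    using P.V.subspace_add[OF ssR that] by simp
  have R_scl: "(scl M c m, scl N c n) \<in> R" if "(m, n) \<in> R" for m n c
    using P.V.subspace_scale[OF ssR that, of c] by simp
  have R_mode: "(mode M X j m, mode N X j n) \<in> R" if "(m, n) \<in> R" for m n X j
    using mR[OF that, of X j] by simp
  have R_0: "(0, 0) \<in> R" using P.V.subspace_0[OF ssR] by (simp add: zero_prod_def)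
  have inW: "n \<in> W" if "(m, n) \<in> R" for m n unfolding W_def using image_eqI[of n snd "(m, n)" R] that by simp
  have subW: "sl2_submodule N W"
    unfolding sl2_submodule_mode N.V.subspace_def
    by (intro conjI ballI allI) (rule inW[OF R_0] inW[OF R_add[OF phi phi]] inW[OF R_scl[OF phi]] inW[OF R_mode[OF phi]]; assumption)+
  have inU: "m \<in> fst ` R" if "(m, n) \<in> R" for m n using image_eqI[of m fst "(m, n)" R] that by simp
  have fstR: "(m, SOME n. (m, n) \<in> R) \<in> R" if "m \<in> fst ` R" for m
    using that by (auto intro: someI)
  have subU: "sl2_submodule M (fst ` R)"
    unfolding sl2_submodule_mode M.V.subspace_def
    by (intro conjI ballI allI) (rule inU[OF R_0] inU[OF R_add[OF fstR fstR]] inU[OF R_scl[OF fstR]] inU[OF R_mode[OF fstR]]; assumption)+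
  obtain a where a: "a \<in> A" using A(1) by blast
  have "u a \<in> fst ` R" by (rule inU[OF inR[OF a]])
  then have "fst ` R \<noteq> {0}" using A(2)[OF a] by blast
  then have UR: "fst ` R = UNIV" using irr subU unfolding irreducible_sl2_def by blast
  have L0_phi: "sugawara_L0 k M (\<phi> v) = scl M c (\<phi> v)" if v: "v \<in> W" "sugawara_L0 k N v = scl N c v" for v c
  proof -
    have "sugawara_L0 k ?P (\<phi> v, v) \<in> R"
    proof -
      obtain K where K: "killed_above ?P K (\<phi> v, v)" using P.killed_above_exists by blast
      show ?thesis unfolding P.sugawara_bounded[OF K] sug_zero_def sug_term_def
        by (intro P.V.subspace_scale[OF ssR] P.V.subspace_add[OF ssR] P.V.subspace_diff[OF ssR] P.V.subspace_sum[OF ssR]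
            mR[where X = cE, unfolded mode.simps] mR[where X = cF, unfolded mode.simps]
            mR[where X = cH, unfolded mode.simps] phi[OF v(1)])
    qed
    then have "(sugawara_L0 k M (\<phi> v), sugawara_L0 k N v) \<in> R" by (simp add: sP)
    moreover have "(scl M c (\<phi> v), scl N c v) \<in> R" using R_scl phi[OF v(1)] by blast
    ultimately show ?thesis unfolding v(2) by (rule uniq)
  qed
  have "bij_betw \<phi> W UNIV"
    unfolding bij_betw_def
  proof
    show "inj_on \<phi> W"
    proof (rule inj_onI)
      fix n n' assume n: "n \<in> W" "n' \<in> W" "\<phi> n = \<phi> n'"
      show "n = n'" by (rule uniq2[OF phi[OF n(1)]]) (simp only: n(3) phi[OF n(2)])
    qed
    show "\<phi> ` W = UNIV"
    proof -
      have "m \<in> \<phi> ` W" for m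
      proof -
        have "m \<in> fst ` R" using UR by simp
        from fstR[OF this] obtain n where "(m, n) \<in> R" by blast
        then show ?thesis using phi_eq[of m n] inW[of m n] by blast
      qed
      then show ?thesis by blast
    qed
  qed
  moreover have "W \<subseteq> W'" if W': "sl2_submodule N W'" "x ` A \<subseteq> W'" for W'
  proof -
    have "sl2_submodule ?P (UNIV \<times> W')"
      using W'(1) unfolding sl2_submodule_mode N.V.subspace_def P.V.subspace_def by (auto simp: zero_prod_def)
    moreover have "\<Gamma> \<subseteq> UNIV \<times> W'"
      unfolding \<Gamma>_def
      by (rule P.V.span_minimal) (use W'(2) calculation in \<open>auto simp: B_def sl2_submodule_mode\<close>)
    ultimately have "R \<subseteq> UNIV \<times> W'" unfolding R_def by (rule P.generated_minimal)
    then show ?thesis unfolding W_def by auto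
  qed
  moreover have "x ` A \<subseteq> W" using inW[OF inR] by blast
  moreover have "\<forall>v\<in>W. hop M 0 (\<phi> v) = \<phi> (hop N 0 v)"
    using phi_eq[OF R_mode[where X = cH and j = 0, OF phi]] by simp
  moreover have "\<forall>v\<in>W. \<forall>w\<in>W. \<phi> (v + w) = \<phi> v + \<phi> w" using phi_eq[OF R_add[OF phi phi]] by blast
  moreover have "\<forall>c. \<forall>v\<in>W. \<phi> (scl N c v) = scl M c (\<phi> v)" using phi_eq[OF R_scl[OF phi]] by blast
  ultimately show ?thesis using subW L0_phi by (intro exI[of _ W] exI[of _ \<phi>]) blast
qed

section \<open>The beta-gamma system\<close>

text \<open>
  Normally ordered products are infinite sums of modes with finitely many nonzero terms on each vector.
\<close>

definition lfsum :: "(int \<Rightarrow> 'v::ab_group_add) \<Rightarrow> 'v" where "lfsum F = (\<Sum>i | F i \<noteq> 0. F i)"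

lemma lfsum_eq: "finite J \<Longrightarrow> (\<And>i. i \<notin> J \<Longrightarrow> F i = 0) \<Longrightarrow> lfsum F = sum F J"
  unfolding lfsum_def by (rule sum.mono_neutral_left) auto

lemma sum_sgn:
  assumes "a \<le> 0" "0 \<le> (c::int)"
  shows "(\<Sum>i\<in>{a..c}. sgn i) = a + c"
proof -
  have "{a..c} = {a..-1} \<union> {0..c}" using assms by auto
  then have "(\<Sum>i\<in>{a..c}. sgn i) = (\<Sum>i\<in>{a..-1}. sgn i) + (\<Sum>i\<in>{0..c}. sgn i)"
    by (simp add: sum.union_disjoint)
  also have "(\<Sum>i\<in>{a..-1}. sgn i) = (\<Sum>i\<in>{a..-1}. -1)" by (rule sum.cong) auto
  also have "{0..c} = insert 0 {1..c}" using assms by auto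
  also have "(\<Sum>i\<in>insert 0 {1..c}. sgn i) = (\<Sum>i\<in>{1..c}. sgn i)" by simp
  also have "\<dots> = (\<Sum>i\<in>{1..c}. 1)" by (rule sum.cong) auto
  finally show ?thesis using assms by simp
qed

lemma sum_delta_mem: "finite J \<Longrightarrow> x \<in> J \<Longrightarrow> (\<Sum>i\<in>J. if i = x then f i else 0) = f x"
  by simp

text \<open>
  Modes with \<open>[\<gamma>_m, \<beta>_n] = \<delta>_(m+n,0)\<close> on a smooth module.
\<close>

locale betagamma = complex_space sc for sc :: "complex \<Rightarrow> 'v::ab_group_add \<Rightarrow> 'v" +
  fixes b g :: "int \<Rightarrow> 'v \<Rightarrow> 'v"
  assumes lin_b: "\<And>n. Vector_Spaces.linear sc sc (b n)" and lin_g: "\<And>n. Vector_Spaces.linear sc sc (g n)"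
    and bb: "\<And>m n v. b m (b n v) = b n (b m v)" and gg: "\<And>m n v. g m (g n v) = g n (g m v)"
    and gb: "\<And>m n v. g m (b n v) = b n (g m v) + (if m + n = 0 then v else 0)"
    and bg_smooth: "\<And>v. \<exists>N. \<forall>n\<ge>N. b n v = 0 \<and> g n v = 0"
begin

lemma b_lin: "b n (x + y) = b n x + b n y" "b n (sc c x) = sc c (b n x)" "b n 0 = 0" "b n (x - y) = b n x - b n y"
   "b n (- x) = - b n x" "b n (\<Sum>i\<in>I. F i) = (\<Sum>i\<in>I. b n (F i))"
proof -
  interpret l: Vector_Spaces.linear sc sc "b n" by (rule lin_b)
  show "b n (x + y) = b n x + b n y" "b n (sc c x) = sc c (b n x)" "b n 0 = 0" "b n (x - y) = b n x - b n y"
   "b n (- x) = - b n x" "b n (\<Sum>i\<in>I. F i) = (\<Sum>i\<in>I. b n (F i))"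
    by (fact l.add l.scale l.zero l.diff l.neg l.sum)+
qed

lemma g_lin: "g n (x + y) = g n x + g n y" "g n (sc c x) = sc c (g n x)" "g n 0 = 0" "g n (x - y) = g n x - g n y"
   "g n (- x) = - g n x" "g n (\<Sum>i\<in>I. F i) = (\<Sum>i\<in>I. g n (F i))"
proof -
  interpret l: Vector_Spaces.linear sc sc "g n" by (rule lin_g)
  show "g n (x + y) = g n x + g n y" "g n (sc c x) = sc c (g n x)" "g n 0 = 0" "g n (x - y) = g n x - g n y"
   "g n (- x) = - g n x" "g n (\<Sum>i\<in>I. F i) = (\<Sum>i\<in>I. g n (F i))"
    by (fact l.add l.scale l.zero l.diff l.neg l.sum)+
qed

lemmas bg_lin = b_lin g_lin

definition killed :: "int \<Rightarrow> 'v \<Rightarrow> bool" where "killed T v \<longleftrightarrow> 0 \<le> T \<and> (\<forall>n>T. b n v = 0 \<and> g n v = 0)"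

lemma killed_mono: "killed T v \<Longrightarrow> T \<le> T' \<Longrightarrow> killed T' v"
  by (auto simp: killed_def)

lemma killed_exists: "\<exists>T. killed T v"
proof -
  obtain N where "\<forall>n\<ge>N. b n v = 0 \<and> g n v = 0" using bg_smooth by blast
  then show ?thesis by (intro exI[of _ "max 0 N"]) (auto simp: killed_def)
qed

lemma killed_exists2: "\<exists>T. killed T v \<and> killed T w"
proof -
  obtain T1 T2 where "killed T1 v" "killed T2 w" using killed_exists by blast
  then show ?thesis by (intro exI[of _ "max T1 T2"]) (auto intro: killed_mono)
qed

text \<open>
  Symmetrized products \<open>\<beta>_i \<gamma>_(n-i) + \<gamma>_(n-i) \<beta>_i\<close>. For \<open>n = 0\<close> the summand \<open>sgn i\<close> is the constant
  that makes all but finitely many terms vanish on a given vector; it removes the divergent normal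
  ordering constant symmetrically.
\<close>

definition hterm :: "int \<Rightarrow> 'v \<Rightarrow> int \<Rightarrow> 'v"
  where "hterm n v i = b i (g (n - i) v) + g (n - i) (b i v) + (if n = 0 then sc (of_int (sgn i)) v else 0)"

definition currents :: "'v sl2_module" where
  "currents = \<lparr>scl = sc, eop = (\<lambda>n v. sc (1/2) (lfsum (\<lambda>i. b i (b (n - i) v)))),
    fop = (\<lambda>n v. sc (1/2) (lfsum (\<lambda>i. g i (g (n - i) v)))),
    hop = (\<lambda>n v. sc (1/2) (lfsum (hterm n v)))\<rparr>"

abbreviation "E \<equiv> eop currents"
abbreviation "F \<equiv> fop currents"
abbreviation "H \<equiv> hop currents"

lemma scl_currents [simp]: "scl currents = sc" by (simp add: currents_def)

lemma E_sum: "killed T v \<Longrightarrow> a \<le> n - T \<Longrightarrow> T \<le> c \<Longrightarrow> E n v = sc (1/2) (\<Sum>i\<in>{a..c}. b i (b (n - i) v))"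
proof -
  assume T: "killed T v" "a \<le> n - T" "T \<le> c"
  have "lfsum (\<lambda>i. b i (b (n - i) v)) = (\<Sum>i\<in>{a..c}. b i (b (n - i) v))"
  proof (rule lfsum_eq)
    fix i assume "i \<notin> {a..c}"
    then have "n - i > T \<or> i > T" using T by auto
    then show "b i (b (n - i) v) = 0" using T(1) bb[of i "n - i" v] by (auto simp: killed_def bg_lin)
  qed simp
  then show ?thesis by (simp add: currents_def)
qed

lemma F_sum: "killed T v \<Longrightarrow> a \<le> n - T \<Longrightarrow> T \<le> c \<Longrightarrow> F n v = sc (1/2) (\<Sum>i\<in>{a..c}. g i (g (n - i) v))"
proof -
  assume T: "killed T v" "a \<le> n - T" "T \<le> c"
  have "lfsum (\<lambda>i. g i (g (n - i) v)) = (\<Sum>i\<in>{a..c}. g i (g (n - i) v))"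
  proof (rule lfsum_eq)
    fix i assume "i \<notin> {a..c}"
    then have "n - i > T \<or> i > T" using T by auto
    then show "g i (g (n - i) v) = 0" using T(1) gg[of i "n - i" v] by (auto simp: killed_def bg_lin)
  qed simp
  then show ?thesis by (simp add: currents_def)
qed

lemma H_sum:
  assumes T: "killed T v" "a \<le> n - T" "a \<le> 0" "T \<le> c"
  shows "H n v = sc (1/2) (\<Sum>i\<in>{a..c}. hterm n v i)"
proof -
  have "lfsum (hterm n v) = (\<Sum>i\<in>{a..c}. hterm n v i)"
  proof (rule lfsum_eq)
    fix i assume "i \<notin> {a..c}"
    then consider "i < a" | "i > c" by fastforce
    then show "hterm n v i = 0"
    proof cases
      case 1
      then have "g (n - i) v = 0" "i < 0" using T by (auto simp: killed_def)
      then show ?thesis by (auto simp: hterm_def gb bg_lin)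
    next
      case 2
      then have "b i v = 0" "i > 0" using T by (auto simp: killed_def)
      moreover have "b i (g (n - i) v) = - (if n = 0 then v else 0)"
        using gb[of "n - i" i v] \<open>b i v = 0\<close> by (simp add: bg_lin eq_neg_iff_add_eq_0)
      ultimately show ?thesis by (simp add: hterm_def bg_lin)
    qed
  qed simp
  then show ?thesis by (simp add: currents_def)
qed

lemma E_lin: "E n (x + y) = E n x + E n y" "E n (sc c x) = sc c (E n x)"
proof -
  obtain T where T: "killed T x" "killed T y" using killed_exists2 by blast
  then have "killed T (x + y)" "killed T (sc c x)" by (auto simp: killed_def bg_lin)
  note s = T[THEN E_sum[OF _ order_refl order_refl]] this[THEN E_sum[OF _ order_refl order_refl]]
  show "E n (x + y) = E n x + E n y" "E n (sc c x) = sc c (E n x)"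
    unfolding s by (simp_all add: bg_lin sum.distrib scale_right_distrib scale_sum_right mult.commute)
qed

lemma F_lin: "F n (x + y) = F n x + F n y" "F n (sc c x) = sc c (F n x)"
proof -
  obtain T where T: "killed T x" "killed T y" using killed_exists2 by blast
  then have "killed T (x + y)" "killed T (sc c x)" by (auto simp: killed_def bg_lin)
  note s = T[THEN F_sum[OF _ order_refl order_refl]] this[THEN F_sum[OF _ order_refl order_refl]]
  show "F n (x + y) = F n x + F n y" "F n (sc c x) = sc c (F n x)"
    unfolding s by (simp_all add: bg_lin sum.distrib scale_right_distrib scale_sum_right mult.commute)
qed

lemma hterm_lin: "hterm n (x + y) i = hterm n x i + hterm n y i" "hterm n (sc c x) i = sc c (hterm n x i)"
  by (simp_all add: hterm_def bg_lin scale_right_distrib mult.commute)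

lemma H_lin: "H n (x + y) = H n x + H n y" "H n (sc c x) = sc c (H n x)"
proof -
  obtain T where T: "killed T x" "killed T y" using killed_exists2 by blast
  then have "killed T (x + y)" "killed T (sc c x)" by (auto simp: killed_def bg_lin)
  note s = T[THEN H_sum[OF _ min.cobounded1 min.cobounded2 order_refl]] this[THEN H_sum[OF _ min.cobounded1 min.cobounded2 order_refl]]
  show "H n (x + y) = H n x + H n y" "H n (sc c x) = sc c (H n x)"
    unfolding s by (simp_all add: hterm_lin sum.distrib scale_right_distrib scale_sum_right mult.commute)
qed

lemma linI: "(\<And>x y. f (x + y) = f x + f y) \<Longrightarrow> (\<And>c x. f (sc c x) = sc c (f x)) \<Longrightarrow> Vector_Spaces.linear sc sc f"
  by unfold_locales simp_all

lemma linear_EFH: "Vector_Spaces.linear sc sc (E n)" "Vector_Spaces.linear sc sc (F n)" "Vector_Spaces.linear sc sc (H n)"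
  by (rule linI; simp add: E_lin F_lin H_lin)+

lemma EFH_sum: "E n (\<Sum>i\<in>I. G i) = (\<Sum>i\<in>I. E n (G i))" "F n (\<Sum>i\<in>I. G i) = (\<Sum>i\<in>I. F n (G i))"
  "H n (\<Sum>i\<in>I. G i) = (\<Sum>i\<in>I. H n (G i))"
proof -
  interpret e: Vector_Spaces.linear sc sc "E n" by (rule linear_EFH)
  interpret f: Vector_Spaces.linear sc sc "F n" by (rule linear_EFH)
  interpret h: Vector_Spaces.linear sc sc "H n" by (rule linear_EFH)
  show "E n (\<Sum>i\<in>I. G i) = (\<Sum>i\<in>I. E n (G i))" "F n (\<Sum>i\<in>I. G i) = (\<Sum>i\<in>I. F n (G i))"
    "H n (\<Sum>i\<in>I. G i) = (\<Sum>i\<in>I. H n (G i))" by (fact e.sum f.sum h.sum)+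
qed

lemma bg: "b n (g m v) = g m (b n v) - (if m + n = 0 then v else 0)"
  by (simp add: gb)

lemma half_twice: "sc (1/2) (v + v) = v"
  using scale_left_distrib[of "1/2" "1/2" v] by (simp add: scale_right_distrib)

lemma half_twice_minus: "- sc (1/2) v - sc (1/2) v = - v"
  using half_twice[of v] by (simp add: scale_right_distrib) (metis minus_add_distrib uminus_add_conv_diff add.commute)

text \<open>
  The brackets of the currents with \<open>\<beta>\<close> and \<open>\<gamma>\<close>: they act on the pair \<open>(\<beta>, \<gamma>)\<close> as on the
  two-dimensional module, which reduces the brackets of the currents to single commutators.
\<close>

lemma E_b: "E m (b j v) = b j (E m v)"
proof -
  obtain T where T: "killed T v" "killed T (b j v)" using killed_exists2 by blast
  show ?thesis unfolding T[THEN E_sum[OF _ order_refl order_refl]]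
    by (simp add: bg_lin bb[of j])
qed

lemma F_g: "F m (g j v) = g j (F m v)"
proof -
  obtain T where T: "killed T v" "killed T (g j v)" using killed_exists2 by blast
  show ?thesis unfolding T[THEN F_sum[OF _ order_refl order_refl]]
    by (simp add: bg_lin gg[of j])
qed

lemma E_g: "E m (g j v) = g j (E m v) - b (m + j) v"
proof -
  obtain T0 where T0: "killed T0 v" "killed T0 (g j v)" using killed_exists2 by blast
  define T where "T = T0 + \<bar>j\<bar> + \<bar>m\<bar>"
  have T: "killed T v" "killed T (g j v)" using T0[THEN killed_mono, of T] by (auto simp: T_def)
  have T1: "T \<ge> \<bar>j\<bar> + \<bar>m\<bar>" using T0 by (simp add: T_def killed_def)
  let ?J = "{m - T..T}"
  have mem: "m + j \<in> ?J" "- j \<in> ?J" using T1 by auto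
  have t: "b i (b (m - i) (g j v)) = g j (b i (b (m - i) v)) - (if i = m + j then b i v else 0) - (if i = - j then b (m - i) v else 0)" for i
  proof -
    have e: "(j + (m - i) = 0) = (i = m + j)" "(j + i = 0) = (i = - j)" by auto
    show ?thesis by (simp add: bg e bg_lin)
  qed
  have "(\<Sum>i\<in>?J. b i (b (m - i) (g j v))) = (\<Sum>i\<in>?J. g j (b i (b (m - i) v))) - b (m + j) v - b (m + j) v"
    unfolding t sum_subtractf sum_delta_mem[OF finite_atLeastAtMost_int mem(1)] sum_delta_mem[OF finite_atLeastAtMost_int mem(2)] by simp
  then show ?thesis unfolding T[THEN E_sum[OF _ order_refl order_refl]]
    by (simp add: bg_lin scale_right_diff_distrib half_twice_minus)
qed

lemma H_b: "H m (b j v) = b j (H m v) + b (m + j) v"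
proof -
  obtain T0 where T0: "killed T0 v" "killed T0 (b j v)" using killed_exists2 by blast
  define T where "T = T0 + \<bar>j\<bar> + \<bar>m\<bar>"
  have T: "killed T v" "killed T (b j v)" using T0[THEN killed_mono, of T] by (auto simp: T_def)
  have T1: "T \<ge> \<bar>j\<bar> + \<bar>m\<bar>" using T0 by (simp add: T_def killed_def)
  let ?J = "{- T - \<bar>m\<bar>..T}"
  have mem: "m + j \<in> ?J" "- j \<in> ?J" using T1 by auto
  have J: "- T - \<bar>m\<bar> \<le> m - T" "- T - \<bar>m\<bar> \<le> 0" using T1 by auto
  have t: "hterm m (b j v) i = b j (hterm m v i) + (if i = m + j then b i v else 0) + (if i = m + j then b i v else 0)" for i
  proof -
    have e: "(m - i + j = 0) = (i = m + j)" by auto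
    show ?thesis by (simp add: hterm_def gb e bg_lin bb[of j])
  qed
  have "(\<Sum>i\<in>?J. hterm m (b j v) i) = (\<Sum>i\<in>?J. b j (hterm m v i)) + b (m + j) v + b (m + j) v"
    unfolding t sum.distrib sum_delta_mem[OF finite_atLeastAtMost_int mem(1)] sum_delta_mem[OF finite_atLeastAtMost_int mem(2)] by simp
  then show ?thesis unfolding T[THEN H_sum[OF _ J order_refl]]
    using half_twice[of "b (m + j) v"] by (simp add: bg_lin scale_right_distrib add.assoc)
qed

lemma H_g: "H m (g j v) = g j (H m v) - g (m + j) v"
proof -
  obtain T0 where T0: "killed T0 v" "killed T0 (g j v)" using killed_exists2 by blast
  define T where "T = T0 + \<bar>j\<bar> + \<bar>m\<bar>"
  have T: "killed T v" "killed T (g j v)" using T0[THEN killed_mono, of T] by (auto simp: T_def)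
  have T1: "T \<ge> \<bar>j\<bar> + \<bar>m\<bar>" using T0 by (simp add: T_def killed_def)
  let ?J = "{- T - \<bar>m\<bar>..T}"
  have mem: "m + j \<in> ?J" "- j \<in> ?J" using T1 by auto
  have J: "- T - \<bar>m\<bar> \<le> m - T" "- T - \<bar>m\<bar> \<le> 0" using T1 by auto
  have t: "hterm m (g j v) i = g j (hterm m v i) - (if i = - j then g (m - i) v else 0) - (if i = - j then g (m - i) v else 0)" for i
  proof -
    have e: "(j + i = 0) = (i = - j)" by auto
    show ?thesis by (simp add: hterm_def bg e bg_lin gg[of j])
  qed
  have "(\<Sum>i\<in>?J. hterm m (g j v) i) = (\<Sum>i\<in>?J. g j (hterm m v i)) - g (m + j) v - g (m + j) v"
    unfolding t sum_subtractf sum_delta_mem[OF finite_atLeastAtMost_int mem(1)] sum_delta_mem[OF finite_atLeastAtMost_int mem(2)] by simp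
  then show ?thesis unfolding T[THEN H_sum[OF _ J order_refl]]
    by (simp add: bg_lin scale_right_diff_distrib half_twice_minus)
qed

lemma E_E: "E m (E n v) = E n (E m v)"
proof -
  obtain T where T: "killed T v" "killed T (E m v)" using killed_exists2 by blast
  show ?thesis unfolding T[THEN E_sum[OF _ order_refl order_refl, where n = n]]
    by (simp add: E_lin EFH_sum E_b)
qed

lemma F_F: "F m (F n v) = F n (F m v)"
proof -
  obtain T where T: "killed T v" "killed T (F m v)" using killed_exists2 by blast
  show ?thesis unfolding T[THEN F_sum[OF _ order_refl order_refl, where n = n]]
    by (simp add: F_lin EFH_sum F_g)
qed

lemma H_E: "H m (E n v) = E n (H m v) + sc 2 (E (m + n) v)"
proof -
  obtain T0 where T0: "killed T0 v" "killed T0 (H m v)" using killed_exists2 by blast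
  define T where "T = T0 + \<bar>n\<bar> + \<bar>m\<bar>"
  have T: "killed T v" "killed T (H m v)" using T0[THEN killed_mono, of T] by (auto simp: T_def)
  let ?J = "{n - T..T}"
  have 1: "E (m + n) v = sc (1/2) (\<Sum>i\<in>?J. b (m + i) (b (n - i) v))"
  proof -
    have "E (m + n) v = sc (1/2) (\<Sum>i\<in>{m + n - T..m + T}. b i (b (m + n - i) v))"
      by (rule E_sum[OF T0(1)]) (auto simp: T_def)
    also have "(\<Sum>i\<in>{m + n - T..m + T}. b i (b (m + n - i) v)) = (\<Sum>i\<in>?J. b (m + i) (b (n - i) v))"
      by (rule sum.reindex_bij_witness[of _ "\<lambda>i. m + i" "\<lambda>i. i - m"]) (auto simp: algebra_simps)
    finally show ?thesis .
  qed
  have 2: "E (m + n) v = sc (1/2) (\<Sum>i\<in>?J. b i (b (m + (n - i)) v))"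
    using E_sum[OF T0(1), of "n - T" "m + n" T] by (simp add: T_def add_diff_eq)
  have "H m (E n v) = sc (1/2) (\<Sum>i\<in>?J. b i (b (n - i) (H m v))) +
    (sc (1/2) (\<Sum>i\<in>?J. b i (b (m + (n - i)) v)) + sc (1/2) (\<Sum>i\<in>?J. b (m + i) (b (n - i) v)))"
    unfolding E_sum[OF T(1) order_refl order_refl, where n = n]
    by (simp add: H_lin EFH_sum H_b bg_lin sum.distrib scale_right_distrib)
  also have "\<dots> = E n (H m v) + (E (m + n) v + E (m + n) v)"
    unfolding 1[symmetric] 2[symmetric] E_sum[OF T(2) order_refl order_refl, where n = n] ..
  finally show ?thesis using scale_left_distrib[of 1 1 "E (m + n) v"] by simp
qed

lemma H_F: "H m (F n v) = F n (H m v) - sc 2 (F (m + n) v)"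
proof -
  obtain T0 where T0: "killed T0 v" "killed T0 (H m v)" using killed_exists2 by blast
  define T where "T = T0 + \<bar>n\<bar> + \<bar>m\<bar>"
  have T: "killed T v" "killed T (H m v)" using T0[THEN killed_mono, of T] by (auto simp: T_def)
  let ?J = "{n - T..T}"
  have 1: "F (m + n) v = sc (1/2) (\<Sum>i\<in>?J. g (m + i) (g (n - i) v))"
  proof -
    have "F (m + n) v = sc (1/2) (\<Sum>i\<in>{m + n - T..m + T}. g i (g (m + n - i) v))"
      by (rule F_sum[OF T0(1)]) (auto simp: T_def)
    also have "(\<Sum>i\<in>{m + n - T..m + T}. g i (g (m + n - i) v)) = (\<Sum>i\<in>?J. g (m + i) (g (n - i) v))"
      by (rule sum.reindex_bij_witness[of _ "\<lambda>i. m + i" "\<lambda>i. i - m"]) (auto simp: algebra_simps)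
    finally show ?thesis .
  qed
  have 2: "F (m + n) v = sc (1/2) (\<Sum>i\<in>?J. g i (g (m + (n - i)) v))"
    using F_sum[OF T0(1), of "n - T" "m + n" T] by (simp add: T_def add_diff_eq)
  have "H m (F n v) = sc (1/2) (\<Sum>i\<in>?J. g i (g (n - i) (H m v))) -
    (sc (1/2) (\<Sum>i\<in>?J. g i (g (m + (n - i)) v)) + sc (1/2) (\<Sum>i\<in>?J. g (m + i) (g (n - i) v)))"
    unfolding F_sum[OF T(1) order_refl order_refl, where n = n]
    by (simp add: H_lin EFH_sum H_g bg_lin sum_subtractf scale_right_diff_distrib)
  also have "\<dots> = F n (H m v) - (F (m + n) v + F (m + n) v)"
    unfolding 1[symmetric] 2[symmetric] F_sum[OF T(2) order_refl order_refl, where n = n] ..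
  finally show ?thesis using scale_left_distrib[of 1 1 "F (m + n) v"] by simp
qed

lemma sum_bg:
  assumes "killed T v" "a \<le> n - T" "a \<le> 0" "T \<le> c"
  shows "sc (1/2) (\<Sum>i\<in>{a..c}. b i (g (n - i) v) + g (n - i) (b i v)) =
     H n v - (if n = 0 then sc (of_int (a + c) / 2) v else 0)"
proof -
  have c: "c \<ge> 0" using assms by (simp add: killed_def)
  have "(\<Sum>i\<in>{a..c}. hterm n v i) = (\<Sum>i\<in>{a..c}. b i (g (n - i) v) + g (n - i) (b i v)) +
    (if n = 0 then sc (of_int (\<Sum>i\<in>{a..c}. sgn i)) v else 0)"
    by (simp add: hterm_def sum.distrib scale_sum_left)
  then show ?thesis unfolding H_sum[OF assms] sum_sgn[OF assms(3) c]
    by (simp add: scale_right_distrib)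
qed

text \<open>
  The central term is the difference of the constants \<open>sgn i\<close> over two index ranges shifted by \<open>m\<close>.
\<close>

lemma E_F: "E m (F n v) = F n (E m v) - H (m + n) v - sc (if m + n = 0 then - of_int m / 2 else 0) v"
proof -
  obtain T0 where T0: "killed T0 v" "killed T0 (E m v)" using killed_exists2 by blast
  define T where "T = T0 + \<bar>n\<bar> + \<bar>m\<bar>"
  have T: "killed T v" "killed T (E m v)" using T0[THEN killed_mono, of T] by (auto simp: T_def)
  have T0': "T0 \<ge> 0" using T0 by (simp add: killed_def)
  let ?J = "{n - T..T}"
  have r: "(\<Sum>i\<in>?J. g i (b (m + (n - i)) v)) = (\<Sum>i\<in>?J. g (n - i) (b (m + i) v))"
    by (rule sum.reindex_bij_witness[of _ "\<lambda>i. n - i" "\<lambda>i. n - i"]) auto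
  have r2: "(\<Sum>i\<in>?J. b (m + i) (g (n - i) v) + g (n - i) (b (m + i) v)) =
      (\<Sum>i\<in>{m + n - T..m + T}. b i (g (m + n - i) v) + g (m + n - i) (b i v))"
    by (rule sum.reindex_bij_witness[of _ "\<lambda>i. i - m" "\<lambda>i. m + i"]) (auto simp: algebra_simps)
  have "E m (F n v) = sc (1/2) (\<Sum>i\<in>?J. g i (g (n - i) (E m v))) -
    sc (1/2) ((\<Sum>i\<in>?J. b (m + i) (g (n - i) v)) + (\<Sum>i\<in>?J. g i (b (m + (n - i)) v)))"
    unfolding F_sum[OF T(1) order_refl order_refl, where n = n]
    by (simp add: E_lin EFH_sum E_g bg_lin sum_subtractf scale_right_diff_distrib scale_right_distrib)
  also have "\<dots> = F n (E m v) - sc (1/2) (\<Sum>i\<in>{m + n - T..m + T}. b i (g (m + n - i) v) + g (m + n - i) (b i v))"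
    unfolding r sum.distrib[symmetric] r2 F_sum[OF T(2) order_refl order_refl, where n = n] ..
  also have "sc (1/2) (\<Sum>i\<in>{m + n - T..m + T}. b i (g (m + n - i) v) + g (m + n - i) (b i v)) =
    H (m + n) v - (if m + n = 0 then sc (of_int ((m + n - T) + (m + T)) / 2) v else 0)"
    by (rule sum_bg[OF T0(1)]) (use T0' in \<open>auto simp: T_def\<close>)
  finally show ?thesis by (auto simp: add_eq_0_iff)
qed

lemma H_H: "H m (H n v) = H n (H m v) + sc (if m + n = 0 then - of_int m else 0) v"
proof -
  obtain T0 where T0: "killed T0 v" "killed T0 (H m v)" using killed_exists2 by blast
  define T where "T = T0 + \<bar>n\<bar> + \<bar>m\<bar>"
  have T: "killed T v" "killed T (H m v)" using T0[THEN killed_mono, of T] by (auto simp: T_def)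
  have T0': "T0 \<ge> 0" using T0 by (simp add: killed_def)
  let ?J = "{- T - \<bar>n\<bar>..T}"
  have J: "- T - \<bar>n\<bar> \<le> n - T" "- T - \<bar>n\<bar> \<le> 0" using T0' by (auto simp: T_def)
  have r: "(\<Sum>i\<in>?J. b (m + i) (g (n - i) v) + g (n - i) (b (m + i) v)) =
      (\<Sum>i\<in>{m - T - \<bar>n\<bar>..m + T}. b i (g (m + n - i) v) + g (m + n - i) (b i v))"
    by (rule sum.reindex_bij_witness[of _ "\<lambda>i. i - m" "\<lambda>i. m + i"]) (auto simp: algebra_simps)
  have r': "b i (g (m + (n - i)) v) + g (m + (n - i)) (b i v) = b i (g (m + n - i) v) + g (m + n - i) (b i v)" for i
    by (simp add: add_diff_eq)
  have t: "H m (hterm n v i) = hterm n (H m v) i + (b (m + i) (g (n - i) v) + g (n - i) (b (m + i) v))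
     - (b i (g (m + (n - i)) v) + g (m + (n - i)) (b i v))" for i
  proof -
    have H0: "H m 0 = 0" using H_lin(2)[of m 0 0] by simp
    show ?thesis by (simp add: hterm_def H_lin H_b H_g bg_lin H0)
  qed
  have "H m (H n v) = sc (1/2) (\<Sum>i\<in>?J. hterm n (H m v) i) +
    (sc (1/2) (\<Sum>i\<in>?J. b (m + i) (g (n - i) v) + g (n - i) (b (m + i) v)) -
     sc (1/2) (\<Sum>i\<in>?J. b i (g (m + n - i) v) + g (m + n - i) (b i v)))"
    unfolding H_sum[OF T(1) J order_refl] H_lin EFH_sum t r'
    by (simp only: sum.distrib sum_subtractf scale_right_distrib scale_right_diff_distrib add_diff_eq)
  also have "sc (1/2) (\<Sum>i\<in>?J. hterm n (H m v) i) = H n (H m v)"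
    unfolding H_sum[OF T(2) J order_refl] ..
  also have "sc (1/2) (\<Sum>i\<in>?J. b (m + i) (g (n - i) v) + g (n - i) (b (m + i) v)) =
    H (m + n) v - (if m + n = 0 then sc (of_int ((m - T - \<bar>n\<bar>) + (m + T)) / 2) v else 0)"
    unfolding r by (rule sum_bg[OF T0(1)]) (use T0' in \<open>auto simp: T_def\<close>)
  also have "sc (1/2) (\<Sum>i\<in>?J. b i (g (m + n - i) v) + g (m + n - i) (b i v)) =
    H (m + n) v - (if m + n = 0 then sc (of_int ((- T - \<bar>n\<bar>) + T) / 2) v else 0)"
    by (rule sum_bg[OF T0(1)]) (use T0' in \<open>auto simp: T_def\<close>)
  finally have "H m (H n v) = H n (H m v) + (if m + n = 0 then sc (of_int (- T - \<bar>n\<bar> + T) / 2) v -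
      sc (of_int ((m - T - \<bar>n\<bar>) + (m + T)) / 2) v else 0)" by simp
  also have "sc (of_int (- T - \<bar>n\<bar> + T) / 2) v - sc (of_int ((m - T - \<bar>n\<bar>) + (m + T)) / 2) v = sc (- of_int m) v"
  proof -
    have "(of_int (- T - \<bar>n\<bar> + T) / 2 - of_int ((m - T - \<bar>n\<bar>) + (m + T)) / 2 :: complex) = - of_int m"
      by (simp add: field_simps)
    then show ?thesis by (simp only: scale_left_diff_distrib[symmetric])
  qed
  finally show ?thesis by simp
qed

lemma currents_vanish:
  assumes T: "killed T v" and n: "n > T + T"
  shows "E n v = 0 \<and> F n v = 0 \<and> H n v = 0"
  proof (intro conjI)
    have T0: "T \<ge> 0" using T by (simp add: killed_def)
    have z: "b i (b (n - i) v) = 0" "g i (g (n - i) v) = 0" "hterm n v i = 0" for i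
    proof -
      have c: "i > T \<or> n - i > T" using n by linarith
      then show "b i (b (n - i) v) = 0" "g i (g (n - i) v) = 0"
        using T bb[of i "n - i" v] gg[of i "n - i" v] by (auto simp: killed_def bg_lin)
      have "b i (g (n - i) v) = g (n - i) (b i v)" using n T0 by (simp add: bg)
      then show "hterm n v i = 0" using c T n T0 by (auto simp: killed_def hterm_def bg_lin)
    qed
    then show "E n v = 0" "F n v = 0" "H n v = 0" by (simp_all add: currents_def lfsum_def)
  qed

text \<open>
  The symplectic boson realization of \<open>sl(2)\<close> at level \<open>-1/2\<close>.
\<close>

lemma currents_affine: "affine (- 1 / 2) currents"
  unfolding affine_def
proof (rule affine_sl2_module.intro, goal_cases)
  case 1
  show ?case using vector_space_axioms by simp
next
  case (2 n) show ?case using linear_EFH by simp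
next
  case (3 n) show ?case using linear_EFH by simp
next
  case (4 n) show ?case using linear_EFH by simp
next
  case (5 m n v) show ?case by (simp add: H_E)
next
  case (6 m n v) show ?case by (simp add: H_F)
next
  case (7 m n v) show ?case by (simp add: H_H[of m n])
next
  case (8 m n v) show ?case by (simp add: E_F[of m n])
next
  case (9 m n v) show ?case by (rule E_E)
next
  case (10 m n v) show ?case by (rule F_F)
next
  case (11 v)
  obtain T where T: "killed T v" using killed_exists by blast
  show ?case using currents_vanish[OF T] by (intro exI[of _ "T + T + 1"]) simp
qed

text \<open>
  A derivation that grades the fields grades the currents. Together with the value on the top this
  identifies the Sugawara \<open>L_0\<close> with the number of modes weighted by their indices.
\<close>

lemma grading_currents:
  assumes D: "Vector_Spaces.linear sc sc D"
    and Db: "\<And>n v. D (b n v) = b n (D v) - sc (of_int n) (b n v)"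
    and Dg: "\<And>n v. D (g n v) = g n (D v) - sc (of_int n) (g n v)"
  shows "D (mode currents X n v) = mode currents X n (D v) - sc (of_int n) (mode currents X n v)"
proof -
  interpret D: Vector_Spaces.linear sc sc D by (rule D)
  obtain T where T: "killed T v" "killed T (D v)" using killed_exists2 by blast
  note se = T[THEN E_sum[OF _ order_refl order_refl, where n = n]]
  note sf = T[THEN F_sum[OF _ order_refl order_refl, where n = n]]
  note sh = T[THEN H_sum[OF _ min.cobounded1 min.cobounded2 order_refl, where n = n]]
  have i: "sc (of_int i) w + sc (of_int (n - i)) w = sc (of_int n) w" for i w
    by (simp add: scale_left_distrib[symmetric])
  have e: "D (b i (b (n - i) v)) = b i (b (n - i) (D v)) - sc (of_int n) (b i (b (n - i) v))" for i
    unfolding i[of i, symmetric] by (simp add: Db bg_lin)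
  have f: "D (g i (g (n - i) v)) = g i (g (n - i) (D v)) - sc (of_int n) (g i (g (n - i) v))" for i
    unfolding i[of i, symmetric] by (simp add: Dg bg_lin)
  have bg': "D (b i (g (n - i) v)) = b i (g (n - i) (D v)) - sc (of_int n) (b i (g (n - i) v))" for i
    unfolding i[of i, symmetric] by (simp add: Db Dg bg_lin)
  have gb': "D (g (n - i) (b i v)) = g (n - i) (b i (D v)) - sc (of_int n) (g (n - i) (b i v))" for i
    unfolding i[of i, symmetric] by (simp add: Db Dg bg_lin)
  have h: "D (hterm n v i) = hterm n (D v) i - sc (of_int n) (hterm n v i)" for i
    unfolding hterm_def D.add bg' gb' by (simp add: scale_right_distrib D.scale)
  show ?thesis
  proof (cases X)
    case cE
    then show ?thesis unfolding cE mode.simps se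
      by (simp add: D.scale D.sum e sum_subtractf scale_right_diff_distrib scale_sum_right mult.commute)
  next
    case cF
    then show ?thesis unfolding cF mode.simps sf
      by (simp add: D.scale D.sum f sum_subtractf scale_right_diff_distrib scale_sum_right mult.commute)
  next
    case cH
    then show ?thesis unfolding cH mode.simps sh
      by (simp add: D.scale D.sum h sum_subtractf scale_right_diff_distrib scale_sum_right mult.commute)
  qed
qed

end

section \<open>Weight modules of the beta-gamma system\<close>

type_synonym bgindex = "int \<times> nat multiset \<times> nat multiset"
type_synonym bgspace = "bgindex \<Rightarrow>\<^sub>0 complex"

abbreviation mono_vec :: "bgindex \<Rightarrow> bgspace" where "mono_vec i \<equiv> Poly_Mapping.single i 1"

text \<open>
  \<open>(a, P, Q)\<close> is \<open>x^a\<close> times creation modes: the entry \<open>i\<close> of \<open>P\<close> is \<open>\<beta>_(-i-1)\<close>, that of \<open>Q\<close> is \<open>\<gamma>_(-i-1)\<close>.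
  Positive modes act as derivatives.
\<close>

definition beta_basis :: "int \<Rightarrow> bgindex \<Rightarrow> bgspace"
  where "beta_basis n = (\<lambda>(a, P, Q).
    if n < 0 then Poly_Mapping.single (a, add_mset (nat (- n) - 1) P, Q) 1
    else if n = 0 then Poly_Mapping.single (a + 1, P, Q) 1
    else Poly_Mapping.single (a, P, Q - {#nat n - 1#}) (- of_nat (count Q (nat n - 1))))"

text \<open>
  \<open>\<gamma>_0\<close> is the derivative with respect to \<open>x\<close> on \<open>x^(a + \<rho>)\<close>. For \<open>\<rho> = 0\<close> it annihilates \<open>x^0\<close>, so that
  \<open>a \<ge> 0\<close> is a submodule; otherwise \<open>a\<close> runs through all integers.
\<close>

definition gamma_basis :: "complex \<Rightarrow> int \<Rightarrow> bgindex \<Rightarrow> bgspace"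
  where "gamma_basis \<rho> n = (\<lambda>(a, P, Q).
    if n < 0 then Poly_Mapping.single (a, P, add_mset (nat (- n) - 1) Q) 1
    else if n = 0 then Poly_Mapping.single (a - 1, P, Q) (of_int a + \<rho>)
    else Poly_Mapping.single (a, P - {#nat n - 1#}, Q) (of_nat (count P (nat n - 1))))"

definition beta :: "int \<Rightarrow> bgspace \<Rightarrow> bgspace" where "beta n = plin (beta_basis n)"
definition gamma :: "complex \<Rightarrow> int \<Rightarrow> bgspace \<Rightarrow> bgspace" where "gamma \<rho> n = plin (gamma_basis \<rho> n)"

lemma beta_single:
  "n < 0 \<Longrightarrow> beta n (Poly_Mapping.single (a, P, Q) c) = Poly_Mapping.single (a, add_mset (nat (- n) - 1) P, Q) c"
  "beta 0 (Poly_Mapping.single (a, P, Q) c) = Poly_Mapping.single (a + 1, P, Q) c"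
  "n > 0 \<Longrightarrow> beta n (Poly_Mapping.single (a, P, Q) c) = Poly_Mapping.single (a, P, Q - {#nat n - 1#}) (- of_nat (count Q (nat n - 1)) * c)"
  by (simp_all add: beta_def beta_basis_def mult.commute)

lemma gamma_single:
  "n < 0 \<Longrightarrow> gamma \<rho> n (Poly_Mapping.single (a, P, Q) c) = Poly_Mapping.single (a, P, add_mset (nat (- n) - 1) Q) c"
  "gamma \<rho> 0 (Poly_Mapping.single (a, P, Q) c) = Poly_Mapping.single (a - 1, P, Q) ((of_int a + \<rho>) * c)"
  "n > 0 \<Longrightarrow> gamma \<rho> n (Poly_Mapping.single (a, P, Q) c) = Poly_Mapping.single (a, P - {#nat n - 1#}, Q) (of_nat (count P (nat n - 1)) * c)"
  by (simp_all add: gamma_def gamma_basis_def mult.commute)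

lemma plinear_beta [simp, intro]: "plinear (beta n)" by (simp add: beta_def)
lemma plinear_gamma [simp, intro]: "plinear (gamma \<rho> n)" by (simp add: gamma_def)

lemma add_remove_swap: "x \<noteq> y \<Longrightarrow> add_mset x P - {#y#} = add_mset x (P - {#y#})"
  by (rule diff_union_swap[symmetric]) simp

lemma count_remove_sym: "count Q x * count (Q - {#x#}) y = count Q y * count (Q - {#y#}) x"
  by (cases "x = y") auto

lemma int_trichotomy:
  fixes n :: int
  obtains x where "n = - int x - 1" | "n = 0" | x where "n = int x + 1"
proof -
  consider "n < 0" | "n = 0" | "n > 0" by linarith
  then show thesis
  proof cases
    case 1
    then have "n = - int (nat (- n) - 1) - 1" by auto
    then show thesis using that(1) by blast
  next
    case 3
    then have "n = int (nat n - 1) + 1" by auto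
    then show thesis using that(3) by blast
  qed (use that in blast)
qed

lemma beta_mono:
  "beta (- int x - 1) (Poly_Mapping.single (a, P, Q) c) = Poly_Mapping.single (a, add_mset x P, Q) c"
  "beta 0 (Poly_Mapping.single (a, P, Q) c) = Poly_Mapping.single (a + 1, P, Q) c"
  "beta (int x + 1) (Poly_Mapping.single (a, P, Q) c) = Poly_Mapping.single (a, P, Q - {#x#}) (- of_nat (count Q x) * c)"
  by (simp_all add: beta_single nat_add_distrib)

lemma gamma_mono:
  "gamma \<rho> (- int x - 1) (Poly_Mapping.single (a, P, Q) c) = Poly_Mapping.single (a, P, add_mset x Q) c"
  "gamma \<rho> 0 (Poly_Mapping.single (a, P, Q) c) = Poly_Mapping.single (a - 1, P, Q) ((of_int a + \<rho>) * c)"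
  "gamma \<rho> (int x + 1) (Poly_Mapping.single (a, P, Q) c) = Poly_Mapping.single (a, P - {#x#}, Q) (of_nat (count P x) * c)"
  by (simp_all add: gamma_single nat_add_distrib)

lemma beta_beta: "beta m (beta n v) = beta n (beta m v)"
proof (rule plinear_eqI[where F = "\<lambda>v. beta m (beta n v)" and G = "\<lambda>v. beta n (beta m v)"])
  fix b :: bgindex
  obtain a P Q where b: "b = (a, P, Q)" by (cases b)
  show "beta m (beta n (mono_vec b)) = beta n (beta m (mono_vec b))"
  proof (rule int_trichotomy[of m]; rule int_trichotomy[of n])
    fix x y assume mn: "m = int x + 1" "n = int y + 1"
    have "of_nat (count Q x * count (Q - {#x#}) y) = (of_nat (count Q y * count (Q - {#y#}) x) :: complex)"
      by (simp only: count_remove_sym)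
    then show ?thesis unfolding mn b beta_mono by (cases "x = y") (simp_all add: add_mset_commute mult.commute)
  qed (simp_all only: b beta_mono add_mset_commute)
qed (auto intro: plinear_compose)

lemma gamma_gamma: "gamma \<rho> m (gamma \<rho> n v) = gamma \<rho> n (gamma \<rho> m v)"
proof (rule plinear_eqI[where F = "\<lambda>v. gamma \<rho> m (gamma \<rho> n v)" and G = "\<lambda>v. gamma \<rho> n (gamma \<rho> m v)"])
  fix b :: bgindex
  obtain a P Q where b: "b = (a, P, Q)" by (cases b)
  show "gamma \<rho> m (gamma \<rho> n (mono_vec b)) = gamma \<rho> n (gamma \<rho> m (mono_vec b))"
  proof (rule int_trichotomy[of m]; rule int_trichotomy[of n])
    fix x y assume mn: "m = int x + 1" "n = int y + 1"
    have "of_nat (count P x * count (P - {#x#}) y) = (of_nat (count P y * count (P - {#y#}) x) :: complex)"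
      by (simp only: count_remove_sym)
    then show ?thesis unfolding mn b gamma_mono by (cases "x = y") (simp_all add: add_mset_commute mult.commute)
  qed (simp_all add: b gamma_mono add_mset_commute mult.commute)
qed (auto intro: plinear_compose)

lemma plinear_add_fun: "plinear F \<Longrightarrow> plinear G \<Longrightarrow> plinear (\<lambda>v. F v + G v)"
  by (simp add: plinear_def pm.scale_right_distrib)

lemma remove_insert_coeff:
  "Poly_Mapping.single (f (add_mset x P - {#y#})) (of_nat (count (add_mset x P) y) :: complex) =
   Poly_Mapping.single (f (add_mset x (P - {#y#}))) (of_nat (count P y)) + (if x = y then Poly_Mapping.single (f P) 1 else 0)"
proof (cases "x = y")
  case True
  show ?thesis
  proof (cases "y \<in># P")
    case True
    then show ?thesis using \<open>x = y\<close> by (simp add: single_add[symmetric] add.commute)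
  next
    case False
    then have "count P y = 0" by (simp add: not_in_iff)
    then show ?thesis using \<open>x = y\<close> by (simp del: count_eq_zero_iff)
  qed
qed (simp add: add_remove_swap)

lemma gamma_beta: "gamma \<rho> m (beta n v) = beta n (gamma \<rho> m v) + (if m + n = 0 then v else 0)"
proof (rule plinear_eqI[where F = "\<lambda>v. gamma \<rho> m (beta n v)" and G = "\<lambda>v. beta n (gamma \<rho> m v) + (if m + n = 0 then v else 0)"])
  fix b :: bgindex
  obtain a P Q where b: "b = (a, P, Q)" by (cases b)
  show "gamma \<rho> m (beta n (mono_vec b)) = beta n (gamma \<rho> m (mono_vec b)) + (if m + n = 0 then mono_vec b else 0)"
  proof (rule int_trichotomy[of m]; rule int_trichotomy[of n])
    fix x y assume mn: "m = int x + 1" "n = - int y - 1"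
    show ?thesis unfolding mn b gamma_mono beta_mono
      using remove_insert_coeff[of "\<lambda>P. (a, P, Q)" y P x] by (simp add: eq_commute[of y x])
  next
    fix x y assume mn: "m = - int x - 1" "n = int y + 1"
    have "Poly_Mapping.single (a, P, add_mset x Q - {#y#}) (- of_nat (count (add_mset x Q) y) :: complex) =
      - Poly_Mapping.single (a, P, add_mset x Q - {#y#}) (of_nat (count (add_mset x Q) y))"
      by (simp only: single_uminus)
    also have "\<dots> = Poly_Mapping.single (a, P, add_mset x (Q - {#y#})) (- of_nat (count Q y)) -
        (if x = y then mono_vec (a, P, Q) else 0)"
      unfolding remove_insert_coeff[of "\<lambda>Q. (a, P, Q)" x Q y] by (simp add: single_uminus)
    finally show ?thesis unfolding mn b gamma_mono beta_mono by (auto simp: eq_commute[of y x])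
  next
    assume mn: "m = 0" "n = 0"
    show ?thesis unfolding mn b gamma_mono beta_mono by (simp add: single_add[symmetric] algebra_simps)
  qed (simp_all add: b gamma_mono beta_mono mult.commute)
next
  show "plinear (\<lambda>v. beta n (gamma \<rho> m v) + (if m + n = 0 then v else 0))"
    by (rule plinear_add_fun, rule plinear_compose[OF plinear_beta plinear_gamma]) (simp add: plinear_def)
qed (auto intro: plinear_compose)

lemma plinear_zeroI: "plinear F \<Longrightarrow> (\<And>b. b \<in> keys v \<Longrightarrow> F (Poly_Mapping.single b 1) = 0) \<Longrightarrow> F v = 0"
proof -
  assume F: "plinear F" and z: "\<And>b. b \<in> keys v \<Longrightarrow> F (Poly_Mapping.single b 1) = 0"
  have "F v = (\<Sum>b\<in>keys v. pscale (lookup v b) (F (Poly_Mapping.single b 1)))"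
    unfolding plinear_scale[OF F, symmetric] plinear_sum[OF F, symmetric]
    using pm_decompose[of v] by simp
  then show ?thesis using z by simp
qed

lemma betagamma_model: "betagamma pscale beta (gamma \<rho>)"
proof (rule betagamma.intro[OF pm.complex_space_axioms betagamma_axioms.intro], goal_cases)
  case (6 v)
  define N where "N = Suc (\<Sum>b\<in>keys v. wt (fst (snd b)) + wt (snd (snd b)))"
  have "beta n v = 0 \<and> gamma \<rho> n v = 0" if n: "n \<ge> int N" for n
  proof -
    have "N > 0" by (simp add: N_def)
    then have n0: "n > 0" using n by linarith
    have w: "wt P < nat n" "wt Q < nat n" if "(a, P, Q) \<in> keys v" for a P Q
    proof -
      have "wt (fst (snd (a, P, Q))) + wt (snd (snd (a, P, Q))) \<le> (\<Sum>b\<in>keys v. wt (fst (snd b)) + wt (snd (snd b)))"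
        by (rule member_le_sum[OF that]) auto
      then have "wt P < N" "wt Q < N" unfolding N_def by auto
      then show "wt P < nat n" "wt Q < nat n" using n by linarith+
    qed
    have c: "count P (nat n - 1) = 0" "count Q (nat n - 1) = 0" if "(a, P, Q) \<in> keys v" for a P Q
      using w[OF that] wt_ge[of "nat n - 1" P] wt_ge[of "nat n - 1" Q] n0
      by (auto simp: count_eq_zero_iff)
    have "beta n v = 0"
      by (rule plinear_zeroI) (use c n0 in \<open>auto simp: beta_single simp del: count_eq_zero_iff\<close>)
    moreover have "gamma \<rho> n v = 0"
      by (rule plinear_zeroI) (use c n0 in \<open>auto simp: gamma_single simp del: count_eq_zero_iff\<close>)
    ultimately show ?thesis by blast
  qed
  then show ?case by blast
qed (auto simp: plinear_iff[symmetric] gamma_beta intro: beta_beta gamma_gamma)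

lemma plinear_subspaceI:
  assumes F: "plinear F" and S: "pm.subspace S" and z: "\<And>b. b \<in> keys v \<Longrightarrow> F (Poly_Mapping.single b 1) \<in> S"
  shows "F v \<in> S"
proof -
  have "F v = (\<Sum>b\<in>keys v. pscale (lookup v b) (F (Poly_Mapping.single b 1)))"
    unfolding plinear_scale[OF F, symmetric] plinear_sum[OF F, symmetric]
    using pm_decompose[of v] by simp
  also have "\<dots> \<in> S" by (intro pm.subspace_sum[OF S] pm.subspace_scale[OF S] z)
  finally show ?thesis .
qed

section \<open>Charge sectors\<close>

text \<open>
  The charge \<open>a + |P| - |Q|\<close> is the \<open>h_0\<close>-weight up to a shift; the currents change it by even numbers.
\<close>

definition sector :: "complex \<Rightarrow> int \<Rightarrow> bgindex set"
  where "sector \<rho> i = {(a, P, Q). (\<rho> = 0 \<longrightarrow> a \<ge> 0) \<and> even (a + int (size P) - int (size Q) - i)}"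

definition sector_space :: "complex \<Rightarrow> int \<Rightarrow> bgspace set"
  where "sector_space \<rho> i = {v. keys v \<subseteq> sector \<rho> i}"

lemma subspace_sector: "pm.subspace (sector_space \<rho> i)"
  unfolding pm.subspace_def
proof (intro conjI ballI allI)
  show "0 \<in> sector_space \<rho> i" by (simp add: sector_space_def)
next
  fix v w assume "v \<in> sector_space \<rho> i" "w \<in> sector_space \<rho> i"
  then show "v + w \<in> sector_space \<rho> i"
    using Poly_Mapping.keys_add[of v w] unfolding sector_space_def by blast
next
  fix c v assume v: "v \<in> sector_space \<rho> i"
  have "keys (pscale c v) \<subseteq> keys v" by (auto simp: in_keys_iff)
  then show "pscale c v \<in> sector_space \<rho> i" using v unfolding sector_space_def by blast
qed

lemma single_sector: "c = 0 \<or> b \<in> sector \<rho> i \<Longrightarrow> Poly_Mapping.single b c \<in> sector_space \<rho> i"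
  by (auto simp: sector_space_def)

lemma beta_sector: "v \<in> sector_space \<rho> i \<Longrightarrow> beta n v \<in> sector_space \<rho> (i + 1)"
proof (rule plinear_subspaceI[OF plinear_beta subspace_sector])
  fix b assume v: "v \<in> sector_space \<rho> i" "b \<in> keys v"
  obtain a P Q where b: "b = (a, P, Q)" by (cases b)
  have s: "(a, P, Q) \<in> sector \<rho> i" using v b by (auto simp: sector_space_def)
  show "beta n (mono_vec b) \<in> sector_space \<rho> (i + 1)"
  proof (rule int_trichotomy[of n])
    fix x assume n: "n = int x + 1"
    show ?thesis unfolding n b beta_mono
    proof (rule single_sector, cases "x \<in># Q")
      case True
      then have "size Q = Suc (size (Q - {#x#}))" by (metis insert_DiffM size_add_mset)
      then show "- of_nat (count Q x) * 1 = (0::complex) \<or> (a, P, Q - {#x#}) \<in> sector \<rho> (i + 1)"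
        using s by (auto simp: sector_def)
    qed (simp add: not_in_iff del: count_eq_zero_iff)
  qed (use s in \<open>auto simp: b beta_mono sector_def intro!: single_sector\<close>)
qed

lemma gamma_sector: "v \<in> sector_space \<rho> i \<Longrightarrow> gamma \<rho> n v \<in> sector_space \<rho> (i + 1)"
proof (rule plinear_subspaceI[OF plinear_gamma subspace_sector])
  fix b assume v: "v \<in> sector_space \<rho> i" "b \<in> keys v"
  obtain a P Q where b: "b = (a, P, Q)" by (cases b)
  have s: "(a, P, Q) \<in> sector \<rho> i" using v b by (auto simp: sector_space_def)
  show "gamma \<rho> n (mono_vec b) \<in> sector_space \<rho> (i + 1)"
  proof (rule int_trichotomy[of n])
    fix x assume n: "n = int x + 1"
    show ?thesis unfolding n b gamma_mono
    proof (rule single_sector, cases "x \<in># P")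
      case True
      then have "size P = Suc (size (P - {#x#}))" by (metis insert_DiffM size_add_mset)
      then show "of_nat (count P x) * 1 = (0::complex) \<or> (a, P - {#x#}, Q) \<in> sector \<rho> (i + 1)"
        using s by (auto simp: sector_def)
    qed (simp add: not_in_iff del: count_eq_zero_iff)
  next
    assume n: "n = 0"
    show ?thesis unfolding n b gamma_mono
    proof (rule single_sector, cases "\<rho> = 0 \<and> a = 0")
      case False
      then show "(of_int a + \<rho>) * 1 = (0::complex) \<or> (a - 1, P, Q) \<in> sector \<rho> (i + 1)"
        using s by (auto simp: sector_def)
    qed simp
  qed (use s in \<open>auto simp: b gamma_mono sector_def intro!: single_sector\<close>)
qed

lemma sector_periodic: "sector_space \<rho> (i + 1 + 1) = sector_space \<rho> i"
  by (simp add: sector_space_def sector_def)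

context
  fixes \<rho> :: complex
begin

interpretation N: betagamma pscale beta "gamma \<rho>" by (rule betagamma_model)

abbreviation "model \<equiv> N.currents"

interpretation A: affine "- 1 / 2" model by (rule N.currents_affine)

lemma killed_mono_vec:
  assumes "\<And>p. p \<in># P \<Longrightarrow> int p < T" "\<And>q. q \<in># Q \<Longrightarrow> int q < T" "T \<ge> 0"
  shows "N.killed T (Poly_Mapping.single (a, P, Q) c)"
  unfolding N.killed_def
proof (intro conjI allI impI)
  fix n assume n: "n > T"
  then have n0: "n > 0" using assms(3) by simp
  have "count P (nat n - 1) = 0" "count Q (nat n - 1) = 0"
    using assms(1,2)[of "nat n - 1"] n n0 by (auto simp: count_eq_zero_iff)
  then show "beta n (Poly_Mapping.single (a, P, Q) c) = 0" "gamma \<rho> n (Poly_Mapping.single (a, P, Q) c) = 0"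
    using n0 by (simp_all add: beta_single gamma_single del: count_eq_zero_iff)
qed (rule assms(3))

lemma killed_wt: "N.killed (int (wt P + wt Q)) (Poly_Mapping.single (a, P, Q) c)"
  by (rule killed_mono_vec) (auto dest!: wt_ge)

lemma killed_top: "N.killed 0 (mono_vec (a, {#}, {#}))"
  by (rule killed_mono_vec) auto

lemma model_submodule: "sl2_submodule model (sector_space \<rho> i)"
  unfolding sl2_submodule_def N.scl_currents
proof (intro conjI allI ballI subspace_sector)
  fix n v assume v: "v \<in> sector_space \<rho> i"
  obtain T where T: "N.killed T v" using N.killed_exists by blast
  have two: "beta m (beta n v) \<in> sector_space \<rho> i" "beta m (gamma \<rho> n v) \<in> sector_space \<rho> i"
     "gamma \<rho> m (beta n v) \<in> sector_space \<rho> i" "gamma \<rho> m (gamma \<rho> n v) \<in> sector_space \<rho> i" for m n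
    using beta_sector[OF beta_sector[OF v]] beta_sector[OF gamma_sector[OF v]]
     gamma_sector[OF beta_sector[OF v]] gamma_sector[OF gamma_sector[OF v]] by (simp_all only: sector_periodic)
  show "N.E n v \<in> sector_space \<rho> i" unfolding N.E_sum[OF T order_refl order_refl]
    by (intro pm.subspace_scale pm.subspace_sum subspace_sector two)
  show "N.F n v \<in> sector_space \<rho> i" unfolding N.F_sum[OF T order_refl order_refl]
    by (intro pm.subspace_scale pm.subspace_sum subspace_sector two)
  have "N.hterm n v j \<in> sector_space \<rho> i" for j
    unfolding N.hterm_def
    using v by (auto intro!: pm.subspace_add pm.subspace_scale subspace_sector two pm.subspace_0)
  then show "N.H n v \<in> sector_space \<rho> i" unfolding N.H_sum[OF T min.cobounded1 min.cobounded2 order_refl]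
    by (intro pm.subspace_scale pm.subspace_sum subspace_sector)
qed

lemma top_E: "N.E 0 (mono_vec (a, {#}, {#})) = pscale (1/2) (mono_vec (a + 2, {#}, {#}))"
  unfolding N.E_sum[OF killed_top, of 0 0 0, simplified] by (simp add: beta_mono add.commute)

lemma top_F: "N.F 0 (mono_vec (a, {#}, {#})) =
    pscale ((of_int a + \<rho>) * (of_int a + \<rho> - 1) / 2) (mono_vec (a - 2, {#}, {#}))"
  unfolding N.F_sum[OF killed_top, of 0 0 0, simplified] by (simp add: gamma_mono algebra_simps diff_divide_distrib add_divide_distrib)

lemma top_pos: "j > 0 \<Longrightarrow> mode model X j (mono_vec (a, {#}, {#})) = 0"
  using N.currents_vanish[OF killed_top, of j a] by (cases X) simp_all

lemma H0_mono: "N.H 0 (mono_vec (a, P, Q)) =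
   pscale (of_int (a + int (size P) - int (size Q)) + \<rho> + 1/2) (mono_vec (a, P, Q))"
proof (induction Q)
  case empty
  show ?case
  proof (induction P)
    case empty
    have "N.H 0 (mono_vec (a, {#}, {#})) = pscale (1/2) (N.hterm 0 (mono_vec (a, {#}, {#})) 0)"
      using N.H_sum[OF killed_top, of 0 0 0] by simp
    also have "\<dots> = pscale (of_int a + \<rho> + 1/2) (mono_vec (a, {#}, {#}))"
      by (simp add: N.hterm_def beta_mono gamma_mono single_add[symmetric] field_simps)
    finally show ?case by simp
  next
    case (add x P)
    have e: "mono_vec (a, add_mset x P, {#}) = beta (- int x - 1) (mono_vec (a, P, {#}))"
      by (simp only: beta_mono)
    show ?case unfolding e N.H_b add by (simp add: beta_mono single_add[symmetric] plinear_scale[OF plinear_beta] algebra_simps)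
  qed
next
  case (add x Q)
  have e: "mono_vec (a, P, add_mset x Q) = gamma \<rho> (- int x - 1) (mono_vec (a, P, Q))"
    by (simp only: gamma_mono)
  show ?case unfolding e N.H_g add by (simp add: gamma_mono single_diff[symmetric] plinear_scale[OF plinear_gamma] algebra_simps)
qed

text \<open>
  The operator that \<open>L_0\<close> turns out to be, up to the constant \<open>-1/8\<close>.
\<close>

definition degree :: "bgspace \<Rightarrow> bgspace"
  where "degree = plin (\<lambda>b. Poly_Mapping.single b (of_nat (wt (fst (snd b)) + wt (snd (snd b)))))"

lemma degree_single: "degree (Poly_Mapping.single (a, P, Q) c) = Poly_Mapping.single (a, P, Q) (of_nat (wt P + wt Q) * c)"
  by (simp add: degree_def mult.commute)

lemma plinear_minus_fun: "plinear F \<Longrightarrow> plinear G \<Longrightarrow> plinear (\<lambda>v. F v - G v)"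
  by (simp add: plinear_def pm.scale_right_diff_distrib)

lemma plinear_scale_fun: "plinear G \<Longrightarrow> plinear (\<lambda>v. pscale c (G v))"
  by (simp add: plinear_def pm.scale_right_distrib mult.commute)

lemma plinear_degree: "plinear degree" by (simp add: degree_def)

lemma wt_remove: "x \<in># P \<Longrightarrow> wt P = Suc x + wt (P - {#x#})"
  by (metis insert_DiffM wt_simps(2))

lemma degree_beta: "degree (beta n v) = beta n (degree v) - pscale (of_int n) (beta n v)"
proof (rule plinear_eqI[where F = "\<lambda>v. degree (beta n v)" and G = "\<lambda>v. beta n (degree v) - pscale (of_int n) (beta n v)"])
  fix b :: bgindex
  obtain a P Q where b: "b = (a, P, Q)" by (cases b)
  show "degree (beta n (mono_vec b)) = beta n (degree (mono_vec b)) - pscale (of_int n) (beta n (mono_vec b))"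
  proof (rule int_trichotomy[of n])
    fix x assume n: "n = int x + 1"
    show ?thesis
    proof (cases "x \<in># Q")
      case True
      then show ?thesis unfolding b degree_single n beta_mono wt_remove[OF True]
        by (simp add: degree_single beta_mono single_diff[symmetric] algebra_simps)
    next
      case False
      then have "count Q x = 0" by (simp add: not_in_iff)
      then show ?thesis unfolding b degree_single n beta_mono by (simp del: count_eq_zero_iff)
    qed
  next
    fix x assume n: "n = - int x - 1"
    show ?thesis unfolding b degree_single n beta_mono by (simp add: single_diff[symmetric] algebra_simps)
  next
    assume n: "n = 0"
    show ?thesis unfolding b degree_single n beta_mono by (simp add: algebra_simps)
  qed
qed (rule plinear_compose[OF plinear_degree plinear_beta], rule plinear_minus_fun[OF
    plinear_compose[OF plinear_beta plinear_degree] plinear_scale_fun[OF plinear_beta]])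

lemma degree_gamma: "degree (gamma \<rho> n v) = gamma \<rho> n (degree v) - pscale (of_int n) (gamma \<rho> n v)"
proof (rule plinear_eqI[where F = "\<lambda>v. degree (gamma \<rho> n v)" and G = "\<lambda>v. gamma \<rho> n (degree v) - pscale (of_int n) (gamma \<rho> n v)"])
  fix b :: bgindex
  obtain a P Q where b: "b = (a, P, Q)" by (cases b)
  show "degree (gamma \<rho> n (mono_vec b)) = gamma \<rho> n (degree (mono_vec b)) - pscale (of_int n) (gamma \<rho> n (mono_vec b))"
  proof (rule int_trichotomy[of n])
    fix x assume n: "n = int x + 1"
    show ?thesis
    proof (cases "x \<in># P")
      case True
      then show ?thesis unfolding b degree_single n gamma_mono wt_remove[OF True]
        by (simp add: degree_single gamma_mono single_diff[symmetric] algebra_simps)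
    next
      case False
      then have "count P x = 0" by (simp add: not_in_iff)
      then show ?thesis unfolding b degree_single n gamma_mono by (simp del: count_eq_zero_iff)
    qed
  next
    fix x assume n: "n = - int x - 1"
    show ?thesis unfolding b degree_single n gamma_mono by (simp add: single_diff[symmetric] algebra_simps)
  next
    assume n: "n = 0"
    show ?thesis unfolding b degree_single n gamma_mono by (simp add: algebra_simps)
  qed
qed (rule plinear_compose[OF plinear_degree plinear_gamma], rule plinear_minus_fun[OF
    plinear_compose[OF plinear_gamma plinear_degree] plinear_scale_fun[OF plinear_gamma]])

lemma degree_mode: "degree (mode model X n v) = mode model X n (degree v) - pscale (of_int n) (mode model X n v)"
  by (rule N.grading_currents) (simp_all add: plinear_iff[symmetric] plinear_degree degree_beta degree_gamma)

end

section \<open>Ground states of the beta-gamma modules\<close>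

text \<open>
  On a vector killed by the positive modes, \<open>L_0\<close> is a third of the Casimir operator of the horizontal
  \<open>sl(2)\<close>; the relation for \<open>e_0 f_0\<close> is that of the differential operators \<open>x^2 / 2\<close> and \<open>\<partial>^2 / 2\<close>.
\<close>

lemma (in affine) top_L0:
  assumes k: "k = - 1 / 2" and top: "killed_above M 0 v"
    and h: "hop M 0 v = scl M (t + 1/2) v" and ef: "eop M 0 (fop M 0 v) = scl M (t * (t - 1) / 4) v"
  shows "sugawara_L0 k M v = scl M (- 1 / 8) v"
proof -
  have fe0: "fop M 0 (eop M 0 v) = scl M (t * (t - 1) / 4 + (t + 1/2)) v"
    using fe[of 0 0 v] by (simp add: ef h V.scale_left_distrib)
  have hh0: "hop M 0 (hop M 0 v) = scl M ((t + 1/2) * (t + 1/2)) v"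
    by (simp only: h lin V.scale_scale)
  have "sug_zero M v = scl M ((1/2) * ((t + 1/2) * (t + 1/2)) - t * (t - 1) / 4 - (t * (t - 1) / 4 + (t + 1/2))) v"
    unfolding sug_zero_def fe0 ef hh0 by (simp only: V.scale_scale V.scale_left_diff_distrib)
  also have "(1/2) * ((t + 1/2) * (t + 1/2)) - t * (t - 1) / 4 - (t * (t - 1) / 4 + (t + 1/2)) = - 3 / 8"
    by (simp add: field_simps)
  finally have z: "sug_zero M v = scl M (- 3 / 8) v" .
  have c: "1 / (2 * (k + 2)) = 1 / 3" unfolding k by simp
  have e: "{1..0::int} = {}" by simp
  show ?thesis unfolding sugawara_bounded[OF top] z c e by simp
qed

lemma plinear_lookup:
  assumes "plinear F"
  shows "lookup (F w) t = (\<Sum>b\<in>keys w. lookup w b * lookup (F (Poly_Mapping.single b 1)) t)"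
proof -
  have "F w = (\<Sum>b\<in>keys w. pscale (lookup w b) (F (Poly_Mapping.single b 1)))"
    unfolding plinear_scale[OF assms, symmetric] plinear_sum[OF assms, symmetric]
    using pm_decompose[of w] by simp
  then show ?thesis by (simp add: lookup_sum)
qed

context
  fixes \<rho> :: complex
begin

interpretation N: betagamma pscale beta "gamma \<rho>" by (rule betagamma_model)
interpretation A: affine "- 1 / 2" "model \<rho>" by (rule N.currents_affine)

text \<open>
  Among the monomials of \<open>w\<close> with the most \<open>\<gamma>\<close>-modes, take the largest index \<open>j\<close> that occurs. In
  \<open>e_(j+1) w\<close> the term \<open>\<beta>_0 \<beta>_(j+1)\<close> removes one mode of that index and raises the power of \<open>x\<close>;
  by maximality no other term produces the same monomial.
\<close>

lemma ground_no_gamma: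
  assumes E: "\<And>n. n > 0 \<Longrightarrow> N.E n w = 0" and key: "(a, P, Q) \<in> keys w"
  shows "Q = {#}"
proof (rule ccontr)
  assume Q: "Q \<noteq> {#}"
  define g where "g = Max ((\<lambda>(a, P, Q). size Q) ` keys w)"
  have g_le: "size Q \<le> g" if "(a, P, Q) \<in> keys w" for a P Q
    unfolding g_def using that by (intro Max_ge) force+
  have "g > 0" using g_le[OF key] Q by (metis gr0I le_0_eq size_eq_0_iff_empty)
  have "g \<in> (\<lambda>(a, P, Q). size Q) ` keys w" unfolding g_def using key by (intro Max_in) auto
  then obtain a1 P1 Q1 where b1: "(a1, P1, Q1) \<in> keys w" "size Q1 = g" by auto
  define U where "U = (\<Union>b\<in>{b \<in> keys w. size (snd (snd b)) = g}. set_mset (snd (snd b)))"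
  define j where "j = Max U"
  have finU: "finite U" unfolding U_def by auto
  have "Q1 \<noteq> {#}" using b1 \<open>g > 0\<close> by auto
  then have "U \<noteq> {}" unfolding U_def using b1 by fastforce
  then have "j \<in> U" unfolding j_def using finU by simp
  then obtain b0 where b0: "b0 \<in> keys w" "size (snd (snd b0)) = g" "j \<in># snd (snd b0)" unfolding U_def by blast
  obtain a0 P0 Q0 where b0_eq: "b0 = (a0, P0, Q0)" by (cases b0)
  have le_j: "x \<le> j" if "(a, P, Q) \<in> keys w" "size Q = g" "x \<in># Q" for a P Q x
  proof -
    have "x \<in> U" unfolding U_def using that by force
    then show ?thesis unfolding j_def using finU by simp
  qed
  have Q0: "size Q0 = g" "j \<in># Q0" using b0 by (simp_all add: b0_eq)
  then have szQ0: "size (Q0 - {#j#}) = g - 1" by (simp add: size_Diff_singleton)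
  define n where "n = int j + 1"
  define t where "t = (a0 + 1, P0, Q0 - {#j#})"
  have tm: "lookup (beta i (beta (n - i) (mono_vec b))) t = (if b = b0 \<and> (i = 0 \<or> i = n) then - of_nat (count Q0 j) else 0)"
    if b: "b \<in> keys w" for b i
  proof -
    obtain a P Q where b_eq: "b = (a, P, Q)" by (cases b)
    have kb: "(a, P, Q) \<in> keys w" using b b_eq by simp
    have main: "lookup (Poly_Mapping.single (a + 1, P, Q - {#j#}) (- of_nat (count Q j))) t =
      (if b = b0 then - of_nat (count Q0 j) else (0::complex))"
    proof (cases "j \<in># Q \<and> (a + 1, P, Q - {#j#}) = t")
      case True
      then have "b = b0" unfolding t_def b_eq b0_eq using Q0(2) by (metis add_right_cancel insert_DiffM prod.inject)
      then show ?thesis using True by (simp add: b_eq b0_eq)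
    next
      case False
      then have "b \<noteq> b0" using Q0(2) by (auto simp: b_eq b0_eq t_def)
      moreover have "count Q j = 0 \<or> (a + 1, P, Q - {#j#}) \<noteq> t" using False by (auto simp: count_eq_zero_iff)
      ultimately show ?thesis by (auto simp: lookup_single when_def)
    qed
    have big: "lookup (Poly_Mapping.single (a', P', Q - {#x#}) (- of_nat (count Q x))) t = (0::complex)" if x: "x > j" for x a' P'
    proof (rule ccontr)
      assume "\<not> ?thesis"
      then have "x \<in># Q" "Q - {#x#} = Q0 - {#j#}" by (auto simp: lookup_single when_def t_def split: if_splits)
      then have "size Q = Suc (g - 1)" using szQ0 by (metis insert_DiffM size_add_mset)
      then show False using le_j[OF kb _ \<open>x \<in># Q\<close>] x \<open>g > 0\<close> by simp
    qed
    show ?thesis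
    proof (rule int_trichotomy[of i]; rule int_trichotomy[of "n - i"])
      fix x y assume i: "i = int x + 1" "n - i = int y + 1"
      have "lookup (Poly_Mapping.single (a, P, Q - {#y#} - {#x#}) (of_nat (count (Q - {#y#}) x) * of_nat (count Q y))) t = (0::complex)"
      proof (rule ccontr)
        assume "\<not> ?thesis"
        then have c: "count Q y \<noteq> 0" "count (Q - {#y#}) x \<noteq> 0" "Q - {#y#} - {#x#} = Q0 - {#j#}"
          by (auto simp: lookup_single when_def t_def simp del: diff_diff_add_mset count_diff count_eq_zero_iff split: if_splits)
        then have "y \<in># Q" "x \<in># Q - {#y#}" "Q - {#y#} - {#x#} = Q0 - {#j#}"
          by (metis not_in_iff)+
        then have "size Q = Suc (Suc (g - 1))" using szQ0 by (metis insert_DiffM size_add_mset)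
        then show False using g_le[OF kb] by simp
      qed
      then show ?thesis using i unfolding b_eq i(2) unfolding i(1) beta_mono
        using \<open>i = int x + 1\<close> \<open>n - i = int y + 1\<close> by simp
    next
      assume i: "i = 0"
      fix x assume "n - i = int x + 1"
      then have x: "x = j" by (simp add: i n_def)
      show ?thesis using main unfolding i \<open>n - i = int x + 1\<close>[unfolded i] unfolding b_eq beta_mono x by simp
    next
      fix x assume i: "i = int x + 1" "n - i = 0"
      then have x: "x = j" by (simp add: n_def)
      show ?thesis using main i(2) unfolding i(2) unfolding i(1) b_eq beta_mono x by (auto simp: n_def)
    next
      fix x y assume i: "i = int x + 1" "n - i = - int y - 1"
      have "x > j" "i \<noteq> 0" "i \<noteq> n" using i by (auto simp: n_def)
      then show ?thesis using big[OF \<open>x > j\<close>] unfolding i(2) b_eq unfolding i(1) beta_mono by simp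
    next
      fix x y assume i: "i = - int x - 1" "n - i = int y + 1"
      have "y > j" "i \<noteq> 0" "i \<noteq> n" using i by (auto simp: n_def)
      then show ?thesis using big[OF \<open>y > j\<close>] unfolding i(2) b_eq unfolding i(1) beta_mono by simp
    qed (auto simp: n_def)
  qed
  have "lookup (N.E n (mono_vec b)) t = (if b = b0 then - of_nat (count Q0 j) else 0)" if b: "b \<in> keys w" for b
  proof -
    obtain T where T: "N.killed T (mono_vec b)" using N.killed_exists by blast
    then have T0: "T \<ge> 0" by (simp add: N.killed_def)
    let ?J = "{- T..n + T}"
    have "n \<noteq> 0" by (simp add: n_def)
    then have tml: "lookup (beta i (beta (n - i) (mono_vec b))) t = (if i = 0 then if b = b0 then - of_nat (count Q0 j) else 0 else 0)
        + (if i = n then if b = b0 then - of_nat (count Q0 j) else 0 else 0)" for i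
      by (simp only: tm[OF b]) auto
    have "lookup (N.E n (mono_vec b)) t = 1/2 * (\<Sum>i\<in>?J. lookup (beta i (beta (n - i) (mono_vec b))) t)"
      using N.E_sum[OF T, of "- T" n "n + T"] T0 by (simp add: n_def lookup_sum)
    also have "(\<Sum>i\<in>?J. lookup (beta i (beta (n - i) (mono_vec b))) t) =
      (\<Sum>i\<in>?J. (if i = 0 then if b = b0 then - of_nat (count Q0 j) else 0 else 0) + (if i = n then if b = b0 then - of_nat (count Q0 j) else 0 else 0))"
      by (simp only: tml)
    also have "\<dots> = 2 * (if b = b0 then - of_nat (count Q0 j) else 0)"
      using T0 by (simp add: sum.distrib n_def)
    finally show ?thesis by simp
  qed
  note tops = this
  have l: "plinear (N.E n)" by (simp add: plinear_iff N.linear_EFH)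
  have "lookup (N.E n w) t = (\<Sum>b\<in>keys w. if b = b0 then - lookup w b0 * of_nat (count Q0 j) else 0)"
    by (rule trans[OF plinear_lookup[OF l]], rule sum.cong[OF refl]) (simp add: tops)
  also have "\<dots> = - lookup w b0 * of_nat (count Q0 j)" using b0(1) by simp
  finally have "lookup w b0 * of_nat (count Q0 j) = 0" using E[of n] by (simp add: n_def)
  then show False using b0(1) Q0(2) by (auto simp: in_keys_iff count_eq_zero_iff)
qed

text \<open>
  Once there are no \<open>\<gamma>\<close>-modes, the same argument works with \<open>h_(j+1)\<close>, whose term \<open>\<beta>_0 \<gamma>_(j+1)\<close>
  removes a \<open>\<beta>\<close>-mode of the largest index.
\<close>

lemma ground_no_beta:
  assumes noQ: "\<And>a P Q. (a, P, Q) \<in> keys w \<Longrightarrow> Q = {#}"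
    and H: "\<And>n. n > 0 \<Longrightarrow> N.H n w = 0" and key: "(a, P, Q) \<in> keys w"
  shows "P = {#}"
proof (rule ccontr)
  assume P: "P \<noteq> {#}"
  define U where "U = (\<Union>b\<in>keys w. set_mset (fst (snd b)))"
  define j where "j = Max U"
  have finU: "finite U" unfolding U_def by auto
  have "U \<noteq> {}" unfolding U_def using P key by fastforce
  then have "j \<in> U" unfolding j_def using finU by simp
  then obtain b0 where b0: "b0 \<in> keys w" "j \<in># fst (snd b0)" unfolding U_def by blast
  obtain a0 P0 where b0_eq: "b0 = (a0, P0, {#})" using noQ b0(1) by (cases b0) auto
  have le_j: "x \<le> j" if "(a, P, Q) \<in> keys w" "x \<in># P" for a P Q x
  proof -
    have "x \<in> U" unfolding U_def using that by force
    then show ?thesis unfolding j_def using finU by simp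
  qed
  have P0: "j \<in># P0" using b0 by (simp add: b0_eq)
  define n where "n = int j + 1"
  define t where "t = (a0 + 1, P0 - {#j#}, {#} :: nat multiset)"
  have tm: "lookup (beta i (gamma \<rho> (n - i) (mono_vec b))) t = (if b = b0 \<and> i = 0 then of_nat (count P0 j) else 0)"
    if b: "b \<in> keys w" for b i
  proof -
    obtain a P where b_eq: "b = (a, P, {#})" using noQ b by (cases b) auto
    have kb: "(a, P, {#}) \<in> keys w" using b b_eq by simp
    show ?thesis
    proof (rule int_trichotomy[of i])
      assume i: "i = 0"
      have main: "lookup (Poly_Mapping.single (a + 1, P - {#j#}, {#}) (of_nat (count P j))) t =
        (if b = b0 then of_nat (count P0 j) else (0::complex))"
      proof (cases "j \<in># P \<and> (a + 1, P - {#j#}, {#}) = t")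
        case True
        then have "b = b0" unfolding t_def b_eq b0_eq using P0 by (metis add_right_cancel insert_DiffM prod.inject)
        then show ?thesis using True by (simp add: b_eq b0_eq)
      next
        case False
        then have "b \<noteq> b0" using P0 by (auto simp: b_eq b0_eq t_def)
        moreover have "count P j = 0 \<or> (a + 1, P - {#j#}, {#}) \<noteq> t" using False by (auto simp: count_eq_zero_iff)
        ultimately show ?thesis by (auto simp: lookup_single when_def)
      qed
      have "n - i = int j + 1" by (simp add: i n_def)
      then show ?thesis using main unfolding b_eq by (simp only: gamma_mono i beta_mono) simp
    next
      fix x assume i: "i = - int x - 1"
      define y where "y = j + x + 1"
      have ny: "n - i = int y + 1" by (simp add: i n_def y_def)
      have "y \<notin># P" using le_j[OF kb, of y] by (auto simp: y_def)
      then have "count P y = 0" by (simp add: not_in_iff)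
      then show ?thesis unfolding ny b_eq gamma_mono unfolding i beta_mono by (simp del: count_eq_zero_iff)
    next
      fix x assume i: "i = int x + 1"
      have "beta i (gamma \<rho> (n - i) (mono_vec b)) = 0"
      proof (rule int_trichotomy[of "n - i"])
        fix y assume y: "n - i = - int y - 1"
        have "x \<noteq> y" using i y by (auto simp: n_def)
        then show ?thesis unfolding y b_eq gamma_mono unfolding i beta_mono by simp
      next
        fix y assume y: "n - i = int y + 1"
        show ?thesis unfolding y b_eq gamma_mono unfolding i beta_mono by simp
      next
        assume y: "n - i = 0"
        show ?thesis unfolding y b_eq gamma_mono unfolding i beta_mono by simp
      qed
      then show ?thesis using i by simp
    qed
  qed
  have "lookup (N.H n (mono_vec b)) t = (if b = b0 then of_nat (count P0 j) else 0)" if b: "b \<in> keys w" for b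
  proof -
    obtain T where T: "N.killed T (mono_vec b)" using N.killed_exists by blast
    then have T0: "T \<ge> 0" by (simp add: N.killed_def)
    let ?J = "{- T..T}"
    have ht: "N.hterm n (mono_vec b) i = beta i (gamma \<rho> (n - i) (mono_vec b)) + beta i (gamma \<rho> (n - i) (mono_vec b))" for i
      by (simp add: N.hterm_def n_def gamma_beta)
    have htl: "lookup (N.hterm n (mono_vec b) i) t = (if i = 0 then if b = b0 then 2 * of_nat (count P0 j) else 0 else 0)" for i
      by (simp only: ht lookup_add tm[OF b]) simp
    have "lookup (N.H n (mono_vec b)) t = 1/2 * (\<Sum>i\<in>?J. lookup (N.hterm n (mono_vec b) i) t)"
      using N.H_sum[OF T, of "- T" n "T"] T0 by (simp add: n_def lookup_sum)
    also have "(\<Sum>i\<in>?J. lookup (N.hterm n (mono_vec b) i) t) =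
      (\<Sum>i\<in>?J. (if i = 0 then if b = b0 then 2 * of_nat (count P0 j) else 0 else 0))"
      by (simp only: htl)
    also have "\<dots> = (if b = b0 then 2 * of_nat (count P0 j) else 0)"
      using T0 by simp
    finally show ?thesis by (auto split: if_splits)
  qed
  note tops = this
  have l: "plinear (N.H n)" by (simp add: plinear_iff N.linear_EFH)
  have "lookup (N.H n w) t = (\<Sum>b\<in>keys w. if b = b0 then lookup w b0 * of_nat (count P0 j) else 0)"
    by (rule trans[OF plinear_lookup[OF l]], rule sum.cong[OF refl]) (simp add: tops)
  also have "\<dots> = lookup w b0 * of_nat (count P0 j)" using b0(1) by simp
  finally have "lookup w b0 * of_nat (count P0 j) = 0" using H[of n] by (simp add: n_def)
  then show False using b0(1) P0 by (auto simp: in_keys_iff count_eq_zero_iff)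
qed

lemma top_killed_above: "killed_above (model \<rho>) 0 (mono_vec (a, {#}, {#}))"
  unfolding killed_above_def using N.currents_vanish[OF killed_top] by simp

lemma top_weight: "sugawara_L0 (- 1 / 2) (model \<rho>) (mono_vec (a, {#}, {#})) = pscale (- 1 / 8) (mono_vec (a, {#}, {#}))"
proof -
  have "sugawara_L0 (- 1 / 2) (model \<rho>) (mono_vec (a, {#}, {#})) = scl (model \<rho>) (- 1 / 8) (mono_vec (a, {#}, {#}))"
  proof (rule A.top_L0[OF refl top_killed_above, where t = "of_int a + \<rho>"])
    show "N.H 0 (mono_vec (a, {#}, {#})) = scl (model \<rho>) (of_int a + \<rho> + 1/2) (mono_vec (a, {#}, {#}))"
      by (simp add: H0_mono)
    have "N.E 0 (N.F 0 (mono_vec (a, {#}, {#}))) = pscale ((of_int a + \<rho>) * (of_int a + \<rho> - 1) / 2) (N.E 0 (mono_vec (a - 2, {#}, {#})))"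
      unfolding top_F by (rule N.E_lin)
    then show "N.E 0 (N.F 0 (mono_vec (a, {#}, {#}))) =
       scl (model \<rho>) ((of_int a + \<rho>) * (of_int a + \<rho> - 1) / 4) (mono_vec (a, {#}, {#}))"
      unfolding top_E by simp
  qed
  then show ?thesis by simp
qed

text \<open>
  Vectors killed by the positive modes are polynomials in \<open>x\<close> alone, and there \<open>L_0 = -1/8\<close>.
\<close>

lemma ground_weight:
  assumes "\<And>X j. j > 0 \<Longrightarrow> mode (model \<rho>) X j w = 0"
  shows "sugawara_L0 (- 1 / 2) (model \<rho>) w = pscale (- 1 / 8) w"
proof -
  have E: "N.E n w = 0" if "n > 0" for n using assms[OF that, of cE] by simp
  have H: "N.H n w = 0" if "n > 0" for n using assms[OF that, of cH] by simp
  have tops: "\<exists>a. b = (a, {#}, {#})" if "b \<in> keys w" for b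
  proof -
    obtain a P Q where b: "b = (a, P, Q)" by (cases b)
    have Q: "Q = {#}" if "(a, P, Q) \<in> keys w" for a P Q by (rule ground_no_gamma[OF E that])
    have P: "P = {#}" if "(a, P, Q) \<in> keys w" for a P Q by (rule ground_no_beta[OF Q H that])
    show ?thesis using P[of a P Q] Q[of a P Q] that unfolding b by blast
  qed
  have l: "plinear (\<lambda>w. sugawara_L0 (- 1 / 2) (model \<rho>) w - pscale (- 1 / 8) w)"
    unfolding plinear_def using A.sugawara_add A.sugawara_scale
    by (simp add: algebra_simps)
  have "sugawara_L0 (- 1 / 2) (model \<rho>) w - pscale (- 1 / 8) w = 0"
  proof (rule plinear_zeroI[OF l])
    fix b assume "b \<in> keys w"
    then obtain a where "b = (a, {#}, {#})" using tops by blast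
    then show "sugawara_L0 (- 1 / 2) (model \<rho>) (mono_vec b) - pscale (- 1 / 8) (mono_vec b) = 0"
      using top_weight by simp
  qed
  then show ?thesis by (simp only: right_minus_eq)
qed

end

section \<open>Generation of a sector from its top\<close>

text \<open>
  The power of \<open>x\<close> from which on \<open>generate_high\<close> creates the modes \<open>P\<close>, \<open>Q\<close> out of the top. The
  coefficients are chosen so that each correction term in \<open>generate_high\<close> has a smaller measure
  even after its own power of \<open>x\<close> is taken into account.
\<close>

definition meas :: "nat multiset \<Rightarrow> nat multiset \<Rightarrow> nat"
  where "meas P Q = 2 * sum_mset P + size P + size Q + 2 * wt Q"

lemma meas_add: "meas (add_mset x P) Q = meas P Q + 2 * x + 1" "meas P (add_mset x Q) = meas P Q + 2 * x + 3"
  by (simp_all add: meas_def)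

lemma meas_remove: "x \<in># P \<Longrightarrow> meas P Q = meas (P - {#x#}) Q + 2 * x + 1" "x \<in># Q \<Longrightarrow> meas P Q = meas P (Q - {#x#}) + 2 * x + 3"
  by (metis insert_DiffM meas_add(1)) (metis insert_DiffM meas_add(2))

lemma size_remove: "x \<in># P \<Longrightarrow> size P = Suc (size (P - {#x#}))"
  by (metis insert_DiffM size_add_mset)

context
  fixes \<rho> :: complex
begin

interpretation N: betagamma pscale beta "gamma \<rho>" by (rule betagamma_model)
interpretation A: affine "- 1 / 2" "model \<rho>" by (rule N.currents_affine)

text \<open>
  Creating modes while there are enough powers of \<open>x\<close>: \<open>h_(-m)\<close> contains \<open>\<beta>_0 \<gamma>_(-m)\<close> and \<open>e_(-m)\<close> contains
  \<open>\<beta>_0 \<beta>_(-m)\<close>, which add the wanted mode together with one power of \<open>x\<close>. All other terms have a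
  smaller measure.
\<close>

lemma generate_high:
  assumes W: "sl2_submodule (model \<rho>) W" and tops: "\<And>a. a \<ge> 0 \<Longrightarrow> even (a - i) \<Longrightarrow> mono_vec (a, {#}, {#}) \<in> W"
  shows "int (meas P Q) \<le> a \<Longrightarrow> even (a + int (size P) - int (size Q) - i) \<Longrightarrow> mono_vec (a, P, Q) \<in> W"
proof (induction "meas P Q" arbitrary: a P Q rule: less_induct)
  case less
  have sub: "pm.subspace W" and mE: "\<And>n v. v \<in> W \<Longrightarrow> N.E n v \<in> W" and mH: "\<And>n v. v \<in> W \<Longrightarrow> N.H n v \<in> W"
    using W by (auto simp: sl2_submodule_def)
  have sgl: "Poly_Mapping.single b c \<in> W" if "c = 0 \<or> mono_vec b \<in> W" for b c
    using that pm.subspace_scale[OF sub, of "mono_vec b" c] pm.subspace_0[OF sub] by auto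
  have IH: "mono_vec (a', P', Q') \<in> W" if "meas P' Q' < meas P Q" "int (meas P' Q') \<le> a'"
      "even (a' + int (size P') - int (size Q') - i)" for a' P' Q'
    using less.hyps that by blast
  show ?case
  proof (cases Q)
    case (add q Q')
    define m where "m = int q + 1"
    define v' where "v' = mono_vec (a - 1, P, Q')"
    have mq: "meas P Q = meas P Q' + 2 * q + 3" by (simp add: add meas_add)
    have v': "v' \<in> W" unfolding v'_def
      by (rule IH) (use less.prems mq in \<open>auto simp: add\<close>)
    define T where "T = int (wt P + wt Q')"
    have T: "N.killed T v'" unfolding v'_def T_def by (rule killed_wt)
    define t where "t j = beta j (gamma \<rho> (- m - j) v')" for j
    let ?J = "{min (- m - T) 0..T}"
    have ht: "N.hterm (- m) v' j = t j + t j" for j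
      by (simp add: N.hterm_def t_def m_def gamma_beta)
    have H: "N.H (- m) v' = (\<Sum>j\<in>?J. t j)"
      unfolding N.H_sum[OF T min.cobounded1 min.cobounded2 order_refl] ht sum.distrib by (rule N.half_twice)
    have "0 \<in> ?J" using T by (simp add: N.killed_def)
    then have H2: "N.H (- m) v' = t 0 + (\<Sum>j\<in>?J - {0}. t j)" unfolding H by (simp add: sum.remove)
    have t0: "t 0 = mono_vec (a, P, Q)"
      unfolding t_def v'_def add m_def using gamma_mono(1)[of \<rho> q "a - 1" P Q' 1] by (simp add: beta_mono)
    have "t j \<in> W" if "j \<noteq> 0" for j
    proof (rule int_trichotomy[of j])
      fix x assume j: "j = int x + 1"
      define y where "y = q + 1 + x"
      have e: "- m - j = - int y - 1" by (simp add: j m_def y_def)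
      have ne: "x \<noteq> y" by (simp add: y_def)
      show ?thesis unfolding t_def v'_def e gamma_mono unfolding j beta_mono
      proof (rule sgl, cases "x \<in># Q'")
        case True
        have "mono_vec (a - 1, P, add_mset y (Q' - {#x#})) \<in> W"
          using less.prems mq meas_remove(2)[OF True, of P] size_remove[OF True]
          by (intro IH) (auto simp: meas_add y_def add)
        then show "- of_nat (count (add_mset y Q') x) * 1 = (0::complex) \<or> mono_vec (a - 1, P, add_mset y Q' - {#x#}) \<in> W"
          using ne by (simp add: add_remove_swap)
      next
        case False
        then show "- of_nat (count (add_mset y Q') x) * 1 = (0::complex) \<or> mono_vec (a - 1, P, add_mset y Q' - {#x#}) \<in> W"
          using ne by (simp add: not_in_iff)
      qed
    next
      fix x assume j: "j = - int x - 1"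
      show ?thesis
      proof (rule int_trichotomy[of "- m - j"])
        fix y assume e: "- m - j = - int y - 1"
        have xy: "x + y + 1 = q" using e by (simp add: j m_def)
        have "mono_vec (a - 1, add_mset x P, add_mset y Q') \<in> W"
          using less.prems mq xy by (intro IH) (auto simp: meas_add add)
        then show ?thesis unfolding t_def v'_def e gamma_mono unfolding j beta_mono .
      next
        assume e: "- m - j = 0"
        have xq: "x = q" using e by (simp add: j m_def)
        have "mono_vec (a - 1 - 1, add_mset x P, Q') \<in> W"
          using less.prems mq xq by (intro IH) (auto simp: meas_add add)
        then show ?thesis unfolding t_def v'_def e gamma_mono unfolding j beta_mono by (intro sgl) blast
      next
        fix y assume e: "- m - j = int y + 1"
        have xy: "x = y + q + 1" using e by (simp add: j m_def)
        show ?thesis unfolding t_def v'_def e gamma_mono unfolding j beta_mono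
        proof (rule sgl, cases "y \<in># P")
          case True
          have "mono_vec (a - 1, add_mset x (P - {#y#}), Q') \<in> W"
            using less.prems mq meas_remove(1)[OF True, of Q'] size_remove[OF True]
            by (intro IH) (auto simp: meas_add xy add)
          then show "of_nat (count P y) * 1 = (0::complex) \<or> mono_vec (a - 1, add_mset x (P - {#y#}), Q') \<in> W" ..
        qed (simp add: not_in_iff)
      qed
    qed (use that in simp)
    then have "(\<Sum>j\<in>?J - {0}. t j) \<in> W" by (intro pm.subspace_sum[OF sub]) auto
    then have "N.H (- m) v' - (\<Sum>j\<in>?J - {0}. t j) \<in> W" using mH[OF v'] by (intro pm.subspace_diff[OF sub])
    then show ?thesis unfolding H2 t0 by simp
  next
    case empty
    show ?thesis
    proof (cases P)
      case (add p P')
      define m where "m = int p + 1"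
      define v' where "v' = mono_vec (a - 1, P', {#})"
      have mq: "meas P Q = meas P' {#} + 2 * p + 1" by (simp add: add empty meas_add)
      have v': "v' \<in> W" unfolding v'_def
        by (rule IH) (use less.prems mq in \<open>auto simp: add empty\<close>)
      define T where "T = int (wt P' + wt {#})"
      have T: "N.killed T v'" unfolding v'_def T_def by (rule killed_wt)
      define t where "t j = beta j (beta (- m - j) v')" for j
      define J where "J = {- m - T..T}"
      have T0: "T \<ge> 0" using T by (simp add: N.killed_def)
      have E: "N.E (- m) v' = pscale (1/2) (\<Sum>j\<in>J. t j)"
        unfolding N.E_sum[OF T order_refl order_refl] t_def J_def ..
      have "J = insert 0 (insert (- m) (J - {0, - m}))" unfolding J_def using T0 by (auto simp: m_def)
      then have "(\<Sum>j\<in>J. t j) = (\<Sum>j\<in>insert 0 (insert (- m) (J - {0, - m})). t j)" by simp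
      also have "\<dots> = t 0 + (t (- m) + (\<Sum>j\<in>J - {0, - m}. t j))"
        by (simp add: J_def m_def)
      finally have J: "(\<Sum>j\<in>J. t j) = t 0 + (t (- m) + (\<Sum>j\<in>J - {0, - m}. t j))" .
      have t0: "t 0 = mono_vec (a, P, Q)"
        unfolding t_def v'_def add empty m_def using beta_mono(1)[of p "a - 1" P' "{#}" 1] by (simp add: beta_mono)
      have tm: "t (- m) = mono_vec (a, P, Q)"
        unfolding t_def v'_def add empty m_def using beta_mono(1)[of p a P' "{#}" 1] by (simp add: beta_mono)
      have "t j \<in> W" if "j \<noteq> 0" "j \<noteq> - m" for j
      proof (rule int_trichotomy[of j])
        fix x assume j: "j = int x + 1"
        have "t j = beta (- m - j) (beta j v')" unfolding t_def by (rule beta_beta)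
        also have "beta j v' = 0" unfolding v'_def j beta_mono by simp
        finally show ?thesis using pm.subspace_0[OF sub] by (simp add: plinear_0)
      next
        fix x assume j: "j = - int x - 1"
        show ?thesis
        proof (rule int_trichotomy[of "- m - j"])
          fix y assume e: "- m - j = - int y - 1"
          have xy: "x + y + 1 = p" using e by (simp add: j m_def)
          have "mono_vec (a - 1, add_mset x (add_mset y P'), {#}) \<in> W"
            using less.prems mq xy by (intro IH) (auto simp: meas_add add empty)
          then show ?thesis unfolding t_def v'_def e beta_mono unfolding j beta_mono .
        next
          fix y assume e: "- m - j = int y + 1"
          have "beta (- m - j) v' = 0" unfolding v'_def e beta_mono by simp
          then show ?thesis unfolding t_def using pm.subspace_0[OF sub] by (simp add: plinear_0)
        qed (use that in simp)
      qed (use that in simp)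
      then have "(\<Sum>j\<in>J - {0, - m}. t j) \<in> W" by (intro pm.subspace_sum[OF sub]) auto
      then have "N.E (- m) v' - pscale (1/2) (\<Sum>j\<in>J - {0, - m}. t j) \<in> W"
        using mE[OF v'] by (intro pm.subspace_diff[OF sub] pm.subspace_scale[OF sub])
      moreover have "N.E (- m) v' - pscale (1/2) (\<Sum>j\<in>J - {0, - m}. t j) = mono_vec (a, P, Q)"
        unfolding E J t0 tm by (simp add: pm.scale_right_distrib single_add[symmetric] add.assoc[symmetric])
      ultimately show ?thesis by simp
    next
      case 2: empty
      show ?thesis unfolding empty 2 by (rule tops) (use less.prems in \<open>auto simp: empty 2\<close>)
    qed
  qed
qed

lemma half_odd_nonzero: "odd n \<Longrightarrow> of_int a + of_int n / 2 \<noteq> (0 :: complex)"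
proof
  assume n: "odd n" and z: "of_int a + of_int n / 2 = (0 :: complex)"
  have "of_int (2 * a + n) = 2 * (of_int a + of_int n / 2 :: complex)" by simp
  also have "\<dots> = 0" unfolding z by simp
  finally have "2 * a + n = 0" by (simp only: of_int_eq_0_iff)
  then show False using n by presburger
qed

text \<open>
  From large \<open>a\<close> one descends with \<open>f_0\<close>, which lowers the power of \<open>x\<close> by two with a coefficient
  \<open>(a + \<rho> + 1) (a + \<rho> + 2) / 2\<close> that is nonzero on the sector. Its remaining terms turn a \<open>\<beta>\<close>-mode into a
  \<open>\<gamma>\<close>-mode, so an outer induction on \<open>|P|\<close> disposes of them.
\<close>

lemma generate_all:
  assumes rho: "\<rho> = 0 \<or> \<rho> = - 1 / 2"
    and W: "sl2_submodule (model \<rho>) W" and tops: "\<And>a. a \<ge> 0 \<Longrightarrow> even (a - i) \<Longrightarrow> mono_vec (a, {#}, {#}) \<in> W"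
  shows "(a, P, Q) \<in> sector \<rho> i \<Longrightarrow> mono_vec (a, P, Q) \<in> W"
proof (induction "size P" arbitrary: a P Q rule: less_induct)
  case less
  have sub: "pm.subspace W" and mF: "\<And>n v. v \<in> W \<Longrightarrow> N.F n v \<in> W"
    using W by (auto simp: sl2_submodule_def)
  have sgl: "Poly_Mapping.single b c \<in> W" if "c = 0 \<or> mono_vec b \<in> W" for b c
    using that pm.subspace_scale[OF sub, of "mono_vec b" c] pm.subspace_0[OF sub] by auto
  have "int (meas P Q) \<le> a + 2 * int k \<Longrightarrow> (a, P, Q) \<in> sector \<rho> i \<Longrightarrow> mono_vec (a, P, Q) \<in> W" for k
  proof (induction k arbitrary: a)
    case 0
    then show ?case by (intro generate_high[OF W tops]) (auto simp: sector_def)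
  next
    case (Suc k)
    have v: "mono_vec (a + 2, P, Q) \<in> W" using Suc.prems by (intro Suc.IH) (auto simp: sector_def)
    define v where "v = mono_vec (a + 2, P, Q)"
    obtain T where T: "N.killed T v" using N.killed_exists by blast
    then have T0: "T \<ge> 0" by (simp add: N.killed_def)
    define t where "t j = gamma \<rho> j (gamma \<rho> (0 - j) v)" for j
    have F: "N.F 0 v = pscale (1/2) (\<Sum>j\<in>{0 - T..T}. t j)"
      unfolding N.F_sum[OF T order_refl order_refl] t_def ..
    have "0 \<in> {0 - T..T}" using T0 by simp
    then have S: "(\<Sum>j\<in>{0 - T..T}. t j) = t 0 + (\<Sum>j\<in>{0 - T..T} - {0}. t j)" by (simp add: sum.remove)
    define c where "c = (of_int a + \<rho> + 1) * (of_int a + \<rho> + 2)"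
    have t0: "t 0 = pscale c (mono_vec (a, P, Q))"
      unfolding t_def v_def c_def by (simp add: gamma_mono algebra_simps)
    have c0: "c \<noteq> 0"
      using rho
    proof
      assume r: "\<rho> = 0"
      then have "a \<ge> 0" using Suc.prems by (simp add: sector_def)
      have c: "c = of_int ((a + 1) * (a + 2))" unfolding c_def r by (simp add: algebra_simps)
      have "(a + 1) * (a + 2) \<noteq> 0" using \<open>a \<ge> 0\<close> by simp
      then show ?thesis unfolding c by (simp only: of_int_eq_0_iff not_False_eq_True)
    next
      assume r: "\<rho> = - 1 / 2"
      have e: "of_int a + \<rho> + 1 = of_int a + of_int 1 / 2" "of_int a + \<rho> + 2 = of_int a + of_int 3 / 2" unfolding r by simp_all
      show ?thesis unfolding c_def e using half_odd_nonzero[of 1 a] half_odd_nonzero[of 3 a] by simp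
    qed
    \<comment> \<open>The terms \<open>\<gamma>_(-j) \<gamma>_j\<close> of \<open>f_0\<close> trade a \<open>\<beta>\<close>-mode for a \<open>\<gamma>\<close>-mode.\<close>
    have low: "Poly_Mapping.single (a + 2, P - {#x#}, add_mset x Q) (of_nat (count P x)) \<in> W" for x
    proof (rule sgl, cases "x \<in># P")
      case True
      have "mono_vec (a + 2, P - {#x#}, add_mset x Q) \<in> W"
        using Suc.prems size_remove[OF True] by (intro less.hyps) (auto simp: sector_def)
      then show "of_nat (count P x) = (0::complex) \<or> mono_vec (a + 2, P - {#x#}, add_mset x Q) \<in> W" ..
    qed (simp add: not_in_iff)
    have "t j \<in> W" if "j \<noteq> 0" for j
    proof (rule int_trichotomy[of j])
      fix x assume j: "j = int x + 1"
      have e: "0 - j = - int x - 1" by (simp add: j)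
      show ?thesis using low[of x] unfolding t_def v_def e gamma_mono unfolding j gamma_mono by simp
    next
      fix x assume j: "j = - int x - 1"
      have e: "0 - j = int x + 1" by (simp add: j)
      show ?thesis using low[of x] unfolding t_def v_def e gamma_mono unfolding j gamma_mono by simp
    qed (use that in simp)
    then have "(\<Sum>j\<in>{0 - T..T} - {0}. t j) \<in> W" by (intro pm.subspace_sum[OF sub]) auto
    then have "pscale (2 / c) (N.F 0 v - pscale (1/2) (\<Sum>j\<in>{0 - T..T} - {0}. t j)) \<in> W"
      using mF[OF v, folded v_def] by (intro pm.subspace_diff[OF sub] pm.subspace_scale[OF sub])
    moreover have "pscale (2 / c) (N.F 0 v - pscale (1/2) (\<Sum>j\<in>{0 - T..T} - {0}. t j)) = mono_vec (a, P, Q)"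
      unfolding F S t0 using c0 by (simp add: pm.scale_right_distrib)
    ultimately show ?case by simp
  qed
  \<comment> \<open>After this many steps of size two \<open>generate_high\<close> applies.\<close>
  from this[of "meas P Q + nat (- a)"] less.prems show ?case by simp
qed

lemma sector_space_generated:
  assumes "\<rho> = 0 \<or> \<rho> = - 1 / 2" "sl2_submodule (model \<rho>) W"
    "\<And>a. a \<ge> 0 \<Longrightarrow> even (a - i) \<Longrightarrow> mono_vec (a, {#}, {#}) \<in> W"
  shows "sector_space \<rho> i \<subseteq> W"
proof
  fix v assume v: "v \<in> sector_space \<rho> i"
  have sub: "pm.subspace W" using assms(2) by (simp add: sl2_submodule_def)
  have "v = (\<Sum>b\<in>keys v. pscale (lookup v b) (mono_vec b))" using pm_decompose[of v] by simp
  also have "\<dots> \<in> W"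
  proof (intro pm.subspace_sum[OF sub] pm.subspace_scale[OF sub])
    fix b assume "b \<in> keys v"
    then have b: "b \<in> sector \<rho> i" using v by (auto simp: sector_space_def)
    obtain a P Q where "b = (a, P, Q)" by (cases b)
    then show "mono_vec b \<in> W" using generate_all[OF assms, where a = a and P = P and Q = Q] b by simp
  qed
  finally show "v \<in> W" .
qed

text \<open>
  The vectors on which the two sides agree form a submodule, by \<open>degree_mode\<close> and \<open>sugawara_mode\<close>, and
  it contains the top.
\<close>

lemma L0_model:
  assumes "\<rho> = 0 \<or> \<rho> = - 1 / 2" and v: "v \<in> sector_space \<rho> i"
  shows "sugawara_L0 (- 1 / 2) (model \<rho>) v = degree v - pscale (1 / 8) v"
proof -
  define L where "L = sugawara_L0 (- 1 / 2) (model \<rho>)"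
  define W where "W = {v. L v = degree v - pscale (1 / 8) v}"
  have deg: "degree (x + y) = degree x + degree y" "degree (pscale c x) = pscale c (degree x)" "degree 0 = 0" for x y c
    using plinear_degree by (simp_all add: plinear_def plinear_0[OF plinear_degree])
  have L: "L (pscale c x) = pscale c (L x)" "L (x + y) = L x + L y" "L 0 = 0" for c x y
    unfolding L_def using A.sugawara_scale[of c x] A.sugawara_add[of x y] A.sugawara_0 by (simp_all only: N.scl_currents)
  have sub: "pm.subspace W"
    unfolding pm.subspace_def W_def
    by (simp add: L deg pm.scale_right_distrib pm.scale_right_diff_distrib mult.commute)
  have m: "mode (model \<rho>) X n v \<in> W" if "v \<in> W" for X n v
  proof -
    have lm: "mode (model \<rho>) X n (degree v - pscale (1 / 8) v) = mode (model \<rho>) X n (degree v) - pscale (1 / 8) (mode (model \<rho>) X n v)"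
    proof -
      interpret l: Vector_Spaces.linear "scl (model \<rho>)" "scl (model \<rho>)" "mode (model \<rho>) X n" by (rule A.linear_mode)
      show ?thesis using l.diff[of "degree v" "pscale (1/8) v"] l.scale[of "1/8" v] by simp
    qed
    have Lm: "L (mode (model \<rho>) X n v) = mode (model \<rho>) X n (L v) - pscale (of_int n) (mode (model \<rho>) X n v)"
      unfolding L_def using A.sugawara_mode[of X n v] by simp
    have Lv: "L v = degree v - pscale (1 / 8) v" using that by (simp add: W_def)
    show ?thesis unfolding W_def mem_Collect_eq Lm Lv lm degree_mode[of \<rho> X n v]
      by (simp add: algebra_simps)
  qed
  have "sector_space \<rho> i \<subseteq> W"
  proof (rule sector_space_generated[OF assms(1)])
    show "sl2_submodule (model \<rho>) W" unfolding sl2_submodule_mode using sub m by simp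
    show "mono_vec (a, {#}, {#}) \<in> W" for a
      unfolding W_def mem_Collect_eq L_def top_weight degree_single by (simp add: single_uminus)
  qed
  then show ?thesis using v unfolding W_def L_def by blast
qed

end

section \<open>Irreducible modules with a beta-gamma top\<close>

text \<open>
  The powers of \<open>x\<close> in the sector, which label its ground states.
\<close>

definition top_index :: "complex \<Rightarrow> int \<Rightarrow> int set"
  where "top_index \<rho> i = {a. (\<rho> = 0 \<longrightarrow> a \<ge> 0) \<and> even (a - i)}"

text \<open>
  If the ground states \<open>u a\<close> carry the same action of the horizontal \<open>sl(2)\<close> as the \<open>x^a\<close>, then
  \<open>irreducible_comparison\<close> transports the monomial basis of the sector to \<open>M\<close>.
\<close>

lemma irreducible_eigenbasis:
  fixes M :: "'v::ab_group_add sl2_module"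
  assumes rho: "\<rho> = 0 \<or> \<rho> = - 1 / 2" and i: "i = 0 \<or> i = (1::int)"
    and M: "affine (- 1 / 2) M" and irr: "irreducible_sl2 M"
    and u0: "\<And>a. a \<in> top_index \<rho> i \<Longrightarrow> u a \<noteq> 0"
    and pos: "\<And>a X j. a \<in> top_index \<rho> i \<Longrightarrow> j > 0 \<Longrightarrow> mode M X j (u a) = 0"
    and h: "\<And>a. a \<in> top_index \<rho> i \<Longrightarrow> hop M 0 (u a) = scl M (of_int a + \<rho> + 1/2) (u a)"
    and e: "\<And>a. a \<in> top_index \<rho> i \<Longrightarrow> eop M 0 (u a) = scl M (1/2) (u (a + 2))"
    and f: "\<And>a. a \<in> top_index \<rho> i \<Longrightarrow> fop M 0 (u a) = scl M ((of_int a + \<rho>) * (of_int a + \<rho> - 1) / 2) (u (a - 2))"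
  shows "\<exists>f. inj_on f (sector \<rho> i) \<and> \<not> module.dependent (scl M) (f ` sector \<rho> i) \<and>
    module.span (scl M) (f ` sector \<rho> i) = UNIV \<and>
    (\<forall>(a, P, Q)\<in>sector \<rho> i. hop M 0 (f (a, P, Q)) = scl M (of_int (a + int (size P) - int (size Q)) + \<rho> + 1/2) (f (a, P, Q)) \<and>
      sugawara_L0 (- 1 / 2) M (f (a, P, Q)) = scl M (of_nat (wt P + wt Q) - 1 / 8) (f (a, P, Q)))"
proof -
  interpret M: affine "- 1 / 2" M by (rule M)
  interpret N: betagamma pscale beta "gamma \<rho>" by (rule betagamma_model)
  interpret A: affine "- 1 / 2" "model \<rho>" by (rule N.currents_affine)
  define A where "A = top_index \<rho> i"
  define x where "x a = mono_vec (a, {#} :: nat multiset, {#} :: nat multiset)" for a :: int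
  have low: "(of_int a + \<rho>) * (of_int a + \<rho> - 1) / 2 = 0" if "a \<in> A" "a - 2 \<notin> A" for a
  proof -
    have "\<rho> = 0" "a = 0 \<or> a = 1" using that by (auto simp: A_def top_index_def)
    then show ?thesis by auto
  qed
  have Aup: "a + 2 \<in> A" if "a \<in> A" for a using that by (auto simp: A_def top_index_def)
  have L0M: "sugawara_L0 (- 1 / 2) M (u a) = scl M (- 1 / 8) (u a)" if a: "a \<in> A" for a
  proof (rule M.top_L0[OF refl, where t = "of_int a + \<rho>"])
    show "killed_above M 0 (u a)"
      unfolding killed_above_def using pos[of a _ cE] pos[of a _ cF] pos[of a _ cH] a by (simp add: A_def)
    show "hop M 0 (u a) = scl M (of_int a + \<rho> + 1 / 2) (u a)" using h a by (simp add: A_def)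
    show "eop M 0 (fop M 0 (u a)) = scl M ((of_int a + \<rho>) * (of_int a + \<rho> - 1) / 4) (u a)"
    proof (cases "a - 2 \<in> A")
      case True
      then show ?thesis using f[of a] e[of "a - 2"] a by (simp add: A_def M.lin)
    next
      case False
      have z: "(of_int a + \<rho>) * (of_int a + \<rho> - 1) = 0" using low[OF a False] by (simp only: divide_eq_0_iff) simp
      show ?thesis using f[of a] a unfolding z by (simp add: A_def M.lin)
    qed
  qed
  have "\<exists>W \<phi>. sl2_submodule (model \<rho>) W \<and> x ` A \<subseteq> W \<and> (\<forall>W'. sl2_submodule (model \<rho>) W' \<longrightarrow> x ` A \<subseteq> W' \<longrightarrow> W \<subseteq> W') \<and>
    bij_betw \<phi> W UNIV \<and> (\<forall>v\<in>W. \<forall>w\<in>W. \<phi> (v + w) = \<phi> v + \<phi> w) \<and> (\<forall>c. \<forall>v\<in>W. \<phi> (scl (model \<rho>) c v) = scl M c (\<phi> v)) \<and>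
    (\<forall>v\<in>W. hop M 0 (\<phi> v) = \<phi> (hop (model \<rho>) 0 v)) \<and> (\<forall>v\<in>W. \<forall>c. sugawara_L0 (- 1 / 2) (model \<rho>) v = scl (model \<rho>) c v \<longrightarrow> sugawara_L0 (- 1 / 2) M (\<phi> v) = scl M c (\<phi> v))"
  proof (rule irreducible_comparison[OF _ M N.currents_affine irr, where y = "- 1 / 8" and wg = "\<lambda>a. of_int a + \<rho> + 1/2" and u = u])
    show "(- 1 / 2 + 2 :: complex) \<noteq> 0" by simp
    have "i \<in> A" using i by (auto simp: A_def top_index_def)
    then show "A \<noteq> {}" by blast
    show "u a \<noteq> 0" if "a \<in> A" for a using u0 that by (simp add: A_def)
    show "x a \<noteq> 0" if "a \<in> A" for a unfolding x_def by (metis lookup_single_eq lookup_zero zero_neq_one)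
    show "mode M X j (u a) = 0" if "a \<in> A" "j > 0" for a X j using pos that by (simp add: A_def)
    show "mode (model \<rho>) X j (x a) = 0" if "a \<in> A" "j > 0" for a X j unfolding x_def by (rule top_pos[OF that(2)])
    show "\<exists>b\<in>A. \<exists>c. mode M X 0 (u a) = scl M c (u b) \<and> mode (model \<rho>) X 0 (x a) = scl (model \<rho>) c (x b)" if a: "a \<in> A" for a X
    proof (cases X)
      case cE
      show ?thesis unfolding cE mode.simps
        by (rule bexI[OF _ Aup[OF a]], rule exI[of _ "1/2"]) (use e a in \<open>simp add: A_def x_def top_E\<close>)
    next
      case cH
      show ?thesis unfolding cH mode.simps
        by (rule bexI[OF _ a], rule exI[of _ "of_int a + \<rho> + 1/2"]) (use h a in \<open>simp add: A_def x_def H0_mono\<close>)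
    next
      case cF
      have fa: "fop M 0 (u a) = scl M ((of_int a + \<rho>) * (of_int a + \<rho> - 1) / 2) (u (a - 2))"
        using f a by (simp add: A_def)
      have fx: "N.F 0 (x a) = pscale ((of_int a + \<rho>) * (of_int a + \<rho> - 1) / 2) (x (a - 2))"
        unfolding x_def by (rule top_F)
      show ?thesis
      proof (cases "a - 2 \<in> A")
        case True
        show ?thesis unfolding cF mode.simps fa fx N.scl_currents using True by blast
      next
        case False
        show ?thesis unfolding cF mode.simps fa fx low[OF a False] N.scl_currents
          by (rule bexI[OF _ a], rule exI[of _ 0]) simp
      qed
    qed
    show "sugawara_L0 (- 1 / 2) M (u a) = scl M (- 1 / 8) (u a)" if "a \<in> A" for a by (rule L0M[OF that])
    show "sugawara_L0 (- 1 / 2) (model \<rho>) (x a) = scl (model \<rho>) (- 1 / 8) (x a)" for a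
      unfolding x_def N.scl_currents by (rule top_weight)
    show "hop M 0 (u a) = scl M (of_int a + \<rho> + 1/2) (u a)" if "a \<in> A" for a using h that by (simp add: A_def)
    show "hop (model \<rho>) 0 (x a) = scl (model \<rho>) (of_int a + \<rho> + 1/2) (x a)" for a
      unfolding x_def N.scl_currents H0_mono by simp
    show "inj_on (\<lambda>a. of_int a + \<rho> + 1/2 :: complex) A" by (simp add: inj_on_def)
    show "sugawara_L0 (- 1 / 2) (model \<rho>) n = scl (model \<rho>) (- 1 / 8) n"
      if "\<And>X j. 0 < j \<Longrightarrow> mode (model \<rho>) X j n = 0" for n
      unfolding N.scl_currents by (rule ground_weight[OF that])
  qed
  then obtain W \<phi> where R: "sl2_submodule (model \<rho>) W \<and> x ` A \<subseteq> W \<and> (\<forall>W'. sl2_submodule (model \<rho>) W' \<longrightarrow> x ` A \<subseteq> W' \<longrightarrow> W \<subseteq> W') \<and>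
    bij_betw \<phi> W UNIV \<and> (\<forall>v\<in>W. \<forall>w\<in>W. \<phi> (v + w) = \<phi> v + \<phi> w) \<and> (\<forall>c. \<forall>v\<in>W. \<phi> (scl (model \<rho>) c v) = scl M c (\<phi> v)) \<and>
    (\<forall>v\<in>W. hop M 0 (\<phi> v) = \<phi> (hop (model \<rho>) 0 v)) \<and> (\<forall>v\<in>W. \<forall>c. sugawara_L0 (- 1 / 2) (model \<rho>) v = scl (model \<rho>) c v \<longrightarrow> sugawara_L0 (- 1 / 2) M (\<phi> v) = scl M c (\<phi> v))"
    by (elim exE) (rule that)
  have W: "sl2_submodule (model \<rho>) W" "x ` A \<subseteq> W" using R by blast+
  have W3: "W \<subseteq> W'" if "sl2_submodule (model \<rho>) W'" "x ` A \<subseteq> W'" for W' using R that by blast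
  have bij: "bij_betw \<phi> W UNIV" using R by blast
  have add: "\<phi> (v + w) = \<phi> v + \<phi> w" if "v \<in> W" "w \<in> W" for v w using R that by blast
  have scale: "\<phi> (pscale c v) = scl M c (\<phi> v)" if "v \<in> W" for c v using R that unfolding N.scl_currents by blast
  have hop: "hop M 0 (\<phi> v) = \<phi> (hop (model \<rho>) 0 v)" if "v \<in> W" for v using R that by blast
  have L0: "sugawara_L0 (- 1 / 2) M (\<phi> v) = scl M c (\<phi> v)"
    if "v \<in> W" "sugawara_L0 (- 1 / 2) (model \<rho>) v = pscale c v" for v c using R that unfolding N.scl_currents by blast
  have WS: "W = sector_space \<rho> i"
  proof
    show "sector_space \<rho> i \<subseteq> W"
    proof (rule sector_space_generated[OF rho W(1)])
      fix a :: int assume "a \<ge> 0" "even (a - i)"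
      then have "a \<in> A" by (simp add: A_def top_index_def)
      then show "mono_vec (a, {#}, {#}) \<in> W" using W(2) unfolding x_def by blast
    qed
    show "W \<subseteq> sector_space \<rho> i"
      by (rule W3[OF model_submodule]) (auto simp: x_def A_def top_index_def sector_def intro!: single_sector)
  qed
  have subW: "pm.subspace W" unfolding WS by (rule subspace_sector)
  have monoW: "mono_vec b \<in> W" if "b \<in> sector \<rho> i" for b
    unfolding WS using that by (intro single_sector) blast
  have phi0: "\<phi> 0 = 0" using scale[OF pm.subspace_0[OF subW], of 0] by simp
  have phi_sum: "\<phi> (\<Sum>b\<in>J. g b) = (\<Sum>b\<in>J. \<phi> (g b))" if "\<And>b. b \<in> J \<Longrightarrow> g b \<in> W" for J and g :: "bgindex \<Rightarrow> bgspace"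
    using that
  proof (induction J rule: infinite_finite_induct)
    case (insert b J)
    have "\<phi> (g b + sum g J) = \<phi> (g b) + \<phi> (sum g J)"
      by (rule add) (use insert.prems in \<open>auto intro: pm.subspace_sum[OF subW]\<close>)
    then show ?case using insert by simp
  qed (simp_all add: phi0)
  define F where "F b = \<phi> (mono_vec b)" for b
  have inj: "inj_on F (sector \<rho> i)"
  proof (rule inj_onI)
    fix b c assume bc: "b \<in> sector \<rho> i" "c \<in> sector \<rho> i" "F b = F c"
    have "mono_vec b = mono_vec c"
      by (rule inj_onD[OF bij_betw_imp_inj_on[OF bij] bc(3)[unfolded F_def] monoW[OF bc(1)] monoW[OF bc(2)]])
    then show "b = c" by (metis lookup_single_eq lookup_single_not_eq zero_neq_one)
  qed
  have ind: "\<not> M.V.dependent (F ` sector \<rho> i)"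
  proof (rule M.V.independent_imageI[OF inj])
    fix J c b assume J: "finite J" "J \<subseteq> sector \<rho> i" "(\<Sum>b\<in>J. scl M (c b) (F b)) = 0" "b \<in> J"
    have mW: "pscale (c b) (mono_vec b) \<in> W" if "b \<in> J" for b
      using J(2) that by (intro pm.subspace_scale[OF subW] monoW) blast
    have "\<phi> (\<Sum>b\<in>J. pscale (c b) (mono_vec b)) = (\<Sum>b\<in>J. \<phi> (pscale (c b) (mono_vec b)))"
      by (rule phi_sum[OF mW])
    also have "\<dots> = (\<Sum>b\<in>J. scl M (c b) (F b))"
      unfolding F_def using J(2) by (intro sum.cong refl scale monoW) blast
    also have "\<dots> = \<phi> 0" unfolding J(3) phi0 ..
    finally have "(\<Sum>b\<in>J. pscale (c b) (mono_vec b)) = 0"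
      by (rule inj_onD[OF bij_betw_imp_inj_on[OF bij] _ pm.subspace_sum[OF subW mW] pm.subspace_0[OF subW]])
    then have "lookup (\<Sum>b\<in>J. pscale (c b) (mono_vec b)) b = 0" by simp
    then show "c b = 0" using J(1,4) by (simp add: lookup_sum lookup_single when_def)
  qed
  have span: "M.V.span (F ` sector \<rho> i) = UNIV"
  proof -
    have "m \<in> M.V.span (F ` sector \<rho> i)" for m
    proof -
      obtain v where v: "v \<in> W" "m = \<phi> v" using bij_betw_imp_surj_on[OF bij] by blast
      have ks: "keys v \<subseteq> sector \<rho> i" using v(1) unfolding WS sector_space_def by blast
      have "m = \<phi> (\<Sum>b\<in>keys v. pscale (lookup v b) (mono_vec b))"
        unfolding v(2) using pm_decompose[of v] by simp
      also have "\<dots> = (\<Sum>b\<in>keys v. \<phi> (pscale (lookup v b) (mono_vec b)))"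
        using ks by (intro phi_sum pm.subspace_scale[OF subW] monoW) blast
      also have "\<dots> = (\<Sum>b\<in>keys v. scl M (lookup v b) (F b))"
        unfolding F_def using ks by (intro sum.cong refl scale monoW) blast
      also have "\<dots> \<in> M.V.span (F ` sector \<rho> i)"
        using ks by (intro M.V.span_sum M.V.span_scale M.V.span_base imageI) blast
      finally show ?thesis .
    qed
    then show ?thesis by blast
  qed
  have eig: "hop M 0 (F (a, P, Q)) = scl M (of_int (a + int (size P) - int (size Q)) + \<rho> + 1/2) (F (a, P, Q)) \<and>
      sugawara_L0 (- 1 / 2) M (F (a, P, Q)) = scl M (of_nat (wt P + wt Q) - 1 / 8) (F (a, P, Q))"
    if b: "(a, P, Q) \<in> sector \<rho> i" for a P Q
  proof
    show "hop M 0 (F (a, P, Q)) = scl M (of_int (a + int (size P) - int (size Q)) + \<rho> + 1/2) (F (a, P, Q))"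
      unfolding F_def hop[OF monoW[OF b]] H0_mono by (rule scale[OF monoW[OF b]])
    have "sugawara_L0 (- 1 / 2) (model \<rho>) (mono_vec (a, P, Q)) = pscale (of_nat (wt P + wt Q) - 1 / 8) (mono_vec (a, P, Q))"
      unfolding L0_model[OF rho monoW[OF b, unfolded WS]] degree_single by (simp add: single_diff[symmetric])
    then show "sugawara_L0 (- 1 / 2) M (F (a, P, Q)) = scl M (of_nat (wt P + wt Q) - 1 / 8) (F (a, P, Q))"
      unfolding F_def by (rule L0[OF monoW[OF b]])
  qed
  show ?thesis using inj ind span eig by (intro exI[of _ F]) blast
qed

text \<open>
  The vectors \<open>(2 e_0)^n v\<close> match the \<open>x^(i + 2 n)\<close>; the action of \<open>f_0\<close> follows by induction from
  \<open>f_0 v = 0\<close> and the weight of \<open>v\<close>.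
\<close>

lemma lowest_weight_eigenbasis:
  fixes M :: "'v::ab_group_add sl2_module"
  assumes i: "i = 0 \<or> i = (1::int)"
    and M: "affine (- 1 / 2) M" and irr: "irreducible_sl2 M" and v0: "v \<noteq> 0"
    and ev: "\<And>n. n > 0 \<Longrightarrow> eop M n v = 0" and fv: "\<And>n. n \<ge> 0 \<Longrightarrow> fop M n v = 0"
    and hv: "\<And>n. n > 0 \<Longrightarrow> hop M n v = 0" and h0: "hop M 0 v = scl M (of_int i + 1/2) v"
  shows "\<exists>f. inj_on f (sector 0 i) \<and> \<not> module.dependent (scl M) (f ` sector 0 i) \<and>
    module.span (scl M) (f ` sector 0 i) = UNIV \<and>
    (\<forall>(a, P, Q)\<in>sector 0 i. hop M 0 (f (a, P, Q)) = scl M (of_int (a + int (size P) - int (size Q)) + 0 + 1/2) (f (a, P, Q)) \<and>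
      sugawara_L0 (- 1 / 2) M (f (a, P, Q)) = scl M (of_nat (wt P + wt Q) - 1 / 8) (f (a, P, Q)))"
proof -
  interpret M: affine "- 1 / 2" M by (rule M)
  define up where "up n = ((\<lambda>w. scl M 2 (eop M 0 w)) ^^ n) v" for n :: nat
  have up_Suc: "up (Suc n) = scl M 2 (eop M 0 (up n))" and up_0: "up 0 = v" for n by (simp_all add: up_def)
  have pos: "eop M j (up n) = 0 \<and> fop M j (up n) = 0 \<and> hop M j (up n) = 0" if "j > 0" for j n
    using that
  proof (induction n arbitrary: j)
    case 0
    then show ?case by (simp add: up_0 ev fv hv)
  next
    case (Suc n)
    have "eop M j (eop M 0 (up n)) = eop M 0 (eop M j (up n))" by (rule M.bracket_ee)
    then show ?case using Suc by (simp add: up_Suc M.lin M.he M.fe)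
  qed
  have wgt: "hop M 0 (up n) = scl M (of_int (i + 2 * int n) + 1/2) (up n)" for n
  proof (induction n)
    case (Suc n)
    have "hop M 0 (up (Suc n)) = scl M 2 (scl M (of_int (i + 2 * int n) + 1/2) (eop M 0 (up n)) + scl M 2 (eop M 0 (up n)))"
      unfolding up_Suc M.lin M.he Suc by simp
    also have "\<dots> = scl M (of_int (i + 2 * int n) + 1/2 + 2) (up (Suc n))"
      unfolding up_Suc M.V.scale_left_distrib[symmetric] by (simp only: M.V.scale_scale mult.commute)
    also have "of_int (i + 2 * int n) + 1/2 + 2 = (of_int (i + 2 * int (Suc n)) + 1/2 :: complex)" by simp
    finally show ?case .
  qed (simp add: up_0 h0)
  have f_up: "fop M 0 (up (Suc n)) = scl M (of_int ((i + 2 * int n + 2) * (i + 2 * int n + 1)) / 2) (up n)" for n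
  proof (induction n)
    case 0
    have "fop M 0 (up (Suc 0)) = scl M (2 * (of_int i + 1/2)) v"
      using fv[of 0] h0 by (simp add: up_Suc up_0 M.lin M.fe)
    also have "2 * (of_int i + 1/2) = (of_int ((i + 2 * int 0 + 2) * (i + 2 * int 0 + 1)) / 2 :: complex)"
      using i by auto
    finally show ?case by (simp only: up_0)
  next
    case (Suc n)
    define t :: complex where "t = of_int (i + 2 * int (Suc n))"
    have t: "of_int ((i + 2 * int n + 2) * (i + 2 * int n + 1)) = t * (t - 1)"
      "of_int ((i + 2 * int (Suc n) + 2) * (i + 2 * int (Suc n) + 1)) = (t + 2) * (t + 1)"
      unfolding t_def by (simp_all add: algebra_simps)
    have "fop M 0 (up (Suc (Suc n))) = scl M 2 (eop M 0 (fop M 0 (up (Suc n))) + hop M 0 (up (Suc n)))"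
      by (subst up_Suc) (simp add: M.lin M.fe)
    also have "eop M 0 (fop M 0 (up (Suc n))) = scl M (t * (t - 1) / 4) (up (Suc n))"
      unfolding Suc.IH t(1) by (simp add: M.lin up_Suc)
    also have "hop M 0 (up (Suc n)) = scl M (t + 1/2) (up (Suc n))" unfolding wgt t_def ..
    also have "scl M 2 (scl M (t * (t - 1) / 4) (up (Suc n)) + scl M (t + 1/2) (up (Suc n))) =
       scl M (2 * (t * (t - 1) / 4 + (t + 1/2))) (up (Suc n))"
      by (simp only: M.V.scale_left_distrib[symmetric] M.V.scale_scale)
    also have "2 * (t * (t - 1) / 4 + (t + 1/2)) = (t + 2) * (t + 1) / 2" by (simp add: field_simps)
    finally show ?case unfolding t(2) .
  qed
  have nz: "up n \<noteq> 0" for n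
  proof (induction n)
    case (Suc n)
    have "(i + 2 * int n + 2) * (i + 2 * int n + 1) \<noteq> 0" using i by auto
    then have "(of_int ((i + 2 * int n + 2) * (i + 2 * int n + 1)) / 2 :: complex) \<noteq> 0"
      by (simp only: divide_eq_0_iff of_int_eq_0_iff) simp
    then have "fop M 0 (up (Suc n)) \<noteq> 0" unfolding f_up using Suc by simp
    then show ?case using M.lin(9) by metis
  qed (simp add: up_0 v0)
  define u where "u a = up (nat ((a - i) div 2))" for a
  have a_eq: "a = i + 2 * int (nat ((a - i) div 2))" if "a \<in> top_index 0 i" for a
  proof -
    have "even (a - i)" "a \<ge> 0" using that by (auto simp: top_index_def)
    then have "a - i \<ge> 0" "2 * ((a - i) div 2) = a - i" using i by presburger+
    then show ?thesis by simp
  qed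
  have u_eq: "u (i + 2 * int n) = up n" for n by (simp add: u_def)
  show ?thesis
  proof (rule irreducible_eigenbasis[OF _ i M irr, where u = u and \<rho> = 0])
    show "u a \<noteq> 0" for a by (simp add: u_def nz)
    show "mode M X j (u a) = 0" if "j > 0" for a X j using pos[OF that] by (cases X) (simp_all add: u_def)
    fix a assume a: "a \<in> top_index 0 i"
    define n where "n = nat ((a - i) div 2)"
    have an: "a = i + 2 * int n" using a_eq[OF a] by (simp add: n_def)
    show "hop M 0 (u a) = scl M (of_int a + 0 + 1 / 2) (u a)" unfolding an u_eq wgt by simp
    have up: "u (a + 2) = up (Suc n)" using u_eq[of "Suc n"] by (simp add: an algebra_simps)
    show "eop M 0 (u a) = scl M (1 / 2) (u (a + 2))" unfolding up up_Suc unfolding an u_eq by simp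
    show "fop M 0 (u a) = scl M ((of_int a + 0) * (of_int a + 0 - 1) / 2) (u (a - 2))"
    proof (cases n)
      case 0
      then have "a = 0 \<or> a = 1" "u a = v" using an i u_eq[of 0] by (auto simp: up_0)
      then show ?thesis using fv[of 0] by auto
    next
      case (Suc m)
      have um: "u (a - 2) = up m" using u_eq[of m] by (simp add: an Suc algebra_simps)
      show ?thesis unfolding um unfolding an u_eq Suc f_up by (simp add: algebra_simps)
    qed
  qed simp
qed

section \<open>Exponentials of commuting families\<close>

lemma pow_coeff_plinear:
  assumes "\<And>i. plinear (X i)"
  shows "plinear (pow_coeff X j n)"
proof (induction j arbitrary: n)
  case 0
  then show ?case by (simp add: plinear_def)
next
  case (Suc j)
  have "plinear (\<lambda>v. \<Sum>i = 1..n. X i (pow_coeff X j (n - i) v))"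
    unfolding plinear_def
    by (simp add: plinear_add[OF Suc] plinear_scale[OF Suc] plinear_add[OF assms] plinear_scale[OF assms] sum.distrib pm.scale_sum_right)
  then show ?case by (simp add: plinear_def)
qed

lemma pow_coeff_zero:
  assumes "\<And>i. plinear (X i)"
  shows "n < j \<Longrightarrow> pow_coeff X j n v = 0"
proof (induction j arbitrary: n)
  case (Suc j)
  have "X i (pow_coeff X j (n - i) v) = 0" if "i \<in> {1..n}" for i
  proof -
    have "n - i < j" using Suc.prems that by auto
    then show ?thesis using Suc.IH[of "n - i"] by (simp add: plinear_0[OF assms])
  qed
  then show ?case by simp
qed simp

lemma sum_triangle_swap:
  "(\<Sum>i = 1..n. \<Sum>m = 1..n - i. f i m) = (\<Sum>m = 1..n. \<Sum>i = 1..n - m. f i m)" for f :: "nat \<Rightarrow> nat \<Rightarrow> 'a::comm_monoid_add"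
proof -
  have "(\<Sum>i = 1..n. \<Sum>m = 1..n - i. f i m) = (\<Sum>(i, m)\<in>(SIGMA i:{1..n}. {1..n - i}). f i m)"
    by (simp add: sum.Sigma)
  also have "\<dots> = (\<Sum>(m, i)\<in>(SIGMA m:{1..n}. {1..n - m}). f i m)"
    by (rule sum.reindex_bij_witness[of _ "\<lambda>(m, i). (i, m)" "\<lambda>(i, m). (m, i)"]) auto
  also have "\<dots> = (\<Sum>m = 1..n. \<Sum>i = 1..n - m. f i m)" by (simp add: sum.Sigma)
  finally show ?thesis .
qed

text \<open>
  The derivative of the \<open>(j+1)\<close>-st power of a series, coefficientwise.
\<close>

lemma pow_coeff_derivative:
  assumes X: "\<And>i. plinear (X i)" and comm: "\<And>i j v. i > 0 \<Longrightarrow> j > 0 \<Longrightarrow> X i (X j v) = X j (X i v)"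
  shows "pscale (of_nat n) (pow_coeff X (Suc j) n v) =
    pscale (of_nat (Suc j)) (\<Sum>m = 1..n. pscale (of_nat m) (X m (pow_coeff X j (n - m) v)))"
proof (induction j arbitrary: n)
  case 0
  have "pscale (of_nat n) (X i (pow_coeff X 0 (n - i) v)) = pscale (of_nat i) (X i (pow_coeff X 0 (n - i) v))" if "i \<in> {1..n}" for i
    using that by (cases "i = n") (auto simp: plinear_0[OF X])
  then have "(\<Sum>i = 1..n. pscale (of_nat n) (X i (pow_coeff X 0 (n - i) v))) = (\<Sum>i = 1..n. pscale (of_nat i) (X i (pow_coeff X 0 (n - i) v)))"
    by (intro sum.cong) auto
  then show ?case unfolding pow_coeff.simps(2) pm.scale_sum_right by (simp del: pow_coeff.simps)
next
  case (Suc j)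
  let ?P = "\<lambda>j n. pow_coeff X j n v"
  have "pscale (of_nat n) (?P (Suc (Suc j)) n) = (\<Sum>i = 1..n. pscale (of_nat n) (X i (?P (Suc j) (n - i))))"
    by (subst pow_coeff.simps(2)) (simp only: pm.scale_sum_right)
  also have "\<dots> = (\<Sum>i = 1..n. pscale (of_nat i) (X i (?P (Suc j) (n - i))) + X i (pscale (of_nat (n - i)) (?P (Suc j) (n - i))))"
    by (rule sum.cong[OF refl]) (simp add: plinear_scale[OF X] pm.scale_left_distrib[symmetric] of_nat_diff del: pow_coeff.simps)
  also have "\<dots> = (\<Sum>i = 1..n. pscale (of_nat i) (X i (?P (Suc j) (n - i)))) +
     (\<Sum>i = 1..n. \<Sum>m = 1..n - i. pscale (of_nat (Suc j)) (pscale (of_nat m) (X i (X m (?P j (n - i - m))))))"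
    unfolding sum.distrib Suc.IH
    by (simp only: plinear_scale[OF X] plinear_sum[OF X] pm.scale_sum_right)
  also have "(\<Sum>i = 1..n. \<Sum>m = 1..n - i. pscale (of_nat (Suc j)) (pscale (of_nat m) (X i (X m (?P j (n - i - m)))))) =
     (\<Sum>m = 1..n. \<Sum>i = 1..n - m. pscale (of_nat (Suc j)) (pscale (of_nat m) (X i (X m (?P j (n - i - m))))))"
    by (rule sum_triangle_swap)
  also have "\<dots> = (\<Sum>m = 1..n. pscale (of_nat (Suc j)) (pscale (of_nat m) (X m (?P (Suc j) (n - m)))))"
  proof (rule sum.cong[OF refl])
    fix m assume m: "m \<in> {1..n}"
    have "(\<Sum>i = 1..n - m. pscale (of_nat (Suc j)) (pscale (of_nat m) (X i (X m (?P j (n - i - m)))))) =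
       (\<Sum>i = 1..n - m. pscale (of_nat (Suc j)) (pscale (of_nat m) (X m (X i (?P j (n - m - i))))))"
      using m by (intro sum.cong[OF refl]) (simp add: comm[of m] add.commute del: of_nat_Suc)
    then show "(\<Sum>i = 1..n - m. pscale (of_nat (Suc j)) (pscale (of_nat m) (X i (X m (?P j (n - i - m)))))) =
      pscale (of_nat (Suc j)) (pscale (of_nat m) (X m (?P (Suc j) (n - m))))"
      by (simp only: pow_coeff.simps(2) plinear_sum[OF X] pm.scale_sum_right)
  qed
  also have "(\<Sum>i = 1..n. pscale (of_nat i) (X i (?P (Suc j) (n - i)))) + \<dots> =
     pscale (of_nat (Suc (Suc j))) (\<Sum>m = 1..n. pscale (of_nat m) (X m (?P (Suc j) (n - m))))"
    unfolding pm.scale_sum_right[symmetric] of_nat_Suc[of "Suc j"] pm.scale_left_distrib by simp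
  finally show ?case .
qed

text \<open>
  The differential equation \<open>Y' = X' Y\<close> of \<open>Y = exp X\<close>, coefficientwise.
\<close>

lemma exp_coeff_recursion:
  assumes X: "\<And>i. plinear (X i)" and comm: "\<And>i j v. i > 0 \<Longrightarrow> j > 0 \<Longrightarrow> X i (X j v) = X j (X i v)"
  shows "pscale (of_nat n) (exp_coeff X n v) = (\<Sum>m = 1..n. pscale (of_nat m) (X m (exp_coeff X (n - m) v)))"
proof (cases n)
  case (Suc n')
  let ?P = "\<lambda>j n. pow_coeff X j n v"
  have "pscale (of_nat n) (exp_coeff X n v) = (\<Sum>j\<le>n. pscale (1 / fact j) (pscale (of_nat n) (?P j n)))"
    unfolding exp_coeff_def fock_scale_eq pm.scale_sum_right by (simp add: mult.commute)
  also have "\<dots> = pscale (of_nat n) (?P 0 n) + (\<Sum>j\<le>n'. pscale (1 / fact (Suc j)) (pscale (of_nat n) (?P (Suc j) n)))"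
    unfolding Suc by (subst sum.atMost_Suc_shift) simp
  also have "pscale (of_nat n) (?P 0 n) = 0" by (simp add: Suc)
  also have "0 + (\<Sum>j\<le>n'. pscale (1 / fact (Suc j)) (pscale (of_nat n) (?P (Suc j) n))) =
     (\<Sum>j\<le>n'. \<Sum>m = 1..n. pscale (1 / fact j) (pscale (of_nat m) (X m (?P j (n - m)))))"
  proof (simp only: add_0_left, rule sum.cong[OF refl])
    fix j
    have f: "1 / fact (Suc j) * of_nat (Suc j) = (1 / fact j :: complex)"
      by (simp add: field_simps del: of_nat_Suc)
    show "pscale (1 / fact (Suc j)) (pscale (of_nat n) (?P (Suc j) n)) = (\<Sum>m = 1..n. pscale (1 / fact j) (pscale (of_nat m) (X m (?P j (n - m)))))"
    proof -
      have d: "pscale (of_nat n) (?P (Suc j) n) = pscale (of_nat (Suc j)) (\<Sum>m = 1..n. pscale (of_nat m) (X m (?P j (n - m))))"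
        by (rule pow_coeff_derivative[OF X comm])
      show ?thesis unfolding d unfolding pm.scale_scale[of "1 / fact (Suc j)"] f pm.scale_sum_right ..
    qed
  qed
  also have "\<dots> = (\<Sum>m = 1..n. \<Sum>j\<le>n'. pscale (1 / fact j) (pscale (of_nat m) (X m (?P j (n - m)))))"
    by (rule sum.swap)
  also have "\<dots> = (\<Sum>m = 1..n. pscale (of_nat m) (X m (exp_coeff X (n - m) v)))"
  proof (rule sum.cong[OF refl])
    fix m assume m: "m \<in> {1..n}"
    have "exp_coeff X (n - m) v = (\<Sum>j\<le>n'. pscale (1 / fact j) (?P j (n - m)))"
      unfolding exp_coeff_def fock_scale_eq
      by (rule sum.mono_neutral_left) (use m Suc in \<open>auto simp: pow_coeff_zero[OF X]\<close>)
    then show "(\<Sum>j\<le>n'. pscale (1 / fact j) (pscale (of_nat m) (X m (?P j (n - m))))) = pscale (of_nat m) (X m (exp_coeff X (n - m) v))"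
      by (simp add: plinear_sum[OF X] plinear_scale[OF X] pm.scale_sum_right mult.commute)
  qed
  finally show ?thesis .
qed simp

lemma exp_coeff_plinear: "(\<And>i. plinear (X i)) \<Longrightarrow> plinear (exp_coeff X n)"
  using pow_coeff_plinear[of X] unfolding exp_coeff_def fock_scale_eq plinear_def
  by (simp add: sum.distrib pm.scale_sum_right pm.scale_right_distrib mult.commute)

text \<open>
  The coefficients of \<open>exp (c \<Sum>m\<ge>1. X_m z^m / m)\<close>, characterized by the differential equation. The
  index is an integer, with zero coefficients below \<open>0\<close>, so that shifts need no side conditions.
\<close>

locale exp_family =
  fixes X :: "nat \<Rightarrow> fock \<Rightarrow> fock" and c :: complex and Y :: "int \<Rightarrow> fock \<Rightarrow> fock"
  assumes linX: "\<And>m. plinear (X m)" and linY: "\<And>n. plinear (Y n)"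
    and XX: "\<And>m n v. m > 0 \<Longrightarrow> n > 0 \<Longrightarrow> X m (X n v) = X n (X m v)"
    and Y_neg: "\<And>n v. n < 0 \<Longrightarrow> Y n v = 0" and Y_0: "\<And>v. Y 0 v = v"
    and Y_rec: "\<And>n v. pscale (of_nat n) (Y (int n) v) = pscale c (\<Sum>m = 1..n. X m (Y (int n - int m) v))"
begin

lemma Y_rec': "N \<ge> n \<Longrightarrow> pscale (of_nat n) (Y (int n) v) = pscale c (\<Sum>m = 1..N. X m (Y (int n - int m) v))"
  unfolding Y_rec by (rule arg_cong[where f = "pscale c"], rule sum.mono_neutral_left) (auto simp: Y_neg plinear_0[OF linX])

text \<open>
  What commutes with the exponents commutes with the exponential.
\<close>

lemma commute:
  assumes Z: "plinear Z" "\<And>m v. m > 0 \<Longrightarrow> Z (X m v) = X m (Z v)"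
  shows "Z (Y n v) = Y n (Z v)"
proof (cases "n < 0")
  case True
  then show ?thesis by (simp add: Y_neg plinear_0[OF Z(1)])
next
  case False
  have "Z (Y (int k) v) = Y (int k) (Z v)" for k
  proof (induction k rule: less_induct)
    case (less k)
    show ?case
    proof (cases "k = 0")
      case False
      have "pscale (of_nat k) (Z (Y (int k) v)) = pscale c (\<Sum>m = 1..k. Z (X m (Y (int k - int m) v)))"
        unfolding plinear_scale[OF Z(1), symmetric] Y_rec by (simp add: plinear_scale[OF Z(1)] plinear_sum[OF Z(1)])
      also have "\<dots> = pscale c (\<Sum>m = 1..k. X m (Y (int k - int m) (Z v)))"
      proof -
        have "Z (X m (Y (int k - int m) v)) = X m (Y (int k - int m) (Z v))" if "m \<in> {1..k}" for m
          using less.IH[of "k - m"] that Z(2)[of m] by (simp add: of_nat_diff)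
        then show ?thesis by simp
      qed
      also have "\<dots> = pscale (of_nat k) (Y (int k) (Z v))" by (rule Y_rec[symmetric])
      finally show ?thesis using False by simp
    qed (simp add: Y_0)
  qed
  from this[of "nat n"] show ?thesis using False by simp
qed

lemma Y_X: "m > 0 \<Longrightarrow> Y n (X m v) = X m (Y n v)"
  by (rule commute[OF linX, symmetric]) (rule XX)

end

text \<open>
  \<open>exp (c X) exp (- c X) = 1\<close>: the product satisfies the differential equation with right-hand side zero.
\<close>

lemma exp_family_inverse:
  assumes Y: "exp_family X c Y" and Z: "exp_family X (- c) Z"
  shows "(\<Sum>p\<in>{0..n}. Y (int p) (Z (int n - int p) v)) = (if n = 0 then v else 0)"
proof (cases "n = 0")
  case True
  then show ?thesis by (simp add: exp_family.Y_0[OF Y] exp_family.Y_0[OF Z])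
next
  case False
  interpret Y: exp_family X c Y by (rule Y)
  interpret Z: exp_family X "- c" Z by (rule Z)
  let ?g = "\<lambda>p. Y (int p) (Z (int n - int p) v)"
  have "pscale (of_nat n) (\<Sum>p\<in>{0..n}. ?g p) = (\<Sum>p\<in>{0..n}. pscale (of_nat p) (?g p) + pscale (of_nat (n - p)) (?g p))"
    unfolding pm.scale_sum_right
    by (rule sum.cong[OF refl]) (simp add: pm.scale_left_distrib[symmetric] of_nat_diff)
  also have "\<dots> = (\<Sum>p\<in>{0..n}. \<Sum>m = 1..n. pscale c (X m (Y (int p - int m) (Z (int n - int p) v)))) +
      (\<Sum>p\<in>{0..n}. \<Sum>m = 1..n. pscale (- c) (X m (Y (int p) (Z (int n - int p - int m) v))))"
  proof -
    have "pscale (of_nat p) (?g p) = (\<Sum>m = 1..n. pscale c (X m (Y (int p - int m) (Z (int n - int p) v))))" if "p \<in> {0..n}" for p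
      using Y.Y_rec'[of p n] that by (simp add: pm.scale_sum_right)
    moreover have "pscale (of_nat (n - p)) (?g p) = (\<Sum>m = 1..n. pscale (- c) (X m (Y (int p) (Z (int n - int p - int m) v))))" if "p \<in> {0..n}" for p
    proof -
      have "pscale (of_nat (n - p)) (?g p) = Y (int p) (pscale (of_nat (n - p)) (Z (int (n - p)) v))"
        using that by (simp add: plinear_scale[OF Y.linY] of_nat_diff)
      also have "\<dots> = (\<Sum>m = 1..n. pscale (- c) (Y (int p) (X m (Z (int n - int p - int m) v))))"
        using that by (subst Z.Y_rec'[of _ n]) (simp_all add: plinear_scale[OF Y.linY] plinear_sum[OF Y.linY] plinear_neg[OF Y.linY] pm.scale_sum_right of_nat_diff)
      also have "\<dots> = (\<Sum>m = 1..n. pscale (- c) (X m (Y (int p) (Z (int n - int p - int m) v))))"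
        by (rule sum.cong[OF refl]) (simp add: Y.Y_X)
      finally show ?thesis .
    qed
    ultimately show ?thesis by (simp add: sum.distrib)
  qed
  also have "\<dots> = (\<Sum>m = 1..n. pscale c ((\<Sum>p\<in>{0..n}. X m (Y (int p - int m) (Z (int n - int p) v))) -
      (\<Sum>p\<in>{0..n}. X m (Y (int p) (Z (int n - int p - int m) v)))))"
    by (simp only: sum.swap[of _ "{1..n}"] sum.distrib[symmetric] pm.scale_right_diff_distrib pm.scale_sum_right pm.scale_minus_left)
       (simp add: sum_negf sum_subtractf)
  also have "\<dots> = 0"
  proof (rule sum.neutral, rule ballI)
    fix m assume m: "m \<in> {1..n}"
    have "(\<Sum>p\<in>{0..n}. X m (Y (int p - int m) (Z (int n - int p) v))) =
       (\<Sum>p\<in>{0..n}. X m (Y (int p) (Z (int n - int p - int m) v)))"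
    proof -
      have "(\<Sum>p\<in>{0..n}. X m (Y (int p - int m) (Z (int n - int p) v))) = (\<Sum>p\<in>{m..n}. X m (Y (int p - int m) (Z (int n - int p) v)))"
        by (rule sum.mono_neutral_right) (auto simp: Y.Y_neg plinear_0[OF Y.linX])
      also have "\<dots> = (\<Sum>p\<in>{0..n - m}. X m (Y (int p) (Z (int n - int p - int m) v)))"
        by (rule sum.reindex_bij_witness[of _ "\<lambda>p. p + m" "\<lambda>p. p - m"]) (use m in \<open>auto simp: of_nat_diff algebra_simps\<close>)
      also have "\<dots> = (\<Sum>p\<in>{0..n}. X m (Y (int p) (Z (int n - int p - int m) v)))"
        by (rule sum.mono_neutral_left) (use m in \<open>auto simp: Z.Y_neg plinear_0[OF Y.linX] plinear_0[OF Y.linY]\<close>)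
      finally show ?thesis .
    qed
    then show "pscale c ((\<Sum>p\<in>{0..n}. X m (Y (int p - int m) (Z (int n - int p) v))) -
      (\<Sum>p\<in>{0..n}. X m (Y (int p) (Z (int n - int p - int m) v)))) = 0" by simp
  qed
  finally show ?thesis using False by simp
qed

section \<open>Vertex operators\<close>

definition cre :: "nat \<Rightarrow> fock \<Rightarrow> fock" where "cre m = heis 1 0 (- int m)"
definition ann :: "nat \<Rightarrow> fock \<Rightarrow> fock" where "ann m = heis 1 0 (int m)"

lemma heis_nonzero_weight: "n \<noteq> 0 \<Longrightarrow> heis \<kappa> \<nu> n = heis \<kappa> 0 n"
proof -
  assume "n \<noteq> 0"
  then have "heis_basis \<kappa> \<nu> n = heis_basis \<kappa> 0 n" by (simp add: heis_basis_def fun_eq_iff)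
  then show ?thesis by (simp add: heis_eq_plin)
qed

lemma plinear_cre [simp]: "plinear (cre m)" and plinear_ann [simp]: "plinear (ann m)"
  by (simp_all add: cre_def ann_def)

lemma cre_single: "cre (Suc x) (Poly_Mapping.single P c) = Poly_Mapping.single (add_mset x P) c"
  by (simp add: cre_def heis_eq_plin heis_basis_def nat_add_distrib)

lemma ann_single: "ann (Suc x) (Poly_Mapping.single P c) = Poly_Mapping.single (P - {#x#}) (of_nat (Suc x) * of_nat (count P x) * c)"
  by (simp add: ann_def heis_eq_plin heis_basis_def mult.commute nat_add_distrib)

lemma cre_cre: "m > 0 \<Longrightarrow> n > 0 \<Longrightarrow> cre m (cre n v) = cre n (cre m v)"
proof (rule plinear_eqI[where F = "\<lambda>v. cre m (cre n v)" and G = "\<lambda>v. cre n (cre m v)"])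
  fix P assume "m > 0" "n > 0"
  then obtain x y where "m = Suc x" "n = Suc y" by (metis gr0_implies_Suc)
  then show "cre m (cre n (Poly_Mapping.single P 1)) = cre n (cre m (Poly_Mapping.single P 1))"
    by (simp add: cre_single add_mset_commute)
qed (rule plinear_compose; simp)+

lemma ann_ann: "m > 0 \<Longrightarrow> n > 0 \<Longrightarrow> ann m (ann n v) = ann n (ann m v)"
proof (rule plinear_eqI[where F = "\<lambda>v. ann m (ann n v)" and G = "\<lambda>v. ann n (ann m v)"])
  fix P assume "m > 0" "n > 0"
  then obtain x y where mn: "m = Suc x" "n = Suc y" by (metis gr0_implies_Suc)
  have "of_nat (count P x * count (P - {#x#}) y) = (of_nat (count P y * count (P - {#y#}) x) :: complex)"
    by (simp only: count_remove_sym)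
  then show "ann m (ann n (Poly_Mapping.single P 1)) = ann n (ann m (Poly_Mapping.single P 1))"
    unfolding mn ann_single by (cases "x = y") (simp_all add: add_mset_commute mult_ac)
qed (rule plinear_compose; simp)+

lemma ann_cre: "m > 0 \<Longrightarrow> n > 0 \<Longrightarrow> ann m (cre n v) = cre n (ann m v) + (if m = n then pscale (of_nat m) v else 0)"
proof (rule plinear_eqI[where F = "\<lambda>v. ann m (cre n v)" and G = "\<lambda>v. cre n (ann m v) + (if m = n then pscale (of_nat m) v else 0)"])
  fix P assume "m > 0" "n > 0"
  then obtain x y where mn: "m = Suc x" "n = Suc y" by (metis gr0_implies_Suc)
  have "pscale (of_nat (Suc x)) (Poly_Mapping.single (add_mset y P - {#x#}) (of_nat (count (add_mset y P) x))) =
    pscale (of_nat (Suc x)) (Poly_Mapping.single (add_mset y (P - {#x#})) (of_nat (count P x)) + (if y = x then Poly_Mapping.single P 1 else 0))"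
    using remove_insert_coeff[of "\<lambda>P. P" y P x] by (simp only:)
  then show "ann m (cre n (Poly_Mapping.single P 1)) = cre n (ann m (Poly_Mapping.single P 1)) + (if m = n then pscale (of_nat m) (Poly_Mapping.single P 1) else 0)"
    unfolding mn ann_single cre_single by (auto simp: pm.scale_right_distrib)
next
  show "plinear (\<lambda>v. cre n (ann m v) + (if m = n then pscale (of_nat m) v else 0))"
    by (rule plinear_add_fun, rule plinear_compose[OF plinear_cre plinear_ann])
       (auto simp: plinear_def pm.scale_right_distrib mult.commute)
qed (rule plinear_compose; simp)+

text \<open>
  \<open>Cop\<close> and \<open>Dop\<close> are the creation and annihilation halves of the vertex operator. They are the same
  on all Fock spaces, as only nonzero modes enter.
\<close>

definition Cop :: "complex \<Rightarrow> int \<Rightarrow> fock \<Rightarrow> fock"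
  where "Cop \<alpha> n v = (if n < 0 then 0 else vertex_creation \<alpha> 0 (nat n) v)"
definition Dop :: "complex \<Rightarrow> int \<Rightarrow> fock \<Rightarrow> fock"
  where "Dop \<alpha> n v = (if n < 0 then 0 else vertex_annihilation \<alpha> 0 (nat n) v)"

lemma exp_coeff_cong:
  assumes "\<And>i. i > 0 \<Longrightarrow> X i = X' i"
  shows "exp_coeff X n v = exp_coeff X' n v"
proof -
  have "pow_coeff X j n v = pow_coeff X' j n v" for j n
    by (induction j arbitrary: n) (auto simp: assms intro!: sum.cong)
  then show ?thesis by (simp add: exp_coeff_def)
qed

lemma vertex_creation_eq: "vertex_creation \<alpha> \<nu> n v = Cop \<alpha> (int n) v"
  unfolding Cop_def vertex_creation_def
  by simp (rule exp_coeff_cong, subst heis_nonzero_weight, simp_all)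

lemma vertex_annihilation_eq: "vertex_annihilation \<alpha> \<nu> n v = Dop \<alpha> (int n) v"
  unfolding Dop_def vertex_annihilation_def
  by simp (rule exp_coeff_cong, subst heis_nonzero_weight, simp_all)

lemma exp_family_exp_coeff:
  assumes X: "\<And>m. plinear (X m)" and XX: "\<And>m n v. m > 0 \<Longrightarrow> n > 0 \<Longrightarrow> X m (X n v) = X n (X m v)"
  shows "exp_family X c (\<lambda>n v. if n < 0 then 0 else exp_coeff (\<lambda>i v. pscale (c / of_nat i) (X i v)) (nat n) v)"
proof
  let ?X = "\<lambda>i v. pscale (c / of_nat i) (X i v)"
  have lX: "plinear (?X i)" for i using X[of i] by (simp add: plinear_def pm.scale_right_distrib mult.commute)
  have cX: "?X i (?X j v) = ?X j (?X i v)" if "i > 0" "j > 0" for i j v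
    using XX[OF that] by (simp add: plinear_scale[OF X] mult.commute)
  show "plinear (\<lambda>v. if n < 0 then 0 else exp_coeff ?X (nat n) v)" for n
    using exp_coeff_plinear[of ?X "nat n", OF lX] by (simp add: plinear_def)
  show "(if 0 < (0::int) then 0 else exp_coeff ?X (nat 0) v) = v" for v by (simp add: exp_coeff_def fock_scale_eq)
  show "pscale (of_nat n) (if int n < 0 then 0 else exp_coeff ?X (nat (int n)) v) = pscale c (\<Sum>m = 1..n.
     X m (if int n - int m < 0 then 0 else exp_coeff ?X (nat (int n - int m)) v))" for n v
  proof -
    have "pscale (of_nat n) (exp_coeff ?X n v) = (\<Sum>m = 1..n. pscale (of_nat m) (?X m (exp_coeff ?X (n - m) v)))"
      by (rule exp_coeff_recursion[OF lX cX])
    also have "\<dots> = (\<Sum>m = 1..n. pscale c (X m (if int n - int m < 0 then 0 else exp_coeff ?X (nat (int n - int m)) v)))"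
      by (rule sum.cong) (auto simp: nat_diff_distrib)
    finally show ?thesis by (simp add: pm.scale_sum_right)
  qed
qed (simp_all add: X XX)

lemma Cop_family: "exp_family cre \<alpha> (Cop \<alpha>)"
proof -
  have "Cop \<alpha> = (\<lambda>n v. if n < 0 then 0 else exp_coeff (\<lambda>i v. pscale (\<alpha> / of_nat i) (cre i v)) (nat n) v)"
    by (simp add: fun_eq_iff Cop_def vertex_creation_def cre_def fock_scale_eq)
  then show ?thesis using exp_family_exp_coeff[of cre \<alpha>, OF plinear_cre cre_cre] by simp
qed

lemma Dop_family: "exp_family ann (- \<alpha>) (Dop \<alpha>)"
proof -
  have "Dop \<alpha> = (\<lambda>n v. if n < 0 then 0 else exp_coeff (\<lambda>i v. pscale (- \<alpha> / of_nat i) (ann i v)) (nat n) v)"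
    by (simp add: fun_eq_iff Dop_def vertex_annihilation_def ann_def fock_scale_eq)
  then show ?thesis using exp_family_exp_coeff[of ann "- \<alpha>", OF plinear_ann ann_ann] by simp
qed

interpretation C: exp_family cre \<alpha> "Cop \<alpha>" for \<alpha> by (rule Cop_family)
interpretation D: exp_family ann "- \<alpha>" "Dop \<alpha>" for \<alpha> by (rule Dop_family)

lemma Cop_Cop: "Cop \<alpha> m (Cop \<beta> n v) = Cop \<beta> n (Cop \<alpha> m v)"
  by (rule C.commute[OF C.linY]) (rule C.Y_X)

lemma Dop_Dop: "Dop \<alpha> m (Dop \<beta> n v) = Dop \<beta> n (Dop \<alpha> m v)"
  by (rule D.commute[OF D.linY]) (rule D.Y_X)

text \<open>
  \<open>D(z) a_(-m) = (a_(-m) - \<alpha> z^(-m)) D(z)\<close>, by the differential equation for \<open>D\<close>.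
\<close>

lemma Dop_cre:
  assumes m: "m > 0"
  shows "Dop \<alpha> j (cre m v) = cre m (Dop \<alpha> j v) - pscale \<alpha> (Dop \<alpha> (j - int m) v)"
proof (cases "j < 0")
  case True
  then show ?thesis by (simp add: D.Y_neg plinear_0)
next
  case False
  have "Dop \<alpha> (int k) (cre m v) = cre m (Dop \<alpha> (int k) v) - pscale \<alpha> (Dop \<alpha> (int k - int m) v)" for k
  proof (induction k rule: less_induct)
    case (less k)
    show ?case
    proof (cases "k = 0")
      case True
      then show ?thesis using m by (simp add: D.Y_0 D.Y_neg)
    next
      case False
      let ?d = "\<lambda>t. Dop \<alpha> (int k - int t) v"
      let ?N = "k + m"
      have 1: "ann t (Dop \<alpha> (int k - int t) (cre m v)) = cre m (ann t (?d t)) + (if t = m then pscale (of_nat m) (?d m) else 0)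
          - pscale \<alpha> (ann t (Dop \<alpha> (int k - int m - int t) v))" if t: "t \<in> {1..k}" for t
      proof -
        have "Dop \<alpha> (int k - int t) (cre m v) = cre m (?d t) - pscale \<alpha> (Dop \<alpha> (int k - int m - int t) v)"
          using less.IH[of "k - t"] t by (simp add: of_nat_diff algebra_simps)
        then show ?thesis using t m by (simp add: plinear_diff plinear_scale ann_cre)
      qed
      have "pscale (of_nat k) (Dop \<alpha> (int k) (cre m v)) = pscale (- \<alpha>) (\<Sum>t = 1..k. ann t (Dop \<alpha> (int k - int t) (cre m v)))"
        by (rule D.Y_rec)
      also have "\<dots> = pscale (- \<alpha>) ((\<Sum>t = 1..k. cre m (ann t (?d t))) + (\<Sum>t = 1..k. if t = m then pscale (of_nat m) (?d m) else 0)
          - (\<Sum>t = 1..k. pscale \<alpha> (ann t (Dop \<alpha> (int k - int m - int t) v))))"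
        unfolding sum.distrib[symmetric] sum_subtractf[symmetric] by (rule arg_cong[where f = "pscale (- \<alpha>)"], rule sum.cong[OF refl 1])
      also have "(\<Sum>t = 1..k. cre m (ann t (?d t))) = cre m (\<Sum>t = 1..k. ann t (?d t))"
        by (simp add: plinear_sum)
      also have "(\<Sum>t = 1..k. if t = m then pscale (of_nat m) (?d m) else 0) = pscale (of_nat m) (?d m)"
        using m by (auto simp: D.Y_neg)
      also have "pscale (- \<alpha>) (cre m (\<Sum>t = 1..k. ann t (?d t)) + pscale (of_nat m) (?d m) - (\<Sum>t = 1..k. pscale \<alpha> (ann t (Dop \<alpha> (int k - int m - int t) v))))
         = cre m (pscale (- \<alpha>) (\<Sum>t = 1..k. ann t (?d t))) - pscale (\<alpha> * of_nat m) (?d m) - pscale \<alpha> (pscale (- \<alpha>) (\<Sum>t = 1..k. ann t (Dop \<alpha> (int k - int m - int t) v)))"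
      proof -
        have "pscale (- \<alpha>) (cre m S + pscale (of_nat m) w - pscale \<alpha> S') =
            cre m (pscale (- \<alpha>) S) - pscale (\<alpha> * of_nat m) w - pscale \<alpha> (pscale (- \<alpha>) S')" for S S' w
          by (simp add: pm.scale_right_distrib pm.scale_right_diff_distrib plinear_scale plinear_neg mult.commute)
        then show ?thesis by (simp only: pm.scale_sum_right[symmetric])
      qed
      also have "pscale (- \<alpha>) (\<Sum>t = 1..k. ann t (?d t)) = pscale (of_nat k) (Dop \<alpha> (int k) v)" by (rule D.Y_rec[symmetric])
      also have "pscale (- \<alpha>) (\<Sum>t = 1..k. ann t (Dop \<alpha> (int k - int m - int t) v)) = pscale (of_int (int k - int m)) (?d m)"
      proof (cases "m \<le> k")
        case True
        then have e: "int k - int m = int (k - m)" by simp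
        show ?thesis unfolding e of_int_of_nat_eq by (rule D.Y_rec'[symmetric]) simp
      next
        case False
        then show ?thesis by (simp add: D.Y_neg plinear_0)
      qed
      also have "cre m (pscale (of_nat k) (Dop \<alpha> (int k) v)) - pscale (\<alpha> * of_nat m) (?d m) - pscale \<alpha> (pscale (of_int (int k - int m)) (?d m))
         = pscale (of_nat k) (cre m (Dop \<alpha> (int k) v) - pscale \<alpha> (?d m))"
      proof -
        have comb: "x - pscale a d - pscale \<alpha> (pscale b d) = x - pscale (a + \<alpha> * b) d" for x d :: fock and a b
          by (simp add: pm.scale_left_distrib diff_diff_eq)
        have "\<alpha> * of_nat m + \<alpha> * of_int (int k - int m) = of_nat k * \<alpha>" by (simp add: algebra_simps)
        then show ?thesis unfolding comb by (simp add: plinear_scale pm.scale_right_diff_distrib)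
      qed
      finally show ?thesis using False by simp
    qed
  qed
  from this[of "nat j"] show ?thesis using False by simp
qed

lemma sum_telescope_int: "(\<Sum>m = 1..n. g (int m) - g (int m + 1)) = g 1 - g (int n + 1)" for g :: "int \<Rightarrow> 'a::ab_group_add"
  by (induction n) (simp_all add: algebra_simps)

text \<open>
  \<open>D_\<alpha>(z) C_\<alpha>(w) = (1 - w/z) C_\<alpha>(w) D_\<alpha>(z)\<close> if \<open>\<alpha>^2 = 1\<close>. The proof is by induction along the recursion
  for \<open>C\<close>; the commutators with its modes form a telescoping sum.
\<close>

lemma Dop_Cop_same:
  assumes ab: "\<alpha> * \<alpha> = 1"
  shows "Dop \<alpha> j (Cop \<alpha> i v) = Cop \<alpha> i (Dop \<alpha> j v) - Cop \<alpha> (i - 1) (Dop \<alpha> (j - 1) v)"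
proof (cases "i < 0")
  case True
  then show ?thesis by (simp add: C.Y_neg plinear_0[OF D.linY])
next
  case False
  have "Dop \<alpha> j (Cop \<alpha> (int k) v) = Cop \<alpha> (int k) (Dop \<alpha> j v) - Cop \<alpha> (int k - 1) (Dop \<alpha> (j - 1) v)" for k j
  proof (induction k arbitrary: j rule: less_induct)
    case (less k)
    show ?case
    proof (cases "k = 0")
      case True
      then show ?thesis by (simp add: C.Y_0 C.Y_neg)
    next
      case False
      define g where "g m = Cop \<alpha> (int k - m) (Dop \<alpha> (j - m) v)" for m
      have t: "pscale \<alpha> (Dop \<alpha> j (cre m (Cop \<alpha> (int k - int m) v))) =
         pscale \<alpha> (cre m (Cop \<alpha> (int k - int m) (Dop \<alpha> j v))) - pscale \<alpha> (cre m (Cop \<alpha> (int k - 1 - int m) (Dop \<alpha> (j - 1) v))) - (g (int m) - g (int m + 1))"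
        if m: "m \<in> {1..k}" for m
      proof -
        have IH: "Dop \<alpha> j' (Cop \<alpha> (int k - int m) v) = Cop \<alpha> (int k - int m) (Dop \<alpha> j' v) - Cop \<alpha> (int k - int m - 1) (Dop \<alpha> (j' - 1) v)" for j'
          using less.IH[of "k - m" j'] m by (simp add: of_nat_diff)
        have e: "int k - int m - 1 = int k - 1 - int m" "j - int m - 1 = j - (int m + 1)" "int k - 1 - int m = int k - (int m + 1)" by simp_all
        have "Dop \<alpha> j (cre m (Cop \<alpha> (int k - int m) v)) = cre m (Cop \<alpha> (int k - int m) (Dop \<alpha> j v)) - cre m (Cop \<alpha> (int k - int m - 1) (Dop \<alpha> (j - 1) v))
           - pscale \<alpha> (g (int m) - g (int m + 1))"
          using m by (simp add: Dop_cre IH plinear_diff g_def e)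
        then show ?thesis by (simp add: pm.scale_right_diff_distrib ab e(1))
      qed
      have "pscale (of_nat k) (Dop \<alpha> j (Cop \<alpha> (int k) v)) = (\<Sum>m = 1..k. pscale \<alpha> (Dop \<alpha> j (cre m (Cop \<alpha> (int k - int m) v))))"
        unfolding plinear_scale[OF D.linY, symmetric] C.Y_rec by (simp only: plinear_scale[OF D.linY] plinear_sum[OF D.linY] pm.scale_sum_right)
      also have "\<dots> = (\<Sum>m = 1..k. pscale \<alpha> (cre m (Cop \<alpha> (int k - int m) (Dop \<alpha> j v)))) - (\<Sum>m = 1..k. pscale \<alpha> (cre m (Cop \<alpha> (int k - 1 - int m) (Dop \<alpha> (j - 1) v))))
          - (\<Sum>m = 1..k. g (int m) - g (int m + 1))"
        unfolding sum_subtractf[symmetric] by (rule sum.cong[OF refl t])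
      also have "(\<Sum>m = 1..k. pscale \<alpha> (cre m (Cop \<alpha> (int k - int m) (Dop \<alpha> j v)))) = pscale (of_nat k) (Cop \<alpha> (int k) (Dop \<alpha> j v))"
        unfolding C.Y_rec pm.scale_sum_right ..
      also have "(\<Sum>m = 1..k. pscale \<alpha> (cre m (Cop \<alpha> (int k - 1 - int m) (Dop \<alpha> (j - 1) v)))) = pscale (of_nat (k - 1)) (Cop \<alpha> (int k - 1) (Dop \<alpha> (j - 1) v))"
        using C.Y_rec'[of "k - 1" k \<alpha> "Dop \<alpha> (j - 1) v"] False by (simp add: of_nat_diff pm.scale_sum_right)
      also have "(\<Sum>m = 1..k. g (int m) - g (int m + 1)) = Cop \<alpha> (int k - 1) (Dop \<alpha> (j - 1) v)"
        unfolding sum_telescope_int by (simp add: g_def C.Y_neg)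
      also have "pscale (of_nat k) (Cop \<alpha> (int k) (Dop \<alpha> j v)) - pscale (of_nat (k - 1)) (Cop \<alpha> (int k - 1) (Dop \<alpha> (j - 1) v)) - Cop \<alpha> (int k - 1) (Dop \<alpha> (j - 1) v)
         = pscale (of_nat k) (Cop \<alpha> (int k) (Dop \<alpha> j v) - Cop \<alpha> (int k - 1) (Dop \<alpha> (j - 1) v))"
        using False by (simp add: pm.scale_right_diff_distrib of_nat_diff pm.scale_left_diff_distrib)
      finally show ?thesis using False by simp
    qed
  qed
  from this[where k = "nat i" and j = j] show ?thesis using False by simp
qed

text \<open>
  For opposite charges the factor is \<open>(1 - w/z)^(-1)\<close>; here the denominator is cleared.
\<close>

lemma Dop_Cop_opposite:
  assumes ab: "\<alpha> * \<beta> = - 1"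
  shows "Dop \<alpha> j (Cop \<beta> i v) = Cop \<beta> i (Dop \<alpha> j v) + Dop \<alpha> (j - 1) (Cop \<beta> (i - 1) v)"
proof (cases "i < 0")
  case True
  then show ?thesis by (simp add: C.Y_neg plinear_0[OF D.linY])
next
  case False
  have "Dop \<alpha> j (Cop \<beta> (int k) v) = Cop \<beta> (int k) (Dop \<alpha> j v) + Dop \<alpha> (j - 1) (Cop \<beta> (int k - 1) v)" for k
  proof (induction k rule: less_induct)
    case (less k)
    show ?case
    proof (cases "k = 0")
      case True
      then show ?thesis by (simp add: C.Y_0 C.Y_neg plinear_0[OF D.linY])
    next
      case False
      define g where "g m = Dop \<alpha> (j - m) (Cop \<beta> (int k - m) v)" for m
      have Dc: "pscale \<beta> (Dop \<alpha> i (cre m w)) = pscale \<beta> (cre m (Dop \<alpha> i w)) + Dop \<alpha> (i - int m) w" if "m > 0" for i m w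
        using that ab by (simp add: Dop_cre pm.scale_right_diff_distrib mult.commute)
      have t: "pscale \<beta> (Dop \<alpha> j (cre m (Cop \<beta> (int k - int m) v))) =
         pscale \<beta> (cre m (Cop \<beta> (int k - int m) (Dop \<alpha> j v))) + pscale \<beta> (Dop \<alpha> (j - 1) (cre m (Cop \<beta> (int k - 1 - int m) v))) + (g (int m) - g (int m + 1))"
        if m: "m \<in> {1..k}" for m
      proof -
        have IH: "Dop \<alpha> j (Cop \<beta> (int k - int m) v) = Cop \<beta> (int k - int m) (Dop \<alpha> j v) + Dop \<alpha> (j - 1) (Cop \<beta> (int k - int m - 1) v)"
          using less.IH[of "k - m"] m by (simp add: of_nat_diff)
        have e: "int k - int m - 1 = int k - 1 - int m" "j - 1 - int m = j - (int m + 1)" by simp_all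
        have e3: "int k - 1 - int m = int k - (int m + 1)" by simp
        have m0: "m > 0" using m by simp
        show ?thesis unfolding Dc[OF m0] IH e(1) e(2) g_def
          by (simp add: plinear_add pm.scale_right_distrib e3)
      qed
      have "pscale (of_nat k) (Dop \<alpha> j (Cop \<beta> (int k) v)) = (\<Sum>m = 1..k. pscale \<beta> (Dop \<alpha> j (cre m (Cop \<beta> (int k - int m) v))))"
        unfolding plinear_scale[OF D.linY, symmetric] C.Y_rec by (simp only: plinear_scale[OF D.linY] plinear_sum[OF D.linY] pm.scale_sum_right)
      also have "\<dots> = (\<Sum>m = 1..k. pscale \<beta> (cre m (Cop \<beta> (int k - int m) (Dop \<alpha> j v)))) + (\<Sum>m = 1..k. pscale \<beta> (Dop \<alpha> (j - 1) (cre m (Cop \<beta> (int k - 1 - int m) v))))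
          + (\<Sum>m = 1..k. g (int m) - g (int m + 1))"
        unfolding sum.distrib[symmetric] by (rule sum.cong[OF refl t])
      also have "(\<Sum>m = 1..k. pscale \<beta> (cre m (Cop \<beta> (int k - int m) (Dop \<alpha> j v)))) = pscale (of_nat k) (Cop \<beta> (int k) (Dop \<alpha> j v))"
        unfolding C.Y_rec pm.scale_sum_right ..
      also have "(\<Sum>m = 1..k. pscale \<beta> (Dop \<alpha> (j - 1) (cre m (Cop \<beta> (int k - 1 - int m) v)))) = Dop \<alpha> (j - 1) (pscale \<beta> (\<Sum>m = 1..k. cre m (Cop \<beta> (int k - 1 - int m) v)))"
        by (simp only: plinear_scale[OF D.linY] plinear_sum[OF D.linY] pm.scale_sum_right)
      also have "pscale \<beta> (\<Sum>m = 1..k. cre m (Cop \<beta> (int k - 1 - int m) v)) = pscale (of_nat (k - 1)) (Cop \<beta> (int k - 1) v)"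
        using C.Y_rec'[of "k - 1" k \<beta> v] False by (simp add: of_nat_diff)
      also have "(\<Sum>m = 1..k. g (int m) - g (int m + 1)) = Dop \<alpha> (j - 1) (Cop \<beta> (int k - 1) v)"
        unfolding sum_telescope_int by (simp add: g_def C.Y_neg plinear_0[OF D.linY])
      also have "pscale (of_nat k) (Cop \<beta> (int k) (Dop \<alpha> j v)) + Dop \<alpha> (j - 1) (pscale (of_nat (k - 1)) (Cop \<beta> (int k - 1) v)) + Dop \<alpha> (j - 1) (Cop \<beta> (int k - 1) v)
         = pscale (of_nat k) (Cop \<beta> (int k) (Dop \<alpha> j v) + Dop \<alpha> (j - 1) (Cop \<beta> (int k - 1) v))"
        using False by (simp add: plinear_scale[OF D.linY] plinear_diff[OF D.linY] pm.scale_right_distrib of_nat_diff pm.scale_left_diff_distrib)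
      finally show ?thesis using False by simp
    qed
  qed
  from this[of "nat i"] show ?thesis using False by simp
qed

section \<open>Modes of the screening currents\<close>

text \<open>
  Vectors whose monomials have weights in \<open>A\<close>. Integers rather than naturals, so that lowering the
  weight below zero gives the zero space instead of truncating.
\<close>

definition wset :: "int set \<Rightarrow> fock set" where "wset A = {v. \<forall>P\<in>keys v. int (wt P) \<in> A}"

lemma subspace_wset: "pm.subspace (wset A)"
  unfolding pm.subspace_def
proof (intro conjI ballI allI)
  show "0 \<in> wset A" by (simp add: wset_def)
next
  fix v w assume "v \<in> wset A" "w \<in> wset A"
  then show "v + w \<in> wset A" using Poly_Mapping.keys_add[of v w] unfolding wset_def by blast
next
  fix c v assume v: "v \<in> wset A"
  have "keys (pscale c v) \<subseteq> keys v" by (auto simp: in_keys_iff)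
  then show "pscale c v \<in> wset A" using v unfolding wset_def by blast
qed

lemma single_wset: "c = 0 \<or> int (wt P) \<in> A \<Longrightarrow> Poly_Mapping.single P c \<in> wset A"
  by (auto simp: wset_def)

lemma cre_wset:
  assumes "m > 0" "v \<in> wset A" shows "cre m v \<in> wset {x. x + (- 1) * int m \<in> A}"
proof (rule plinear_subspaceI[OF plinear_cre subspace_wset])
  fix P assume "P \<in> keys v"
  then have "int (wt P) \<in> A" using assms(2) by (simp add: wset_def)
  moreover obtain x where "m = Suc x" using assms(1) by (metis gr0_implies_Suc)
  ultimately show "cre m (Poly_Mapping.single P 1) \<in> wset {x. x + (- 1) * int m \<in> A}"
    by (auto simp: cre_single intro!: single_wset)
qed

lemma ann_wset:
  assumes "m > 0" "v \<in> wset A" shows "ann m v \<in> wset {x. x + 1 * int m \<in> A}"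
proof (rule plinear_subspaceI[OF plinear_ann subspace_wset])
  fix P assume "P \<in> keys v"
  then have P: "int (wt P) \<in> A" using assms(2) by (simp add: wset_def)
  obtain x where m: "m = Suc x" using assms(1) by (metis gr0_implies_Suc)
  show "ann m (Poly_Mapping.single P 1) \<in> wset {x. x + 1 * int m \<in> A}"
    unfolding m ann_single
  proof (rule single_wset, cases "x \<in># P")
    case True
    then show "of_nat (Suc x) * of_nat (count P x) * 1 = (0::complex) \<or> int (wt (P - {#x#})) \<in> {z. z + 1 * int (Suc x) \<in> A}"
      using P wt_remove[OF True] by (simp add: algebra_simps)
  qed (simp add: not_in_iff)
qed

lemma exp_family_wset:
  assumes "exp_family X c Y" and X: "\<And>m A v. m > 0 \<Longrightarrow> v \<in> wset A \<Longrightarrow> X m v \<in> wset {x. x + s * int m \<in> A}"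
    and v: "v \<in> wset A"
  shows "Y n v \<in> wset {x. x + s * n \<in> A}"
proof (cases "n < 0")
  interpret exp_family X c Y by fact
  case True
  then show ?thesis by (simp add: Y_neg pm.subspace_0[OF subspace_wset])
next
  interpret exp_family X c Y by fact
  case False
  have "Y (int k) v \<in> wset {x. x + s * int k \<in> A}" for k
  proof (induction k rule: less_induct)
    case (less k)
    show ?case
    proof (cases "k = 0")
      case True
      then show ?thesis using v by (simp add: Y_0)
    next
      case False
      have "X m (Y (int k - int m) v) \<in> wset {x. x + s * int k \<in> A}" if m: "m \<in> {1..k}" for m
      proof -
        have "Y (int k - int m) v \<in> wset {x. x + s * (int k - int m) \<in> A}"
          using less.IH[of "k - m"] m by (simp add: of_nat_diff)
        then have "X m (Y (int k - int m) v) \<in> wset {x. x + s * int m \<in> {x. x + s * (int k - int m) \<in> A}}"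
          using m by (intro X) auto
        then show ?thesis by (simp add: algebra_simps)
      qed
      then have "pscale (of_nat k) (Y (int k) v) \<in> wset {x. x + s * int k \<in> A}"
        unfolding Y_rec by (intro pm.subspace_scale[OF subspace_wset] pm.subspace_sum[OF subspace_wset])
      then have "pscale (1 / of_nat k) (pscale (of_nat k) (Y (int k) v)) \<in> wset {x. x + s * int k \<in> A}"
        by (rule pm.subspace_scale[OF subspace_wset])
      then show ?thesis using False by simp
    qed
  qed
  from this[of "nat n"] show ?thesis using False by simp
qed

lemma Cop_wset: "v \<in> wset A \<Longrightarrow> Cop \<alpha> n v \<in> wset {x. x - n \<in> A}"
  using exp_family_wset[OF Cop_family cre_wset, of v A \<alpha> n] by simp

lemma Dop_wset: "v \<in> wset A \<Longrightarrow> Dop \<alpha> n v \<in> wset {x. x + n \<in> A}"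
  using exp_family_wset[OF Dop_family ann_wset, of v A \<alpha> n] by simp

lemma wset_mono: "A \<subseteq> B \<Longrightarrow> v \<in> wset A \<Longrightarrow> v \<in> wset B" by (auto simp: wset_def)

lemma wset_neg: "v \<in> wset A \<Longrightarrow> (\<And>x. x \<in> A \<Longrightarrow> x < 0) \<Longrightarrow> v = 0"
  unfolding wset_def by (metis (no_types, lifting) all_not_in_conv keys_eq_empty mem_Collect_eq not_less of_nat_0_le_iff)

lemma Dop_bound: "v \<in> wset {..K} \<Longrightarrow> Dop \<alpha> j v \<in> wset {..K - j}"
  by (rule wset_mono[OF _ Dop_wset]) auto

lemma Dop_vanish: "v \<in> wset {..K} \<Longrightarrow> j > K \<Longrightarrow> Dop \<alpha> j v = 0"
  by (rule wset_neg[OF Dop_bound]) auto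

lemma wset_bound_exists: "\<exists>K\<ge>0. v \<in> wset {..K}"
proof (intro exI conjI)
  have "wt P \<le> (\<Sum>P\<in>keys v. wt P)" if "P \<in> keys v" for P using that by (intro member_le_sum) auto
  then show "v \<in> wset {..int (\<Sum>P\<in>keys v. wt P)}" unfolding wset_def by (auto simp del: of_nat_sum)
qed (simp add: sum_nonneg)

text \<open>
  The mode of \<open>V_\<alpha>(z)\<close> that raises the weight by \<open>m\<close>; the factor \<open>z^(\<alpha>\<nu>)\<close> only determines which
  \<open>m\<close> is the residue.
\<close>

definition Wop :: "complex \<Rightarrow> int \<Rightarrow> fock \<Rightarrow> fock"
  where "Wop \<alpha> m v = (\<Sum>j | Dop \<alpha> j v \<noteq> 0. Cop \<alpha> (j + m) (Dop \<alpha> j v))"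

lemma Wop_sum:
  assumes "v \<in> wset {..K}" "K \<le> L"
  shows "Wop \<alpha> m v = (\<Sum>j\<in>{0..L}. Cop \<alpha> (j + m) (Dop \<alpha> j v))"
  unfolding Wop_def
proof (rule sum.mono_neutral_left)
  show "{j. Dop \<alpha> j v \<noteq> 0} \<subseteq> {0..L}"
  proof
    fix j assume "j \<in> {j. Dop \<alpha> j v \<noteq> 0}"
    then have "\<not> j < 0" "\<not> K < j" using D.Y_neg Dop_vanish[OF assms(1)] by auto
    then show "j \<in> {0..L}" using assms(2) by auto
  qed
qed (auto simp: plinear_0[OF C.linY])

lemma plinear_Wop: "plinear (Wop \<alpha> m)"
  unfolding plinear_def
proof (intro conjI allI)
  fix v w
  obtain K1 K2 where K: "v \<in> wset {..K1}" "w \<in> wset {..K2}" using wset_bound_exists by blast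
  define K where "K = max K1 K2"
  have vw: "v \<in> wset {..K}" "w \<in> wset {..K}" using K by (auto simp: K_def intro: wset_mono[rotated])
  then have "v + w \<in> wset {..K}" by (rule pm.subspace_add[OF subspace_wset])
  note s = vw[THEN Wop_sum[OF _ order_refl]] this[THEN Wop_sum[OF _ order_refl]]
  show "Wop \<alpha> m (v + w) = Wop \<alpha> m v + Wop \<alpha> m w" unfolding s
    by (simp add: plinear_add[OF D.linY] plinear_add[OF C.linY] sum.distrib)
next
  fix c v
  obtain K where v: "v \<in> wset {..K}" using wset_bound_exists by blast
  then have "pscale c v \<in> wset {..K}" by (rule pm.subspace_scale[OF subspace_wset])
  note s = v[THEN Wop_sum[OF _ order_refl]] this[THEN Wop_sum[OF _ order_refl]]
  show "Wop \<alpha> m (pscale c v) = pscale c (Wop \<alpha> m v)" unfolding s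
    by (simp add: plinear_scale[OF D.linY] plinear_scale[OF C.linY] pm.scale_sum_right)
qed

lemma Wop_wset: "v \<in> wset A \<Longrightarrow> Wop \<alpha> m v \<in> wset {x. x - m \<in> A}"
  unfolding Wop_def
proof (rule pm.subspace_sum[OF subspace_wset])
  fix j assume v: "v \<in> wset A"
  have "Cop \<alpha> (j + m) (Dop \<alpha> j v) \<in> wset {x. x - (j + m) \<in> {x. x + j \<in> A}}"
    by (intro Cop_wset Dop_wset v)
  then show "Cop \<alpha> (j + m) (Dop \<alpha> j v) \<in> wset {x. x - m \<in> A}" by (simp add: algebra_simps)
qed

text \<open>
  The modes of \<open>V_\<alpha>\<close> with \<open>\<alpha>^2 = 1\<close> anticommute up to the shift of indices caused by the change of
  Fock space, so composing two adjacent ones gives a symmetric sum minus itself.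
\<close>

lemma Wop_square:
  assumes a: "\<alpha> * \<alpha> = 1"
  shows "Wop \<alpha> (n - 1) (Wop \<alpha> n v) = 0"
proof -
  obtain K where K: "K \<ge> 0" "v \<in> wset {..K}" using wset_bound_exists by blast
  define J where "J = K + \<bar>n\<bar> + 1"
  have y: "Wop \<alpha> n v \<in> wset {..K + \<bar>n\<bar>}" by (rule wset_mono[OF _ Wop_wset[OF K(2)]]) auto
  define h where "h m n j s = Cop \<alpha> (j + m) (Cop \<alpha> (s + n) (Dop \<alpha> j (Dop \<alpha> s v)))" for m n j s
  have Ds: "Dop \<alpha> s v \<in> wset {..K}" if "s \<ge> 0" for s
    by (rule wset_mono[OF _ Dop_bound[OF K(2)]]) (use that in auto)
  have hz: "h m n j s = 0" if "j < 0 \<or> j > K" "s \<ge> 0" for m n j s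
    using that Dop_vanish[OF Ds[OF that(2)]] by (auto simp: h_def D.Y_neg plinear_0[OF C.linY])
  have sym: "(\<Sum>j\<in>{0..K}. \<Sum>s\<in>{0..K}. h (n - 1) n j s) = (\<Sum>j\<in>{0..K}. \<Sum>s\<in>{0..K}. h n (n - 1) j s)"
  proof -
    have "h (n - 1) n j s = h n (n - 1) s j" for j s unfolding h_def by (simp add: Cop_Cop[of _ "j + _"] Dop_Dop[of _ j])
    then show ?thesis by (subst sum.swap) simp
  qed
  have "Wop \<alpha> (n - 1) (Wop \<alpha> n v) = (\<Sum>j\<in>{0..J}. \<Sum>s\<in>{0..K}. Cop \<alpha> (j + (n - 1)) (Dop \<alpha> j (Cop \<alpha> (s + n) (Dop \<alpha> s v))))"
  proof -
    have "K + \<bar>n\<bar> \<le> J" by (simp add: J_def)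
    then have 1: "Wop \<alpha> (n - 1) (Wop \<alpha> n v) = (\<Sum>j\<in>{0..J}. Cop \<alpha> (j + (n - 1)) (Dop \<alpha> j (Wop \<alpha> n v)))"
      by (rule Wop_sum[OF y])
    show ?thesis unfolding 1 unfolding Wop_sum[OF K(2) order_refl]
      by (simp add: plinear_sum[OF D.linY] plinear_sum[OF C.linY])
  qed
  also have "\<dots> = (\<Sum>j\<in>{0..J}. \<Sum>s\<in>{0..K}. h (n - 1) n j s - h n (n - 1) (j - 1) s)"
    by (intro sum.cong refl) (simp add: Dop_Cop_same[OF a] plinear_diff[OF C.linY] h_def algebra_simps)
  also have "\<dots> = (\<Sum>j\<in>{0..J}. \<Sum>s\<in>{0..K}. h (n - 1) n j s) - (\<Sum>j\<in>{0..J}. \<Sum>s\<in>{0..K}. h n (n - 1) (j - 1) s)"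
    by (simp add: sum_subtractf)
  also have "(\<Sum>j\<in>{0..J}. \<Sum>s\<in>{0..K}. h (n - 1) n j s) = (\<Sum>j\<in>{0..K}. \<Sum>s\<in>{0..K}. h (n - 1) n j s)"
    by (rule sum.mono_neutral_right) (auto simp: J_def hz intro!: sum.neutral)
  also have "(\<Sum>j\<in>{0..J}. \<Sum>s\<in>{0..K}. h n (n - 1) (j - 1) s) = (\<Sum>j\<in>{-1..J - 1}. \<Sum>s\<in>{0..K}. h n (n - 1) j s)"
    by (rule sum.reindex_bij_witness[of _ "\<lambda>j. j + 1" "\<lambda>j. j - 1"]) auto
  also have "\<dots> = (\<Sum>j\<in>{0..K}. \<Sum>s\<in>{0..K}. h n (n - 1) j s)"
    by (rule sum.mono_neutral_right) (auto simp: J_def hz intro!: sum.neutral)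
  finally show ?thesis unfolding sym by simp
qed

text \<open>
  The geometric series for \<open>(1 - w/z)^(-1)\<close>, which terminates on each vector.
\<close>

lemma Dop_Cop_expand:
  assumes ab: "\<alpha> * \<beta> = - 1" and N: "j \<le> int N"
  shows "Dop \<alpha> j (Cop \<beta> i w) = (\<Sum>t\<in>{0..int N}. Cop \<beta> (i - t) (Dop \<alpha> (j - t) w))"
proof -
  have "Dop \<alpha> j (Cop \<beta> i w) = (\<Sum>t\<in>{0..int n}. Cop \<beta> (i - t) (Dop \<alpha> (j - t) w)) + Dop \<alpha> (j - int n - 1) (Cop \<beta> (i - int n - 1) w)" for n
  proof (induction n)
    case 0
    then show ?case using Dop_Cop_opposite[OF ab, of j i w] by simp
  next
    case (Suc n)
    have s: "{0..int (Suc n)} = insert (int n + 1) {0..int n}" by auto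
    have e: "j - int (Suc n) - 1 = j - int n - 1 - 1" "i - int (Suc n) - 1 = i - int n - 1 - 1"
      "j - (int n + 1) = j - int n - 1" "i - (int n + 1) = i - int n - 1" by simp_all
    have "(\<Sum>t\<in>{0..int (Suc n)}. Cop \<beta> (i - t) (Dop \<alpha> (j - t) w)) =
      Cop \<beta> (i - int n - 1) (Dop \<alpha> (j - int n - 1) w) + (\<Sum>t\<in>{0..int n}. Cop \<beta> (i - t) (Dop \<alpha> (j - t) w))"
      unfolding s by (subst sum.insert) (simp_all only: e finite_atLeastAtMost_int atLeastAtMost_iff, simp)
    then show ?case unfolding Suc.IH e Dop_Cop_opposite[OF ab, of "j - int n - 1" "i - int n - 1" w]
      by (simp only: ac_simps)
  qed
  from this[of N] show ?thesis using N by (simp add: D.Y_neg)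
qed

text \<open>
  Normal ordering of a product of modes of opposite charges; \<open>t\<close> is the index of the geometric series.
\<close>

lemma Wop_product:
  assumes ab: "\<alpha> * \<beta> = - 1" and K: "K \<ge> 0" "v \<in> wset {..K}" and L: "L \<ge> K + \<bar>n\<bar>"
  shows "Wop \<alpha> m (Wop \<beta> n v) = (\<Sum>s\<in>{0..K}. \<Sum>r\<in>{0..K}. \<Sum>t\<in>{0..L}.
    Cop \<alpha> (r + t + m) (Cop \<beta> (s + n - t) (Dop \<alpha> r (Dop \<beta> s v))))"
proof -
  have y: "Wop \<beta> n v \<in> wset {..L}" by (rule wset_mono[OF _ Wop_wset[OF K(2)]]) (use L in auto)
  have LK: "L \<le> K + L" using K by simp
  define f where "f s j t = Cop \<alpha> (j + m) (Cop \<beta> (s + n - t) (Dop \<alpha> (j - t) (Dop \<beta> s v)))" for s j t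
  have Ds: "Dop \<beta> s v \<in> wset {..K}" if "s \<ge> 0" for s
    by (rule wset_mono[OF _ Dop_bound[OF K(2)]]) (use that in auto)
  have fz: "f s j t = 0" if "j - t < 0 \<or> j - t > K \<or> t > L" "s \<in> {0..K}" for s j t
  proof -
    have "Dop \<alpha> (j - t) (Dop \<beta> s v) = 0 \<or> s + n - t < 0"
      using that Dop_vanish[OF Ds, of s] L by (auto simp: D.Y_neg)
    then show ?thesis by (auto simp: f_def C.Y_neg plinear_0[OF C.linY])
  qed
  have "Wop \<alpha> m (Wop \<beta> n v) = (\<Sum>j\<in>{0..K + L}. \<Sum>s\<in>{0..K}. Cop \<alpha> (j + m) (Dop \<alpha> j (Cop \<beta> (s + n) (Dop \<beta> s v))))"
    unfolding Wop_sum[OF y LK] unfolding Wop_sum[OF K(2) order_refl]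
    by (simp add: plinear_sum[OF D.linY] plinear_sum[OF C.linY])
  also have "\<dots> = (\<Sum>j\<in>{0..K + L}. \<Sum>s\<in>{0..K}. \<Sum>t\<in>{0..K + L}. f s j t)"
  proof (intro sum.cong refl)
    fix j s assume "j \<in> {0..K + L}"
    then have "j \<le> int (nat (K + L))" "int (nat (K + L)) = K + L" using K L by auto
    then show "Cop \<alpha> (j + m) (Dop \<alpha> j (Cop \<beta> (s + n) (Dop \<beta> s v))) = (\<Sum>t\<in>{0..K + L}. f s j t)"
      using Dop_Cop_expand[OF ab, of j "nat (K + L)" "s + n" "Dop \<beta> s v"]
      by (simp add: f_def plinear_sum[OF C.linY])
  qed
  also have "\<dots> = (\<Sum>s\<in>{0..K}. \<Sum>j\<in>{0..K + L}. \<Sum>t\<in>{0..K + L}. f s j t)" by (rule sum.swap)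
  also have "\<dots> = (\<Sum>s\<in>{0..K}. \<Sum>r\<in>{0..K}. \<Sum>t\<in>{0..L}. f s (r + t) t)"
  proof (rule sum.cong[OF refl])
    fix s assume s: "s \<in> {0..K}"
    define S where "S = {(j, t). t \<in> {0..L} \<and> j - t \<in> {0..K}}"
    have "(\<Sum>j\<in>{0..K + L}. \<Sum>t\<in>{0..K + L}. f s j t) = (\<Sum>(j, t)\<in>{0..K + L} \<times> {0..K + L}. f s j t)"
      by (simp add: sum.cartesian_product)
    also have "\<dots> = (\<Sum>(j, t)\<in>S. f s j t)"
      by (rule sum.mono_neutral_right) (use K L s in \<open>auto simp: S_def intro!: fz\<close>)
    also have "\<dots> = (\<Sum>(r, t)\<in>{0..K} \<times> {0..L}. f s (r + t) t)"
      by (rule sum.reindex_bij_witness[of _ "\<lambda>(r, t). (r + t, t)" "\<lambda>(j, t). (j - t, t)"]) (auto simp: S_def)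
    finally show "(\<Sum>j\<in>{0..K + L}. \<Sum>t\<in>{0..K + L}. f s j t) = (\<Sum>r\<in>{0..K}. \<Sum>t\<in>{0..L}. f s (r + t) t)"
      by (simp add: sum.cartesian_product)
  qed
  finally show ?thesis by (simp add: f_def)
qed

lemma exp_family_inverse_int:
  assumes Y: "exp_family X c Y" and Z: "exp_family X (- c) Z" and ab: "a \<le> 0" "M \<le> b"
  shows "(\<Sum>p\<in>{a..b}. Y p (Z (M - p) v)) = (if M = 0 then v else 0)"
proof (cases "M < 0")
  case True
  have "Y p (Z (M - p) v) = 0" for p
    using True exp_family.Y_neg[OF Y, of p] exp_family.Y_neg[OF Z, of "M - p"] plinear_0[OF exp_family.linY[OF Y]]
    by (cases "p < 0") auto
  then show ?thesis using True by simp
next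
  case False
  have "(\<Sum>p\<in>{a..b}. Y p (Z (M - p) v)) = (\<Sum>p\<in>{0..M}. Y p (Z (M - p) v))"
    by (rule sum.mono_neutral_right)
       (use ab exp_family.Y_neg[OF Y] exp_family.Y_neg[OF Z] plinear_0[OF exp_family.linY[OF Y]] in auto)
  also have "\<dots> = (\<Sum>p\<in>{0..nat M}. Y (int p) (Z (int (nat M) - int p) v))"
    by (rule sum.reindex_bij_witness[of _ int nat]) (use False in auto)
  also have "\<dots> = (if M = 0 then v else 0)" unfolding exp_family_inverse[OF Y Z] using False by auto
  finally show ?thesis .
qed

text \<open>
  In the normally ordered form the two products are the parts \<open>t \<ge> 0\<close> and \<open>t < 0\<close> of one sum over all
  integers. The full sum over \<open>t\<close> contains \<open>C_\<alpha>(w) C_(-\<alpha>)(w) = 1\<close>, and the remaining sum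
  \<open>D_\<alpha>(z) D_(-\<alpha>)(z) = 1\<close>.
\<close>

lemma Wop_anticommutator:
  assumes a: "\<alpha> * \<alpha> = 1" and b: "\<beta> = - \<alpha>"
  shows "Wop \<alpha> m (Wop \<beta> n v) + Wop \<beta> (n + 1) (Wop \<alpha> (m - 1) v) = (if m + n = 0 then v else 0)"
proof -
  have ab: "\<alpha> * \<beta> = - 1" "\<beta> * \<alpha> = - 1" using a b by auto
  obtain K where K: "K \<ge> 0" "v \<in> wset {..K}" using wset_bound_exists by blast
  \<comment> \<open>A common cutoff for the two products, large enough that the ranges \<open>t \<ge> 0\<close> and \<open>t < 0\<close> cover all nonzero terms.\<close>
  define L where "L = K + \<bar>n\<bar> + \<bar>m\<bar> + 1"
  have L: "L \<ge> K + \<bar>n\<bar>" "L \<ge> K + \<bar>m - 1\<bar>" by (auto simp: L_def)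
  define w where "w r s = Dop \<alpha> r (Dop \<beta> s v)" for r s
  define h where "h r s t = Cop \<alpha> (r + m + t) (Cop \<beta> (s + n - t) (w r s))" for r s t
  have 1: "Wop \<alpha> m (Wop \<beta> n v) = (\<Sum>s\<in>{0..K}. \<Sum>r\<in>{0..K}. \<Sum>t\<in>{0..L}. h r s t)"
    unfolding Wop_product[OF ab(1) K L(1)] h_def w_def by (simp add: algebra_simps)
  have "Wop \<beta> (n + 1) (Wop \<alpha> (m - 1) v) = (\<Sum>s\<in>{0..K}. \<Sum>r\<in>{0..K}. \<Sum>t\<in>{0..L}. h s r (- 1 - t))"
    unfolding Wop_product[OF ab(2) K L(2)] h_def w_def
    by (intro sum.cong refl) (simp add: Cop_Cop[of \<beta> _ \<alpha>] Dop_Dop[of \<beta> _ \<alpha>] algebra_simps)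
  also have "\<dots> = (\<Sum>s\<in>{0..K}. \<Sum>r\<in>{0..K}. \<Sum>t\<in>{0..L}. h r s (- 1 - t))" by (rule sum.swap)
  finally have 2: "Wop \<beta> (n + 1) (Wop \<alpha> (m - 1) v) = (\<Sum>s\<in>{0..K}. \<Sum>r\<in>{0..K}. \<Sum>t\<in>{0..L}. h r s (- 1 - t))" .
  have 3: "(\<Sum>t\<in>{0..L}. h r s t) + (\<Sum>t\<in>{0..L}. h r s (- 1 - t)) = (if r + s + (m + n) = 0 then w r s else 0)"
    if rs: "r \<in> {0..K}" "s \<in> {0..K}" for r s
  proof -
    have "(\<Sum>t\<in>{0..L}. h r s (- 1 - t)) = (\<Sum>t\<in>{- L - 1..- 1}. h r s t)"
      by (rule sum.reindex_bij_witness[of _ "\<lambda>t. - 1 - t" "\<lambda>t. - 1 - t"]) auto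
    then have "(\<Sum>t\<in>{0..L}. h r s t) + (\<Sum>t\<in>{0..L}. h r s (- 1 - t)) = (\<Sum>t\<in>{- L - 1..- 1} \<union> {0..L}. h r s t)"
      by (subst sum.union_disjoint) auto
    also have "{- L - 1..- 1} \<union> {0..L} = {- L - 1..L}" using K by (auto simp: L_def)
    also have "(\<Sum>t\<in>{- L - 1..L}. h r s t) = (\<Sum>p\<in>{r + m - L - 1..r + m + L}. Cop \<alpha> p (Cop \<beta> (r + s + (m + n) - p) (w r s)))"
      by (rule sum.reindex_bij_witness[of _ "\<lambda>p. p - (r + m)" "\<lambda>t. r + m + t"]) (auto simp: h_def algebra_simps)
    also have "\<dots> = (if r + s + (m + n) = 0 then w r s else 0)"
      using Cop_family[of \<beta>] rs K unfolding b by (intro exp_family_inverse_int[OF Cop_family]) (auto simp: L_def)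
    finally show ?thesis .
  qed
  have "Wop \<alpha> m (Wop \<beta> n v) + Wop \<beta> (n + 1) (Wop \<alpha> (m - 1) v) =
     (\<Sum>s\<in>{0..K}. \<Sum>r\<in>{0..K}. if r + s + (m + n) = 0 then w r s else 0)"
    unfolding 1 2 sum.distrib[symmetric] by (intro sum.cong refl 3[unfolded sum.distrib[symmetric]])
  also have "\<dots> = (\<Sum>r\<in>{0..K}. \<Sum>s\<in>{0..K}. if r + s + (m + n) = 0 then w r s else 0)" by (rule sum.swap)
  also have "\<dots> = (\<Sum>r\<in>{0..K}. Dop \<alpha> r (Dop \<beta> (- (m + n) - r) v))"
  proof (rule sum.cong[OF refl])
    fix r assume r: "r \<in> {0..K}"
    have "(\<Sum>s\<in>{0..K}. if r + s + (m + n) = 0 then w r s else 0) = (\<Sum>s\<in>{0..K}. if s = - (m + n) - r then w r s else 0)"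
      by (rule sum.cong) auto
    also have "\<dots> = w r (- (m + n) - r)"
    proof (cases "- (m + n) - r \<in> {0..K}")
      case False
      then have "Dop \<beta> (- (m + n) - r) v = 0" using D.Y_neg Dop_vanish[OF K(2)] by auto
      then show ?thesis using False by (auto simp: w_def plinear_0[OF D.linY])
    qed simp
    finally show "(\<Sum>s\<in>{0..K}. if r + s + (m + n) = 0 then w r s else 0) = Dop \<alpha> r (Dop \<beta> (- (m + n) - r) v)"
      by (simp add: w_def)
  qed
  also have "\<dots> = (\<Sum>r\<in>{0..max K (- (m + n))}. Dop \<alpha> r (Dop \<beta> (- (m + n) - r) v))"
  proof (rule sum.mono_neutral_left)
    show "\<forall>r\<in>{0..max K (- (m + n))} - {0..K}. Dop \<alpha> r (Dop \<beta> (- (m + n) - r) v) = 0"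
      unfolding Dop_Dop[of \<alpha>] by (auto simp: Dop_vanish[OF K(2)] plinear_0[OF D.linY])
  qed auto
  also have "\<dots> = (if - (m + n) = 0 then v else 0)"
    using Dop_family[of \<beta>] unfolding b by (intro exp_family_inverse_int[OF Dop_family]) auto
  finally show ?thesis by (simp add: add_eq_0_iff)
qed

text \<open>
  On the Fock space of weight \<open>\<nu>\<close> the residue of \<open>V_(-1)\<close> is the mode of degree \<open>\<nu> - 1\<close>.
\<close>

lemma vertex_residue_Wop: "vertex_residue (- 1) (of_int \<nu>) v = Wop (- 1) (\<nu> - 1) v"
proof -
  obtain K where K: "K \<ge> 0" "v \<in> wset {..K}" using wset_bound_exists by blast
  have cond: "(- 1 * of_int \<nu> + of_nat i - of_nat j = (- 1 :: complex)) = (int i = int j + (\<nu> - 1))" for i j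
  proof -
    have "(- 1 * of_int \<nu> + of_nat i - of_nat j = (- 1 :: complex)) = (of_int (int i) = (of_int (int j + (\<nu> - 1)) :: complex))"
      by (auto simp: algebra_simps)
    then show ?thesis by (simp only: of_int_eq_iff)
  qed
  let ?S = "{(i, j). int i = int j + (\<nu> - 1) \<and> Dop (- 1) (int j) v \<noteq> 0}"
  have "vertex_residue (- 1) (of_int \<nu>) v = (\<Sum>(i, j)\<in>?S. Cop (- 1) (int i) (Dop (- 1) (int j) v))"
    unfolding vertex_residue_def cond vertex_creation_eq vertex_annihilation_eq ..
  also have "\<dots> = (\<Sum>j\<in>{j. Dop (- 1) j v \<noteq> 0 \<and> j + (\<nu> - 1) \<ge> 0}. Cop (- 1) (j + (\<nu> - 1)) (Dop (- 1) j v))"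
    by (rule sum.reindex_bij_witness[of _ "\<lambda>j. (nat (j + (\<nu> - 1)), nat j)" "\<lambda>(i, j). int j"])
       (auto simp: D.Y_neg not_less[symmetric] intro: ccontr)
  also have "\<dots> = Wop (- 1) (\<nu> - 1) v"
    unfolding Wop_def
  proof (rule sum.mono_neutral_left)
    have "{j. Dop (- 1) j v \<noteq> 0} \<subseteq> {0..K}" using D.Y_neg Dop_vanish[OF K(2)] by (auto simp: not_less[symmetric])
    then show "finite {j. Dop (- 1) j v \<noteq> 0}" by (rule finite_subset) simp
  next
    have "Cop (- 1) (i + (\<nu> - 1)) w = 0" if "\<not> i + (\<nu> - 1) \<ge> 0" for i w
      using that by (intro C.Y_neg) simp
    then show "\<forall>i\<in>{j. Dop (- 1) j v \<noteq> 0} - {j. Dop (- 1) j v \<noteq> 0 \<and> j + (\<nu> - 1) \<ge> 0}. Cop (- 1) (i + (\<nu> - 1)) (Dop (- 1) i v) = 0"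
      by blast
  qed auto
  finally show ?thesis .
qed

section \<open>The kernel of the screening charge\<close>

definition part :: "nat \<Rightarrow> nat" where "part n = card {P. wt P = n}"

definition part_int :: "int \<Rightarrow> nat" where "part_int d = (if d < 0 then 0 else part (nat d))"

text \<open>
  The weight \<open>d\<close> part of the kernel of the screening charge on the Fock space of weight \<open>\<nu>\<close>.
\<close>

definition ker :: "int \<Rightarrow> int \<Rightarrow> fock set" where "ker \<nu> d = {v \<in> wset {d}. Wop (- 1) (\<nu> - 1) v = 0}"

lemma subspace_ker: "pm.subspace (ker \<nu> d)"
  using subspace_wset[of "{d}"] plinear_Wop[of "- 1" "\<nu> - 1"]
  unfolding pm.subspace_def ker_def by (simp add: plinear_0[OF plinear_Wop] plinear_def)

definition mono_fock :: "nat multiset \<Rightarrow> fock" where "mono_fock P = Poly_Mapping.single P 1"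

lemma inj_mono_fock: "inj_on mono_fock S"
proof (rule inj_onI)
  fix P Q assume "mono_fock P = mono_fock Q"
  then have "lookup (mono_fock P) P = lookup (mono_fock Q) P" by simp
  then show "P = Q" unfolding mono_fock_def by (simp add: lookup_single when_def split: if_splits)
qed

lemma independent_mono_fock: "pm.independent (mono_fock ` S)"
proof (rule pm.independent_imageI[OF inj_mono_fock])
  fix J c P assume J: "finite J" "(\<Sum>i\<in>J. pscale (c i) (mono_fock i)) = 0" "P \<in> J"
  have "lookup (\<Sum>i\<in>J. pscale (c i) (mono_fock i)) P = c P"
    using J(1,3) by (simp add: lookup_sum mono_fock_def lookup_single when_def)
  then show "c P = 0" by (simp add: J(2))
qed

lemma wset_span: "wset {d} = pm.span (mono_fock ` {P. int (wt P) = d})"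
proof
  show "wset {d} \<subseteq> pm.span (mono_fock ` {P. int (wt P) = d})"
  proof
    fix v assume v: "v \<in> wset {d}"
    have "v = (\<Sum>P\<in>keys v. pscale (lookup v P) (mono_fock P))"
      using pm_decompose[of v] by (simp add: mono_fock_def)
    also have "\<dots> \<in> pm.span (mono_fock ` {P. int (wt P) = d})"
      using v by (intro pm.span_sum pm.span_scale pm.span_base imageI) (simp add: wset_def)
    finally show "v \<in> pm.span (mono_fock ` {P. int (wt P) = d})" .
  qed
  show "pm.span (mono_fock ` {P. int (wt P) = d}) \<subseteq> wset {d}"
    by (rule pm.span_minimal[OF _ subspace_wset]) (auto simp: mono_fock_def intro!: single_wset)
qed

lemma finite_wt_int: "finite {P. int (wt P) = d}"
proof -
  have "{P. int (wt P) = d} \<subseteq> {P. wt P = nat d}" by auto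
  then show ?thesis by (rule finite_subset) simp
qed

lemma card_wt_int: "card {P. int (wt P) = d} = part_int d"
proof (cases "d < 0")
  case True
  then have "{P. int (wt P) = d} = {}" by auto
  then show ?thesis using True by (simp add: part_int_def)
next
  case False
  then have "{P. int (wt P) = d} = {P. wt P = nat d}" by auto
  then show ?thesis using False by (simp add: part_int_def part_def)
qed

definition ker_basis :: "int \<Rightarrow> int \<Rightarrow> fock set"
  where "ker_basis \<nu> d = (SOME B. B \<subseteq> ker \<nu> d \<and> pm.independent B \<and> ker \<nu> d \<subseteq> pm.span B)"

lemma ker_basis: "ker_basis \<nu> d \<subseteq> ker \<nu> d" "pm.independent (ker_basis \<nu> d)" "ker \<nu> d = pm.span (ker_basis \<nu> d)"
  "finite (ker_basis \<nu> d)"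
proof -
  obtain B where "B \<subseteq> ker \<nu> d" "pm.independent B" "ker \<nu> d \<subseteq> pm.span B"
    by (rule pm.maximal_independent_subset[of "ker \<nu> d"])
  then have "\<exists>B. B \<subseteq> ker \<nu> d \<and> pm.independent B \<and> ker \<nu> d \<subseteq> pm.span B" by blast
  then have b: "ker_basis \<nu> d \<subseteq> ker \<nu> d \<and> pm.independent (ker_basis \<nu> d) \<and> ker \<nu> d \<subseteq> pm.span (ker_basis \<nu> d)"
    unfolding ker_basis_def by (rule someI_ex)
  then show "ker_basis \<nu> d \<subseteq> ker \<nu> d" "pm.independent (ker_basis \<nu> d)" by blast+
  show "ker \<nu> d = pm.span (ker_basis \<nu> d)" using b pm.span_minimal[OF _ subspace_ker] by blast
  have "ker_basis \<nu> d \<subseteq> pm.span (mono_fock ` {P. int (wt P) = d})"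
    using b unfolding wset_span[symmetric] ker_def by blast
  then show "finite (ker_basis \<nu> d)"
    using b pm.independent_span_bound[of "mono_fock ` {P. int (wt P) = d}" "ker_basis \<nu> d"] finite_wt_int by blast
qed

definition ker_dim :: "int \<Rightarrow> int \<Rightarrow> nat" where "ker_dim \<nu> d = card (ker_basis \<nu> d)"

text \<open>
  Write \<open>Q\<close> for the screening mode and \<open>P\<close> for the mode of \<open>V_1\<close> in the opposite direction. By the
  anticommutation relation \<open>Q P\<close> is the identity on the next kernel, and every \<open>v\<close> is the sum of a vector
  in the kernel and \<open>P (Q v)\<close> with \<open>Q v\<close> in the next kernel. So the space of weight \<open>d\<close> is the direct sum of
  the kernel and a copy of the next one, of weight \<open>d + \<nu> - 1\<close>.
\<close>

lemma ker_exact: "ker_dim \<nu> d + ker_dim (\<nu> - 1) (d + \<nu> - 1) = part_int d"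
proof -
  let ?Q = "Wop (- 1) (\<nu> - 1)" and ?P = "Wop 1 (1 - \<nu>)"
  have ac: "Wop (- 1) m (Wop 1 n v) + Wop 1 (n + 1) (Wop (- 1) (m - 1) v) = (if m + n = 0 then v else 0)" for m n v
    by (rule Wop_anticommutator) simp_all
  have QP: "?Q (?P w) = w" if "w \<in> ker (\<nu> - 1) (d + \<nu> - 1)" for w
    using ac[of "\<nu> - 1" "1 - \<nu>" w] that by (simp add: ker_def plinear_0[OF plinear_Wop])
  have Pw: "?P w \<in> wset {d}" if "w \<in> ker (\<nu> - 1) (d + \<nu> - 1)" for w
  proof -
    have "w \<in> wset {d + \<nu> - 1}" using that by (simp add: ker_def)
    then have "?P w \<in> wset {x. x - (1 - \<nu>) \<in> {d + \<nu> - 1}}" by (rule Wop_wset)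
    then show ?thesis by (rule wset_mono[rotated]) auto
  qed
  define B where "B b = (if b then ker_basis \<nu> d else ?P ` ker_basis (\<nu> - 1) (d + \<nu> - 1))" for b
  have injP: "inj_on ?P (ker (\<nu> - 1) (d + \<nu> - 1))" by (metis QP inj_onI)
  have indP: "pm.independent (?P ` ker_basis (\<nu> - 1) (d + \<nu> - 1))"
  proof (rule pm.independent_imageI)
    show "inj_on ?P (ker_basis (\<nu> - 1) (d + \<nu> - 1))" using injP ker_basis(1) by (rule inj_on_subset)
    fix J c i assume J: "finite J" "J \<subseteq> ker_basis (\<nu> - 1) (d + \<nu> - 1)" "(\<Sum>i\<in>J. pscale (c i) (?P i)) = 0" "i \<in> J"
    have "(\<Sum>i\<in>J. pscale (c i) i) = ?Q (\<Sum>i\<in>J. pscale (c i) (?P i))"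
      unfolding plinear_sum[OF plinear_Wop] plinear_scale[OF plinear_Wop]
      using J(2) ker_basis(1) by (intro sum.cong refl) (auto simp: QP subset_iff)
    also have "\<dots> = 0" unfolding J(3) by (rule plinear_0[OF plinear_Wop])
    finally show "c i = 0" using pm.independentD[OF ker_basis(2) J(1,2) _ J(4)] by blast
  qed
  have spanP: "v \<in> ?P ` ker (\<nu> - 1) (d + \<nu> - 1)" if "v \<in> pm.span (?P ` ker_basis (\<nu> - 1) (d + \<nu> - 1))" for v
  proof -
    interpret l: Vector_Spaces.linear pscale pscale ?P using plinear_Wop by (simp add: plinear_iff)
    show ?thesis using that unfolding l.span_image ker_basis(3)[symmetric] .
  qed
  have fB: "finite (B b) \<and> pm.independent (B b)" for b
    unfolding B_def using ker_basis(2,4) indP by simp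
  have dir: "\<forall>b\<in>UNIV. v b = 0" if v: "\<And>b. b \<in> UNIV \<Longrightarrow> v b \<in> pm.span (B b)" "(\<Sum>b\<in>UNIV. v b) = 0" for v
  proof -
    have 1: "v True \<in> ker \<nu> d" using v(1)[of True] unfolding B_def by (simp add: ker_basis(3)[symmetric])
    obtain w where w: "w \<in> ker (\<nu> - 1) (d + \<nu> - 1)" "v False = ?P w"
      using spanP v(1)[of False] unfolding B_def by auto
    have s: "v True + v False = 0" using v(2) by (simp add: UNIV_bool add.commute)
    have "?Q (v True + v False) = w" using 1 w by (simp add: plinear_add[OF plinear_Wop] QP ker_def)
    then have "w = 0" unfolding s by (simp add: plinear_0[OF plinear_Wop])
    then have "v False = 0" by (simp add: w(2) plinear_0[OF plinear_Wop])
    then show ?thesis using s by (metis (full_types) add_0_right)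
  qed
  note ds = pm.independent_direct_sum[of UNIV B, OF finite_UNIV fB dir]
  have U: "(\<Union>b\<in>UNIV. B b) = B True \<union> B False" by (simp add: UNIV_bool Un_commute)
  have span: "pm.span (B True \<union> B False) = wset {d}"
  proof
    have "B True \<subseteq> wset {d}" using ker_basis(1) by (auto simp: B_def ker_def)
    moreover have "B False \<subseteq> wset {d}" using ker_basis(1) Pw by (auto simp: B_def)
    ultimately show "pm.span (B True \<union> B False) \<subseteq> wset {d}" by (intro pm.span_minimal[OF _ subspace_wset]) blast
    show "wset {d} \<subseteq> pm.span (B True \<union> B False)"
    proof
      fix v assume v: "v \<in> wset {d}"
      have Psv: "Wop 1 (- \<nu>) v \<in> wset {x. x - (- \<nu>) \<in> {d}}" by (rule Wop_wset[OF v])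
      have "Wop (- 1) \<nu> (Wop 1 (- \<nu>) v) \<in> wset {x. x - \<nu> \<in> {x. x - (- \<nu>) \<in> {d}}}" by (rule Wop_wset[OF Psv])
      then have "Wop (- 1) \<nu> (Wop 1 (- \<nu>) v) \<in> wset {d}" by (rule wset_mono[rotated]) auto
      moreover have "?Q (Wop (- 1) \<nu> (Wop 1 (- \<nu>) v)) = 0" by (rule Wop_square) simp
      ultimately have 1: "Wop (- 1) \<nu> (Wop 1 (- \<nu>) v) \<in> ker \<nu> d" by (simp add: ker_def)
      have "?Q v \<in> wset {x. x - (\<nu> - 1) \<in> {d}}" by (rule Wop_wset[OF v])
      then have "?Q v \<in> wset {d + \<nu> - 1}" by (rule wset_mono[rotated]) auto
      moreover have "Wop (- 1) (\<nu> - 1 - 1) (?Q v) = 0" by (rule Wop_square) simp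
      ultimately have 2: "?Q v \<in> ker (\<nu> - 1) (d + \<nu> - 1)" by (simp add: ker_def)
      have "?P (?Q v) \<in> pm.span (?P ` ker_basis (\<nu> - 1) (d + \<nu> - 1))"
      proof -
        interpret l: Vector_Spaces.linear pscale pscale ?P using plinear_Wop by (simp add: plinear_iff)
        show ?thesis unfolding l.span_image ker_basis(3)[symmetric] using 2 by blast
      qed
      then have 3: "?P (?Q v) \<in> pm.span (B True \<union> B False)"
        using pm.span_mono[of "B False" "B True \<union> B False"] by (auto simp: B_def)
      have 4: "Wop (- 1) \<nu> (Wop 1 (- \<nu>) v) \<in> pm.span (B True \<union> B False)"
        using 1 pm.span_mono[of "B True" "B True \<union> B False"] unfolding ker_basis(3) by (auto simp: B_def)
      have "v = Wop (- 1) \<nu> (Wop 1 (- \<nu>) v) + ?P (?Q v)" using ac[of \<nu> "- \<nu>" v] by (simp add: add.commute)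
      then show "v \<in> pm.span (B True \<union> B False)" using pm.span_add[OF 4 3] by simp
    qed
  qed
  have ind: "pm.independent (B True \<union> B False)" using ds(1) unfolding U .
  have "card (B True \<union> B False) = pm.dim (pm.span (B True \<union> B False))"
    unfolding pm.dim_span by (rule pm.dim_eq_card_independent[OF ind, symmetric])
  also have "\<dots> = pm.dim (wset {d})" by (simp only: span)
  also have "pm.dim (wset {d}) = card (mono_fock ` {P. int (wt P) = d})"
    unfolding wset_span pm.dim_span by (rule pm.dim_eq_card_independent[OF independent_mono_fock])
  also have "\<dots> = part_int d" by (simp add: card_image[OF inj_mono_fock] card_wt_int)
  finally have "card (\<Union>b\<in>UNIV. B b) = part_int d" unfolding U .
  moreover have "card (\<Union>b\<in>UNIV. B b) = card (ker_basis \<nu> d) + card (?P ` ker_basis (\<nu> - 1) (d + \<nu> - 1))"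
  proof -
    have "(\<Sum>b\<in>UNIV. card (B b)) = card (B True) + card (B False)" by (simp add: UNIV_bool add.commute)
    then show ?thesis using ds(2) by (simp only: B_def if_True if_False)
  qed
  moreover have "card (?P ` ker_basis (\<nu> - 1) (d + \<nu> - 1)) = card (ker_basis (\<nu> - 1) (d + \<nu> - 1))"
    by (rule card_image[OF inj_on_subset[OF injP ker_basis(1)]])
  ultimately show ?thesis by (simp add: ker_dim_def)
qed

lemma ker_dim_neg: "d < 0 \<Longrightarrow> ker_dim \<nu> d = 0"
  using ker_exact[of \<nu> d] by (simp add: part_int_def)

text \<open>
  The homogeneous component of weight \<open>d\<close>.
\<close>

definition hpart :: "int \<Rightarrow> fock \<Rightarrow> fock"
  where "hpart d = plin (\<lambda>P. Poly_Mapping.single P (if int (wt P) = d then 1 else 0))"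

lemma lookup_hpart: "lookup (hpart d v) P = (if int (wt P) = d then lookup v P else 0)"
  by (simp add: hpart_def lookup_plin_diag)

lemma hpart_wset: "hpart d v \<in> wset {d}"
  by (auto simp: wset_def in_keys_iff lookup_hpart split: if_splits)

lemma hpart_sum: "v = (\<Sum>d\<in>(\<lambda>P. int (wt P)) ` keys v. hpart d v)"
proof (rule poly_mapping_eqI)
  fix P
  show "lookup v P = lookup (\<Sum>d\<in>(\<lambda>P. int (wt P)) ` keys v. hpart d v) P"
  proof (cases "P \<in> keys v")
    case True
    have "(\<Sum>d\<in>(\<lambda>P. int (wt P)) ` keys v. if int (wt P) = d then lookup v P else 0) = lookup v P"
      using True by (subst sum.delta') auto
    then show ?thesis by (simp add: lookup_sum lookup_hpart)
  next
    case False
    then show ?thesis by (simp add: lookup_sum lookup_hpart in_keys_iff)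
  qed
qed

text \<open>
  The screening mode is homogeneous, so its kernel is graded.
\<close>

lemma hpart_ker:
  assumes "Wop (- 1) (\<nu> - 1) v = 0"
  shows "hpart d v \<in> ker \<nu> d"
proof -
  have W: "Wop (- 1) (\<nu> - 1) (hpart e v) \<in> wset {e + (\<nu> - 1)}" for e
    by (rule wset_mono[OF _ Wop_wset[OF hpart_wset]]) auto
  have "Wop (- 1) (\<nu> - 1) (hpart d v) = 0"
  proof (rule poly_mapping_eqI)
    fix P
    have key: "lookup (Wop (- 1) (\<nu> - 1) (hpart e v)) P = 0" if "int (wt P) \<noteq> e + (\<nu> - 1)" for e
      using W[of e] that by (auto simp: wset_def in_keys_iff)
    show "lookup (Wop (- 1) (\<nu> - 1) (hpart d v)) P = lookup 0 P"
    proof (cases "int (wt P) = d + (\<nu> - 1) \<and> d \<in> (\<lambda>P. int (wt P)) ` keys v")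
      case True
      have "0 = lookup (Wop (- 1) (\<nu> - 1) (\<Sum>e\<in>(\<lambda>P. int (wt P)) ` keys v. hpart e v)) P"
        using assms hpart_sum[of v] by simp
      also have "\<dots> = (\<Sum>e\<in>(\<lambda>P. int (wt P)) ` keys v. lookup (Wop (- 1) (\<nu> - 1) (hpart e v)) P)"
        by (simp add: plinear_sum[OF plinear_Wop] lookup_sum)
      also have "\<dots> = (\<Sum>e\<in>{d}. lookup (Wop (- 1) (\<nu> - 1) (hpart e v)) P)"
        by (rule sum.mono_neutral_right) (use True in \<open>auto intro!: key\<close>)
      finally show ?thesis by simp
    next
      case False
      show ?thesis
      proof (cases "d \<in> (\<lambda>P. int (wt P)) ` keys v")
        case False
        have "hpart d v = 0"
          by (rule poly_mapping_eqI) (use False in \<open>auto simp: lookup_hpart in_keys_iff\<close>)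
        then show ?thesis by (simp add: plinear_0[OF plinear_Wop])
      qed (use False key[of d] in auto)
    qed
  qed
  then show ?thesis by (simp add: ker_def hpart_wset)
qed

section \<open>Counting pairs of partitions\<close>

definition pairs :: "int \<Rightarrow> nat" where "pairs d = card {(P, Q). int (wt P + wt Q) = d}"

definition bounded_pairs :: "int \<Rightarrow> int \<Rightarrow> nat"
  where "bounded_pairs c d = card {(P, Q). int (wt P + wt Q) = d \<and> int (size P) - int (size Q) \<le> c}"

lemma finite_pairs: "finite {(P, Q). int (wt P + wt Q) = d \<and> R P Q}"
proof -
  have "{(P, Q). int (wt P + wt Q) = d \<and> R P Q} \<subseteq> {P. wt P \<le> nat d} \<times> {Q. wt Q \<le> nat d}" by auto
  then show ?thesis by (rule finite_subset) simp
qed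

lemma pairs_convolution: "pairs d = (\<Sum>j\<in>{0..d}. part_int j * part_int (d - j))"
proof -
  have "{(P, Q). int (wt P + wt Q) = d} = (\<Union>j\<in>{0..d}. {P. int (wt P) = j} \<times> {Q. int (wt Q) = d - j})" by auto
  then have "pairs d = (\<Sum>j\<in>{0..d}. card ({P. int (wt P) = j} \<times> {Q. int (wt Q) = d - j}))"
    unfolding pairs_def by (simp, intro card_UN_disjoint) (auto simp: finite_wt_int)
  then show ?thesis by (simp add: card_cartesian_product card_wt_int)
qed

lemma pairs_neg: "d < 0 \<Longrightarrow> pairs d = 0"
  by (simp add: pairs_convolution)

text \<open>
  Exchanging \<open>P\<close> and \<open>Q\<close> maps the pairs with \<open>|P| - |Q| > c\<close> to those with \<open>|P| - |Q| \<le> - c - 1\<close>.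
\<close>

lemma bounded_pairs_complement: "bounded_pairs c d + bounded_pairs (- c - 1) d = pairs d"
proof -
  let ?A = "{(P, Q). int (wt P + wt Q) = d \<and> int (size P) - int (size Q) \<le> c}"
  let ?B = "{(P, Q). int (wt P + wt Q) = d \<and> \<not> int (size P) - int (size Q) \<le> c}"
  have "bounded_pairs (- c - 1) d = card ?B"
    unfolding bounded_pairs_def
  proof (rule bij_betw_same_card)
    show "bij_betw (\<lambda>(P, Q). (Q, P)) {(P, Q). int (wt P + wt Q) = d \<and> int (size P) - int (size Q) \<le> - c - 1} ?B"
      by (rule bij_betw_byWitness[where f' = "\<lambda>(P, Q). (Q, P)"]) auto
  qed
  moreover have "{(P, Q). int (wt P + wt Q) = d} = ?A \<union> ?B" by auto
  moreover have "card (?A \<union> ?B) = card ?A + card ?B"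
    by (rule card_Un_disjoint) (use finite_pairs in auto)
  ultimately show ?thesis unfolding pairs_def bounded_pairs_def by simp
qed

text \<open>
  In terms of partitions, \<open>mset_up\<close> increases every part by one and \<open>mset_down\<close> decreases every part
  by one, discarding the parts that vanish (an entry \<open>i\<close> is a part \<open>i + 1\<close>).
\<close>

definition mset_up :: "nat multiset \<Rightarrow> nat multiset" where "mset_up P = image_mset Suc P"
definition mset_down :: "nat multiset \<Rightarrow> nat multiset" where "mset_down Q = image_mset (\<lambda>x. x - 1) (filter_mset (\<lambda>x. x > 0) Q)"

lemma mset_down_add: "mset_down (A + B) = mset_down A + mset_down B"
  unfolding mset_down_def by (simp only: filter_union_mset image_mset_union)

lemma mset_down_replicate_0: "mset_down (replicate_mset n 0) = {#}"
proof (induction n)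
  case 0
  show ?case unfolding mset_down_def by simp
next
  case (Suc n)
  have "mset_down {#0#} = {#}" unfolding mset_down_def by simp
  then show ?case using mset_down_add[of "{#0#}" "replicate_mset n 0"] Suc by simp
qed

lemma mset_down_up: "mset_down (replicate_mset n 0 + mset_up P) = P"
proof -
  have "mset_down (mset_up P) = P"
  proof (induction P)
    case (add x P)
    have "mset_down {#Suc x#} = {#x#}" unfolding mset_down_def by simp
    then show ?case using mset_down_add[of "{#Suc x#}" "mset_up P"] add by (simp add: mset_up_def)
  qed (simp add: mset_down_def mset_up_def)
  then show ?thesis by (simp only: mset_down_add mset_down_replicate_0 add_0)
qed

lemma mset_up_down: "replicate_mset (count Q 0) 0 + mset_up (mset_down Q) = Q"
proof (induction Q)
  case (add x Q)
  show ?case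
  proof (cases "x = 0")
    case True
    then show ?thesis using add by (simp add: mset_down_def)
  next
    case False
    then have "mset_up (mset_down (add_mset x Q)) = add_mset x (mset_up (mset_down Q))"
      by (simp add: mset_up_def mset_down_def)
    then show ?thesis using add False by simp
  qed
qed (simp add: mset_up_def mset_down_def)

lemma size_mset_down: "size (mset_down Q) + count Q 0 = size Q"
  by (induction Q) (auto simp: mset_down_def)

lemma wt_mset_down: "wt (mset_down Q) + size Q = wt Q"
  by (induction Q) (auto simp: mset_down_def)

lemma wt_mset_up: "wt (mset_up P) = wt P + size P"
  by (induction P) (auto simp: mset_up_def)

lemma wt_replicate_0: "wt (replicate_mset n 0) = n" by (induction n) auto

text \<open>
  The bijection \<open>(P, Q) \<mapsto> (Q decreased, P increased with h - |P| + |Q| parts 1 added)\<close>: the bound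
  \<open>|P| - |Q| \<le> h\<close> says that the number of added parts is natural. The inverse map discards exactly these parts.
\<close>

lemma bounded_pairs_symmetry: "bounded_pairs (- h) (d + h) = bounded_pairs h d"
proof -
  \<comment> \<open>\<open>\<phi> (- h)\<close> is the inverse of \<open>\<phi> h\<close>.\<close>
  define \<phi> where "\<phi> h = (\<lambda>(P, Q). (mset_down Q, replicate_mset (nat (h - int (size P) + int (size Q))) 0 + mset_up P))" for h :: int
  define S where "S h d = {(P, Q). int (wt P + wt Q) = d \<and> int (size P) - int (size Q) \<le> h}" for h d :: int
  have maps: "\<phi> h ` S h d \<subseteq> S (- h) (d + h)" for h d
  proof
    fix x assume "x \<in> \<phi> h ` S h d"
    then obtain P Q where PQ: "(P, Q) \<in> S h d" "x = \<phi> h (P, Q)" by auto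
    have 1: "int (size (mset_down Q)) \<le> int (size Q)" using size_mset_down[of Q] by simp
    have 2: "int (wt (mset_down Q)) + int (size Q) = int (wt Q)" using wt_mset_down[of Q] by simp
    show "x \<in> S (- h) (d + h)" using PQ 1 2
      by (auto simp: \<phi>_def S_def wt_replicate_0 wt_mset_up mset_up_def[symmetric]) (simp_all add: mset_up_def)
  qed
  have inv: "\<phi> (- h) (\<phi> h x) = x" if "x \<in> S h d" for h d x
  proof -
    obtain P Q where x: "x = (P, Q)" by (cases x)
    have "nat (- h - int (size (mset_down Q)) + int (size (replicate_mset (nat (h - int (size P) + int (size Q))) 0 + mset_up P))) = count Q 0"
      using that size_mset_down[of Q] by (simp add: x S_def mset_up_def)
    then show ?thesis unfolding x \<phi>_def by (simp add: mset_down_up mset_up_down)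
  qed
  have "bij_betw (\<phi> h) (S h d) (S (- h) (d + h))"
  proof (rule bij_betw_byWitness[where f' = "\<phi> (- h)"])
    show "\<forall>x\<in>S h d. \<phi> (- h) (\<phi> h x) = x" using inv by blast
    show "\<forall>x\<in>S (- h) (d + h). \<phi> h (\<phi> (- h) x) = x" using inv[where h = "- h" and d = "d + h"] by simp
    show "\<phi> h ` S h d \<subseteq> S (- h) (d + h)" by (rule maps)
    show "\<phi> (- h) ` S (- h) (d + h) \<subseteq> S h d" using maps[of "- h" "d + h"] by simp
  qed
  then have "card (S h d) = card (S (- h) (d + h))" by (rule bij_betw_same_card)
  then show ?thesis by (simp add: bounded_pairs_def S_def)
qed

text \<open>
  Complement and symmetry combined; the counterpart of \<open>ker_exact\<close>.
\<close>

lemma bounded_pairs_recursion: "bounded_pairs c d + bounded_pairs (c + 1) (d - c - 1) = pairs d"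
proof -
  have "bounded_pairs (- (c + 1)) (d - c - 1 + (c + 1)) = bounded_pairs (c + 1) (d - c - 1)" by (rule bounded_pairs_symmetry)
  then have "bounded_pairs (- c - 1) d = bounded_pairs (c + 1) (d - c - 1)" by simp
  then show ?thesis using bounded_pairs_complement[of c d] by simp
qed

lemma bounded_pairs_neg: "d < 0 \<Longrightarrow> bounded_pairs c d = 0"
  using bounded_pairs_complement[of c d] pairs_neg[of d] by simp

text \<open>
  The conformal weight \<open>n (n - 1) / 2\<close> of the highest weight vector of the Fock space of weight \<open>n\<close>.
\<close>

definition tri :: "int \<Rightarrow> int" where "tri n = n * (n - 1) div 2"

lemma two_tri: "2 * tri n = n * (n - 1)"
  unfolding tri_def by (rule dvd_mult_div_cancel) simp

lemma tri_Suc: "tri (n + 1) = tri n + n"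
proof -
  have "2 * tri (n + 1) = 2 * (tri n + n)" using two_tri[of n] two_tri[of "n + 1"] by (simp add: algebra_simps)
  then show ?thesis by simp
qed

lemma tri_pred: "tri (n - 1) = tri n - n + 1"
  using tri_Suc[of "n - 1"] by simp

lemma tri_nonneg: "tri n \<ge> 0"
proof -
  have "n * (n - 1) \<ge> 0"
  proof (cases "n \<ge> 1")
    case False
    then show ?thesis by (intro mult_nonpos_nonpos) auto
  qed simp
  then show ?thesis using two_tri[of n] by simp
qed

lemma tri_bound: "tri n \<ge> \<bar>n\<bar> - 1"
proof -
  have "n * (n - 1) \<ge> 2 * (\<bar>n\<bar> - 1)"
  proof (cases "n \<ge> 1")
    case True
    have "(n - 1) * (n - 2) \<ge> 0"
    proof (cases "n = 1")
      case False
      then show ?thesis using True by (intro mult_nonneg_nonneg) auto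
    qed simp
    then show ?thesis using True by (simp add: algebra_simps)
  next
    case False
    have "(- n) * (- n - 1) \<ge> 0"
    proof (cases "n = 0")
      case False
      then show ?thesis using \<open>\<not> n \<ge> 1\<close> by (intro mult_nonneg_nonneg) auto
    qed simp
    then show ?thesis using False by (simp add: algebra_simps)
  qed
  then show ?thesis using two_tri[of n] by simp
qed

text \<open>
  Both sides satisfy \<open>X n + X (n - 1) = pairs (t - tri n)\<close> and vanish for large \<open>n\<close>; downward
  induction gives equality everywhere.
\<close>

lemma ker_convolution_eq_bounded_pairs:
  "(\<Sum>j\<in>{0..t}. part_int j * ker_dim n (t - j - tri n)) = bounded_pairs n (t - tri (n + 1))"
proof -
  define X where "X n = (\<Sum>j\<in>{0..t}. part_int j * ker_dim n (t - j - tri n))" for n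
  define Y where "Y n = bounded_pairs n (t - tri (n + 1))" for n
  have Xrec: "X n + X (n - 1) = pairs (t - tri n)" for n
  proof -
    have "X n + X (n - 1) = (\<Sum>j\<in>{0..t}. part_int j * (ker_dim n (t - j - tri n) + ker_dim (n - 1) (t - j - tri n + n - 1)))"
      unfolding X_def sum.distrib[symmetric] distrib_left[symmetric] by (simp add: tri_pred algebra_simps)
    also have "\<dots> = (\<Sum>j\<in>{0..t}. part_int j * part_int (t - tri n - j))"
    proof (intro sum.cong refl)
      fix j
      have "ker_dim n (t - j - tri n) + ker_dim (n - 1) (t - j - tri n + n - 1) = part_int (t - tri n - j)"
        using ker_exact[of n "t - j - tri n"] by (simp add: algebra_simps)
      then show "part_int j * (ker_dim n (t - j - tri n) + ker_dim (n - 1) (t - j - tri n + n - 1)) = part_int j * part_int (t - tri n - j)"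
        by (simp only:)
    qed
    also have "\<dots> = (\<Sum>j\<in>{0..t - tri n}. part_int j * part_int (t - tri n - j))"
      by (rule sum.mono_neutral_right) (use tri_nonneg[of n] in \<open>auto simp: part_int_def\<close>)
    finally show ?thesis by (simp add: pairs_convolution)
  qed
  have Yrec: "Y n + Y (n - 1) = pairs (t - tri n)" for n
  proof -
    have "t - tri n - (n - 1) - 1 = t - tri (n + 1)" unfolding tri_Suc by simp
    then show ?thesis using bounded_pairs_recursion[of "n - 1" "t - tri n"] unfolding Y_def by simp
  qed
  have zero: "X n = 0" "Y n = 0" if "n > t + 1" "n > 0" for n
  proof -
    have "t - tri n < 0" "t - tri (n + 1) < 0" using tri_bound[of n] tri_bound[of "n + 1"] that by auto
    then show "X n = 0" "Y n = 0" unfolding X_def Y_def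
      by (auto intro!: sum.neutral ker_dim_neg simp: bounded_pairs_neg)
  qed
  have "X (m - int k) = Y (m - int k)" if "m > t + 1" "m > 0" for m k
  proof (induction k)
    case 0
    then show ?case using zero[OF that] by simp
  next
    case (Suc k)
    have "m - int (Suc k) = (m - int k) - 1" by simp
    show ?case unfolding \<open>m - int (Suc k) = (m - int k) - 1\<close>
      using Xrec[of "m - int k"] Yrec[of "m - int k"] Suc.IH by linarith
  qed
  \<comment> \<open>Start where both sides vanish and descend to \<open>n\<close>.\<close>
  from this[of "max n (max (t + 2) 1)" "nat (max n (max (t + 2) 1) - n)"] show ?thesis by (simp add: X_def Y_def)
qed

section \<open>Characters of the triplet modules\<close>

lemma finite_abs_le: "finite {n::int. \<bar>n\<bar> \<le> k}"
proof -
  have "{n::int. \<bar>n\<bar> \<le> k} = {- k..k}" by auto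
  then show ?thesis by simp
qed

lemma infsum_finite_support:
  fixes f :: "'i \<Rightarrow> nat"
  assumes "finite S" "S \<subseteq> A" "\<And>x. x \<in> A - S \<Longrightarrow> f x = 0"
  shows "infsum f A = sum f S" "f summable_on A"
proof -
  have "infsum f A = infsum f S" by (rule infsum_cong_neutral) (use assms in auto)
  then show "infsum f A = sum f S" using assms(1) by simp
  have "f summable_on S \<longleftrightarrow> f summable_on A" by (rule summable_on_cong_neutral) (use assms in auto)
  then show "f summable_on A" using assms(1) by simp
qed

text \<open>
  The series \<open>\<Sum>t\<ge>0. w t q^(\<kappa> + t)\<close> with no power of \<open>z\<close>.
\<close>

definition series_on :: "complex \<Rightarrow> (int \<Rightarrow> nat) \<Rightarrow> fseries \<Rightarrow> bool"
  where "series_on \<kappa> w F \<longleftrightarrow> (\<forall>t. F (0, \<kappa> + of_int t) = w t) \<and> (\<forall>x y. F (x, y) \<noteq> 0 \<longrightarrow> x = 0 \<and> (\<exists>t. y = \<kappa> + of_int t)) \<and> (\<forall>t<0. w t = 0)"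

lemma ch_VD_value:
  assumes "x = l + of_int m * 2"
  shows "ch_VD l (x, - x\<^sup>2 / 2 - 1 / 24 + of_int j) = part_int j"
proof -
  have "{(\<nu>, P). (\<exists>m::int. \<nu> = l + of_int m * 2) \<and> \<nu> = x \<and> - \<nu>\<^sup>2 / 2 + of_nat (wt P) = - x\<^sup>2 / 2 - 1 / 24 + of_int j + 1 / 24}
     = (\<lambda>P. (x, P)) ` {P. int (wt P) = j}"
  proof -
    have "(of_nat (wt P) = (of_int j :: complex)) = (int (wt P) = j)" for P
      by (metis of_int_eq_iff of_int_of_nat_eq)
    then show ?thesis using assms by auto
  qed
  then show ?thesis unfolding ch_VD_card by (simp add: card_image inj_on_def card_wt_int)
qed

lemma ch_VD_support:
  assumes "ch_VD l (x, y) \<noteq> 0"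
  shows "(\<exists>m::int. x = l + of_int m * 2) \<and> (\<exists>j::int. y = - x\<^sup>2 / 2 - 1 / 24 + of_int j)"
proof -
  have "{(\<nu>, P). (\<exists>m::int. \<nu> = l + of_int m * 2) \<and> \<nu> = x \<and> - \<nu>\<^sup>2 / 2 + of_nat (wt P) = y + 1 / 24} \<noteq> {}"
    using assms unfolding ch_VD_card by (metis card.empty)
  then obtain \<nu> P where "(\<exists>m::int. \<nu> = l + of_int m * 2)" "\<nu> = x" "- \<nu>\<^sup>2 / 2 + of_nat (wt P) = y + 1 / 24" by blast
  then have "y = - x\<^sup>2 / 2 - 1 / 24 + of_int (int (wt P))" "(\<exists>m::int. x = l + of_int m * 2)" by (auto simp: algebra_simps)
  then show ?thesis by blast
qed

text \<open>
  The Heisenberg factor has at each \<open>z^x\<close> the single leading exponent \<open>- x^2/2 - 1/24\<close>, so the product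
  with a series in \<open>q\<close> is the convolution with the partition numbers.
\<close>

lemma product_with_VD:
  assumes F: "series_on \<kappa> w F"
  shows "fs_multipliable (ch_VD l) F"
    and "x = l + of_int m * 2 \<Longrightarrow> fs_mult (ch_VD l) F (x, - x\<^sup>2 / 2 - 1 / 24 + \<kappa> + of_int t) = (\<Sum>j\<in>{0..t}. part_int j * w (t - j))"
    and "fs_mult (ch_VD l) F (x, y) \<noteq> 0 \<Longrightarrow> (\<exists>m::int. x = l + of_int m * 2) \<and> (\<exists>t::int. y = - x\<^sup>2 / 2 - 1 / 24 + \<kappa> + of_int t)"
proof -
  have supp: "\<exists>m j t. j \<ge> 0 \<and> t \<ge> j \<and> x = l + of_int m * 2 \<and> z = (x, - x\<^sup>2 / 2 - 1 / 24 + of_int j) \<and> y = - x\<^sup>2 / 2 - 1 / 24 + \<kappa> + of_int t"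
    if nz: "ch_VD l z * F ((x, y) - z) \<noteq> 0" for x y z
  proof -
    obtain z1 z2 where z: "z = (z1, z2)" by (cases z)
    have n: "ch_VD l (z1, z2) \<noteq> 0" "F (x - z1, y - z2) \<noteq> 0" using nz by (auto simp: z)
    obtain m j where mj: "z1 = l + of_int m * 2" "z2 = - z1\<^sup>2 / 2 - 1 / 24 + of_int j"
      using ch_VD_support[OF n(1)] by blast
    have "x - z1 = 0 \<and> (\<exists>t. y - z2 = \<kappa> + of_int t)" using F n(2) unfolding series_on_def by blast
    then obtain u where u: "x = z1" "y - z2 = \<kappa> + of_int u" by auto
    have "j \<ge> 0" using n(1) ch_VD_value[OF mj(1), of j] unfolding mj(2)[symmetric] by (auto simp: part_int_def split: if_splits)
    moreover have "u \<ge> 0" using n(2) F unfolding series_on_def u by (metis cancel_comm_monoid_add_class.diff_cancel not_le)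
    ultimately show ?thesis using mj u by (intro exI[of _ m] exI[of _ j] exI[of _ "u + j"]) (auto simp: z algebra_simps)
  qed
  have fin: "(\<lambda>z. ch_VD l z * F ((x, y) - z)) summable_on UNIV \<and> infsum (\<lambda>z. ch_VD l z * F ((x, y) - z)) UNIV =
      (\<Sum>z\<in>(\<lambda>j. (x, - x\<^sup>2 / 2 - 1 / 24 + of_int j)) ` {0..t}. ch_VD l z * F ((x, y) - z))"
    if yt: "y = - x\<^sup>2 / 2 - 1 / 24 + \<kappa> + of_int t" for x y t
  proof -
    let ?S = "(\<lambda>j. (x, - x\<^sup>2 / 2 - 1 / 24 + of_int j)) ` {0..t}"
    have "ch_VD l z * F ((x, y) - z) = 0" if z: "z \<in> UNIV - ?S" for z
    proof (rule ccontr)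
      assume "ch_VD l z * F ((x, y) - z) \<noteq> 0"
      from supp[OF this] obtain m j t' where "j \<ge> 0" "t' \<ge> j" "z = (x, - x\<^sup>2 / 2 - 1 / 24 + of_int j)" "y = - x\<^sup>2 / 2 - 1 / 24 + \<kappa> + of_int t'" by blast
      moreover from this have "t' = t" using yt by simp
      ultimately have "z \<in> ?S" by (intro image_eqI[of _ _ j]) simp_all
      then show False using z by blast
    qed
    then show ?thesis using infsum_finite_support[of ?S UNIV "\<lambda>z. ch_VD l z * F ((x, y) - z)"] by simp
  qed
  have zero: "ch_VD l z * F ((x, y) - z) = 0" if "\<not> ((\<exists>m::int. x = l + of_int m * 2) \<and> (\<exists>t::int. y = - x\<^sup>2 / 2 - 1 / 24 + \<kappa> + of_int t))" for x y z
    using supp[of z x y] that by blast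
  show "fs_multipliable (ch_VD l) F"
    unfolding fs_multipliable_def
  proof
    fix p :: "complex \<times> complex"
    obtain x y where p: "p = (x, y)" by (cases p)
    show "(\<lambda>z. ch_VD l z * F (p - z)) summable_on UNIV"
    proof (cases "(\<exists>m::int. x = l + of_int m * 2) \<and> (\<exists>t::int. y = - x\<^sup>2 / 2 - 1 / 24 + \<kappa> + of_int t)")
      case True
      then show ?thesis using fin unfolding p by blast
    next
      case False
      have "(\<lambda>z. ch_VD l z * F (p - z)) = (\<lambda>z. 0)" unfolding p using zero[OF False] by blast
      then show ?thesis by simp
    qed
  qed
  show "(\<exists>m::int. x = l + of_int m * 2) \<and> (\<exists>t::int. y = - x\<^sup>2 / 2 - 1 / 24 + \<kappa> + of_int t)"
    if "fs_mult (ch_VD l) F (x, y) \<noteq> 0"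
  proof (rule ccontr)
    assume "\<not> ?thesis"
    then have "(\<lambda>z. ch_VD l z * F ((x, y) - z)) = (\<lambda>z. 0)" using zero by blast
    then show False using that unfolding fs_mult_def by simp
  qed
  show "fs_mult (ch_VD l) F (x, - x\<^sup>2 / 2 - 1 / 24 + \<kappa> + of_int t) = (\<Sum>j\<in>{0..t}. part_int j * w (t - j))"
    if x: "x = l + of_int m * 2"
  proof -
    let ?z = "\<lambda>j::int. (x, - x\<^sup>2 / 2 - 1 / 24 + of_int j)"
    have "fs_mult (ch_VD l) F (x, - x\<^sup>2 / 2 - 1 / 24 + \<kappa> + of_int t) = (\<Sum>z\<in>?z ` {0..t}. ch_VD l z * F ((x, - x\<^sup>2 / 2 - 1 / 24 + \<kappa> + of_int t) - z))"
      unfolding fs_mult_def using fin[OF refl] by blast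
    also have "\<dots> = (\<Sum>j\<in>{0..t}. ch_VD l (?z j) * F ((x, - x\<^sup>2 / 2 - 1 / 24 + \<kappa> + of_int t) - ?z j))"
      by (rule sum.reindex_cong[of ?z]) (auto simp: inj_on_def)
    also have "\<dots> = (\<Sum>j\<in>{0..t}. part_int j * w (t - j))"
    proof (intro sum.cong refl)
      fix j
      have "(x, - x\<^sup>2 / 2 - 1 / 24 + \<kappa> + of_int t) - ?z j = (0, \<kappa> + of_int (t - j))" by simp
      moreover have "F (0, \<kappa> + of_int (t - j)) = w (t - j)" using F unfolding series_on_def by blast
      ultimately show "ch_VD l (?z j) * F ((x, - x\<^sup>2 / 2 - 1 / 24 + \<kappa> + of_int t) - ?z j) = part_int j * w (t - j)"
        using ch_VD_value[OF x, of j] by simp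
    qed
    finally show ?thesis .
  qed
qed

text \<open>
  \<open>n^2 / 2\<close> up to a constant: in terms of \<open>n = \<mu> - 1/2\<close>, the conformal weight of the Fock space of
  weight \<open>\<mu>\<close> in \<open>W_(r,2)\<close>.
\<close>

definition sq :: "int \<Rightarrow> int \<Rightarrow> int" where "sq i n = (n * n - i) div 2"

lemma two_sq: "i = 0 \<or> i = 1 \<Longrightarrow> even (n - i) \<Longrightarrow> 2 * sq i n = n * n - i"
  unfolding sq_def by (rule dvd_mult_div_cancel) auto

lemma sq_bound: "i = 0 \<or> i = 1 \<Longrightarrow> even (n - i) \<Longrightarrow> sq i n \<ge> \<bar>n\<bar> - 1"
proof -
  assume i: "i = 0 \<or> i = 1" "even (n - i)"
  have "(\<bar>n\<bar> - 1) * (\<bar>n\<bar> - 1) \<ge> 0" by simp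
  then have "n * n \<ge> 2 * \<bar>n\<bar> - 1" by (simp add: algebra_simps abs_if split: if_splits)
  then show ?thesis using two_sq[OF i] i(1) by linarith
qed

lemma sq_nonneg: "i = 0 \<or> i = 1 \<Longrightarrow> even (n - i) \<Longrightarrow> sq i n \<ge> 0"
proof -
  assume i: "i = 0 \<or> i = 1" "even (n - i)"
  have "2 * sq i n \<ge> - 1" using two_sq[OF i] i(1) zero_le_square[of n] by linarith
  then show ?thesis by linarith
qed

definition fock_series :: "int \<Rightarrow> int \<Rightarrow> nat"
  where "fock_series i t = (\<Sum>n | even (n - i) \<and> sq i n \<le> t. part_int (t - sq i n))"

definition ker_series :: "int \<Rightarrow> int \<Rightarrow> nat"
  where "ker_series i t = (\<Sum>n | even (n - i) \<and> tri n \<le> t. ker_dim n (t - tri n))"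

lemma finite_sq: "i = 0 \<or> i = 1 \<Longrightarrow> finite {n. even (n - i) \<and> sq i n \<le> t}"
proof (rule finite_subset[OF _ finite_abs_le[of "t + 1"]])
  assume i: "i = 0 \<or> i = 1"
  have "\<bar>n\<bar> \<le> t + 1" if "even (n - i)" "sq i n \<le> t" for n using sq_bound[OF i that(1)] that(2) by linarith
  then show "{n. even (n - i) \<and> sq i n \<le> t} \<subseteq> {n. \<bar>n\<bar> \<le> t + 1}" by blast
qed

lemma finite_tri: "finite {n. even (n - i) \<and> tri n \<le> t}"
proof (rule finite_subset[OF _ finite_abs_le[of "t + 1"]])
  have "\<bar>n\<bar> \<le> t + 1" if "tri n \<le> t" for n using tri_bound[of n] that by linarith
  then show "{n. even (n - i) \<and> tri n \<le> t} \<subseteq> {n. \<bar>n\<bar> \<le> t + 1}" by blast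
qed

lemma ch_W_fock_eigen:
  assumes r: "r = 1 \<or> r = 2" and i: "i = int r - 1"
  defines "I \<equiv> {(\<nu>, P). \<exists>m::int. \<nu> = alpha r 2 + of_int m * alpha_plus}"
  shows "ch_W r 2 (x, y) = card {j\<in>I. 0 = x \<and> (fst j)\<^sup>2 / (2 * 1) - alpha_zero / 2 * fst j + of_nat (wt (snd j)) = y + (- 2) / 24}"
    and "(\<And>(x::complex) y. finite {j\<in>I. 0 = x \<and> (fst j)\<^sup>2 / (2 * 1) - alpha_zero / 2 * fst j + of_nat (wt (snd j)) = y}) \<Longrightarrow> ch_W_defined r 2"
proof -
  have T: "triplet_simple r 2 = lattice_module alpha_plus (alpha r 2)" by (simp add: triplet_simple_def)
  have L: "lattice_module alpha_plus (alpha r 2) = fsum.span (fock_vec ` I)" unfolding I_def by (rule lattice_module_span)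
  have z: "0 = fsum_scale 0 (fock_vec j)" for j by simp
  show "ch_W r 2 (x, y) = card {j\<in>I. 0 = x \<and> (fst j)\<^sup>2 / (2 * 1) - alpha_zero / 2 * fst j + of_nat (wt (snd j)) = y + (- 2) / 24}"
    unfolding ch_W_def T trace_series_def prod.case
    by (rule fsum.dim_joint_eigenspace_eigenbasis[OF linear_fsum_zero linear_fsum_L0 inj_fock_vec
         independent_fock_vec L z fsum_L0_fock_vec]) simp_all
  show "ch_W_defined r 2" if "\<And>(x::complex) y. finite {j\<in>I. 0 = x \<and> (fst j)\<^sup>2 / (2 * 1) - alpha_zero / 2 * fst j + of_nat (wt (snd j)) = y}"
    unfolding ch_W_defined_def T
    by (rule fsum.trace_defined_eigenbasis[OF linear_fsum_zero linear_fsum_L0 inj_fock_vec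
         independent_fock_vec L z fsum_L0_fock_vec]) (simp, simp, rule that)
qed

lemma fock_fiber:
  assumes r: "r = 1 \<or> r = 2" and i: "i = int r - 1"
  defines "I \<equiv> {(\<nu>, P). \<exists>m::int. \<nu> = alpha r 2 + of_int m * alpha_plus}"
  defines "S y \<equiv> {j\<in>I. (fst j)\<^sup>2 / (2 * 1) - alpha_zero / 2 * fst j + of_nat (wt (snd j)) = y}"
  shows "S (- 1 / 8 + of_int i / 2 + of_int t) =
      (\<lambda>(n, P). (1/2 + of_int n, P)) ` (SIGMA n:{n. even (n - i) \<and> sq i n \<le> t}. {P. int (wt P) = t - sq i n})"
    and "S y \<noteq> {} \<Longrightarrow> \<exists>t. y = - 1 / 8 + of_int i / 2 + of_int t"
proof -
  have i01: "i = 0 \<or> i = 1" using r i by auto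
  have I: "j \<in> I \<longleftrightarrow> (\<exists>n P. even (n - i) \<and> j = (1/2 + of_int n, P))" for j
  proof -
    have a: "alpha r 2 = 1/2 - of_int i" using r i by (auto simp: alpha_def alpha_plus_def alpha_minus_def)
    show ?thesis
    proof
      assume "j \<in> I"
      then obtain m P where j: "j = (1/2 - of_int i + of_int m * 2, P)" by (auto simp: I_def a alpha_plus_def)
      show "\<exists>n P. even (n - i) \<and> j = (1/2 + of_int n, P)"
        by (intro exI[of _ "2 * m - i"] exI[of _ P]) (simp add: j algebra_simps)
    next
      assume "\<exists>n P. even (n - i) \<and> j = (1/2 + of_int n, P)"
      then obtain n P where j: "even (n - i)" "j = (1/2 + of_int n, P)" by blast
      then have "even (n + i)" by simp
      then obtain m where "n + i = 2 * m" by (elim evenE)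
      then have n: "n = 2 * m - i" by simp
      show "j \<in> I" unfolding I_def a alpha_plus_def by (auto simp: j(2) n algebra_simps intro!: exI[of _ m])
    qed
  qed
  have val: "(1/2 + of_int n)\<^sup>2 / (2 * 1) - alpha_zero / 2 * (1/2 + of_int n) + of_nat (wt P) =
      - 1 / 8 + of_int i / 2 + (of_int (sq i n + int (wt P)) :: complex)" if "even (n - i)" for n P
  proof -
    have "(of_int (2 * sq i n) :: complex) = of_int (n * n - i)" using two_sq[OF i01 that] by simp
    then have s: "(of_int (sq i n) :: complex) = (of_int n * of_int n - of_int i) / 2" by (simp add: mult.commute)
    show ?thesis by (simp add: alpha_zero_def s power2_eq_square field_simps)
  qed
  have eq: "((1/2 + of_int n)\<^sup>2 / (2 * 1) - alpha_zero / 2 * (1/2 + of_int n) + of_nat (wt P) =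
      - 1 / 8 + of_int i / 2 + (of_int t :: complex)) = (sq i n + int (wt P) = t)" if "even (n - i)" for n P
    unfolding val[OF that] by (simp only: add_left_cancel of_int_eq_iff)
  show "S (- 1 / 8 + of_int i / 2 + of_int t) =
      (\<lambda>(n, P). (1/2 + of_int n, P)) ` (SIGMA n:{n. even (n - i) \<and> sq i n \<le> t}. {P. int (wt P) = t - sq i n})" (is "_ = ?R")
  proof (intro set_eqI iffI)
    fix j assume "j \<in> S (- 1 / 8 + of_int i / 2 + of_int t)"
    then obtain n P where j: "even (n - i)" "j = (1/2 + of_int n, P)"
        "(1/2 + of_int n)\<^sup>2 / (2 * 1) - alpha_zero / 2 * (1/2 + of_int n) + of_nat (wt P) = - 1 / 8 + of_int i / 2 + (of_int t :: complex)"
      unfolding S_def I by auto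
    then have "sq i n + int (wt P) = t" using eq by blast
    then show "j \<in> ?R" using j(1,2) by (intro image_eqI[of _ _ "(n, P)"]) auto
  next
    fix j assume "j \<in> ?R"
    then obtain n P where j: "even (n - i)" "j = (1/2 + of_int n, P)" "int (wt P) = t - sq i n" by auto
    then have "sq i n + int (wt P) = t" by simp
    then show "j \<in> S (- 1 / 8 + of_int i / 2 + of_int t)"
      unfolding S_def mem_Collect_eq I using eq[OF j(1), of P] j(1,2) by auto
  qed
  show "\<exists>t. y = - 1 / 8 + of_int i / 2 + of_int t" if "S y \<noteq> {}"
  proof -
    from that obtain n P where "even (n - i)"
        "(1/2 + of_int n)\<^sup>2 / (2 * 1) - alpha_zero / 2 * (1/2 + of_int n) + of_nat (wt P) = y"
      unfolding S_def I by auto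
    then have "y = - 1 / 8 + of_int i / 2 + of_int (sq i n + int (wt P))" using val by metis
    then show ?thesis by blast
  qed
qed

lemma inj_half_shift: "inj_on (\<lambda>(n, P). (1/2 + of_int n :: complex, P)) A"
  by (auto simp: inj_on_def)

lemma fock_fiber_card:
  assumes r: "r = 1 \<or> r = 2" and i: "i = int r - 1"
  defines "I \<equiv> {(\<nu>, P). \<exists>m::int. \<nu> = alpha r 2 + of_int m * alpha_plus}"
  shows "card {j\<in>I. (fst j)\<^sup>2 / (2 * 1) - alpha_zero / 2 * fst j + of_nat (wt (snd j)) = - 1 / 8 + of_int i / 2 + of_int t} = fock_series i t"
    and "finite {j\<in>I. (fst j)\<^sup>2 / (2 * 1) - alpha_zero / 2 * fst j + of_nat (wt (snd j)) = y}"
proof -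
  have i01: "i = 0 \<or> i = 1" using r i by auto
  note f = fock_fiber[OF r i, folded I_def]
  have fin: "finite (SIGMA n:{n. even (n - i) \<and> sq i n \<le> t}. {P. int (wt P) = t - sq i n})" for t
    by (intro finite_SigmaI finite_sq[OF i01] finite_wt_int)
  show "card {j\<in>I. (fst j)\<^sup>2 / (2 * 1) - alpha_zero / 2 * fst j + of_nat (wt (snd j)) = - 1 / 8 + of_int i / 2 + of_int t} = fock_series i t"
    unfolding f(1) card_image[OF inj_half_shift] fock_series_def
    by (subst card_SigmaI[OF finite_sq[OF i01]]) (simp_all add: finite_wt_int card_wt_int)
  show "finite {j\<in>I. (fst j)\<^sup>2 / (2 * 1) - alpha_zero / 2 * fst j + of_nat (wt (snd j)) = y}"
  proof (cases "{j\<in>I. (fst j)\<^sup>2 / (2 * 1) - alpha_zero / 2 * fst j + of_nat (wt (snd j)) = y} = {}")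
    case True
    then show ?thesis by (simp only: finite.emptyI)
  next
    case False
    from f(2)[OF False] obtain t where y: "y = - 1 / 8 + of_int i / 2 + of_int t" by blast
    show ?thesis unfolding y f(1) using fin by (rule finite_imageI)
  qed
qed

lemma ch_W_fock:
  assumes r: "r = 1 \<or> r = 2" and i: "i = int r - 1"
  shows "ch_W_defined r 2" "series_on (1 / 12 - 1 / 8 + of_int i / 2) (fock_series i) (ch_W r 2)"
proof -
  have i01: "i = 0 \<or> i = 1" using r i by auto
  note e = ch_W_fock_eigen[OF r i]
  note c = fock_fiber_card[OF r i]
  note f = fock_fiber[OF r i]
  show "ch_W_defined r 2"
  proof (rule e(2))
    fix x y :: complex
    show "finite {j \<in> {(\<nu>, P). \<exists>m. \<nu> = alpha r 2 + complex_of_int m * alpha_plus}. 0 = x \<and>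
        (fst j)\<^sup>2 / (2 * 1) - alpha_zero / 2 * fst j + of_nat (wt (snd j)) = y}"
      by (rule finite_subset[OF _ c(2)[of y]]) blast
  qed
  show "series_on (1 / 12 - 1 / 8 + of_int i / 2) (fock_series i) (ch_W r 2)"
    unfolding series_on_def
  proof (intro conjI allI impI)
    fix t
    have y: "1 / 12 - 1 / 8 + of_int i / 2 + of_int t + (- 2) / 24 = (- 1 / 8 + of_int i / 2 + of_int t :: complex)" by simp
    show "ch_W r 2 (0, 1 / 12 - 1 / 8 + of_int i / 2 + of_int t) = fock_series i t"
      unfolding e(1) y c(1)[of t, symmetric] by simp
  next
    fix x y assume nz: "ch_W r 2 (x, y) \<noteq> 0"
    let ?S = "{j \<in> {(\<nu>, P). \<exists>m. \<nu> = alpha r 2 + complex_of_int m * alpha_plus}. 0 = x \<and>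
        (fst j)\<^sup>2 / (2 * 1) - alpha_zero / 2 * fst j + complex_of_nat (wt (snd j)) = y + (- 2) / 24}"
    have "card ?S \<noteq> 0" using nz unfolding e(1) .
    then have "?S \<noteq> {}" by (intro notI) (simp only: card.empty)
    then obtain j where j: "j \<in> ?S" by (meson ex_in_conv)
    then show "x = 0" by simp
    have "\<exists>t. y + (- 2) / 24 = - 1 / 8 + of_int i / 2 + of_int t"
      by (rule f(2), rule notI) (use j in blast)
    then obtain t where "y + (- 2) / 24 = - 1 / 8 + of_int i / 2 + of_int t" by blast
    then have "y = 1 / 12 - 1 / 8 + of_int i / 2 + of_int t" by (simp add: algebra_simps)
    then show "\<exists>t. y = 1 / 12 - 1 / 8 + of_int i / 2 + of_int t" by blast
  next
    fix t :: int assume "t < 0"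
    then have "{n. even (n - i) \<and> sq i n \<le> t} = {}" using sq_nonneg[OF i01] by fastforce
    then show "fock_series i t = 0" unfolding fock_series_def by (simp only: sum.empty)
  qed
qed

lemma wset_unique: "b \<in> wset {d} \<Longrightarrow> b \<in> wset {d'} \<Longrightarrow> b \<noteq> 0 \<Longrightarrow> d = d'"
proof -
  assume b: "b \<in> wset {d}" "b \<in> wset {d'}" "b \<noteq> 0"
  then obtain P where P: "P \<in> keys b" using keys_eq_empty by blast
  have "int (wt P) \<in> {d}" "int (wt P) \<in> {d'}" using b(1,2) P unfolding wset_def by blast+
  then show "d = d'" by simp
qed

lemma hpart_of_wset: "b \<in> wset {d'} \<Longrightarrow> hpart d b = (if d' = d then b else 0)"
  by (rule poly_mapping_eqI) (auto simp: lookup_hpart wset_def in_keys_iff)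

lemma plinear_hpart: "plinear (hpart d)" unfolding hpart_def by (rule plinear_plin)

definition ker_index :: "int \<Rightarrow> (int \<times> int \<times> fock) set"
  where "ker_index i = {(n, d, b). even (n - i) \<and> b \<in> ker_basis n d}"

definition ker_vec :: "int \<times> int \<times> fock \<Rightarrow> fock_sum"
  where "ker_vec = (\<lambda>(n, d, b). Poly_Mapping.single (of_int n) b)"

lemma ker_basis_wset: "b \<in> ker_basis n d \<Longrightarrow> b \<in> wset {d}"
  using ker_basis(1)[of n d] unfolding ker_def by blast

lemma ker_basis_nonzero: "b \<in> ker_basis n d \<Longrightarrow> b \<noteq> 0"
  using ker_basis(2)[of n d] pm.dependent_zero by metis

lemma ker_basis_neg: "d < 0 \<Longrightarrow> ker_basis n d = {}"
  using ker_dim_neg[of d n] ker_basis(4)[of n d] unfolding ker_dim_def by simp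

lemma lookup_ker_vec: "lookup (ker_vec (n, d, b)) (of_int m) = (if n = m then b else 0)"
  unfolding ker_vec_def by (simp add: lookup_single when_def)

lemma inj_ker_vec: "inj_on ker_vec (ker_index i)"
proof (rule inj_onI)
  fix j k assume j: "j \<in> ker_index i" "k \<in> ker_index i" "ker_vec j = ker_vec k"
  obtain n d b where jj: "j = (n, d, b)" by (cases j)
  obtain n' d' b' where kk: "k = (n', d', b')" by (cases k)
  have b: "b \<in> ker_basis n d" "b' \<in> ker_basis n' d'" using j(1,2) unfolding jj kk ker_index_def by simp_all
  have "lookup (ker_vec j) (of_int n) = lookup (ker_vec k) (of_int n)" by (simp only: j(3))
  then have e: "b = (if n' = n then b' else 0)" unfolding jj kk lookup_ker_vec by simp
  then have n: "n' = n" using ker_basis_nonzero[OF b(1)] by (auto split: if_splits)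
  then have bb: "b = b'" using e by simp
  have "d = d'" using wset_unique[OF ker_basis_wset[OF b(1)]] ker_basis_wset[OF b(2)] ker_basis_nonzero[OF b(1)] bb by blast
  then show "j = k" using n bb jj kk by simp
qed

lemma independent_ker_vec: "fsum.independent (ker_vec ` ker_index i)"
proof (rule fsum.independent_imageI[OF inj_ker_vec])
  fix J c j assume J: "finite J" "J \<subseteq> ker_index i" "(\<Sum>j\<in>J. fsum_scale (c j) (ker_vec j)) = 0" "j \<in> J"
  obtain n d b where j: "j = (n, d, b)" by (cases j)
  let ?J = "{b. (n, d, b) \<in> J}"
  have summand: "pscale (c k) (hpart d (lookup (ker_vec k) (of_int n))) =
      (if k \<in> (\<lambda>b. (n, d, b)) ` ?J then pscale (c k) (snd (snd k)) else 0)" if k: "k \<in> J" for k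
  proof -
    obtain n' d' b' where kk: "k = (n', d', b')" by (cases k)
    have "b' \<in> ker_basis n' d'" using k J(2) unfolding kk ker_index_def by auto
    then have "hpart d b' = (if d' = d then b' else 0)" by (intro hpart_of_wset ker_basis_wset)
    then show ?thesis using k unfolding kk lookup_ker_vec by (auto simp: plinear_0[OF plinear_hpart])
  qed
  have "0 = hpart d (lookup (\<Sum>k\<in>J. fsum_scale (c k) (ker_vec k)) (of_int n))"
    unfolding J(3) by (simp add: plinear_0[OF plinear_hpart])
  also have "\<dots> = (\<Sum>k\<in>J. pscale (c k) (hpart d (lookup (ker_vec k) (of_int n))))"
    by (simp add: lookup_sum plinear_sum[OF plinear_hpart] plinear_scale[OF plinear_hpart])
  also have "\<dots> = (\<Sum>k\<in>J. if k \<in> (\<lambda>b. (n, d, b)) ` ?J then pscale (c k) (snd (snd k)) else 0)"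
    by (rule sum.cong[OF refl summand])
  also have "\<dots> = (\<Sum>k\<in>(\<lambda>b. (n, d, b)) ` ?J. pscale (c k) (snd (snd k)))"
    by (subst sum.inter_filter[symmetric, OF J(1)], rule sum.cong) auto
  also have "\<dots> = (\<Sum>b\<in>?J. pscale (c (n, d, b)) b)"
    by (rule sum.reindex_cong[of "\<lambda>b. (n, d, b)"]) (auto simp: inj_on_def)
  finally have s: "(\<Sum>b\<in>?J. pscale (c (n, d, b)) b) = 0" by simp
  have "finite ?J"
  proof (rule finite_subset)
    show "?J \<subseteq> (\<lambda>k. snd (snd k)) ` J" by (auto intro!: image_eqI)
  qed (use J(1) in simp)
  moreover have "?J \<subseteq> ker_basis n d" using J(2) unfolding ker_index_def by auto
  ultimately have "c (n, d, b) = 0" using pm.independentD[OF ker_basis(2) _ _ s] J(4) unfolding j by blast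
  then show "c j = 0" by (simp only: j)
qed

text \<open>
  The translation of the weight is injective, so distinct Fock spaces do not interfere and the
  kernel can be computed on each of them.
\<close>

lemma lookup_Q_minus: "lookup (Q_minus v) \<mu> = (if \<mu> + 1 \<in> keys v then vertex_residue (- 1) (\<mu> + 1) (lookup v (\<mu> + 1)) else 0)"
proof -
  have "lookup (Q_minus v) \<mu> = (\<Sum>\<nu>\<in>keys v. if \<nu> = \<mu> + 1 then vertex_residue (- 1) (\<mu> + 1) (lookup v (\<mu> + 1)) else 0)"
    unfolding Q_minus_def lookup_sum alpha_minus_def
    by (rule sum.cong[OF refl]) (auto simp: lookup_single when_def)
  then show ?thesis by simp
qed

lemma triplet_simple_1_iff:
  assumes r: "r = 1 \<or> r = 2" and i: "i = int r - 1"
  shows "v \<in> triplet_simple r 1 \<longleftrightarrow> keys v \<subseteq> {of_int n | n. even (n - i)} \<and> (\<forall>n. Wop (- 1) (n - 1) (lookup v (of_int n)) = 0)"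
proof -
  have a: "alpha r 1 = - of_int i" using r i by (auto simp: alpha_def alpha_plus_def alpha_minus_def)
  have K: "{alpha r 1 + of_int m * alpha_plus | m. True} = {of_int n | n. even (n - i)}"
  proof (intro set_eqI iffI)
    fix x assume "x \<in> {alpha r 1 + of_int m * alpha_plus | m. True}"
    then obtain m where "x = - of_int i + of_int m * 2" unfolding a alpha_plus_def by blast
    then have "x = of_int (2 * m - i)" by simp
    moreover have "even (2 * m - i - i)" by simp
    ultimately show "x \<in> {of_int n | n. even (n - i)}" by blast
  next
    fix x :: complex assume "x \<in> {of_int n | n. even (n - i)}"
    then obtain n where n: "x = of_int n" "even (n - i)" by blast
    then have "even (n + i)" by simp
    then obtain m where "n + i = 2 * m" by (elim evenE)
    then have "n = 2 * m - i" by simp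
    then have "x = of_int (2 * m - i)" using n(1) by simp
    then have "x = alpha r 1 + of_int m * alpha_plus" unfolding a alpha_plus_def by simp
    then show "x \<in> {alpha r 1 + of_int m * alpha_plus | m. True}" by blast
  qed
  have Q: "Q_minus v = 0 \<longleftrightarrow> (\<forall>n. Wop (- 1) (n - 1) (lookup v (of_int n)) = 0)"
    if k: "keys v \<subseteq> {of_int n | n. even (n - i)}"
  proof
    assume Q: "Q_minus v = 0"
    show "\<forall>n. Wop (- 1) (n - 1) (lookup v (of_int n)) = 0"
    proof
      fix n
      show "Wop (- 1) (n - 1) (lookup v (of_int n)) = 0"
      proof (cases "of_int n \<in> keys v")
        case True
        then show ?thesis using lookup_Q_minus[of v "of_int n - 1"] unfolding Q vertex_residue_Wop[symmetric] by simp
      next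
        case False
        then show ?thesis by (simp add: in_keys_iff plinear_0[OF plinear_Wop])
      qed
    qed
  next
    assume W: "\<forall>n. Wop (- 1) (n - 1) (lookup v (of_int n)) = 0"
    show "Q_minus v = 0"
    proof (rule poly_mapping_eqI)
      fix \<mu>
      show "lookup (Q_minus v) \<mu> = lookup 0 \<mu>"
      proof (cases "\<mu> + 1 \<in> keys v")
        case True
        then obtain n where n: "\<mu> + 1 = of_int n" using k by blast
        show ?thesis unfolding lookup_Q_minus n vertex_residue_Wop using W by simp
      next
        case False
        then show ?thesis by (simp add: lookup_Q_minus)
      qed
    qed
  qed
  have "v \<in> triplet_simple r 1 \<longleftrightarrow> keys v \<subseteq> {of_int n | n. even (n - i)} \<and> Q_minus v = 0"
    unfolding triplet_simple_def lattice_module_def K by simp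
  then show ?thesis using Q by blast
qed

lemma fsum_single_span:
  assumes "x \<in> pm.span B"
  shows "Poly_Mapping.single \<nu> x \<in> fsum.span (Poly_Mapping.single \<nu> ` B)"
proof -
  have "pm.subspace {x. Poly_Mapping.single \<nu> x \<in> fsum.span (Poly_Mapping.single \<nu> ` B)}"
    unfolding pm.subspace_def
  proof (intro conjI ballI allI)
    show "0 \<in> {x. Poly_Mapping.single \<nu> x \<in> fsum.span (Poly_Mapping.single \<nu> ` B)}" by (simp add: fsum.span_zero)
    fix x y assume "x \<in> {x. Poly_Mapping.single \<nu> x \<in> fsum.span (Poly_Mapping.single \<nu> ` B)}"
      "y \<in> {x. Poly_Mapping.single \<nu> x \<in> fsum.span (Poly_Mapping.single \<nu> ` B)}"
    then show "x + y \<in> {x. Poly_Mapping.single \<nu> x \<in> fsum.span (Poly_Mapping.single \<nu> ` B)}"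
      by (simp add: single_add fsum.span_add)
  next
    fix c x assume x: "x \<in> {x. Poly_Mapping.single \<nu> x \<in> fsum.span (Poly_Mapping.single \<nu> ` B)}"
    have "Poly_Mapping.single \<nu> (pscale c x) = fsum_scale c (Poly_Mapping.single \<nu> x)"
      by (rule fock_sum_eqI) (simp add: lookup_single when_def)
    then show "pscale c x \<in> {x. Poly_Mapping.single \<nu> x \<in> fsum.span (Poly_Mapping.single \<nu> ` B)}"
      using x by (simp add: fsum.span_scale)
  qed
  moreover have "B \<subseteq> {x. Poly_Mapping.single \<nu> x \<in> fsum.span (Poly_Mapping.single \<nu> ` B)}"
    by (auto intro: fsum.span_base)
  ultimately show ?thesis using pm.span_minimal assms by blast
qed

text \<open>
  The kernel is graded by the Fock weight and by the conformal weight, so the bases of its homogeneous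
  parts combine to a basis.
\<close>

lemma triplet_simple_1_span:
  assumes r: "r = 1 \<or> r = 2" and i: "i = int r - 1"
  shows "triplet_simple r 1 = fsum.span (ker_vec ` ker_index i)"
proof
  note T = triplet_simple_1_iff[OF r i]
  have sub: "fsum.subspace (triplet_simple r 1)"
    unfolding fsum.subspace_def
  proof (intro conjI ballI allI)
    show "0 \<in> triplet_simple r 1" unfolding T by (simp add: plinear_0[OF plinear_Wop])
    fix v w assume v: "v \<in> triplet_simple r 1" and w: "w \<in> triplet_simple r 1"
    have "keys (v + w) \<subseteq> keys v \<union> keys w" by (rule Poly_Mapping.keys_add)
    then show "v + w \<in> triplet_simple r 1" using v w unfolding T
      by (simp add: lookup_add plinear_add[OF plinear_Wop]) blast
  next
    fix c v assume v: "v \<in> triplet_simple r 1"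
    have "keys (fsum_scale c v) \<subseteq> keys v" by (auto simp: in_keys_iff)
    then show "fsum_scale c v \<in> triplet_simple r 1" using v unfolding T
      by (simp add: plinear_scale[OF plinear_Wop]) blast
  qed
  show "fsum.span (ker_vec ` ker_index i) \<subseteq> triplet_simple r 1"
  proof (rule fsum.span_minimal[OF _ sub], rule subsetI)
    fix x assume "x \<in> ker_vec ` ker_index i"
    then obtain n d b where x: "x = ker_vec (n, d, b)" "even (n - i)" "b \<in> ker_basis n d" unfolding ker_index_def by auto
    have W: "Wop (- 1) (n - 1) b = 0" using x(3) ker_basis(1)[of n d] unfolding ker_def by blast
    have "keys x \<subseteq> {of_int n}" unfolding x(1) ker_vec_def by simp
    moreover have "Wop (- 1) (m - 1) (lookup x (of_int m)) = 0" for m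
      unfolding x(1) lookup_ker_vec using W by (cases "n = m") (simp_all add: plinear_0[OF plinear_Wop])
    ultimately show "x \<in> triplet_simple r 1" unfolding T using x(2) by blast
  qed
  show "triplet_simple r 1 \<subseteq> fsum.span (ker_vec ` ker_index i)"
  proof
    fix v assume v: "v \<in> triplet_simple r 1"
    have dec: "v = (\<Sum>\<nu>\<in>keys v. Poly_Mapping.single \<nu> (lookup v \<nu>))"
      by (rule poly_mapping_eqI) (simp add: lookup_sum lookup_single when_def sum.If_cases in_keys_iff)
    have "Poly_Mapping.single \<nu> (lookup v \<nu>) \<in> fsum.span (ker_vec ` ker_index i)" if nk: "\<nu> \<in> keys v" for \<nu>
    proof -
      obtain n where n: "\<nu> = of_int n" "even (n - i)" using v nk unfolding T by blast
      have W: "Wop (- 1) (n - 1) (lookup v \<nu>) = 0" using v unfolding T n(1) by blast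
      have base: "Poly_Mapping.single \<nu> (hpart d (lookup v \<nu>)) \<in> fsum.span (ker_vec ` ker_index i)" for d
      proof -
        have "hpart d (lookup v \<nu>) \<in> pm.span (ker_basis n d)"
          unfolding ker_basis(3)[symmetric] by (rule hpart_ker[OF W])
        then have "Poly_Mapping.single \<nu> (hpart d (lookup v \<nu>)) \<in> fsum.span (Poly_Mapping.single \<nu> ` ker_basis n d)"
          by (rule fsum_single_span)
        moreover have "Poly_Mapping.single \<nu> ` ker_basis n d \<subseteq> ker_vec ` ker_index i"
        proof (rule image_subsetI)
          fix b assume "b \<in> ker_basis n d"
          then have "(n, d, b) \<in> ker_index i" using n(2) unfolding ker_index_def by simp
          moreover have "Poly_Mapping.single \<nu> b = ker_vec (n, d, b)" unfolding ker_vec_def n(1) by simp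
          ultimately show "Poly_Mapping.single \<nu> b \<in> ker_vec ` ker_index i" by (intro image_eqI)
        qed
        ultimately show ?thesis using fsum.span_mono by blast
      qed
      have "Poly_Mapping.single \<nu> (lookup v \<nu>) = (\<Sum>d\<in>(\<lambda>P. int (wt P)) ` keys (lookup v \<nu>). Poly_Mapping.single \<nu> (hpart d (lookup v \<nu>)))"
        by (rule poly_mapping_eqI, subst hpart_sum) (simp add: lookup_sum lookup_single when_def)
      then show ?thesis using base by (simp add: fsum.span_sum)
    qed
    then show "v \<in> fsum.span (ker_vec ` ker_index i)" by (subst dec) (rule fsum.span_sum)
  qed
qed

lemma fsum_L0_ker_vec:
  assumes "j \<in> ker_index i"
  shows "fsum_L0 1 (alpha_zero / 2) (ker_vec j) = fsum_scale (of_int (tri (fst j) + fst (snd j))) (ker_vec j)"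
proof -
  obtain n d b where j: "j = (n, d, b)" by (cases j)
  have b: "b \<in> wset {d}" using assms unfolding j ker_index_def by (auto intro: ker_basis_wset)
  have "(of_int (2 * tri n) :: complex) = of_int (n * (n - 1))" by (simp only: two_tri)
  then have t: "(of_int (tri n) :: complex) = of_int n * (of_int n - 1) / 2" by (simp add: mult.commute)
  have z: "lookup b P = 0" if "int (wt P) \<noteq> d" for P using b that by (auto simp: wset_def in_keys_iff)
  show ?thesis unfolding j
  proof (rule fock_sum_eqI)
    fix \<nu> P
    show "lookup (lookup (fsum_L0 1 (alpha_zero / 2) (ker_vec (n, d, b))) \<nu>) P =
      lookup (lookup (fsum_scale (of_int (tri (fst (n, d, b)) + fst (snd (n, d, b)))) (ker_vec (n, d, b))) \<nu>) P"
    proof (cases "\<nu> = of_int n \<and> int (wt P) = d")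
      case True
      then have d: "d = int (wt P)" "\<nu> = of_int n" by simp_all
      show ?thesis
        by (simp add: lookup_fsum_L0 lookup_fock_L0 lookup_ker_vec d t alpha_zero_def power2_eq_square field_simps)
    next
      case False
      then have "lookup (lookup (ker_vec (n, d, b)) \<nu>) P = 0" using z[of P]
        unfolding ker_vec_def by (auto simp: lookup_single when_def)
      then show ?thesis by (simp add: lookup_fsum_L0 lookup_fock_L0)
    qed
  qed
qed

lemma ker_fiber:
  "{j \<in> ker_index i. tri (fst j) + fst (snd j) = t} =
    (\<lambda>(n, b). (n, t - tri n, b)) ` (SIGMA n:{n. even (n - i) \<and> tri n \<le> t}. ker_basis n (t - tri n))" (is "?L = ?R")
proof (intro set_eqI iffI)
  fix j assume "j \<in> ?L"
  then obtain n d b where j: "j = (n, d, b)" "even (n - i)" "b \<in> ker_basis n d" "tri n + d = t" unfolding ker_index_def by auto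
  have "\<not> d < 0" using ker_basis_neg[of d n] j(3) by auto
  moreover have d: "d = t - tri n" using j(4) by simp
  ultimately show "j \<in> ?R" using j by (intro image_eqI[of _ _ "(n, b)"]) auto
next
  fix j assume "j \<in> ?R"
  then show "j \<in> ?L" unfolding ker_index_def by auto
qed

lemma ch_W_ker:
  assumes r: "r = 1 \<or> r = 2" and i: "i = int r - 1"
  shows "ch_W_defined r 1" "series_on (1 / 12) (ker_series i) (ch_W r 1)"
proof -
  let ?b = "\<lambda>j :: int \<times> int \<times> fock. of_int (tri (fst j) + fst (snd j)) :: complex"
  have z: "0 = fsum_scale 0 (ker_vec j)" for j by simp
  have one: "(1 :: complex) \<noteq> 0" by simp
  have fin: "finite {j \<in> ker_index i. tri (fst j) + fst (snd j) = t}" for t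
    unfolding ker_fiber by (intro finite_imageI finite_SigmaI finite_tri ker_basis(4))
  have crd: "card {j \<in> ker_index i. tri (fst j) + fst (snd j) = t} = ker_series i t" for t
  proof -
    have "inj_on (\<lambda>(n, b). (n, t - tri n, b)) (SIGMA n:{n. even (n - i) \<and> tri n \<le> t}. ker_basis n (t - tri n))"
      by (auto simp: inj_on_def)
    then show ?thesis unfolding ker_fiber ker_series_def
      by (subst card_image, assumption, subst card_SigmaI[OF finite_tri]) (simp_all add: ker_basis(4) ker_dim_def)
  qed
  have fib: "{j \<in> ker_index i. 0 = x \<and> ?b j = y} = (if x = 0 \<and> (\<exists>t. y = of_int t) then {j \<in> ker_index i. tri (fst j) + fst (snd j) = (THE t. y = of_int t)} else {})" for x y :: complex
  proof (cases "\<exists>t. y = of_int t")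
    case True
    then obtain t where y: "y = of_int t" by blast
    show ?thesis unfolding y by (simp only: of_int_eq_iff) auto
  next
    case False
    then have "\<not> (0 = x \<and> ?b j = y)" for j by (metis (no_types))
    then show ?thesis using False by (simp only: if_False simp_thms empty_def)
  qed
  have finb: "finite {j \<in> ker_index i. 0 = x \<and> ?b j = y}" for x y :: complex
  proof (cases "x = 0 \<and> (\<exists>t. y = of_int t)")
    case True
    show ?thesis unfolding fib if_P[OF True] by (rule fin)
  next
    case False
    show ?thesis unfolding fib if_not_P[OF False] by (rule finite.emptyI)
  qed
  have f0: "ch_W r 1 (x, y) = card {j \<in> ker_index i. 0 = x \<and> ?b j = y + (- 2) / 24}" for x y
    unfolding ch_W_def trace_series_def prod.case
    by (rule fsum.dim_joint_eigenspace_eigenbasis[OF linear_fsum_zero linear_fsum_L0[OF one] inj_ker_vec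
         independent_ker_vec triplet_simple_1_span[OF r i] z fsum_L0_ker_vec])
  show "ch_W_defined r 1"
    unfolding ch_W_defined_def
    by (rule fsum.trace_defined_eigenbasis[OF linear_fsum_zero linear_fsum_L0[OF one] inj_ker_vec
         independent_ker_vec triplet_simple_1_span[OF r i] z fsum_L0_ker_vec])
       (assumption, rule finb)
  show "series_on (1 / 12) (ker_series i) (ch_W r 1)"
    unfolding series_on_def
  proof (intro conjI allI impI)
    fix t
    have y: "1 / 12 + of_int t + (- 2) / 24 = (of_int t :: complex)" by simp
    show "ch_W r 1 (0, 1 / 12 + of_int t) = ker_series i t" unfolding f0 y fib crd[symmetric] by simp
  next
    fix x y assume nz: "ch_W r 1 (x, y) \<noteq> 0"
    then have xy: "x = 0 \<and> (\<exists>t. y + (- 2) / 24 = of_int t)" unfolding f0 fib by (auto split: if_splits)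
    then show "x = 0" by blast
    from xy obtain t where "y + (- 2) / 24 = of_int t" by blast
    then have "y = 1 / 12 + of_int t" by (simp add: algebra_simps)
    then show "\<exists>t. y = 1 / 12 + of_int t" by blast
  next
    fix t :: int assume "t < 0"
    have "\<not> tri n \<le> t" for n using tri_nonneg[of n] \<open>t < 0\<close> by linarith
    then show "ker_series i t = 0" unfolding ker_series_def by simp
  qed
qed

section \<open>Characters of spectral flow orbits\<close>

definition charge :: "int \<times> nat multiset \<times> nat multiset \<Rightarrow> int"
  where "charge = (\<lambda>(a, P, Q). a + int (size P) - int (size Q))"

definition mode_weight :: "int \<times> nat multiset \<times> nat multiset \<Rightarrow> int"
  where "mode_weight = (\<lambda>(a, P, Q). int (wt P + wt Q))"

definition sector_count :: "complex \<Rightarrow> int \<Rightarrow> int \<Rightarrow> nat"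
  where "sector_count \<rho> c d = (if \<rho> = 0 then bounded_pairs c d else pairs d)"

lemma sector_count_neg: "d < 0 \<Longrightarrow> sector_count \<rho> c d = 0"
  unfolding sector_count_def by (simp add: bounded_pairs_neg pairs_neg)

lemma sector_fiber:
  assumes "even (c - i)"
  shows "{j \<in> sector \<rho> i. charge j = c \<and> mode_weight j = d} =
    (\<lambda>(P, Q). (c - int (size P) + int (size Q), P, Q)) ` {(P, Q). int (wt P + wt Q) = d \<and> (\<rho> = 0 \<longrightarrow> int (size P) - int (size Q) \<le> c)}"
    (is "?L = ?g ` ?R")
proof (intro set_eqI iffI)
  fix j assume j: "j \<in> ?L"
  obtain a P Q where jj: "j = (a, P, Q)" by (cases j)
  have "(P, Q) \<in> ?R" "j = ?g (P, Q)" using j unfolding jj sector_def charge_def mode_weight_def by auto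
  then show "j \<in> ?g ` ?R" by (intro image_eqI)
next
  fix j assume "j \<in> ?g ` ?R"
  then obtain P Q where j: "(P, Q) \<in> ?R" "j = ?g (P, Q)" by auto
  have e: "c - int (size P) + int (size Q) + int (size P) - int (size Q) = c" by simp
  show "j \<in> ?L" unfolding j(2) sector_def charge_def mode_weight_def mem_Collect_eq prod.case e
    using j(1) assms by auto
qed

lemma sector_fiber_finite: "finite {j \<in> sector \<rho> i. charge j = c \<and> mode_weight j = d}"
proof (cases "even (c - i)")
  case True
  show ?thesis unfolding sector_fiber[OF True] by (intro finite_imageI finite_pairs)
next
  case False
  then have "{j \<in> sector \<rho> i. charge j = c \<and> mode_weight j = d} = {}" unfolding sector_def charge_def by auto
  then show ?thesis by (simp only: finite.emptyI)
qed

lemma sector_fiber_card: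
  assumes "even (c - i)"
  shows "card {j \<in> sector \<rho> i. charge j = c \<and> mode_weight j = d} = sector_count \<rho> c d"
  unfolding sector_fiber[OF assms]
  by (subst card_image) (auto simp: inj_on_def sector_count_def pairs_def bounded_pairs_def)

text \<open>
  A module with the basis of a sector, together with the data of an orbit: \<open>\<epsilon>\<close> is the number of steps of
  spectral flow from \<open>M\<close> to the module whose orbit is taken (\<open>0\<close> for \<open>\<rho> = -1/2\<close>, \<open>1\<close> for \<open>\<rho> = 0\<close>), and \<open>e c\<close>
  is the energy of the charge \<open>c\<close> in the exponent of \<open>q\<close>, measured from \<open>\<kappa>\<close>.
\<close>

locale eigenbasis =
  fixes M :: "'v::ab_group_add sl2_module" and \<rho> :: complex and i :: int and f :: "int \<times> nat multiset \<times> nat multiset \<Rightarrow> 'v"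
    and \<kappa> :: complex and e :: "int \<Rightarrow> int" and r \<epsilon> :: int
  assumes affine_M: "affine (- 1 / 2) M"
    and inj: "inj_on f (sector \<rho> i)"
    and indep: "\<not> module.dependent (scl M) (f ` sector \<rho> i)"
    and spans: "module.span (scl M) (f ` sector \<rho> i) = UNIV"
    and eig_h: "\<And>j. j \<in> sector \<rho> i \<Longrightarrow> hop M 0 (f j) = scl M (of_int (charge j) + \<rho> + 1/2) (f j)"
    and eig_L: "\<And>j. j \<in> sector \<rho> i \<Longrightarrow> sugawara_L0 (- 1 / 2) M (f j) = scl M (of_int (mode_weight j) - 1/8) (f j)"
    and eps: "of_int \<epsilon> = 2 * (\<rho> + 1/2)"
    and energy: "\<And>c. even (c - i) \<Longrightarrow> of_int (e c) = (of_int c + \<rho> + 1/2)\<^sup>2 / 2 - 1/8 - (\<kappa> - 1/12)"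
    and finite_energy: "\<And>t. finite {c. even (c - i) \<and> e c \<le> t}"
begin

interpretation M: affine "- 1 / 2" M by (rule affine_M)

abbreviation "orbit s \<equiv> spectral_flow (- 1 / 2) (r + s + \<epsilon>) M"

abbreviation "coeff s \<equiv> sl2_ch (- 1 / 2) (orbit s)"

text \<open>
  Completing the square: in terms of the eigenvalue \<open>x\<close> of \<open>h_0\<close>, that of \<open>L_0\<close> is \<open>- x^2 / 2\<close> plus a quantity
  that does not depend on the amount of flow.
\<close>

lemma orbit_eigen:
  assumes j: "j \<in> sector \<rho> i"
  shows "hop (orbit s) 0 (f j) = scl M (of_int (charge j) - of_int (r + s) / 2) (f j)"
    and "sugawara_L0 (- 1 / 2) (orbit s) (f j) = scl M (of_int (mode_weight j + e (charge j)) + \<kappa> - 1/12 -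
      (of_int (charge j) - of_int (r + s) / 2)\<^sup>2 / 2) (f j)"
proof -
  have ev: "even (charge j - i)" using j unfolding sector_def charge_def by auto
  have s: "scl M a (f j) + scl M b (f j) = scl M (a + b) (f j)" for a b by (simp add: M.V.scale_left_distrib)
  have h: "hop (orbit s) 0 (f j) = scl M (of_int (charge j) + \<rho> + 1/2 + of_int (r + s + \<epsilon>) * (- 1 / 2)) (f j)"
    unfolding spectral_flow_sel eig_h[OF j] by (simp only: simp_thms if_True s)
  have 1: "of_int (charge j) + \<rho> + 1/2 + of_int (r + s + \<epsilon>) * (- 1 / 2) = of_int (charge j) - of_int (r + s) / 2"
    by (simp add: eps field_simps)
  show "hop (orbit s) 0 (f j) = scl M (of_int (charge j) - of_int (r + s) / 2) (f j)" unfolding h 1 ..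
  define \<delta> where "\<delta> = \<rho> + 1/2"
  define c where "c = (of_int (charge j) :: complex)"
  define u where "u = (of_int (r + s) :: complex)"
  have sig: "(of_int (r + s + \<epsilon>) :: complex) = u + 2 * \<delta>" by (simp add: u_def \<delta>_def eps)
  have en: "(of_int (e (charge j)) :: complex) = (c + \<delta>)\<^sup>2 / 2 - 1/8 - (\<kappa> - 1/12)"
    using energy[OF ev] by (simp add: c_def \<delta>_def add.assoc)
  have k2: "- 1 / 2 + 2 \<noteq> (0 :: complex)" by simp
  have h0: "hop M 0 (f j) = scl M (c + \<delta>) (f j)" using eig_h[OF j] by (simp add: c_def \<delta>_def add.assoc)
  have "sugawara_L0 (- 1 / 2) (orbit s) (f j) = scl M (of_int (mode_weight j) - 1/8 + (u + 2 * \<delta>) / 2 * (c + \<delta>) + (u + 2 * \<delta>)\<^sup>2 * (- 1 / 2) / 4) (f j)"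
    unfolding M.sugawara_flow[OF k2] eig_L[OF j] h0 sig M.V.scale_scale s ..
  also have "of_int (mode_weight j) - 1/8 + (u + 2 * \<delta>) / 2 * (c + \<delta>) + (u + 2 * \<delta>)\<^sup>2 * (- 1 / 2) / 4 =
      of_int (mode_weight j + e (charge j)) + \<kappa> - 1/12 - (c - u / 2)\<^sup>2 / 2"
    unfolding of_int_add en by (simp add: power2_eq_square field_simps)
  finally show "sugawara_L0 (- 1 / 2) (orbit s) (f j) = scl M (of_int (mode_weight j + e (charge j)) + \<kappa> - 1/12 -
      (of_int (charge j) - of_int (r + s) / 2)\<^sup>2 / 2) (f j)" unfolding c_def u_def .
qed

lemma orbit_linear:
  "Vector_Spaces.linear (scl M) (scl M) (hop (orbit s) 0)"
  "Vector_Spaces.linear (scl M) (scl M) (sugawara_L0 (- 1 / 2) (orbit s))"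
proof -
  interpret F: affine "- 1 / 2" "orbit s" by (rule M.spectral_flow_affine)
  show "Vector_Spaces.linear (scl M) (scl M) (hop (orbit s) 0)" using F.linear_h[of 0] by (simp only: spectral_flow_sel(1))
  show "Vector_Spaces.linear (scl M) (scl M) (sugawara_L0 (- 1 / 2) (orbit s))" using F.linear_sugawara by (simp only: spectral_flow_sel(1))
qed

lemma coeff_card:
  "coeff s (x, y) = card {j \<in> sector \<rho> i. of_int (charge j) - of_int (r + s) / 2 = x \<and>
     of_int (mode_weight j + e (charge j)) + \<kappa> - 1/12 - (of_int (charge j) - of_int (r + s) / 2)\<^sup>2 / 2 = y + (- 1) / 24}"
proof -
  \<comment> \<open>The shift by \<open>- c/24 = 1/24\<close> matches that of the Heisenberg character and of \<open>c = -2\<close>: \<open>1/24 = - 1/24 + 1/12\<close>.\<close>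
  have cc: "sl2_central_charge (- 1 / 2) = - 1" by (simp add: sl2_central_charge_def)
  show ?thesis
    unfolding sl2_ch_def trace_series_def prod.case cc spectral_flow_sel(1)
    by (rule M.V.dim_joint_eigenspace_eigenbasis[OF orbit_linear inj indep spans[symmetric] orbit_eigen])
qed

lemma level_fiber:
  assumes "of_int c - of_int (r + s) / 2 = x" "y = - x\<^sup>2 / 2 - 1 / 24 + \<kappa> + of_int t"
  shows "{j \<in> sector \<rho> i. of_int (charge j) - of_int (r + s) / 2 = x \<and>
     of_int (mode_weight j + e (charge j)) + \<kappa> - 1/12 - (of_int (charge j) - of_int (r + s) / 2)\<^sup>2 / 2 = y + (- 1) / 24} =
     {j \<in> sector \<rho> i. charge j = c \<and> mode_weight j = t - e c}"
proof -
  have a: "(of_int (charge j) - of_int (r + s) / 2 = x) = (charge j = c)" for j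
    unfolding assms(1)[symmetric] by simp
  have b: "(of_int (mode_weight j + e c) + \<kappa> - 1/12 - x\<^sup>2 / 2 = y + (- 1) / 24) = (mode_weight j = t - e c)" for j
  proof -
    have "(of_int (mode_weight j + e c) + \<kappa> - 1/12 - x\<^sup>2 / 2 = y + (- 1) / 24) = ((of_int (mode_weight j + e c) :: complex) = of_int t)"
      unfolding assms(2) by (simp add: algebra_simps)
    then show ?thesis unfolding of_int_eq_iff by auto
  qed
  have "(of_int (charge j) - of_int (r + s) / 2 = x \<and>
     of_int (mode_weight j + e (charge j)) + \<kappa> - 1/12 - (of_int (charge j) - of_int (r + s) / 2)\<^sup>2 / 2 = y + (- 1) / 24)
     = (charge j = c \<and> mode_weight j = t - e c)" for j
    using a[of j] b[of j] by metis
  then show ?thesis by simp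
qed

lemma coeff_value:
  assumes s: "s = 4 * u" and c: "even (c - i)" and x: "of_int c - of_int (r + s) / 2 = x"
  shows "coeff s (x, - x\<^sup>2 / 2 - 1 / 24 + \<kappa> + of_int t) = sector_count \<rho> c (t - e c)"
  unfolding coeff_card level_fiber[OF x refl] by (rule sector_fiber_card[OF c])

lemma coeff_support:
  assumes s: "s = 4 * u" and nz: "j \<in> sector \<rho> i" "of_int (charge j) - of_int (r + s) / 2 = x"
     "of_int (mode_weight j + e (charge j)) + \<kappa> - 1/12 - (of_int (charge j) - of_int (r + s) / 2)\<^sup>2 / 2 = y + (- 1) / 24"
  shows "(\<exists>m. x = (of_int i - of_int r / 2) + of_int m * 2) \<and> (\<exists>t. y = - x\<^sup>2 / 2 - 1 / 24 + \<kappa> + of_int t)"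
proof
  have "even (charge j - i)" using nz(1) unfolding sector_def charge_def by auto
  then obtain w where "charge j - i = 2 * w" by (elim evenE)
  then have w: "charge j = i + 2 * w" by simp
  show "\<exists>m. x = (of_int i - of_int r / 2) + of_int m * 2"
    by (intro exI[of _ "w - u"]) (simp add: nz(2)[symmetric] w s field_simps)
  have "y = - x\<^sup>2 / 2 - 1 / 24 + \<kappa> + of_int (mode_weight j + e (charge j))"
    using nz(3) unfolding nz(2) by (simp add: algebra_simps)
  then show "\<exists>t. y = - x\<^sup>2 / 2 - 1 / 24 + \<kappa> + of_int t" ..
qed

lemma coeff_nonzero:
  assumes s: "s = 4 * u" and nz: "coeff s (x, y) \<noteq> 0"
  shows "(\<exists>m. x = (of_int i - of_int r / 2) + of_int m * 2) \<and> (\<exists>t. y = - x\<^sup>2 / 2 - 1 / 24 + \<kappa> + of_int t)"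
proof -
  let ?S = "{j \<in> sector \<rho> i. of_int (charge j) - of_int (r + s) / 2 = x \<and>
     of_int (mode_weight j + e (charge j)) + \<kappa> - 1/12 - (of_int (charge j) - of_int (r + s) / 2)\<^sup>2 / 2 = y + (- 1) / 24}"
  have "?S \<noteq> {}" using nz unfolding coeff_card by (intro notI) (simp only: card.empty)
  then obtain j where "j \<in> ?S" by (meson ex_in_conv)
  then show ?thesis by (intro coeff_support[OF s, of j]) blast+
qed

lemma orbit_ch_defined:
  assumes s: "s = 4 * u"
  shows "sl2_ch_defined (- 1 / 2) (orbit s)"
  unfolding sl2_ch_defined_def spectral_flow_sel(1)
proof (rule M.V.trace_defined_eigenbasis[OF orbit_linear inj indep spans[symmetric] orbit_eigen])
  fix x y' :: complex
  define y where "y = y' - (- 1) / 24"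
  let ?S = "{j \<in> sector \<rho> i. of_int (charge j) - of_int (r + s) / 2 = x \<and>
     of_int (mode_weight j + e (charge j)) + \<kappa> - 1/12 - (of_int (charge j) - of_int (r + s) / 2)\<^sup>2 / 2 = y + (- 1) / 24}"
  have "finite ?S"
  proof (cases "?S = {}")
    case True
    then show ?thesis by (simp only: finite.emptyI)
  next
    case False
    then obtain j where j: "j \<in> ?S" by (meson ex_in_conv)
    have c: "of_int (charge j) - of_int (r + s) / 2 = x" using j by simp
    obtain t where t: "y = - x\<^sup>2 / 2 - 1 / 24 + \<kappa> + of_int t"
    proof -
      have "\<exists>t. y = - x\<^sup>2 / 2 - 1 / 24 + \<kappa> + of_int t"
        by (rule conjunct2[OF coeff_support[OF s, of j]]) (use j in blast)+
      then show ?thesis using that by blast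
    qed
    show ?thesis unfolding level_fiber[OF c t] by (rule sector_fiber_finite)
  qed
  then show "finite {j \<in> sector \<rho> i. of_int (charge j) - of_int (r + s) / 2 = x \<and>
     of_int (mode_weight j + e (charge j)) + \<kappa> - 1/12 - (of_int (charge j) - of_int (r + s) / 2)\<^sup>2 / 2 = y'}"
    unfolding y_def by simp
qed

text \<open>
  For fixed \<open>x\<close> the flow parameter and the charge determine each other by \<open>s = 2 (c - i) - 4 m\<close>, and
  \<open>4\<close> divides \<open>s\<close> exactly if \<open>c\<close> has the parity of \<open>i\<close>.
\<close>

lemma orbit_sum:
  assumes x: "x = (of_int i - of_int r / 2) + of_int m * 2"
  shows "(\<lambda>s. coeff s (x, - x\<^sup>2 / 2 - 1 / 24 + \<kappa> + of_int t)) summable_on {s. 4 dvd s}"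
    and "infsum (\<lambda>s. coeff s (x, - x\<^sup>2 / 2 - 1 / 24 + \<kappa> + of_int t)) {s. 4 dvd s} =
      (\<Sum>c | even (c - i) \<and> e c \<le> t. sector_count \<rho> c (t - e c))"
proof -
  let ?C = "{c. even (c - i) \<and> e c \<le> t}" and ?g = "\<lambda>c. 2 * (c - i) - 4 * m"
  let ?F = "\<lambda>s. coeff s (x, - x\<^sup>2 / 2 - 1 / 24 + \<kappa> + of_int t)"
  have val: "?F (?g c) = sector_count \<rho> c (t - e c)" if c: "even (c - i)" for c
  proof -
    obtain w where w: "c - i = 2 * w" using c by (elim evenE)
    show ?thesis
    proof (rule coeff_value[OF _ c])
      show "?g c = 4 * (w - m)" using w by simp
      show "of_int c - of_int (r + ?g c) / 2 = x" by (simp add: x field_simps)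
    qed
  qed
  have zero: "?F s = 0" if s: "s \<in> {s. 4 dvd s} - ?g ` ?C" for s
  proof -
    obtain u where u: "s = 4 * u" using s by (auto elim: dvdE)
    define c where "c = i + 2 * m + 2 * u"
    have g: "s = ?g c" and ev: "even (c - i)" by (simp_all add: c_def u)
    have "\<not> e c \<le> t" using s g ev by blast
    then show ?thesis unfolding g val[OF ev] by (intro sector_count_neg) simp
  qed
  have sub: "?g ` ?C \<subseteq> {s. 4 dvd s}"
  proof (rule image_subsetI)
    fix c assume "c \<in> ?C"
    then have "even (c - i)" by blast
    then obtain w where "c - i = 2 * w" by (elim evenE)
    then have "?g c = 4 * (w - m)" by simp
    then show "?g c \<in> {s. 4 dvd s}" by (simp only: mem_Collect_eq dvd_triv_left)
  qed
  note fs = infsum_finite_support[of "?g ` ?C" "{s. 4 dvd s}" ?F, OF finite_imageI[OF finite_energy] sub zero]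
  show "?F summable_on {s. 4 dvd s}" by (rule fs(2))
  have "sum ?F (?g ` ?C) = (\<Sum>c\<in>?C. sector_count \<rho> c (t - e c))"
  proof (rule sum.reindex_cong[of ?g])
    show "?F (?g c) = sector_count \<rho> c (t - e c)" if "c \<in> ?C" for c using that val by blast
  qed (auto simp: inj_on_def)
  then show "infsum ?F {s. 4 dvd s} = (\<Sum>c\<in>?C. sector_count \<rho> c (t - e c))" using fs(1) by (rule trans[rotated])
qed

text \<open>
  Both series live on \<open>x \<in> l + 2\<int>\<close> and on the same translates of \<open>\<int>\<close> in the exponent of \<open>q\<close>, so it
  suffices to compare the sequences in \<open>t\<close>.
\<close>

theorem orbit_character:
  assumes F: "series_on \<kappa> w F"
    and id: "\<And>t. (\<Sum>j\<in>{0..t}. part_int j * w (t - j)) = (\<Sum>c | even (c - i) \<and> e c \<le> t. sector_count \<rho> c (t - e c))"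
  shows "fs_summable {s. 4 dvd s} coeff"
    and "fs_sum {s. 4 dvd s} coeff = fs_mult (ch_VD (of_int i - of_int r / 2)) F"
proof -
  let ?on = "\<lambda>x y. (\<exists>m. x = (of_int i - of_int r / 2) + of_int m * 2) \<and> (\<exists>t. y = - x\<^sup>2 / 2 - 1 / 24 + \<kappa> + of_int t)"
  have off: "coeff s (x, y) = 0" if "\<not> ?on x y" "s \<in> {s. 4 dvd s}" for s x y
  proof -
    obtain u where "s = 4 * u" using \<open>s \<in> {s. 4 dvd s}\<close> by (auto elim: dvdE)
    then show ?thesis using coeff_nonzero[of s u x y] \<open>\<not> ?on x y\<close> by blast
  qed
  have both: "(\<lambda>s. coeff s (x, y)) summable_on {s. 4 dvd s} \<and>
      infsum (\<lambda>s. coeff s (x, y)) {s. 4 dvd s} = fs_mult (ch_VD (of_int i - of_int r / 2)) F (x, y)" for x y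
  proof (cases "?on x y")
    case True
    then obtain m t where m: "x = (of_int i - of_int r / 2) + of_int m * 2" and t: "y = - x\<^sup>2 / 2 - 1 / 24 + \<kappa> + of_int t" by blast
    show ?thesis unfolding t product_with_VD(2)[OF F m] orbit_sum(2)[OF m] id using orbit_sum(1)[OF m] by blast
  next
    case False
    have "fs_mult (ch_VD (of_int i - of_int r / 2)) F (x, y) = 0" using product_with_VD(3)[OF F] False by blast
    moreover have "infsum (\<lambda>s. coeff s (x, y)) {s. 4 dvd s} = 0" by (rule infsum_0) (rule off[OF False])
    moreover have "(\<lambda>s. coeff s (x, y)) summable_on {s. 4 dvd s}" by (rule summable_on_0) (rule off[OF False])
    ultimately show ?thesis by simp
  qed
  show "fs_summable {s. 4 dvd s} coeff" unfolding fs_summable_def using both by simp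
  show "fs_sum {s. 4 dvd s} coeff = fs_mult (ch_VD (of_int i - of_int r / 2)) F"
    unfolding fs_sum_def using both by (simp add: fun_eq_iff)
qed

end

lemma fock_series_convolution:
  assumes i: "i = 0 \<or> i = 1"
  shows "(\<Sum>j\<in>{0..t}. part_int j * fock_series i (t - j)) = (\<Sum>n | even (n - i) \<and> sq i n \<le> t. pairs (t - sq i n))"
proof -
  let ?C = "{n. even (n - i) \<and> sq i n \<le> t}"
  have "fock_series i (t - j) = (\<Sum>n\<in>?C. part_int (t - j - sq i n))" if "j \<in> {0..t}" for j
    unfolding fock_series_def
    by (rule sum.mono_neutral_left[OF finite_sq[OF i]]) (use that in \<open>auto simp: part_int_def\<close>)
  then have "(\<Sum>j\<in>{0..t}. part_int j * fock_series i (t - j)) = (\<Sum>j\<in>{0..t}. \<Sum>n\<in>?C. part_int j * part_int (t - j - sq i n))"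
    by (simp add: sum_distrib_left)
  also have "\<dots> = (\<Sum>n\<in>?C. \<Sum>j\<in>{0..t}. part_int j * part_int (t - j - sq i n))" by (rule sum.swap)
  also have "\<dots> = (\<Sum>n\<in>?C. pairs (t - sq i n))"
  proof (rule sum.cong[OF refl])
    fix n assume n: "n \<in> ?C"
    then have "sq i n \<ge> 0" using sq_nonneg[OF i] by blast
    then have "(\<Sum>j\<in>{0..t}. part_int j * part_int (t - j - sq i n)) = (\<Sum>j\<in>{0..t - sq i n}. part_int j * part_int (t - j - sq i n))"
      by (intro sum.mono_neutral_right) (auto simp: part_int_def)
    then show "(\<Sum>j\<in>{0..t}. part_int j * part_int (t - j - sq i n)) = pairs (t - sq i n)"
      unfolding pairs_convolution by (simp add: algebra_simps)
  qed
  finally show ?thesis .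
qed

text \<open>
  The index ranges of the two sums differ, but each of the extra terms vanishes.
\<close>

lemma ker_series_convolution:
  "(\<Sum>j\<in>{0..t}. part_int j * ker_series i (t - j)) = (\<Sum>n | even (n - i) \<and> tri (n + 1) \<le> t. bounded_pairs n (t - tri (n + 1)))"
proof -
  let ?C = "{n. even (n - i) \<and> tri n \<le> t}" and ?C' = "{n. even (n - i) \<and> tri (n + 1) \<le> t}"
  have fC: "finite ?C" by (rule finite_tri)
  have fC': "finite ?C'"
  proof (rule finite_subset[OF _ finite_abs_le[of "t + 2"]])
    have "\<bar>n\<bar> \<le> t + 2" if "tri (n + 1) \<le> t" for n using tri_bound[of "n + 1"] that by linarith
    then show "?C' \<subseteq> {n. \<bar>n\<bar> \<le> t + 2}" by blast
  qed
  have "ker_series i (t - j) = (\<Sum>n\<in>?C. ker_dim n (t - j - tri n))" if "j \<in> {0..t}" for j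
    unfolding ker_series_def
    by (rule sum.mono_neutral_left[OF fC]) (use that in \<open>auto intro!: ker_dim_neg\<close>)
  then have "(\<Sum>j\<in>{0..t}. part_int j * ker_series i (t - j)) = (\<Sum>j\<in>{0..t}. \<Sum>n\<in>?C. part_int j * ker_dim n (t - j - tri n))"
    by (simp add: sum_distrib_left)
  also have "\<dots> = (\<Sum>n\<in>?C. \<Sum>j\<in>{0..t}. part_int j * ker_dim n (t - j - tri n))" by (rule sum.swap)
  also have "\<dots> = (\<Sum>n\<in>?C. bounded_pairs n (t - tri (n + 1)))" by (simp only: ker_convolution_eq_bounded_pairs)
  also have "\<dots> = (\<Sum>n\<in>?C \<union> ?C'. bounded_pairs n (t - tri (n + 1)))"
  proof (rule sum.mono_neutral_left)
    show "\<forall>n\<in>?C \<union> ?C' - ?C. bounded_pairs n (t - tri (n + 1)) = 0"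
    proof
      fix n assume "n \<in> ?C \<union> ?C' - ?C"
      then have "t < tri n" by auto
      then have "ker_dim n (t - j - tri n) = 0" if "j \<in> {0..t}" for j using that by (intro ker_dim_neg) auto
      then show "bounded_pairs n (t - tri (n + 1)) = 0" unfolding ker_convolution_eq_bounded_pairs[symmetric] by simp
    qed
  qed (use fC fC' in auto)
  also have "\<dots> = (\<Sum>n\<in>?C'. bounded_pairs n (t - tri (n + 1)))"
    by (rule sum.mono_neutral_right) (use fC fC' in \<open>auto intro!: bounded_pairs_neg\<close>)
  finally show ?thesis .
qed

section \<open>Standard modules\<close>

context affine begin

definition ground_weight :: "complex \<Rightarrow> 'v \<Rightarrow> bool"
  where "ground_weight a v \<longleftrightarrow> v \<in> ground_states M \<and> hop M 0 v = scl M a v"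

lemma ground_weight_scale: "ground_weight a v \<Longrightarrow> ground_weight a (scl M c v)"
  unfolding ground_weight_def ground_states_def by (simp add: lin mult.commute)

lemma ground_weight_e: "ground_weight a v \<Longrightarrow> ground_weight (a + 2) (eop M 0 v)"
proof -
  assume v: "ground_weight a v"
  then have 0: "eop M n v = 0" "fop M n v = 0" "hop M n v = 0" if "n > 0" for n
    using that unfolding ground_weight_def ground_states_def by auto
  have "eop M n (eop M 0 v) = eop M 0 (eop M n v)" for n by (rule bracket_ee)
  then have "eop M 0 v \<in> ground_states M" unfolding ground_states_def by (simp add: 0 he fe lin)
  moreover have "hop M 0 (eop M 0 v) = scl M (a + 2) (eop M 0 v)"
    using v unfolding ground_weight_def by (simp add: he lin V.scale_left_distrib)
  ultimately show ?thesis unfolding ground_weight_def by blast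
qed

lemma ground_weight_f: "ground_weight a v \<Longrightarrow> ground_weight (a - 2) (fop M 0 v)"
proof -
  assume v: "ground_weight a v"
  then have 0: "eop M n v = 0" "fop M n v = 0" "hop M n v = 0" if "n > 0" for n
    using that unfolding ground_weight_def ground_states_def by auto
  have "eop M n (fop M 0 v) = 0" if "n > 0" for n
    using fe[of 0 n v] that by (simp add: 0 lin)
  moreover have "fop M n (fop M 0 v) = fop M 0 (fop M n v)" for n by (rule bracket_ff)
  ultimately have "fop M 0 v \<in> ground_states M" unfolding ground_states_def by (simp add: 0 hf lin)
  moreover have "hop M 0 (fop M 0 v) = scl M (a - 2) (fop M 0 v)"
    using v unfolding ground_weight_def by (simp add: hf lin V.scale_left_diff_distrib)
  ultimately show ?thesis unfolding ground_weight_def by blast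
qed

lemma ground_fe:
  "ground_weight a v \<Longrightarrow> fop M 0 (eop M 0 v) = eop M 0 (fop M 0 v) + scl M a v"
  unfolding ground_weight_def by (simp add: fe)

text \<open>
  The prescribed value \<open>-1/8\<close> of \<open>L_0\<close> fixes the Casimir operator on the ground states, hence \<open>e_0 f_0\<close>.
\<close>

lemma ground_ef:
  assumes k: "k = - 1 / 2" and v: "ground_weight a v" and L: "sugawara_L0 k M v = scl M (- 1 / 8) v"
  shows "eop M 0 (fop M 0 v) = scl M ((a - 1/2) * (a - 3/2) / 4) v"
proof -
  let ?y = "eop M 0 (fop M 0 v)"
  have "killed_above M 0 v" using v unfolding killed_above_def ground_weight_def ground_states_def by auto
  then have "scl M (- 1 / 8) v = scl M (1 / (2 * (k + 2))) (sug_zero M v)"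
    using sugawara_bounded[of 0 v] L by simp
  also have "sug_zero M v = scl M (a * a / 2 - a) v - scl M 2 ?y"
    using v ground_fe[OF v] unfolding sug_zero_def ground_weight_def
    by (simp add: lin two_scale V.scale_left_diff_distrib)
  finally have "scl M 3 (scl M (- 1 / 8) v) = scl M 3 (scl M (1 / 3) (scl M (a * a / 2 - a) v - scl M 2 ?y))"
    by (simp add: k)
  then have "scl M (- 3 / 8) v = scl M (a * a / 2 - a) v - scl M 2 ?y" by simp
  then have "scl M 2 ?y = scl M (a * a / 2 - a) v - scl M (- 3 / 8) v" by (simp add: eq_diff_eq diff_eq_eq add.commute)
  also have "\<dots> = scl M (a * a / 2 - a + 3 / 8) v" by (simp only: V.scale_left_diff_distrib[symmetric]) simp
  finally have "scl M (1/2) (scl M 2 ?y) = scl M (1/2) (scl M (a * a / 2 - a + 3 / 8) v)" by (simp only:)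
  then have "?y = scl M (1/2 * (a * a / 2 - a + 3 / 8)) v" by (simp only: V.scale_scale) simp
  also have "1/2 * (a * a / 2 - a + 3 / 8) = (a - 1/2) * (a - 3/2) / 4" by (simp add: field_simps)
  finally show ?thesis .
qed

end

text \<open>
  For integral \<open>a\<close> the factor \<open>(a - 1/2) (a - 3/2)\<close> never vanishes, so \<open>e_0\<close> and \<open>f_0\<close> carry one ground
  state to all weights of its parity. The normalization makes \<open>e_0\<close> act by \<open>1/2\<close> throughout, as in the
  model.
\<close>

lemma standard_eigenbasis:
  fixes M :: "'v::ab_group_add sl2_module"
  assumes i: "i = 0 \<or> i = (1::int)" and std: "is_standard_module (of_int i) M"
  shows "\<exists>f. inj_on f (sector (- 1 / 2) i) \<and> \<not> module.dependent (scl M) (f ` sector (- 1 / 2) i) \<and>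
    module.span (scl M) (f ` sector (- 1 / 2) i) = UNIV \<and>
    (\<forall>(a, P, Q)\<in>sector (- 1 / 2) i. hop M 0 (f (a, P, Q)) = scl M (of_int (a + int (size P) - int (size Q)) + (- 1 / 2) + 1/2) (f (a, P, Q)) \<and>
      sugawara_L0 (- 1 / 2) M (f (a, P, Q)) = scl M (of_nat (wt P + wt Q) - 1 / 8) (f (a, P, Q)))"
proof -
  have M: "affine (- 1 / 2) M" and irr: "irreducible_sl2 M"
    using std unfolding is_standard_module_def affine_def level_def by simp_all
  interpret M: affine "- 1 / 2" M by (rule M)
  let ?G = "{v \<in> ground_states M. hop M 0 v = scl M (of_int i + 2 * of_int 0) v}"
  have "M.V.dim ?G = 1" using std unfolding is_standard_module_def Let_def by blast
  then have "\<not> ?G \<subseteq> {0}" using M.V.dim_le_card[of ?G "{}"] by auto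
  then obtain w where w: "w \<noteq> 0" "M.ground_weight (of_int i) w" unfolding M.ground_weight_def by auto
  have L: "sugawara_L0 (- 1 / 2) M v = scl M (- 1 / 8) v" if "M.ground_weight a v" for a v
    using std that unfolding is_standard_module_def level_def M.ground_weight_def by blast
  \<comment> \<open>The coefficient of \<open>f_0\<close> in the model, \<open>\<partial>^2 / 2\<close> acting on \<open>x^(a - 1/2)\<close>.\<close>
  define d where "d a = (of_int a - 1/2) * (of_int a - 3/2) / (2 :: complex)" for a :: int
  have d0: "d a \<noteq> 0" for a
    using half_odd_nonzero[of "- 1" a] half_odd_nonzero[of "- 3" a] by (simp add: d_def)
  have ef: "eop M 0 (fop M 0 v) = scl M (d a / 2) v" if "M.ground_weight (of_int a) v" for a v
    using M.ground_ef[OF refl that L[OF that]] by (simp add: d_def)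
  have fe: "fop M 0 (eop M 0 v) = scl M (d (a + 2) / 2) v" if "M.ground_weight (of_int a) v" for a v
  proof -
    have "fop M 0 (eop M 0 v) = scl M (d a / 2 + of_int a) v"
      unfolding M.ground_fe[OF that] ef[OF that] by (simp only: M.V.scale_left_distrib)
    also have "d a / 2 + of_int a = d (a + 2) / 2" by (simp add: d_def field_simps)
    finally show ?thesis .
  qed
  define up where "up n = ((\<lambda>v. scl M 2 (eop M 0 v)) ^^ n) w" for n :: nat
  have up_0: "up 0 = w" and up_Suc: "up (Suc n) = scl M 2 (eop M 0 (up n))" for n by (simp_all add: up_def)
  define dn where "dn = rec_nat w (\<lambda>n v. scl M (1 / d (i - 2 * int n)) (fop M 0 v))"
  have dn_0: "dn 0 = w" and dn_Suc: "dn (Suc n) = scl M (1 / d (i - 2 * int n)) (fop M 0 (dn n))" for n by (simp_all add: dn_def)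
  have gup: "M.ground_weight (of_int (i + 2 * int n)) (up n)" for n
  proof (induction n)
    case (Suc n)
    have "of_int (i + 2 * int n) + 2 = (of_int (i + 2 * int (Suc n)) :: complex)" by simp
    then show ?case unfolding up_Suc using M.ground_weight_scale[OF M.ground_weight_e[OF Suc]] by (simp only:)
  qed (simp add: up_0 w)
  have gdn: "M.ground_weight (of_int (i - 2 * int n)) (dn n)" for n
  proof (induction n)
    case (Suc n)
    have "of_int (i - 2 * int n) - 2 = (of_int (i - 2 * int (Suc n)) :: complex)" by simp
    then show ?case unfolding dn_Suc using M.ground_weight_scale[OF M.ground_weight_f[OF Suc]] by (simp only:)
  qed (simp add: dn_0 w)
  have f_up: "fop M 0 (up (Suc n)) = scl M (d (i + 2 * int (Suc n))) (up n)" for n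
  proof -
    have "fop M 0 (up (Suc n)) = scl M (2 * (d (i + 2 * int n + 2) / 2)) (up n)"
      unfolding up_Suc M.lin fe[OF gup] M.V.scale_scale ..
    then show ?thesis by (simp add: add.commute add.left_commute)
  qed
  have e_dn: "eop M 0 (dn (Suc n)) = scl M (1/2) (dn n)" for n
  proof -
    have "eop M 0 (dn (Suc n)) = scl M (1 / d (i - 2 * int n) * (d (i - 2 * int n) / 2)) (dn n)"
      unfolding dn_Suc M.lin ef[OF gdn] M.V.scale_scale ..
    then show ?thesis using d0 by simp
  qed
  have f_dn: "fop M 0 (dn n) = scl M (d (i - 2 * int n)) (dn (Suc n))" for n
    unfolding dn_Suc M.V.scale_scale using d0 by simp
  have e_up: "eop M 0 (up n) = scl M (1/2) (up (Suc n))" for n unfolding up_Suc M.V.scale_scale by simp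
  have nz_up: "up n \<noteq> 0" for n
  proof (induction n)
    case (Suc n)
    show ?case
    proof
      assume "up (Suc n) = 0"
      then have "scl M (d (i + 2 * int (Suc n))) (up n) = 0" using f_up[of n] by (simp add: M.lin)
      then show False using Suc d0 by simp
    qed
  qed (simp add: up_0 w)
  have nz_dn: "dn n \<noteq> 0" for n
  proof (induction n)
    case (Suc n)
    show ?case
    proof
      assume "dn (Suc n) = 0"
      then have "scl M (1/2) (dn n) = 0" using e_dn[of n] by (simp add: M.lin)
      then show False using Suc by simp
    qed
  qed (simp add: dn_0 w)
  \<comment> \<open>One half-line is reached with \<open>e_0\<close>, the other with \<open>f_0\<close>; they share the starting vector.\<close>
  define u where "u a = (if a \<ge> i then up (nat ((a - i) div 2)) else dn (nat ((i - a) div 2)))" for a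
  have u_up: "u (i + 2 * int n) = up n" for n by (simp add: u_def)
  have u_dn: "u (i - 2 * int n) = dn n" for n by (cases "n = 0") (simp_all add: u_def up_0 dn_0)
  have split: "(\<exists>n. a = i + 2 * int n) \<or> (\<exists>n. a = i - 2 * int (Suc n))" if a: "even (a - i)" for a
  proof -
    obtain b where b: "a - i = 2 * b" using a by (elim evenE)
    show ?thesis
    proof (cases "b \<ge> 0")
      case True
      then have "a = i + 2 * int (nat b)" using b by simp
      then show ?thesis by blast
    next
      case False
      then have "a = i - 2 * int (Suc (nat (- b - 1)))" using b by simp
      then show ?thesis by blast
    qed
  qed
  have all: "u a \<noteq> 0 \<and> M.ground_weight (of_int a) (u a) \<and> eop M 0 (u a) = scl M (1/2) (u (a + 2)) \<and>
      fop M 0 (u a) = scl M (d a) (u (a - 2))" if a: "even (a - i)" for a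
    using split[OF a]
  proof (elim disjE exE)
    fix n assume a: "a = i + 2 * int n"
    have 1: "u a = up n" unfolding a by (rule u_up)
    have "a + 2 = i + 2 * int (Suc n)" by (simp add: a)
    then have 2: "u (a + 2) = up (Suc n)" by (simp only: u_up)
    have 3: "fop M 0 (u a) = scl M (d a) (u (a - 2))"
    proof (cases n)
      case 0
      have "a - 2 = i - 2 * int (Suc 0)" "a = i - 2 * int 0" by (simp_all add: a 0)
      then have "u (a - 2) = dn (Suc 0)" "u a = dn 0" "d a = d (i - 2 * int 0)" by (simp_all only: u_dn)
      then show ?thesis using f_dn[of 0] by (simp only:)
    next
      case (Suc m)
      have "a - 2 = i + 2 * int m" "a = i + 2 * int (Suc m)" by (simp_all add: a Suc)
      then have "u (a - 2) = up m" "u a = up (Suc m)" "d a = d (i + 2 * int (Suc m))" by (simp_all only: u_up)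
      then show ?thesis using f_up[of m] by (simp only:)
    qed
    show ?thesis using nz_up gup[of n] e_up 3 unfolding 1 2 a[symmetric] by blast
  next
    fix n assume a: "a = i - 2 * int (Suc n)"
    have 1: "u a = dn (Suc n)" unfolding a by (rule u_dn)
    have "a + 2 = i - 2 * int n" by (simp add: a)
    then have 2: "u (a + 2) = dn n" by (simp only: u_dn)
    have "a - 2 = i - 2 * int (Suc (Suc n))" by (simp add: a)
    then have 3: "u (a - 2) = dn (Suc (Suc n))" by (simp only: u_dn)
    show ?thesis using nz_dn gdn[of "Suc n"] e_dn f_dn[of "Suc n"] unfolding 1 2 3 a[symmetric] by blast
  qed
  show ?thesis
  proof (rule irreducible_eigenbasis[OF _ i M irr, where u = u and \<rho> = "- 1 / 2"])
    fix a X and j :: int assume "a \<in> top_index (- 1 / 2) i"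
    then have ev: "even (a - i)" by (simp add: top_index_def)
    note a = all[OF ev]
    show "u a \<noteq> 0" "eop M 0 (u a) = scl M (1 / 2) (u (a + 2))" using a by blast+
    show "hop M 0 (u a) = scl M (of_int a + - 1 / 2 + 1 / 2) (u a)" using a unfolding M.ground_weight_def by simp
    show "fop M 0 (u a) = scl M ((of_int a + - 1 / 2) * (of_int a + - 1 / 2 - 1) / 2) (u (a - 2))"
      using a unfolding d_def by simp
    show "mode M X j (u a) = 0" if "j > 0"
      using a that unfolding M.ground_weight_def ground_states_def by (cases X) simp_all
  qed simp
qed

section \<open>Highest weight modules\<close>

lemma (in affine) submodule_flow: "sl2_submodule M N \<Longrightarrow> sl2_submodule (spectral_flow k s M) N"
  unfolding sl2_submodule_def by (auto intro: V.subspace_add V.subspace_scale V.subspace_0)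

lemma (in affine) irreducible_flow:
  assumes "irreducible_sl2 M"
  shows "irreducible_sl2 (spectral_flow k s M)"
proof -
  have "sl2_submodule M N" if "sl2_submodule (spectral_flow k s M) N" for N
  proof -
    interpret F: affine k "spectral_flow k s M" by (rule spectral_flow_affine)
    have "spectral_flow k (- s) (spectral_flow k s M) = M"
      by (simp add: spectral_flow_flow[OF affine_axioms] spectral_flow_0[OF affine_axioms])
    then show ?thesis using F.submodule_flow[OF that, of "- s"] by (simp only:)
  qed
  then show ?thesis using assms unfolding irreducible_sl2_def by blast
qed

text \<open>
  The flow by \<open>-1\<close> turns \<open>e_n\<close> into \<open>e_(n-1)\<close> and \<open>f_n\<close> into \<open>f_(n+1)\<close>: a highest weight vector of weight \<open>i\<close>
  becomes a lowest weight vector of weight \<open>i + 1/2\<close>.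
\<close>

lemma highest_weight_eigenbasis:
  fixes M :: "'v::ab_group_add sl2_module"
  assumes i: "i = 0 \<or> i = (1::int)" and M: "affine (- 1 / 2) M" and irr: "irreducible_sl2 M"
    and v: "v \<noteq> 0" "\<And>n. n \<ge> 0 \<Longrightarrow> eop M n v = 0" "\<And>n. n > 0 \<Longrightarrow> fop M n v = 0" "\<And>n. n > 0 \<Longrightarrow> hop M n v = 0"
      "hop M 0 v = scl M (of_int i) v"
  defines "M' \<equiv> spectral_flow (- 1 / 2) (- 1) M"
  shows "\<exists>f. inj_on f (sector 0 i) \<and> \<not> module.dependent (scl M') (f ` sector 0 i) \<and>
    module.span (scl M') (f ` sector 0 i) = UNIV \<and>
    (\<forall>(a, P, Q)\<in>sector 0 i. hop M' 0 (f (a, P, Q)) = scl M' (of_int (a + int (size P) - int (size Q)) + 0 + 1/2) (f (a, P, Q)) \<and>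
      sugawara_L0 (- 1 / 2) M' (f (a, P, Q)) = scl M' (of_nat (wt P + wt Q) - 1 / 8) (f (a, P, Q)))"
proof -
  interpret M: affine "- 1 / 2" M by (rule M)
  have M': "affine (- 1 / 2) M'" unfolding M'_def by (rule M.spectral_flow_affine)
  have irr': "irreducible_sl2 M'" unfolding M'_def by (rule M.irreducible_flow[OF irr])
  show ?thesis
  proof (rule lowest_weight_eigenbasis[OF i M' irr' v(1)])
    show "eop M' n v = 0" if "n > 0" for n using v(2)[of "n - 1"] that by (simp add: M'_def)
    show "fop M' n v = 0" if "n \<ge> 0" for n using v(3)[of "n + 1"] that by (simp add: M'_def)
    show "hop M' n v = 0" if "n > 0" for n using v(4)[of n] that by (simp add: M'_def)
    show "hop M' 0 v = scl M' (of_int i + 1 / 2) v" unfolding M'_def by (simp add: v(5) M.V.scale_left_distrib)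
  qed
qed

section \<open>The four decompositions\<close>

lemma eigenbasis_exists:
  fixes M :: "'v::ab_group_add sl2_module"
  assumes "\<exists>f. inj_on f (sector \<rho> i) \<and> \<not> module.dependent (scl M) (f ` sector \<rho> i) \<and>
    module.span (scl M) (f ` sector \<rho> i) = UNIV \<and>
    (\<forall>(a, P, Q)\<in>sector \<rho> i. hop M 0 (f (a, P, Q)) = scl M (of_int (a + int (size P) - int (size Q)) + \<rho> + 1/2) (f (a, P, Q)) \<and>
      sugawara_L0 (- 1 / 2) M (f (a, P, Q)) = scl M (of_nat (wt P + wt Q) - 1 / 8) (f (a, P, Q)))"
    and M: "affine (- 1 / 2) M" and eps: "of_int \<epsilon> = 2 * (\<rho> + 1/2)"
    and energy: "\<And>c. even (c - i) \<Longrightarrow> of_int (e c) = (of_int c + \<rho> + 1/2)\<^sup>2 / 2 - 1/8 - (\<kappa> - 1/12)"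
    and fin: "\<And>t. finite {c. even (c - i) \<and> e c \<le> t}"
  obtains f where "eigenbasis M \<rho> i f \<kappa> e \<epsilon>"
proof -
  from assms(1) obtain f where f: "inj_on f (sector \<rho> i)" "\<not> module.dependent (scl M) (f ` sector \<rho> i)"
    "module.span (scl M) (f ` sector \<rho> i) = UNIV"
    "\<forall>(a, P, Q)\<in>sector \<rho> i. hop M 0 (f (a, P, Q)) = scl M (of_int (a + int (size P) - int (size Q)) + \<rho> + 1/2) (f (a, P, Q)) \<and>
      sugawara_L0 (- 1 / 2) M (f (a, P, Q)) = scl M (of_nat (wt P + wt Q) - 1 / 8) (f (a, P, Q))"
    by (elim exE conjE)
  have "eigenbasis M \<rho> i f \<kappa> e \<epsilon>"
  proof (rule eigenbasis.intro[OF M f(1-3) _ _ eps energy fin])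
    fix j assume j: "j \<in> sector \<rho> i"
    obtain a P Q where jj: "j = (a, P, Q)" by (cases j)
    have "hop M 0 (f (a, P, Q)) = scl M (of_int (a + int (size P) - int (size Q)) + \<rho> + 1/2) (f (a, P, Q)) \<and>
      sugawara_L0 (- 1 / 2) M (f (a, P, Q)) = scl M (of_nat (wt P + wt Q) - 1 / 8) (f (a, P, Q))"
      using f(4) j unfolding jj by blast
    then show "hop M 0 (f j) = scl M (of_int (charge j) + \<rho> + 1/2) (f j)"
      and "sugawara_L0 (- 1 / 2) M (f j) = scl M (of_int (mode_weight j) - 1/8) (f j)"
      unfolding jj charge_def mode_weight_def by simp_all
  qed
  then show ?thesis by (rule that)
qed

lemma standard_orbit:
  fixes M :: "'v::ab_group_add sl2_module"
  assumes p: "p = 1 \<or> p = 2" and i: "i = int p - 1" and std: "is_standard_module (of_int i) M"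
  shows "orbit_ch_defined level r M"
    and "fs_sum {s. 4 dvd s} (\<lambda>s. sl2_ch level (spectral_flow level (r + s) M)) =
      fs_mult (ch_VD (of_int i - of_int r / 2)) (ch_W p 2)"
proof -
  have i01: "i = 0 \<or> i = 1" using p i by auto
  have M: "affine (- 1 / 2) M" using std unfolding is_standard_module_def affine_def level_def by simp
  \<comment> \<open>\<open>1/12\<close> is \<open>- c/24\<close> for \<open>c = -2\<close>, and the rest is the difference between the conformal weights and \<open>sq i\<close>.\<close>
  let ?\<kappa> = "1 / 12 - 1 / 8 + of_int i / 2 :: complex"
  have energy: "of_int (sq i c) = (of_int c + (- 1 / 2) + 1/2)\<^sup>2 / 2 - 1/8 - (?\<kappa> - 1/12)" if "even (c - i)" for c
  proof -
    have "(of_int (2 * sq i c) :: complex) = of_int (c * c - i)" using two_sq[OF i01 that] by simp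
    then have s: "(of_int (sq i c) :: complex) = (of_int c * of_int c - of_int i) / 2" by (simp add: mult.commute)
    show ?thesis by (simp add: s power2_eq_square field_simps)
  qed
  obtain f where f: "eigenbasis M (- 1 / 2) i f ?\<kappa> (sq i) 0"
    by (rule eigenbasis_exists[OF standard_eigenbasis[OF i01 std] M _ energy finite_sq[OF i01], of 0]) simp_all
  interpret eigenbasis M "- 1 / 2" i f ?\<kappa> "sq i" r 0 by (rule f)
  have id: "(\<Sum>j\<in>{0..t}. part_int j * fock_series i (t - j)) = (\<Sum>c | even (c - i) \<and> sq i c \<le> t. sector_count (- 1 / 2) c (t - sq i c))" for t
    unfolding fock_series_convolution[OF i01] sector_count_def by simp
  note oc = orbit_character[OF ch_W_fock(2)[OF p i] id]
  have od: "sl2_ch_defined (- 1 / 2) (spectral_flow (- 1 / 2) (r + s + 0) M)" if "4 dvd s" for s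
    using that by (elim dvdE) (rule orbit_ch_defined)
  show "orbit_ch_defined level r M"
    unfolding orbit_ch_defined_def level_def using od oc(1) by simp
  show "fs_sum {s. 4 dvd s} (\<lambda>s. sl2_ch level (spectral_flow level (r + s) M)) =
      fs_mult (ch_VD (of_int i - of_int r / 2)) (ch_W p 2)"
    using oc(2) unfolding level_def by simp
qed

lemma highest_weight_orbit:
  fixes M :: "'v::ab_group_add sl2_module"
  assumes p: "p = 1 \<or> p = 2" and i: "i = int p - 1" and M: "affine (- 1 / 2) M" and irr: "irreducible_sl2 M"
    and v: "v \<noteq> 0" "\<And>n. n \<ge> 0 \<Longrightarrow> eop M n v = 0" "\<And>n. n > 0 \<Longrightarrow> fop M n v = 0" "\<And>n. n > 0 \<Longrightarrow> hop M n v = 0"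
      "hop M 0 v = scl M (of_int i) v"
  shows "orbit_ch_defined level r M"
    and "fs_sum {s. 4 dvd s} (\<lambda>s. sl2_ch level (spectral_flow level (s + r) M)) =
      fs_mult (ch_VD (of_int i - of_int r / 2)) (ch_W p 1)"
proof -
  have i01: "i = 0 \<or> i = 1" using p i by auto
  interpret M: affine "- 1 / 2" M by (rule M)
  \<comment> \<open>The flow that turns the highest weight module into a sector with \<open>a \<ge> 0\<close>.\<close>
  define M' where "M' = spectral_flow (- 1 / 2) (- 1) M"
  have M': "affine (- 1 / 2) M'" unfolding M'_def by (rule M.spectral_flow_affine)
  have flow: "spectral_flow (- 1 / 2) (r + s + 1) M' = spectral_flow (- 1 / 2) (r + s) M" for s
    unfolding M'_def spectral_flow_flow[OF M] by simp
  have energy: "of_int (tri (c + 1)) = (of_int c + 0 + 1/2)\<^sup>2 / 2 - 1/8 - (1 / 12 - 1/12 :: complex)" for c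
  proof -
    have "(of_int (2 * tri (c + 1)) :: complex) = of_int ((c + 1) * (c + 1 - 1))" by (simp only: two_tri)
    then have s: "(of_int (tri (c + 1)) :: complex) = (of_int c + 1) * of_int c / 2" by (simp add: mult.commute)
    show ?thesis unfolding s by (simp add: power2_eq_square field_simps)
  qed
  have fin: "finite {c. even (c - i) \<and> tri (c + 1) \<le> t}" for t
  proof (rule finite_subset[OF _ finite_abs_le[of "t + 2"]])
    have "\<bar>c\<bar> \<le> t + 2" if "tri (c + 1) \<le> t" for c using tri_bound[of "c + 1"] that by linarith
    then show "{c. even (c - i) \<and> tri (c + 1) \<le> t} \<subseteq> {c. \<bar>c\<bar> \<le> t + 2}" by blast
  qed
  obtain f where f: "eigenbasis M' 0 i f (1 / 12) (\<lambda>c. tri (c + 1)) 1"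
    by (rule eigenbasis_exists[OF highest_weight_eigenbasis[OF i01 M irr v, folded M'_def] M' _ energy fin, of 1]) simp_all
  interpret eigenbasis M' 0 i f "1 / 12" "\<lambda>c. tri (c + 1)" r 1 by (rule f)
  have id: "(\<Sum>j\<in>{0..t}. part_int j * ker_series i (t - j)) = (\<Sum>c | even (c - i) \<and> tri (c + 1) \<le> t. sector_count 0 c (t - tri (c + 1)))" for t
    unfolding ker_series_convolution sector_count_def by simp
  note oc = orbit_character[OF ch_W_ker(2)[OF p i] id, unfolded flow]
  have od: "sl2_ch_defined (- 1 / 2) (spectral_flow (- 1 / 2) (r + s) M)" if "4 dvd s" for s
    using that unfolding flow[symmetric] by (elim dvdE) (rule orbit_ch_defined)
  show "orbit_ch_defined level r M"
    unfolding orbit_ch_defined_def level_def using od oc(1) by blast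
  show "fs_sum {s. 4 dvd s} (\<lambda>s. sl2_ch level (spectral_flow level (s + r) M)) =
      fs_mult (ch_VD (of_int i - of_int r / 2)) (ch_W p 1)"
    using oc(2) unfolding level_def add.commute[of _ r] .
qed

theorem proposition15:
  fixes L0 :: "'a::ab_group_add sl2_module"
    and L1 :: "'b::ab_group_add sl2_module"
    and E0 :: "'c::ab_group_add sl2_module"
    and E1 :: "'d::ab_group_add sl2_module"
    and r :: int
  assumes "is_vacuum_module L0"
    and "is_doublet_module L1"
    and "is_standard_module 0 E0"
    and "is_standard_module 1 E1"
    and "r \<in> {0, 1, 2, 3}"
  shows "orbit_ch_defined level r E0 \<and> orbit_ch_defined level r E1 \<and>
         orbit_ch_defined level r L0 \<and> orbit_ch_defined level r L1 \<and>
         ch_VD_defined (- of_int r / 2) \<and> ch_VD_defined ((2 - of_int r) / 2) \<and>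
         ch_W_defined 1 1 \<and> ch_W_defined 1 2 \<and> ch_W_defined 2 1 \<and> ch_W_defined 2 2 \<and>
         fs_multipliable (ch_VD (- of_int r / 2)) (ch_W 1 2) \<and>
         fs_multipliable (ch_VD ((2 - of_int r) / 2)) (ch_W 2 2) \<and>
         fs_multipliable (ch_VD (- of_int r / 2)) (ch_W 1 1) \<and>
         fs_multipliable (ch_VD (1 - of_int r / 2)) (ch_W 2 1) \<and>
         (fs_sum {s. 4 dvd s} (\<lambda>s. sl2_ch level (spectral_flow level (r + s) E0)) =
         fs_mult (ch_VD (- of_int r / 2)) (ch_W 1 2)) \<and>
         (fs_sum {s. 4 dvd s} (\<lambda>s. sl2_ch level (spectral_flow level (r + s) E1)) =
         fs_mult (ch_VD ((2 - of_int r) / 2)) (ch_W 2 2)) \<and>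
         (fs_sum {s. 4 dvd s} (\<lambda>s. sl2_ch level (spectral_flow level (s + r) L0)) =
         fs_mult (ch_VD (- of_int r / 2)) (ch_W 1 1)) \<and>
         (fs_sum {s. 4 dvd s} (\<lambda>s. sl2_ch level (spectral_flow level (s + r) L1)) =
         fs_mult (ch_VD (1 - of_int r / 2)) (ch_W 2 1))"
proof -
  have p: "(1::nat) = 1 \<or> (1::nat) = 2" "(2::nat) = 1 \<or> (2::nat) = 2" and i: "(0::int) = int 1 - 1" "(1::int) = int 2 - 1" by simp_all
  have l: "of_int 0 - of_int r / 2 = (- of_int r / 2 :: complex)" "of_int 1 - of_int r / 2 = (1 - of_int r / 2 :: complex)"
    and l2: "(2 - of_int r) / 2 = (1 - of_int r / 2 :: complex)" by (simp_all add: diff_divide_distrib)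
  have E0: "is_standard_module (of_int 0) E0" and E1: "is_standard_module (of_int 1) E1" using assms(3,4) by simp_all
  note e0 = standard_orbit[OF p(1) i(1) E0, of r, unfolded l] and e1 = standard_orbit[OF p(2) i(2) E1, of r, unfolded l]
  have L0: "affine (- 1 / 2) L0" "irreducible_sl2 L0"
    and L1: "affine (- 1 / 2) L1" "irreducible_sl2 L1"
    using assms(1,2) unfolding is_vacuum_module_def is_doublet_module_def affine_def level_def by simp_all
  interpret L0: affine "- 1 / 2" L0 by (rule L0)
  interpret L1: affine "- 1 / 2" L1 by (rule L1)
  obtain v where v: "v \<noteq> 0" "\<forall>n\<ge>0. eop L0 n v = 0 \<and> fop L0 n v = 0 \<and> hop L0 n v = 0"
    using assms(1) unfolding is_vacuum_module_def by blast
  obtain w where w: "w \<in> ground_states L1" "w \<noteq> 0" "eop L1 0 w = 0" "hop L1 0 w = w"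
    using assms(2) unfolding is_doublet_module_def by blast
  have we: "eop L1 n w = 0" if "n \<ge> 0" for n
    using w(1,3) that unfolding ground_states_def by (cases "n = 0") simp_all
  have wf: "fop L1 n w = 0" and wh: "hop L1 n w = 0" if "n > 0" for n
    using w(1) that unfolding ground_states_def by simp_all
  have l0: "orbit_ch_defined level r L0" "fs_sum {s. 4 dvd s} (\<lambda>s. sl2_ch level (spectral_flow level (s + r) L0)) =
      fs_mult (ch_VD (of_int 0 - of_int r / 2)) (ch_W 1 1)"
    by (rule highest_weight_orbit[OF p(1) i(1) L0 v(1)]; use v(2) in simp)+
  have l1: "orbit_ch_defined level r L1" "fs_sum {s. 4 dvd s} (\<lambda>s. sl2_ch level (spectral_flow level (s + r) L1)) =
      fs_mult (ch_VD (of_int 1 - of_int r / 2)) (ch_W 2 1)"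
    by (rule highest_weight_orbit[OF p(2) i(2) L1 w(2) we wf wh]; simp add: w(4))+
  note cf = ch_W_fock[OF p(1) i(1)] ch_W_fock[OF p(2) i(2)] and ck = ch_W_ker[OF p(1) i(1)] ch_W_ker[OF p(2) i(2)]
  show ?thesis unfolding l2
    by (intro conjI e0 e1 l0(1) l1(1) l0(2)[unfolded l] l1(2)[unfolded l] ch_VD_is_defined cf(1,3) ck(1,3)
        product_with_VD(1)[OF cf(2)] product_with_VD(1)[OF cf(4)] product_with_VD(1)[OF ck(2)] product_with_VD(1)[OF ck(4)])
qed

end
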